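(* Let $\frac{3}{4}<s<1$, $0<t<1$ and $2_s^*:=\frac{6}{3-2s}$. Assume: (a) $V\in C^0(\mathbb{R}^3)\cap L^\infty(\mathbb{R}^3)$ and $0$ lies in a spectral gap of the self-adjoint operator $(-\Delta)^s+V$ on $L^2(\mathbb{R}^3)$ (with domain $H^s(\mathbb{R}^3)$); (b) $K\in L^{\frac{3}{4s-3}}(\mathbb{R}^3)\cap L^\infty(\mathbb{R}^3)$ and $K(x)>0$ for a.e. $x\in\mathbb{R}^3$; (c) $2<q<2_s^*$, $g\in L^{q_0}(\mathbb{R}^3)$ with $q_0=\frac{6}{6-q(3-2s)}$, and $g(x)>0$ for a.e. $x\in\mathbb{R}^3$. Then the system $$(-\Delta)^s u+V(x)u=K(x)\phi u+g(x)|u|^{q-2}u,\qquad (I-\Delta)^t\phi=K(x)u^2,\qquad x\in\mathbb{R}^3,$$ possesses infinitely many (weak) solutions $\{(u_n,\phi_{u_n})\}\subset H^s(\mathbb{R}^3)\times L^{t,2}(\mathbb{R}^3)$ satisfying $\lim_{n\to\infty}\|u_n\|_{H^s(\mathbb{R}^3)}=+\infty$.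
   Context: $(-\Delta)^s$ is the fractional Laplacian, $\widehat{(-\Delta)^s u}(\xi)=|\xi|^{2s}\hat u(\xi)$, and $H^s(\mathbb{R}^3)$ the usual fractional Sobolev space. The Bessel space $L^{t,2}(\mathbb{R}^3)$ is the set of $f\in L^2(\mathbb{R}^3)$ with $f=G_t*h$ for some $h\in L^2(\mathbb{R}^3)$, where $G_t=\mathcal{F}^{-1}\big((1+|\xi|^2)^{-t/2}\big)$ is the Bessel kernel; its norm is $\|f\|_{L^{t,2}}=\|h\|_{L^2}=\|(I-\Delta)^{t/2}f\|_{L^2}$, with associated inner product $(\cdot,\cdot)_{L^{t,2}}$. For $u\in H^s(\mathbb{R}^3)$, $\phi_u\in L^{t,2}(\mathbb{R}^3)$ denotes the unique element with $(\phi_u,v)_{L^{t,2}}=\int_{\mathbb{R}^3}K u^2 v\,dx$ for all $v\in L^{t,2}(\mathbb{R}^3)$; equivalently $\phi_u=G_{2t}*(Ku^2)$. A pair $(u,\phi)\in H^s\times L^{t,2}$ is a weak solution of the system if $\phi=\phi_u$ and $\int_{\mathbb{R}^3}\big[(-\Delta)^{s/2}u(-\Delta)^{s/2}v+V uv-K\phi_u uv-g|u|^{q-2}uv\big]dx=0$ for all $v\in H^s(\mathbb{R}^3)$. *)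

theory Defs
  imports "HOL-Analysis.Analysis"
begin

type_synonym R3 = "real^3"

definition sq_int :: "(R3 \<Rightarrow> 'b::real_normed_vector) \<Rightarrow> bool" where
  "sq_int f \<longleftrightarrow> f \<in> borel_measurable lebesgue \<and> integrable lebesgue (\<lambda>x. (norm (f x))\<^sup>2)"

definition in_Lp :: "real \<Rightarrow> (R3 \<Rightarrow> real) \<Rightarrow> bool" where
  "in_Lp p f \<longleftrightarrow> f \<in> borel_measurable lebesgue \<and> integrable lebesgue (\<lambda>x. \<bar>f x\<bar> powr p)"

definition ess_bounded :: "(R3 \<Rightarrow> real) \<Rightarrow> bool" where
  "ess_bounded f \<longleftrightarrow> f \<in> borel_measurable lebesgue \<and> (\<exists>M. AE x in lebesgue. \<bar>f x\<bar> \<le> M)"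

definition fourier1 :: "(R3 \<Rightarrow> real) \<Rightarrow> R3 \<Rightarrow> complex" where
  "fourier1 f \<xi> = (LINT x|lebesgue. complex_of_real (f x) * cis (- (x \<bullet> \<xi>)))"

definition is_fourier :: "(R3 \<Rightarrow> real) \<Rightarrow> (R3 \<Rightarrow> complex) \<Rightarrow> bool" where
  "is_fourier f F \<longleftrightarrow> sq_int f \<and> sq_int F \<and>
     ((\<lambda>n::nat. LINT \<xi>|lebesgue.
         (cmod (F \<xi> - fourier1 (\<lambda>x. indicator (ball 0 (real n)) x * f x) \<xi>))\<^sup>2) \<longlonglongrightarrow> 0)"

definition fourier :: "(R3 \<Rightarrow> real) \<Rightarrow> R3 \<Rightarrow> complex" where
  "fourier f = (SOME F. is_fourier f F)"

definition Hs :: "real \<Rightarrow> (R3 \<Rightarrow> real) set" where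
  "Hs s = {u. sq_int u \<and> (\<exists>F. is_fourier u F \<and>
       integrable lebesgue (\<lambda>\<xi>. (1 + (norm \<xi>)\<^sup>2) powr s * (cmod (F \<xi>))\<^sup>2))}"

definition Hs_norm :: "real \<Rightarrow> (R3 \<Rightarrow> real) \<Rightarrow> real" where
  "Hs_norm s u = sqrt ((2 * pi) powr (-3) *
     (LINT \<xi>|lebesgue. (1 + (norm \<xi>)\<^sup>2) powr s * (cmod (fourier u \<xi>))\<^sup>2))"

text \<open>\<open>\<integral> (-\<Delta>)^{s/2} u (-\<Delta>)^{s/2} v dx\<close>, computed by Plancherel.\<close>
definition frac_form :: "real \<Rightarrow> (R3 \<Rightarrow> real) \<Rightarrow> (R3 \<Rightarrow> real) \<Rightarrow> real" where
  "frac_form s u v = (2 * pi) powr (-3) *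
     Re (LINT \<xi>|lebesgue. complex_of_real ((norm \<xi>) powr (2 * s)) * fourier u \<xi> * cnj (fourier v \<xi>))"

text \<open>Bessel potential space L^{t,2} = {G_t * h | h \<in> L^2}; on the Fourier side
  (convolution theorem) \<open>fourier f = (1+|\<xi>|^2)^{-t/2} fourier h\<close>.\<close>
definition Lt2 :: "real \<Rightarrow> (R3 \<Rightarrow> real) set" where
  "Lt2 t = {f. sq_int f \<and> (\<exists>h. sq_int h \<and>
       (AE \<xi> in lebesgue. fourier f \<xi> = complex_of_real ((1 + (norm \<xi>)\<^sup>2) powr (- t / 2)) * fourier h \<xi>))}"

text \<open>\<open>(f,g)_{L^{t,2}} = ((I-\<Delta>)^{t/2} f, (I-\<Delta>)^{t/2} g)_{L^2}\<close> via Plancherel.\<close>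
definition Lt2_inner :: "real \<Rightarrow> (R3 \<Rightarrow> real) \<Rightarrow> (R3 \<Rightarrow> real) \<Rightarrow> real" where
  "Lt2_inner t f g = (2 * pi) powr (-3) *
     Re (LINT \<xi>|lebesgue. complex_of_real ((1 + (norm \<xi>)\<^sup>2) powr t) * fourier f \<xi> * cnj (fourier g \<xi>))"

definition is_phi_u :: "real \<Rightarrow> (R3 \<Rightarrow> real) \<Rightarrow> (R3 \<Rightarrow> real) \<Rightarrow> (R3 \<Rightarrow> real) \<Rightarrow> bool" where
  "is_phi_u t K u \<phi> \<longleftrightarrow> \<phi> \<in> Lt2 t \<and>
     (\<forall>v \<in> Lt2 t. Lt2_inner t \<phi> v = (LINT x|lebesgue. K x * (u x)\<^sup>2 * v x))"

definition form_A :: "real \<Rightarrow> (R3 \<Rightarrow> real) \<Rightarrow> (R3 \<Rightarrow> real) \<Rightarrow> (R3 \<Rightarrow> real) \<Rightarrow> real" where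
  "form_A s V u v = frac_form s u v + (LINT x|lebesgue. V x * u x * v x)"

text \<open>0 belongs to the resolvent set of the self-adjoint operator A = (-\<Delta>)^s + V
  associated with form_A: A maps its domain
  D(A) = {u \<in> H^s. \<exists>w\<in>L^2. \<forall>v\<in>H^s. form_A u v = \<integral> w v} bijectively onto L^2
  (as a map between classes of a.e. equal functions).\<close>
definition zero_in_gap :: "real \<Rightarrow> (R3 \<Rightarrow> real) \<Rightarrow> bool" where
  "zero_in_gap s V \<longleftrightarrow>
     (\<forall>f. sq_int f \<longrightarrow>
        (\<exists>u \<in> Hs s. \<forall>v \<in> Hs s. form_A s V u v = (LINT x|lebesgue. f x * v x))) \<and>
     (\<forall>u1 \<in> Hs s. \<forall>u2 \<in> Hs s.
        (\<forall>v \<in> Hs s. form_A s V u1 v = form_A s V u2 v) \<longrightarrow> (AE x in lebesgue. u1 x = u2 x))"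

definition weak_solution ::
  "real \<Rightarrow> real \<Rightarrow> real \<Rightarrow> (R3 \<Rightarrow> real) \<Rightarrow> (R3 \<Rightarrow> real) \<Rightarrow> (R3 \<Rightarrow> real)
   \<Rightarrow> (R3 \<Rightarrow> real) \<Rightarrow> (R3 \<Rightarrow> real) \<Rightarrow> bool" where
  "weak_solution s t q V K g u \<phi> \<longleftrightarrow> u \<in> Hs s \<and> \<phi> \<in> Lt2 t \<and> is_phi_u t K u \<phi> \<and>
     (\<forall>v \<in> Hs s. frac_form s u v +
        (LINT x|lebesgue. V x * u x * v x - K x * \<phi> x * u x * v x
                          - g x * \<bar>u x\<bar> powr (q - 2) * u x * v x) = 0)"

end

theory Submission
  imports Defs "HOL-Probability.Probability" "HOL-Library.Diagonal_Subsequence"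
begin

text \<open>The Fourier transform is replaced by the Hartley transform \<open>HT\<close>, a symmetric involution of real \<open>L\<^sup>2\<close>.
  Writing \<open>u = HT (jm s k)\<close> with \<open>jm s \<xi> = (1 + |\<xi>|\<^sup>2)\<close> to the power \<open>- s / 2\<close> identifies \<open>H\<^sup>s\<close> with \<open>L\<^sup>2\<close>, and the weak
  solutions become the critical points of \<open>J k = \<langle>L k, k\<rangle> / 2 - \<Psi> k\<close>, where \<open>L\<close> is bounded, symmetric and, by the
  spectral gap, bounded below, and \<open>\<Psi>\<close> is even, weakly continuous and superquadratic.

  Let \<open>S\<close> be the sign of \<open>L\<close>. On \<open>S\<close>-invariant finite-dimensional spaces \<open>J\<close> satisfies the Palais-Smale condition, and
  if it had no critical value between a high level and a bound that is independent of the dimension, an odd ascending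
  map would violate the Borsuk-Ulam theorem. The Galerkin critical points are bounded because \<open>\<psi>\<close>, the gradient of \<open>\<Psi>\<close>, grows sublinearly
  along sequences on which \<open>\<langle>\<psi> k, k\<rangle>\<close> is bounded, and their weak limits are critical points of \<open>J\<close> of arbitrarily high level, hence of
  arbitrarily large norm.\<close>

section \<open>Tucker's lemma and the Borsuk-Ulam theorem\<close>

text \<open>\<open>J\<close> is bounded on neither side, and the negative space of \<open>L\<close>
  may be infinite-dimensional like the positive one; so linking is done in finite-dimensional
  spaces, with bounds that survive the limit. Invariance under \<open>S\<close> has two uses:
  orthogonality conditions can act on the positive part alone, and \<open>S u\<close> is an
  admissible test vector, which turns sublinear growth of the gradient into a norm bound. Of the
  spectral theory of \<open>L\<close> only its sign enters, so an iteration replaces a spectral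
  resolution. Compactness on the whole space comes from the weights: \<open>3/4 < s\<close> is
  equivalent to \<open>ps > 4\<close> for the critical exponent \<open>ps\<close>, and
  \<open>K\<^sup>2\<close> and \<open>g\<close> have the integrability conjugate to that of
  \<open>|u|^4\<close> and \<open>|u|^q\<close>. The Hartley transform keeps the Hilbert space real;
  as its kernel is symmetric, inversion reduces to preservation of norms of boxes. High levels force
  large norms because \<open>J k\<close> is at most \<open>(1 + M) * (norm k)\<^sup>2 / 2\<close>
  when \<open>M\<close> bounds the potential.\<close>

lemma even_card_involution:
  assumes "finite A" "\<And>a. a \<in> A \<Longrightarrow> f a \<in> A" "\<And>a. a \<in> A \<Longrightarrow> f (f a) = a" "\<And>a. a \<in> A \<Longrightarrow> f a \<noteq> a"
  shows "even (card A)"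
  using assms
proof (induction "card A" arbitrary: A rule: less_induct)
  case less
  show ?case
  proof (cases "A = {}")
    case False
    then obtain a where a: "a \<in> A" by blast
    let ?B = "A - {a, f a}"
    have sub: "{a, f a} \<subseteq> A" using a less.prems by auto
    have "card {a, f a} = 2" using less.prems(4)[OF a] by (simp add: card_insert_if)
    with sub have card: "card A = card ?B + 2"
      by (metis add.commute card_Diff_subset card_mono finite.emptyI finite.insertI le_add_diff_inverse less.prems(1))
    have "even (card ?B)"
    proof (rule less.hyps)
      show "f b \<in> ?B" if "b \<in> ?B" for b
        using that a less.prems(2,3) by (metis Diff_iff insert_iff empty_iff)
    qed (use card less.prems in auto)
    with card show ?thesis by simp
  qed simp
qed

text \<open>A label set that misses part of \<open>P\<close> gives no such \<open>j\<close>. If all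
  \<open>Suc k\<close> labels differ, exactly one lies outside \<open>P\<close> and only its carrier
  may be omitted. If the labels are just \<open>P\<close>, one of them occurs twice and precisely
  its two carriers may be omitted. The right-hand side is the fullness condition of a
  simplex.\<close>

lemma card_doors:
  fixes a :: "nat \<Rightarrow> 'l"
  assumes P: "finite P" "card P = k"
  shows "odd (card {j. j \<le> k \<and> a ` ({..k} - {j}) = P}) \<longleftrightarrow> P \<subseteq> a ` {..k} \<and> card (a ` {..k}) = Suc k"
proof -
  let ?J = "{j. j \<le> k \<and> a ` ({..k} - {j}) = P}"
  have img: "a ` {..k} = insert (a j) (a ` ({..k} - {j}))" if "j \<le> k" for j
    using that by auto
  have le: "card (a ` {..k}) \<le> Suc k" using card_image_le[of "{..k}" a] by simp
  consider (none) "\<not> P \<subseteq> a ` {..k}" | (inj) "P \<subseteq> a ` {..k}" "card (a ` {..k}) = Suc k"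
    | (two) "P \<subseteq> a ` {..k}" "card (a ` {..k}) = k"
    using le P by (metis card_mono finite_atMost finite_imageI le_SucE le_antisym)
  then show ?thesis
  proof cases
    case none
    then have "?J = {}" by blast
    show ?thesis unfolding \<open>?J = {}\<close> using none by simp
  next
    case inj
    then have inj': "inj_on a {..k}" by (simp add: eq_card_imp_inj_on)
    have "card (a ` {..k} - P) = 1" using inj P by (simp add: card_Diff_subset)
    then obtain l where l: "a ` {..k} - P = {l}" by (auto simp: card_1_singleton_iff)
    then have "l \<in> a ` {..k}" by blast
    then obtain i where i: "i \<le> k" "a i = l" by auto
    have "?J = {i}"
    proof (intro equalityI subsetI)
      fix j assume "j \<in> ?J"
      then have "j \<le> k" "a ` ({..k} - {j}) = P" by auto
      then have "l \<notin> a ` ({..k} - {j})" using l by blast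
      then have "i \<notin> {..k} - {j}" using i by blast
      then show "j \<in> {i}" using i by auto
    next
      fix j assume "j \<in> {i}"
      then have "a ` ({..k} - {j}) = a ` {..k} - {l}" using inj' i
        by (auto simp: inj_on_def)
      also have "\<dots> = P" using l inj by blast
      finally show "j \<in> ?J" using i \<open>j \<in> {i}\<close> by simp
    qed
    then show ?thesis using inj by simp
  next
    case two
    then have PA: "P = a ` {..k}" using P by (metis card_subset_eq finite_atMost finite_imageI)
    have "\<not> inj_on a {..k}" using two card_image[of a "{..k}"] by auto
    then obtain i i' where ii: "i \<le> k" "i' \<le> k" "i \<noteq> i'" "a i = a i'" by (auto simp: inj_on_def)
    have e: "a ` ({..k} - {i}) = P"
      using ii unfolding PA by (auto simp: image_iff)
    have "inj_on a ({..k} - {i})" by (rule eq_card_imp_inj_on) (use e P ii in auto)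
    have "?J = {i, i'}"
    proof (intro equalityI subsetI)
      fix j assume "j \<in> ?J"
      then have j: "j \<le> k" "a ` ({..k} - {j}) = P" by auto
      show "j \<in> {i, i'}"
      proof (rule ccontr)
        assume n: "j \<notin> {i, i'}"
        then have "a j \<notin> a ` ({..k} - {i} - {j})"
          using \<open>inj_on a ({..k} - {i})\<close> j by (auto simp: inj_on_def)
        moreover have "a ` ({..k} - {i} - {j}) = a ` ({..k} - {j})"
        proof -
          have "a i \<in> a ` ({..k} - {i} - {j})" unfolding ii(4) using n ii by blast
          moreover have "{..k} - {j} \<subseteq> insert i ({..k} - {i} - {j})" by blast
          ultimately show ?thesis by blast
        qed
        moreover have "a j \<in> P" unfolding PA using j by blast
        ultimately show False using j by simp
      qed
    next
      fix j assume "j \<in> {i, i'}"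
      moreover have "a ` ({..k} - {i'}) = P"
        using ii unfolding PA by (auto simp: image_iff) (metis Diff_iff atMost_iff singletonD)
      ultimately show "j \<in> ?J" using e ii by auto
    qed
    then show ?thesis using ii two by simp
  qed
qed

text \<open>A label is a nonzero integer \<open>l\<close>, standing for the signed unit vector
  \<open>sgn l\<close> times \<open>e\<^sub>i\<close>, \<open>i = \<bar>l\<bar>\<close>; \<open>dir L\<close> is the sum of the vectors of a set of labels.\<close>

definition dir :: "int set \<Rightarrow> nat \<Rightarrow> int" where
  "dir L i = (\<Sum>l\<in>L. if nat \<bar>l\<bar> = i then sgn l else 0)"

text \<open>The Freudenthal (Kuhn) triangulation: from the corner \<open>x\<close> of a unit cube
  the signed unit vectors are added one at a time in the order of \<open>ls\<close>, so that each
  ordering of the same directions gives another simplex of the cube.\<close>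

definition vert :: "(nat \<Rightarrow> int) \<Rightarrow> int list \<Rightarrow> nat \<Rightarrow> nat \<Rightarrow> int" where
  "vert x ls m = (\<lambda>i. x i + dir (set (take m ls)) i)"

lemma dir_eq_sgn:
  assumes "finite L" "inj_on abs L" "l \<in> L" shows "dir L (nat \<bar>l\<bar>) = sgn l"
proof -
  have "dir L (nat \<bar>l\<bar>) = (\<Sum>l'\<in>L. if l' = l then sgn l else 0)"
    unfolding dir_def by (rule sum.cong) (use assms in \<open>auto simp: inj_on_def nat_eq_iff\<close>)
  then show ?thesis using assms by simp
qed

lemma dir_eq_0: "(\<And>l. l \<in> L \<Longrightarrow> nat \<bar>l\<bar> \<noteq> i) \<Longrightarrow> dir L i = 0"
  unfolding dir_def by (rule sum.neutral) auto

lemma dir_insert: "finite L \<Longrightarrow> l \<notin> L \<Longrightarrow> dir (insert l L) i = dir {l} i + dir L i"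
  by (simp add: dir_def)

lemma dir_uminus: "dir (uminus ` L) i = - dir L i"
proof -
  have "dir (uminus ` L) i = (\<Sum>l\<in>L. if nat \<bar>- l\<bar> = i then sgn (- l) else 0)"
    unfolding dir_def by (subst sum.reindex) (auto simp: inj_on_def)
  also have "\<dots> = - dir L i"
    unfolding dir_def sum_negf[symmetric] by (rule sum.cong) (auto simp: sgn_minus)
  finally show ?thesis .
qed

text \<open>The labelling contradicts the conclusion of Tucker's lemma; everything here leads to
  \<open>inconsistent\<close>.\<close>

locale tucker_labelling =
  fixes n :: nat and p :: int and lam :: "(nat \<Rightarrow> int) \<Rightarrow> int" and cube
  defines "cube \<equiv> {v. \<forall>i. \<bar>v i\<bar> \<le> p \<and> (v i \<noteq> 0 \<longrightarrow> i \<in> {1..n})}"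
  assumes p: "p \<ge> 1"
    and lam: "\<And>v. v \<in> cube \<Longrightarrow> 1 \<le> \<bar>lam v\<bar> \<and> \<bar>lam v\<bar> \<le> int n"
    and antipodal: "\<And>v i. v \<in> cube \<Longrightarrow> \<bar>v i\<bar> = p \<Longrightarrow> lam (\<lambda>i. - v i) = - lam v"
    and no_compl: "\<And>v w. v \<in> cube \<Longrightarrow> w \<in> cube \<Longrightarrow> (\<And>i. \<bar>v i - w i\<bar> \<le> 1) \<Longrightarrow> lam v \<noteq> - lam w"
begin

text \<open>The pair \<open>(x, ls)\<close> encodes the simplex with vertices \<open>vert x ls 0, \<dots>, vert x ls k\<close> of the
  triangulated coordinate cell of dimension \<open>k\<close> whose direction signs are \<open>ls\<close>. It is full if the labels of its
  vertices are \<open>ls\<close> together with one more label; the doors are its facets labelled by \<open>ls\<close>. Counting doors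
  modulo 2 shows that the number of full simplices has the same parity in dimensions \<open>k\<close> and \<open>k + 1\<close>,
  although it is \<open>1\<close> in dimension \<open>0\<close> and \<open>0\<close> in dimension \<open>n\<close>.\<close>

definition simplices :: "nat \<Rightarrow> ((nat \<Rightarrow> int) \<times> int list) set" where
  "simplices k = {(x, ls). length ls = k \<and> distinct ls \<and> inj_on abs (set ls) \<and> (\<forall>l\<in>set ls. 1 \<le> \<bar>l\<bar> \<and> \<bar>l\<bar> \<le> int n)
     \<and> (\<forall>i. i \<notin> (nat \<circ> abs) ` set ls \<longrightarrow> x i = 0)
     \<and> (\<forall>l\<in>set ls. 0 \<le> sgn l * x (nat \<bar>l\<bar>) \<and> sgn l * x (nat \<bar>l\<bar>) < p)}"

definition full :: "nat \<Rightarrow> ((nat \<Rightarrow> int) \<times> int list) set" where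
  "full k = {(x, ls) \<in> simplices k. set ls \<subseteq> lam ` vert x ls ` {..k} \<and> card (lam ` vert x ls ` {..k}) = Suc k}"

definition doors :: "nat \<Rightarrow> ((nat \<Rightarrow> int) \<times> int list \<times> nat) set" where
  "doors k = {(x, ls, j). (x, ls) \<in> simplices k \<and> j \<le> k \<and> lam ` vert x ls ` ({..k} - {j}) = set ls}"

lemma simplicesI:
  assumes "length ls = k" "distinct ls" "inj_on abs (set ls)" "\<And>l. l \<in> set ls \<Longrightarrow> 1 \<le> \<bar>l\<bar> \<and> \<bar>l\<bar> \<le> int n"
    and "\<And>i. i \<notin> (nat \<circ> abs) ` set ls \<Longrightarrow> x i = 0"
    and "\<And>l. l \<in> set ls \<Longrightarrow> 0 \<le> sgn l * x (nat \<bar>l\<bar>) \<and> sgn l * x (nat \<bar>l\<bar>) < p"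
  shows "(x, ls) \<in> simplices k"
  unfolding simplices_def using assms by blast

lemma finite_simplices: "finite (simplices k)"
proof -
  let ?X = "{x :: nat \<Rightarrow> int. \<forall>i. (i \<in> {1..n} \<longrightarrow> x i \<in> {-p..p}) \<and> (i \<notin> {1..n} \<longrightarrow> x i = 0)}"
  let ?L = "{ls. set ls \<subseteq> {- int n..int n} \<and> length ls = k}"
  have "x i \<in> {-p..p} \<and> (i \<notin> {1..n} \<longrightarrow> x i = 0)" if "(x, ls) \<in> simplices k" for x ls i
  proof (cases "i \<in> (nat \<circ> abs) ` set ls")
    case True
    then obtain l where l: "l \<in> set ls" "i = nat \<bar>l\<bar>" by auto
    with that have "1 \<le> \<bar>l\<bar>" "\<bar>l\<bar> \<le> int n" "0 \<le> sgn l * x i" "sgn l * x i < p" by (auto simp: simplices_def)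
    then show ?thesis using l by (auto simp: sgn_if split: if_splits)
  qed (use that p in \<open>auto simp: simplices_def\<close>)
  then have "x \<in> ?X" if "(x, ls) \<in> simplices k" for x ls using that by blast
  moreover have "ls \<in> ?L" if "(x, ls) \<in> simplices k" for x ls
    using that by (auto simp: simplices_def abs_le_iff)
  ultimately have "simplices k \<subseteq> ?X \<times> ?L" by (metis (no_types, lifting) SigmaI subrelI)
  moreover have "finite ?X" by (intro finite_set_of_finite_funs) auto
  moreover have "finite ?L" by (intro finite_lists_length_eq) auto
  ultimately show ?thesis by (meson finite_SigmaI finite_subset)
qed

lemma simplices_coord:
  assumes "(x, ls) \<in> simplices k" "l \<in> set ls"
  shows "vert x ls m (nat \<bar>l\<bar>) = x (nat \<bar>l\<bar>) + (if l \<in> set (take m ls) then sgn l else 0)"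
proof -
  have inj: "inj_on abs (set ls)" using assms by (simp add: simplices_def)
  have sub: "set (take m ls) \<subseteq> set ls" by (rule set_take_subset)
  show ?thesis
  proof (cases "l \<in> set (take m ls)")
    case True
    then show ?thesis unfolding vert_def
      using dir_eq_sgn[of "set (take m ls)" l] inj_on_subset[OF inj sub] by simp
  next
    case False
    have "dir (set (take m ls)) (nat \<bar>l\<bar>) = 0"
      by (rule dir_eq_0) (use inj sub assms False in \<open>auto simp: inj_on_def nat_eq_iff\<close>)
    then show ?thesis unfolding vert_def using False by simp
  qed
qed

lemma simplices_coord_0:
  assumes "(x, ls) \<in> simplices k" "i \<notin> (nat \<circ> abs) ` set ls"
  shows "vert x ls m i = 0"
proof -
  have "dir (set (take m ls)) i = 0"
    by (rule dir_eq_0) (use set_take_subset[of m ls] assms in \<open>force simp: image_iff\<close>)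
  then show ?thesis using assms by (auto simp: vert_def simplices_def)
qed

lemma vert_in_cube:
  assumes "(x, ls) \<in> simplices k" shows "vert x ls m \<in> cube"
proof -
  have "\<bar>vert x ls m i\<bar> \<le> p \<and> (vert x ls m i \<noteq> 0 \<longrightarrow> i \<in> {1..n})" for i
  proof (cases "i \<in> (nat \<circ> abs) ` set ls")
    case True
    then obtain l where l: "l \<in> set ls" "i = nat \<bar>l\<bar>" by auto
    with assms have *: "1 \<le> \<bar>l\<bar>" "\<bar>l\<bar> \<le> int n" "0 \<le> sgn l * x i" "sgn l * x i < p" by (auto simp: simplices_def)
    then show ?thesis using l simplices_coord[OF assms l(1), of m]
      by (auto simp: sgn_if split: if_splits)
  qed (use simplices_coord_0[OF assms] p in auto)
  then show ?thesis by (simp add: cube_def)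
qed

lemma vert_adjacent:
  assumes "(x, ls) \<in> simplices k" shows "\<bar>vert x ls m i - vert x ls m' i\<bar> \<le> 1"
proof (cases "i \<in> (nat \<circ> abs) ` set ls")
  case True
  then obtain l where l: "l \<in> set ls" "i = nat \<bar>l\<bar>" by auto
  then show ?thesis using simplices_coord[OF assms l(1)] by (auto simp: sgn_if)
qed (use simplices_coord_0[OF assms] in auto)

lemma labels_not_compl:
  assumes "(x, ls) \<in> simplices k" shows "lam (vert x ls m) \<noteq> - lam (vert x ls m')"
  using no_compl vert_in_cube[OF assms] vert_adjacent[OF assms] by blast

text \<open>Doors are counted simplex by simplex: by \<open>card_doors\<close> a simplex owns an odd
  number of them exactly if it is full.\<close>

lemma parity_doors_full: "even (card (doors k) + card (full k))"
proof -
  have e: "doors k = (\<lambda>((x, ls), j). (x, ls, j)) ` (SIGMA s:simplices k. {j. j \<le> k \<and> (lam \<circ> vert (fst s) (snd s)) ` ({..k} - {j}) = set (snd s)})"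
    by (force simp: doors_def image_comp)
  have "card (doors k) = (\<Sum>s\<in>simplices k. card {j. j \<le> k \<and> (lam \<circ> vert (fst s) (snd s)) ` ({..k} - {j}) = set (snd s)})"
    unfolding e by (subst card_image) (auto simp: inj_on_def finite_simplices)
  moreover have "card (full k) = (\<Sum>s\<in>simplices k. if s \<in> full k then 1 else 0)"
    using finite_simplices by (subst sum.If_cases) (auto simp: full_def intro!: arg_cong[where f=card])
  moreover have "even (card {j. j \<le> k \<and> (lam \<circ> vert (fst s) (snd s)) ` ({..k} - {j}) = set (snd s)} + (if s \<in> full k then 1 else 0))"
    if "s \<in> simplices k" for s
  proof -
    have "card (set (snd s)) = k" using that by (auto simp: simplices_def distinct_card)
    from card_doors[OF _ this, of "lam \<circ> vert (fst s) (snd s)"] show ?thesis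
      using that by (auto simp: full_def image_comp split: prod.splits)
  qed
  ultimately show ?thesis
    by (simp add: sum.distrib[symmetric] dvd_sum)
qed

text \<open>Only the prefix of length \<open>j\<close> distinguishes the two orders of neighbouring
  directions, so the two simplices share the facet opposite vertex \<open>j\<close>.\<close>

lemma vert_swap:
  assumes "j > 0" "j < length ls" "m \<noteq> j"
  shows "vert x (ls[j - 1 := ls ! j, j := ls ! (j - 1)]) m = vert x ls m"
proof -
  have "set (take m (ls[j - 1 := ls ! j, j := ls ! (j - 1)])) = set (take m ls)"
  proof (cases "m < j")
    case False
    then have m: "j < m" using assms by simp
    have "take m (ls[j - 1 := ls ! j, j := ls ! (j - 1)]) = (take m ls)[j - 1 := (take m ls) ! j, j := (take m ls) ! (j - 1)]"
      using m by (simp add: take_update_swap)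
    also have "set \<dots> = set (take m ls)" using m assms by (intro set_swap) auto
    finally show ?thesis .
  qed auto
  then show ?thesis by (simp add: vert_def)
qed

text \<open>Moving the corner along the first direction and appending that direction at the end
  yields the simplex across the facet opposite vertex 0, with vertex numbers shifted by one.\<close>

lemma vert_rotate:
  assumes "distinct (l # ls)" "m \<le> length ls"
  shows "vert (\<lambda>i. x i + dir {l} i) (ls @ [l]) m = vert x (l # ls) (Suc m)"
proof -
  have "l \<notin> set (take m ls)" using assms in_set_takeD[of l m ls] by auto
  then show ?thesis using assms(2) by (simp add: vert_def dir_insert[of "set (take m ls)"] add.assoc)
qed

text \<open>The same facet viewed from the simplex on its other side: in the next unit cube for
  \<open>j = 0\<close>, in the previous one for \<open>j = k\<close>, in the same cube
  otherwise.\<close>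

definition partner :: "nat \<Rightarrow> (nat \<Rightarrow> int) \<times> int list \<times> nat \<Rightarrow> (nat \<Rightarrow> int) \<times> int list \<times> nat" where
  "partner k = (\<lambda>(x, ls, j). if j = 0 then (\<lambda>i. x i + dir {hd ls} i, tl ls @ [hd ls], k)
     else if j = k then (\<lambda>i. x i - dir {last ls} i, last ls # butlast ls, 0)
     else (x, ls[j - 1 := ls ! j, j := ls ! (j - 1)], j))"

text \<open>Facets on the boundary of the big cube, where the step to the next unit cube would leave
  the cell.\<close>

definition outer :: "nat \<Rightarrow> ((nat \<Rightarrow> int) \<times> int list \<times> nat) set" where
  "outer k = {(x, ls, j) \<in> doors k. j = 0 \<and> sgn (hd ls) * x (nat \<bar>hd ls\<bar>) + 1 = p}"

text \<open>Facets in the coordinate hyperplane orthogonal to the last direction, where the step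
  back would leave the orthant; they lie in a cell of one dimension less.\<close>

definition inner_face :: "nat \<Rightarrow> ((nat \<Rightarrow> int) \<times> int list \<times> nat) set" where
  "inner_face k = {(x, ls, j) \<in> doors k. j = k \<and> x (nat \<bar>last ls\<bar>) = 0}"

lemma dir_single: "dir {l} i = (if nat \<bar>l\<bar> = i then sgn l else 0)"
  by (simp add: dir_def)

lemma image_shift: "f ` ({..Suc m} - {0}) = (\<lambda>i. f (Suc i)) ` {..m}"
proof -
  have "{..Suc m} - {0} = Suc ` {..m}" by (auto simp: atMost_Suc_eq_insert_0)
  then show ?thesis by (simp add: image_image)
qed

lemma image_last: "f ` ({..Suc m} - {Suc m}) = f ` {..m}"
  by (rule arg_cong[where f="image f"]) auto

text \<open>A door off the outer boundary leaves room for one more step along \<open>l\<close>;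
  afterwards the coordinate of that axis is nonzero, so the image is no inner face.
  \<open>partner_last\<close> is the reverse passage.\<close>

lemma partner_first:
  assumes d: "(x, l # ls, 0) \<in> doors (Suc m)" and no: "(x, l # ls, 0) \<notin> outer (Suc m)"
  shows "(\<lambda>i. x i + dir {l} i, ls @ [l], Suc m) \<in> doors (Suc m)"
    and "(\<lambda>i. x i + dir {l} i, ls @ [l], Suc m) \<notin> inner_face (Suc m)"
proof -
  let ?x = "\<lambda>i. x i + dir {l} i"
  have s: "(x, l # ls) \<in> simplices (Suc m)" and im: "lam ` vert x (l # ls) ` ({..Suc m} - {0}) = set (l # ls)"
    using d by (auto simp: doors_def)
  have l: "0 \<le> sgn l * x (nat \<bar>l\<bar>)" "sgn l * x (nat \<bar>l\<bar>) < p" "1 \<le> \<bar>l\<bar>" and len: "length ls = m" and dist: "distinct (l # ls)"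
    using s by (auto simp: simplices_def)
  have l': "sgn l * x (nat \<bar>l\<bar>) + 1 < p" using no d l by (auto simp: outer_def)
  have sx: "sgn l * ?x (nat \<bar>l\<bar>) = sgn l * x (nat \<bar>l\<bar>) + 1"
    using l by (auto simp: dir_single algebra_simps sgn_if)
  have sx': "?x (nat \<bar>l'\<bar>) = x (nat \<bar>l'\<bar>)" if "l' \<in> set ls" for l'
    using that s by (auto simp: dir_single simplices_def inj_on_def nat_eq_iff)
  have "(?x, ls @ [l]) \<in> simplices (Suc m)"
  proof (rule simplicesI)
    show "?x i = 0" if "i \<notin> (nat \<circ> abs) ` set (ls @ [l])" for i
    proof -
      have "x i = 0" using that s unfolding simplices_def by auto
      moreover have "nat \<bar>l\<bar> \<noteq> i" using that by auto
      ultimately show ?thesis by (simp add: dir_single)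
    qed
    show "0 \<le> sgn l' * ?x (nat \<bar>l'\<bar>) \<and> sgn l' * ?x (nat \<bar>l'\<bar>) < p" if "l' \<in> set (ls @ [l])" for l'
    proof (cases "l' = l")
      case True
      show ?thesis unfolding True sx using l l' by linarith
    next
      case False
      then have *: "l' \<in> set ls" using that by auto
      show ?thesis unfolding sx'[OF *] using * s unfolding simplices_def by auto
    qed
  qed (use s in \<open>auto simp: simplices_def\<close>)
  moreover have "lam ` vert ?x (ls @ [l]) ` ({..Suc m} - {Suc m}) = set (ls @ [l])"
    using im vert_rotate[OF dist, of _ x] len by (simp add: image_shift image_last image_image)
  ultimately show "(?x, ls @ [l], Suc m) \<in> doors (Suc m)" by (simp add: doors_def)
  show "(?x, ls @ [l], Suc m) \<notin> inner_face (Suc m)" using sx l by (auto simp: inner_face_def)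
qed

lemma partner_last:
  assumes d: "(x, ls @ [l], Suc m) \<in> doors (Suc m)" and no: "(x, ls @ [l], Suc m) \<notin> inner_face (Suc m)"
  shows "(\<lambda>i. x i - dir {l} i, l # ls, 0) \<in> doors (Suc m)"
    and "(\<lambda>i. x i - dir {l} i, l # ls, 0) \<notin> outer (Suc m)"
proof -
  let ?x = "\<lambda>i. x i - dir {l} i"
  have s: "(x, ls @ [l]) \<in> simplices (Suc m)" and im: "lam ` vert x (ls @ [l]) ` ({..Suc m} - {Suc m}) = set (ls @ [l])"
    using d by (auto simp: doors_def)
  have l: "0 \<le> sgn l * x (nat \<bar>l\<bar>)" "sgn l * x (nat \<bar>l\<bar>) < p" "1 \<le> \<bar>l\<bar>" and len: "length ls = m" and dist: "distinct (l # ls)"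
    using s by (auto simp: simplices_def)
  have l': "sgn l * x (nat \<bar>l\<bar>) > 0" using no d l by (auto simp: inner_face_def sgn_if split: if_splits)
  have sx: "sgn l * ?x (nat \<bar>l\<bar>) = sgn l * x (nat \<bar>l\<bar>) - 1"
    using l by (auto simp: dir_single algebra_simps sgn_if)
  have sx': "?x (nat \<bar>l'\<bar>) = x (nat \<bar>l'\<bar>)" if "l' \<in> set ls" for l'
    using that s by (auto simp: dir_single simplices_def inj_on_def nat_eq_iff)
  have "(?x, l # ls) \<in> simplices (Suc m)"
  proof (rule simplicesI)
    show "?x i = 0" if "i \<notin> (nat \<circ> abs) ` set (l # ls)" for i
    proof -
      have "x i = 0" using that s unfolding simplices_def by auto
      moreover have "nat \<bar>l\<bar> \<noteq> i" using that by auto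
      ultimately show ?thesis by (simp add: dir_single)
    qed
    show "0 \<le> sgn l' * ?x (nat \<bar>l'\<bar>) \<and> sgn l' * ?x (nat \<bar>l'\<bar>) < p" if "l' \<in> set (l # ls)" for l'
    proof (cases "l' = l")
      case True
      show ?thesis unfolding True sx using l l' by linarith
    next
      case False
      then have *: "l' \<in> set ls" using that by auto
      show ?thesis unfolding sx'[OF *] using * s unfolding simplices_def by auto
    qed
  qed (use s in \<open>auto simp: simplices_def\<close>)
  moreover have "lam ` vert ?x (l # ls) ` ({..Suc m} - {0}) = set (l # ls)"
    using im vert_rotate[OF dist, of _ ?x] len by (simp add: image_shift image_last image_image)
  ultimately show "(?x, l # ls, 0) \<in> doors (Suc m)" by (simp add: doors_def)
  show "(?x, l # ls, 0) \<notin> outer (Suc m)" using sx l by (auto simp: outer_def)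
qed

lemma partner_mid:
  assumes d: "(x, ls, j) \<in> doors k" and j: "0 < j" "j < k"
  shows "(x, ls[j - 1 := ls ! j, j := ls ! (j - 1)], j) \<in> doors k"
proof -
  let ?s = "ls[j - 1 := ls ! j, j := ls ! (j - 1)]"
  have s: "(x, ls) \<in> simplices k" and im: "lam ` vert x ls ` ({..k} - {j}) = set ls"
    using d by (auto simp: doors_def)
  have len: "length ls = k" using s by (simp add: simplices_def)
  have st: "set ?s = set ls" using j len by (intro set_swap) auto
  have "distinct ?s" using distinct_swap[of "j - 1" ls j] j len s by (auto simp: simplices_def)
  then have "(x, ?s) \<in> simplices k" using s st unfolding simplices_def by auto
  moreover have "vert x ?s ` ({..k} - {j}) = vert x ls ` ({..k} - {j})"
    by (rule image_cong) (use vert_swap[of j ls _ x] j len in auto)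
  ultimately show ?thesis using im st d by (simp add: doors_def)
qed

lemma finite_doors: "finite (doors k)"
proof -
  have "doors k \<subseteq> (\<lambda>((x, ls), j). (x, ls, j)) ` (simplices k \<times> {..k})" by (force simp: doors_def)
  then show ?thesis by (rule finite_subset) (simp add: finite_simplices)
qed

text \<open>\<open>partner\<close> is a fixed-point-free involution of the doors that lie neither on
  the outer boundary nor on an inner face.\<close>

lemma even_interior:
  "even (card (doors (Suc m) - outer (Suc m) - inner_face (Suc m)))" (is "even (card ?I)")
proof (rule even_card_involution)
  show "finite ?I" using finite_doors by blast
  fix a assume a: "a \<in> ?I"
  obtain x ls j where a': "a = (x, ls, j)" by (cases a)
  have len: "length ls = Suc m" and jm: "j \<le> Suc m" and dist: "distinct ls"
    using a a' by (auto simp: doors_def simplices_def)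
  consider (z) "j = 0" | (k) "j = Suc m" | (mid) "0 < j" "j < Suc m" using jm by linarith
  then have "partner (Suc m) a \<in> ?I \<and> partner (Suc m) (partner (Suc m) a) = a \<and> partner (Suc m) a \<noteq> a"
  proof cases
    case z
    obtain l ls' where ls: "ls = l # ls'" using len by (cases ls) auto
    show ?thesis using partner_first[of x l ls' m] a unfolding a' z ls by (auto simp: partner_def outer_def)
  next
    case k
    obtain l ls' where ls: "ls = ls' @ [l]" using len by (cases ls rule: rev_cases) auto
    show ?thesis using partner_last[of x ls' l m] a unfolding a' k ls by (auto simp: partner_def inner_face_def)
  next
    case mid
    have ne: "ls ! (j - 1) \<noteq> ls ! j" using dist mid len by (simp add: nth_eq_iff_index_eq)
    let ?s = "ls[j - 1 := ls ! j, j := ls ! (j - 1)]"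
    have "?s[j - 1 := ?s ! j, j := ?s ! (j - 1)] = ls"
      by (rule nth_equalityI) (use mid len in \<open>auto simp: nth_list_update\<close>)
    moreover have "?s \<noteq> ls" using ne mid len by (metis nth_list_update_eq length_list_update)
    ultimately show ?thesis using partner_mid[of x ls j "Suc m"] a mid unfolding a'
      by (auto simp: partner_def outer_def inner_face_def)
  qed
  then show "partner (Suc m) a \<in> ?I" "partner (Suc m) (partner (Suc m) a) = a" "partner (Suc m) a \<noteq> a" by auto
qed

text \<open>All vertices of an outer facet have the coordinate of the first direction at absolute
  value \<open>p\<close>, which is where the labelling is antipodal.\<close>

lemma outer_antipode:
  assumes "(x, ls, 0) \<in> outer (Suc m)"
  shows "(\<lambda>i. - x i, map uminus ls, 0) \<in> outer (Suc m)"
proof -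
  obtain l ls' where ls: "ls = l # ls'" using assms by (cases ls) (auto simp: outer_def doors_def simplices_def)
  have s: "(x, ls) \<in> simplices (Suc m)" and im: "lam ` vert x ls ` ({..Suc m} - {0}) = set ls"
    and b: "sgn l * x (nat \<bar>l\<bar>) + 1 = p"
    using assms by (auto simp: outer_def doors_def ls)
  have "(nat \<circ> abs) ` uminus ` set ls = (nat \<circ> abs) ` set ls" by (simp add: image_image)
  then have s': "(\<lambda>i. - x i, map uminus ls) \<in> simplices (Suc m)"
    using s unfolding simplices_def by (auto simp: distinct_map inj_on_def sgn_minus)
  have v: "vert (\<lambda>i. - x i) (map uminus ls) r = (\<lambda>i. - vert x ls r i)" for r
    by (simp add: vert_def fun_eq_iff take_map dir_uminus)
  have "lam (vert (\<lambda>i. - x i) (map uminus ls) r) = - lam (vert x ls r)" if "r \<in> {..Suc m} - {0}" for r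
  proof -
    have "l \<in> set (take r ls)" using that by (cases r) (auto simp: ls)
    moreover have "1 \<le> \<bar>l\<bar>" using s by (auto simp: simplices_def ls)
    moreover have "vert x ls r (nat \<bar>l\<bar>) = x (nat \<bar>l\<bar>) + sgn l"
      using simplices_coord[OF s, of l r] calculation by (auto simp: ls)
    moreover have "sgn l = 1 \<or> sgn l = - 1" using \<open>1 \<le> \<bar>l\<bar>\<close> by (auto simp: sgn_if)
    ultimately have "\<bar>vert x ls r (nat \<bar>l\<bar>)\<bar> = p"
      using b p by (elim disjE) simp_all
    then show ?thesis unfolding v using antipodal[OF vert_in_cube[OF s]] by blast
  qed
  then have "lam ` vert (\<lambda>i. - x i) (map uminus ls) ` ({..Suc m} - {0}) = uminus ` lam ` vert x ls ` ({..Suc m} - {0})"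
    unfolding image_image by (intro image_cong) auto
  then show ?thesis using s' im b by (auto simp: outer_def doors_def ls sgn_minus)
qed

text \<open>The antipodal map has no fixed point because it reverses the sign of the nonzero first
  direction.\<close>

lemma even_outer: "even (card (outer (Suc m)))"
proof (rule even_card_involution)
  let ?f = "\<lambda>(x, ls, j). (\<lambda>i. - x i, map uminus ls, j)"
  show "finite (outer (Suc m))" by (rule finite_subset[OF _ finite_doors]) (auto simp: outer_def)
  fix a assume a: "a \<in> outer (Suc m)"
  obtain x ls where a': "a = (x, ls, 0)" using a by (auto simp: outer_def)
  show "?f a \<in> outer (Suc m)" using outer_antipode a unfolding a' by simp
  show "?f (?f a) = a" unfolding a' by (simp add: comp_def)
  have "length ls = Suc m" "\<forall>l\<in>set ls. 1 \<le> \<bar>l\<bar>" using a by (auto simp: a' outer_def doors_def simplices_def)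
  then obtain l ls' where "ls = l # ls'" "l \<noteq> 0" by (cases ls) auto
  then show "?f a \<noteq> a" unfolding a' by auto
qed

text \<open>Dropping the last direction turns an inner face into a simplex of its hyperplane whose
  labels are its directions and one more; conversely that extra label determines the dropped
  direction.\<close>

lemma card_inner_face: "card (inner_face (Suc m)) = card (full m)"
proof -
  have "bij_betw (\<lambda>(x, ls, j). (x, butlast ls)) (inner_face (Suc m)) (full m)"
  proof (rule bij_betw_imageI)
    let ?f = "\<lambda>(x, ls, j). (x, butlast ls) :: (nat \<Rightarrow> int) \<times> int list"
    have *: "\<exists>ls l. a = (x, ls @ [l], Suc m) \<and> (x, ls) \<in> simplices m \<and> x (nat \<bar>l\<bar>) = 0 \<and> distinct (ls @ [l])
       \<and> lam ` vert x ls ` {..m} = insert l (set ls)"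
      if "a \<in> inner_face (Suc m)" "x = fst a" for a x
    proof -
      have "a = (x, fst (snd a), Suc m)" using that by (cases a) (auto simp: inner_face_def)
      then obtain ls0 where a: "a = (x, ls0, Suc m)" by blast
      have in_face: "(x, ls0, Suc m) \<in> inner_face (Suc m)" using that a by metis
      then have "length ls0 = Suc m" by (auto simp: inner_face_def doors_def simplices_def)
      then obtain ls l where ls: "ls0 = ls @ [l]" by (cases ls0 rule: rev_cases) auto
      have s: "(x, ls @ [l]) \<in> simplices (Suc m)" and x0: "x (nat \<bar>l\<bar>) = 0"
        and im: "lam ` vert x (ls @ [l]) ` ({..Suc m} - {Suc m}) = set (ls @ [l])"
        using in_face by (auto simp: ls inner_face_def doors_def)
      have len: "length ls = m" using s by (simp add: simplices_def)
      have "(x, ls) \<in> simplices m" using s x0 unfolding simplices_def by auto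
      moreover have "vert x (ls @ [l]) ` ({..Suc m} - {Suc m}) = vert x ls ` {..m}"
        unfolding image_last by (rule image_cong) (use len in \<open>auto simp: vert_def\<close>)
      ultimately show ?thesis using a ls x0 s im by (auto simp: simplices_def)
    qed
    show "inj_on ?f (inner_face (Suc m))"
    proof (rule inj_onI)
      fix a b assume a: "a \<in> inner_face (Suc m)" and b: "b \<in> inner_face (Suc m)" and e: "?f a = ?f b"
      from *[OF a refl] obtain la l where A: "a = (fst a, la @ [l], Suc m)" "distinct (la @ [l])"
        "lam ` vert (fst a) la ` {..m} = insert l (set la)" by blast
      from *[OF b refl] obtain lb l' where B: "b = (fst b, lb @ [l'], Suc m)" "distinct (lb @ [l'])"
        "lam ` vert (fst b) lb ` {..m} = insert l' (set lb)" by blast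
      have "?f (fst a, la @ [l], Suc m) = ?f (fst b, lb @ [l'], Suc m)" using e A(1) B(1) by metis
      then have "fst a = fst b" "la = lb" by auto
      with A B show "a = b" by (metis Diff_insert_absorb distinct_append disjoint_insert(1) list.set_intros(1) insert_ident insert_iff not_distinct_conv_prefix rotate1.simps(2) set_rotate1 distinct1_rotate distinct.simps(2))
    qed
    show "?f ` inner_face (Suc m) = full m"
    proof (intro equalityI subsetI)
      fix b assume "b \<in> ?f ` inner_face (Suc m)"
      then obtain a where a: "a \<in> inner_face (Suc m)" "b = ?f a" by blast
      from *[OF a(1) refl] obtain ls l where A: "a = (fst a, ls @ [l], Suc m)" "(fst a, ls) \<in> simplices m"
        "distinct (ls @ [l])" "lam ` vert (fst a) ls ` {..m} = insert l (set ls)" by blast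
      have "b = (fst a, ls)" using a A(1) by (metis (no_types, lifting) butlast_snoc case_prod_conv)
      moreover have "length ls = m" using A by (simp add: simplices_def)
      ultimately show "b \<in> full m" using A by (auto simp: full_def distinct_card)
    next
      fix b assume b: "b \<in> full m"
      obtain x ls where b': "b = (x, ls)" by (cases b)
      have s: "(x, ls) \<in> simplices m" and im: "set ls \<subseteq> lam ` vert x ls ` {..m}" "card (lam ` vert x ls ` {..m}) = Suc m"
        using b by (auto simp: b' full_def)
      have len: "length ls = m" and dist: "distinct ls" using s by (auto simp: simplices_def)
      have "card (lam ` vert x ls ` {..m} - set ls) = 1" using im dist len by (simp add: card_Diff_subset distinct_card)
      then obtain l where l: "lam ` vert x ls ` {..m} - set ls = {l}" by (auto simp: card_1_singleton_iff)
      then have im': "lam ` vert x ls ` {..m} = insert l (set ls)" and nl: "l \<notin> set ls" using im by auto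
      obtain r where r: "l = lam (vert x ls r)" using l by blast
      \<comment> \<open>The negative of a label of this simplex is no label of it, and all of
        \<open>ls\<close> are labels. Hence \<open>l\<close> belongs to a new axis and the simplex
        can be extended along it.\<close>
      have "- l \<notin> set ls" using im(1) labels_not_compl[OF s, of _ r] r by force
      then have na: "\<bar>l\<bar> \<notin> abs ` set ls" using nl by (auto simp: abs_if split: if_splits)
      have lr: "1 \<le> \<bar>l\<bar>" "\<bar>l\<bar> \<le> int n" using lam[OF vert_in_cube[OF s, of r]] r by auto
      have ni: "nat \<bar>l\<bar> \<notin> (nat \<circ> abs) ` set ls" using na by (auto simp: image_iff eq_nat_nat_iff)
      then have x0: "x (nat \<bar>l\<bar>) = 0" using s unfolding simplices_def by blast
      have "(x, ls @ [l]) \<in> simplices (Suc m)"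
        using s nl na lr x0 p unfolding simplices_def by auto
      moreover have "vert x (ls @ [l]) ` ({..Suc m} - {Suc m}) = vert x ls ` {..m}"
        unfolding image_last by (rule image_cong) (use len in \<open>auto simp: vert_def\<close>)
      ultimately have "(x, ls @ [l], Suc m) \<in> inner_face (Suc m)"
        using im' x0 by (auto simp: inner_face_def doors_def)
      then show "b \<in> ?f ` inner_face (Suc m)" unfolding b' by (force simp: image_iff)
    qed
  qed
  then show ?thesis by (rule bij_betw_same_card)
qed

text \<open>Modulo 2 the interior and the outer doors cancel, leaving the inner faces, that is, the
  full simplices of the lower dimension.\<close>

lemma parity_full_step: "even (card (full (Suc m)) + card (full m))"
proof -
  let ?D = "doors (Suc m)" and ?O = "outer (Suc m)" and ?F = "inner_face (Suc m)"
  have dj: "?O \<inter> ?F = {}" by (auto simp: outer_def inner_face_def)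
  have sub: "?O \<subseteq> ?D" "?F \<subseteq> ?D" by (auto simp: outer_def inner_face_def)
  have fin: "finite ?O" "finite ?F" using sub finite_doors finite_subset by blast+
  have "card ?D = card (?D - ?O - ?F) + card ?O + card ?F"
    using sub dj fin finite_doors card_mono[OF finite_doors sub(1)]
    by (smt (verit, best) Diff_disjoint Diff_partition Int_commute Un_Diff_Int add.assoc add.commute card_Un_disjoint finite_Diff Diff_subset inf.absorb_iff2 Diff_Int_distrib2 Diff_empty Int_absorb1 Int_Diff subset_antisym Diff_triv sup_commute Diff_eq_empty_iff inf_commute disjoint_iff Diff_iff subsetI subset_iff)
  then show ?thesis using even_interior[of m] even_outer[of m] card_inner_face[of m] parity_doors_full[of "Suc m"]
    by simp
qed

text \<open>In dimension \<open>n\<close> the directions already occupy all axes, so the additional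
  label of a full simplex would be the negative of one of them.\<close>

lemma inconsistent: False
proof -
  have "full 0 = {(\<lambda>_. 0, [])}" by (auto simp: full_def simplices_def)
  then have "odd (card (full 0))" by simp
  moreover have "odd (card (full m)) = odd (card (full 0))" for m
    by (induction m) (use parity_full_step in auto)
  moreover have "full n = {}"
  proof (rule ccontr)
    assume "full n \<noteq> {}"
    then obtain x ls where s: "(x, ls) \<in> simplices n"
      and im: "set ls \<subseteq> lam ` vert x ls ` {..n}" "card (lam ` vert x ls ` {..n}) = Suc n" by (auto simp: full_def)
    have len: "length ls = n" and dist: "distinct ls" and inj: "inj_on abs (set ls)" using s by (auto simp: simplices_def)
    have "abs ` set ls \<subseteq> {1..int n}" using s by (auto simp: simplices_def)
    moreover have "card (abs ` set ls) = n" using inj len dist by (simp add: card_image distinct_card)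
    ultimately have all: "abs ` set ls = {1..int n}" by (intro card_subset_eq) auto
    have "card (lam ` vert x ls ` {..n} - set ls) = 1" using im dist len by (simp add: card_Diff_subset distinct_card)
    then obtain l where l: "lam ` vert x ls ` {..n} - set ls = {l}" by (auto simp: card_1_singleton_iff)
    then obtain r where r: "l = lam (vert x ls r)" "l \<notin> set ls" by blast
    have "\<bar>l\<bar> \<in> abs ` set ls" using lam[OF vert_in_cube[OF s, of r]] r all by auto
    then obtain l' where "l' \<in> set ls" "\<bar>l\<bar> = \<bar>l'\<bar>" by auto
    then have "- l \<in> set ls" using r by (auto simp: abs_if split: if_splits)
    then show False using im(1) labels_not_compl[OF s, of _ r] r by force
  qed
  ultimately show False by (metis card.empty even_zero)
qed

end

theorem tucker:
  fixes n :: nat and p :: int and lam :: "(nat \<Rightarrow> int) \<Rightarrow> int"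
  defines "cube \<equiv> {v. \<forall>i. \<bar>v i\<bar> \<le> p \<and> (v i \<noteq> 0 \<longrightarrow> i \<in> {1..n})}"
  assumes "p \<ge> 1" "\<And>v. v \<in> cube \<Longrightarrow> 1 \<le> \<bar>lam v\<bar> \<and> \<bar>lam v\<bar> \<le> int n"
    and "\<And>v i. v \<in> cube \<Longrightarrow> \<bar>v i\<bar> = p \<Longrightarrow> lam (\<lambda>i. - v i) = - lam v"
  obtains v w where "v \<in> cube" "w \<in> cube" "\<And>i. \<bar>v i - w i\<bar> \<le> 1" "lam v = - lam w"
proof (rule ccontr)
  assume "\<not> thesis"
  then have "tucker_labelling n p lam"
    unfolding tucker_labelling_def using assms(2-4) that unfolding cube_def by blast
  then show False by (rule tucker_labelling.inconsistent)
qed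

section \<open>Antipodal functions on spheres of finite-dimensional spans\<close>

lemma compact_span_ball:
  fixes B :: "'a::real_inner set"
  assumes "finite B" "\<And>x y. x \<in> B \<Longrightarrow> y \<in> B \<Longrightarrow> inner x y = (if x = y then 1 else 0)"
  shows "compact (span B \<inter> cball 0 R)"
  using assms
proof (induction B)
  case empty
  then show ?case by (simp add: Int_insert_left)
next
  case (insert b B)
  have orth: "inner b x = 0" if "x \<in> span B" for x
  proof -
    have "orthogonal b y" if "y \<in> B" for y
      using insert.prems[of b y] insert.hyps that by (auto simp: orthogonal_def)
    then show ?thesis using orthogonal_to_span[OF that] by (simp add: orthogonal_def)
  qed
  have b1: "norm b = 1" using insert.prems[of b b] by (simp add: norm_eq_sqrt_inner)
  \<comment> \<open>Closed balls of the surrounding space need not be compact; here the ball is a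
    closed part of the continuous image of a lower-dimensional ball times an interval.\<close>
  let ?S = "(\<lambda>(x, t). x + t *\<^sub>R b) ` ((span B \<inter> cball 0 R) \<times> {-R..R})"
  have "compact ?S"
    using insert by (intro compact_continuous_image compact_Times) (auto simp: case_prod_unfold intro!: continuous_intros)
  moreover have "span (insert b B) \<inter> cball 0 R = ?S \<inter> cball 0 R"
  proof (intro equalityI subsetI)
    fix y assume y: "y \<in> span (insert b B) \<inter> cball 0 R"
    then obtain t where t: "y - t *\<^sub>R b \<in> span B" using span_breakdown_eq by blast
    let ?x = "y - t *\<^sub>R b"
    have o: "inner ?x b = 0" using orth[OF t] by (simp add: inner_commute)
    have "(norm y)\<^sup>2 = (norm ?x)\<^sup>2 + t\<^sup>2"
    proof -
      have "(norm (?x + t *\<^sub>R b))\<^sup>2 = (norm ?x)\<^sup>2 + 2 * t * inner ?x b + t\<^sup>2 * (norm b)\<^sup>2"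
        unfolding power2_norm_eq_inner by (simp add: inner_add inner_commute power2_eq_square algebra_simps)
      then show ?thesis using o b1 by simp
    qed
    moreover have "0 \<le> R" using y norm_ge_zero[of y] by (simp add: order_trans del: norm_ge_zero)
    moreover have "(norm y)\<^sup>2 \<le> R\<^sup>2" using y by (auto intro!: power_mono)
    ultimately have "(norm ?x)\<^sup>2 \<le> R\<^sup>2" "t\<^sup>2 \<le> R\<^sup>2" using zero_le_power2[of t] zero_le_power2[of "norm ?x"] by linarith+
    then have "norm ?x \<le> R" "\<bar>t\<bar> \<le> R" using \<open>0 \<le> R\<close> by (auto simp: abs_le_square_iff[symmetric])
    then have "(?x, t) \<in> (span B \<inter> cball 0 R) \<times> {-R..R}" using t by auto
    then show "y \<in> ?S \<inter> cball 0 R" using y by (force simp: image_iff)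
  next
    fix y assume y: "y \<in> ?S \<inter> cball 0 R"
    then obtain x t where "x \<in> span B" "y = x + t *\<^sub>R b" by auto
    moreover have "x \<in> span (insert b B)" using calculation span_mono[of B "insert b B"] by blast
    ultimately have "y \<in> span (insert b B)" by (simp add: span_add span_mul span_base)
    then show "y \<in> span (insert b B) \<inter> cball 0 R" using y by blast
  qed
  ultimately show ?case by (simp add: compact_Int_closed)
qed

text \<open>Without a common zero some component has size at least \<open>\<mu>\<close> everywhere.
  Labelling grid points by the first such component and its sign makes a complementary edge a jump
  of \<open>2 * \<mu>\<close> between close points. The sphere has dimension \<open>n\<close>
  because \<open>z\<close> starts at index 0.\<close>

theorem borsuk_ulam:
  fixes z :: "nat \<Rightarrow> 'a::real_inner" and G :: "nat \<Rightarrow> 'a \<Rightarrow> real" and n :: nat and r :: real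
  defines "S \<equiv> sphere 0 r \<inter> span (z ` {..n})"
  assumes orth: "\<And>i j. i \<le> n \<Longrightarrow> j \<le> n \<Longrightarrow> inner (z i) (z j) = (if i = j then 1 else 0)"
    and r: "r > 0"
    and cont: "\<And>j. j \<in> {1..n} \<Longrightarrow> continuous_on S (G j)"
    and odd: "\<And>j x. j \<in> {1..n} \<Longrightarrow> x \<in> S \<Longrightarrow> G j (- x) = - G j x"
  obtains x where "x \<in> S" "\<And>j. j \<in> {1..n} \<Longrightarrow> G j x = 0"
proof (rule ccontr)
  assume nt: "\<not> thesis"
  note hit = that
  have nz: "\<exists>j\<in>{1..n}. G j x \<noteq> 0" if "x \<in> S" for x using hit[OF that] nt by blast
  have n0: "n \<ge> 1"
  proof (rule ccontr)
    assume "\<not> n \<ge> 1"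
    moreover have "r *\<^sub>R z 0 \<in> S" using orth[of 0 0] r
      by (auto simp: S_def norm_eq_sqrt_inner intro!: span_mul intro: span_base)
    ultimately show False using nz by force
  qed
  \<comment> \<open>The grid is mapped into this compact annulus and not onto the sphere itself;
    \<open>H\<close> composes \<open>G\<close> with radial projection.\<close>
  define A where "A = {y \<in> span (z ` {..n}) \<inter> cball 0 (real n + 1). norm y \<ge> 1/2}"
  have "compact (span (z ` {..n}) \<inter> cball 0 (real n + 1))"
    by (rule compact_span_ball) (use orth in fastforce)+
  moreover have "closed {y :: 'a. 1/2 \<le> norm y}" by (intro closed_Collect_le continuous_intros)
  moreover have "A = (span (z ` {..n}) \<inter> cball 0 (real n + 1)) \<inter> {y. 1/2 \<le> norm y}" by (auto simp: A_def)
  ultimately have cA: "compact A" by (metis compact_Int_closed)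
  define H where "H j y = G j ((r / norm y) *\<^sub>R y)" for j y
  have inS: "(r / norm y) *\<^sub>R y \<in> S" if "y \<in> A" for y
    using that r unfolding A_def S_def by (auto intro!: span_mul)
  have Hc: "continuous_on A (H j)" if "j \<in> {1..n}" for j
    unfolding H_def
    by (rule continuous_on_compose2[OF cont[OF that], of A]) (use inS in \<open>auto intro!: continuous_intros simp: A_def\<close>)
  define M where "M y = (\<Sum>j\<in>{1..n}. \<bar>H j y\<bar>)" for y
  have zA: "z 0 \<in> A" using orth[of 0 0] by (auto simp: A_def norm_eq_sqrt_inner intro!: span_base)
  have "continuous_on A M" unfolding M_def by (intro continuous_intros Hc)
  then obtain y0 where y0: "y0 \<in> A" "\<And>y. y \<in> A \<Longrightarrow> M y0 \<le> M y"
    using continuous_attains_inf[OF cA] zA by blast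
  have M0: "M y0 > 0"
  proof -
    obtain j where "j \<in> {1..n}" "H j y0 \<noteq> 0" using nz[OF inS[OF y0(1)]] by (auto simp: H_def)
    then show ?thesis unfolding M_def by (intro sum_pos2[of _ j]) auto
  qed
  \<comment> \<open>Among \<open>n\<close> terms with sum at least \<open>M y0\<close> one is at
    least the average.\<close>
  define \<mu> where "\<mu> = M y0 / n"
  have mu: "\<mu> > 0" using M0 n0 by (simp add: \<mu>_def)
  have big: "\<exists>j\<in>{1..n}. \<bar>H j y\<bar> \<ge> \<mu>" if "y \<in> A" for y
  proof (rule ccontr)
    assume "\<not> ?thesis"
    then have "M y < (\<Sum>j\<in>{1..n}. \<mu>)" unfolding M_def using n0 by (intro sum_strict_mono) (auto simp: not_le)
    then show False using y0(2)[OF that] n0 by (simp add: \<mu>_def)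
  qed
  have "\<exists>d>0. \<forall>y\<in>A. \<forall>y'\<in>A. dist y' y < d \<longrightarrow> dist (H j y') (H j y) < 2 * \<mu>" if "j \<in> {1..n}" for j
  proof -
    from compact_uniformly_continuous[OF Hc[OF that] cA, unfolded uniformly_continuous_on_def, rule_format, of "2 * \<mu>"]
    show ?thesis using mu by simp
  qed
  then obtain d where d: "\<And>j. j \<in> {1..n} \<Longrightarrow> d j > 0 \<and> (\<forall>y\<in>A. \<forall>y'\<in>A. dist y' y < d j \<longrightarrow> dist (H j y') (H j y) < 2 * \<mu>)"
    by metis
  define \<delta> where "\<delta> = Min (d ` {1..n})"
  have "\<delta> > 0" using d n0 by (auto simp: \<delta>_def Min_gr_iff)
  \<comment> \<open>Neighbouring grid points move each of the \<open>n + 1\<close> coordinates by at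
    most \<open>1 / p\<close>, so their images are closer than \<open>\<delta>\<close>.\<close>
  obtain p0 :: nat where p0: "(real n + 1) / \<delta> < real p0" using reals_Archimedean2 by blast
  define p where "p = Suc p0"
  have p: "real p > (real n + 1) / \<delta>" "p \<ge> 1" using p0 by (simp_all add: p_def)
  define cube where "cube = {v :: nat \<Rightarrow> int. \<forall>i. \<bar>v i\<bar> \<le> int p \<and> (v i \<noteq> 0 \<longrightarrow> i \<in> {1..n})}"
  define mx where "mx v = Max ((\<lambda>i. \<bar>v i\<bar>) ` {1..n})" for v :: "nat \<Rightarrow> int"
  \<comment> \<open>The cube is lifted to an upper hemisphere: the coordinate along
    \<open>z 0\<close> vanishes exactly on the boundary of the cube, where the map is therefore
    odd.\<close>
  define y where "y v = (\<Sum>i\<in>{1..n}. (v i / p) *\<^sub>R z i) + (1 - mx v / p) *\<^sub>R z 0" for v :: "nat \<Rightarrow> int"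
  have nz1: "norm (z i) = 1" if "i \<le> n" for i using orth[OF that that] by (simp add: norm_eq_sqrt_inner)
  have innery: "inner (y v) (z i) = (\<Sum>k\<in>{1..n}. (v k / p) * inner (z k) (z i)) + (1 - mx v / p) * inner (z 0) (z i)" for v i
    by (simp add: y_def inner_add_left inner_sum_left)
  have comp: "inner (y v) (z i) = v i / p" if "i \<in> {1..n}" for v i
  proof -
    have "inner (z 0) (z i) = 0" using orth[of 0 i] that by simp
    moreover have "(\<Sum>k\<in>{1..n}. (v k / p) * inner (z k) (z i)) = (\<Sum>k\<in>{1..n}. if k = i then v i / p else 0)"
      by (rule sum.cong) (use that orth[of _ i] in auto)
    ultimately show ?thesis using that unfolding innery by simp
  qed
  have comp0: "inner (y v) (z 0) = 1 - mx v / p" for v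
  proof -
    have "(\<Sum>k\<in>{1..n}. (v k / p) * inner (z k) (z 0)) = 0"
      by (rule sum.neutral) (use orth[of _ 0] in auto)
    then show ?thesis unfolding innery using orth[of 0 0] by simp
  qed
  have mx: "\<bar>v i\<bar> \<le> mx v" if "i \<in> {1..n}" for v i unfolding mx_def using that by (intro Max_ge) auto
  have mx': "\<exists>i\<in>{1..n}. mx v = \<bar>v i\<bar>" for v
  proof -
    have "mx v \<in> (\<lambda>i. \<bar>v i\<bar>) ` {1..n}" unfolding mx_def using n0 by (intro Max_in) auto
    then show ?thesis by auto
  qed
  have mxp: "0 \<le> mx v" "mx v \<le> p" if "v \<in> cube" for v
    using mx'[of v] that by (auto simp: cube_def)
  have yA: "y v \<in> A" if v: "v \<in> cube" for v
  proof -
    have "norm (y v) \<le> (\<Sum>i\<in>{1..n}. norm ((v i / p) *\<^sub>R z i)) + norm ((1 - mx v / p) *\<^sub>R z 0)"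
      unfolding y_def by (intro norm_triangle_le add_right_mono norm_sum)
    also have "\<dots> \<le> (\<Sum>i\<in>{1..n}. 1) + 1"
    proof (intro add_mono sum_mono)
      show "norm ((v i / p) *\<^sub>R z i) \<le> 1" if "i \<in> {1..n}" for i
      proof -
        have "\<bar>real_of_int (v i)\<bar> \<le> real p" using v unfolding cube_def by (metis (mono_tags, lifting) mem_Collect_eq of_int_abs of_int_le_iff of_int_of_nat_eq)
        then show ?thesis using nz1[of i] that p by (simp add: divide_le_eq_1)
      qed
      show "norm ((1 - mx v / p) *\<^sub>R z 0) \<le> 1" using mxp[OF v] p nz1[of 0] by (simp add: abs_le_iff field_simps)
    qed
    finally have "norm (y v) \<le> real n + 1" by simp
    moreover have "1/2 \<le> norm (y v)"
    proof (cases "mx v / p \<ge> 1/2")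
      case True
      obtain i where i: "i \<in> {1..n}" "mx v = \<bar>v i\<bar>" using mx' by blast
      have "mx v / p = \<bar>inner (y v) (z i)\<bar>" using comp[OF i(1)] i by simp
      also have "\<dots> \<le> norm (y v)" using Cauchy_Schwarz_ineq2[of "y v" "z i"] nz1[of i] i by simp
      finally show ?thesis using True by linarith
    next
      case False
      have "1/2 \<le> \<bar>inner (y v) (z 0)\<bar>" using comp0[of v] False by linarith
      also have "\<dots> \<le> norm (y v)" using Cauchy_Schwarz_ineq2[of "y v" "z 0"] nz1[of 0] by simp
      finally show ?thesis .
    qed
    moreover have "y v \<in> span (z ` {..n})"
      unfolding y_def by (intro span_add span_sum span_mul span_base) auto
    ultimately show ?thesis by (simp add: A_def)
  qed
  have ydist: "dist (y v) (y w) < \<delta>" if vw: "v \<in> cube" "w \<in> cube" "\<And>i. \<bar>v i - w i\<bar> \<le> 1" for v w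
  proof -
    have m1: "\<bar>mx v - mx w\<bar> \<le> 1"
    proof -
      obtain i j where i: "i \<in> {1..n}" "mx v = \<bar>v i\<bar>" and j: "j \<in> {1..n}" "mx w = \<bar>w j\<bar>" using mx' by blast
      show ?thesis using mx[OF i(1), of w] mx[OF j(1), of v] i j vw(3)[of i] vw(3)[of j] by linarith
    qed
    have yd: "y v - y w = (\<Sum>i\<in>{1..n}. ((v i - w i) / p) *\<^sub>R z i) + ((mx w - mx v) / p) *\<^sub>R z 0"
      unfolding y_def by (simp add: sum_subtractf diff_divide_distrib algebra_simps)
    have "norm (y v - y w) \<le> (\<Sum>i\<in>{1..n}. norm (((v i - w i) / p) *\<^sub>R z i)) + norm (((mx w - mx v) / p) *\<^sub>R z 0)"
      unfolding yd by (intro norm_triangle_le add_right_mono norm_sum)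
    also have "\<dots> \<le> (\<Sum>i\<in>{1..n}. 1 / p) + 1 / p"
    proof (intro add_mono sum_mono)
      show "norm (((v i - w i) / p) *\<^sub>R z i) \<le> 1 / p" if "i \<in> {1..n}" for i
      proof -
        have "\<bar>real_of_int (v i - w i)\<bar> \<le> 1" using vw(3)[of i] by linarith
        then show ?thesis using nz1[of i] that p by (simp add: divide_right_mono)
      qed
      have "\<bar>real_of_int (mx w - mx v)\<bar> \<le> 1" using m1 by linarith
      then show "norm (((mx w - mx v) / p) *\<^sub>R z 0) \<le> 1 / p" using nz1[of 0] p by (simp add: divide_right_mono)
    qed
    also have "\<dots> = (real n + 1) / p" by (simp add: add_divide_distrib)
    also have "\<dots> < \<delta>" using p \<open>\<delta> > 0\<close> by (simp add: field_simps)
    finally show ?thesis by (simp add: dist_norm)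
  qed
  define J where "J v = (LEAST j. j \<in> {1..n} \<and> \<bar>H j (y v)\<bar> \<ge> \<mu>)" for v
  define lab where "lab v = (if H (J v) (y v) > 0 then int (J v) else - int (J v))" for v
  have J: "J v \<in> {1..n} \<and> \<bar>H (J v) (y v)\<bar> \<ge> \<mu>" if "v \<in> cube" for v
    unfolding J_def by (rule LeastI_ex) (use big[OF yA[OF that]] in blast)
  have anti: "lab (\<lambda>i. - v i) = - lab v" if v: "v \<in> cube" "\<bar>v i\<bar> = int p" for v i
  proof -
    have i: "i \<in> {1..n}" using v p unfolding cube_def by fastforce
    have "mx v = p" using mx[OF i, of v] mxp[OF v(1)] v by simp
    moreover have "mx (\<lambda>i. - v i) = mx v" by (simp add: mx_def)
    ultimately have y: "y (\<lambda>i. - v i) = - y v" using p by (simp add: y_def sum_negf)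
    have Hn: "H j (- y v) = - H j (y v)" if "j \<in> {1..n}" for j
      using odd[OF that inS[OF yA[OF v(1)]]] by (simp add: H_def)
    have "J (\<lambda>i. - v i) = J v" unfolding J_def y using Hn by (metis abs_minus_cancel)
    then show ?thesis using Hn[of "J v"] J[OF v(1)] mu unfolding lab_def y by auto
  qed
  have cube_minus: "(\<lambda>i. - v i) \<in> cube" if "v \<in> cube" for v using that by (simp add: cube_def)
  obtain v w where vw: "v \<in> cube" "w \<in> cube" "\<And>i. \<bar>v i - w i\<bar> \<le> 1" "lab v = - lab w"
  proof (rule tucker[of "int p" n lab])
    show "1 \<le> \<bar>lab v\<bar> \<and> \<bar>lab v\<bar> \<le> int n" if "v \<in> {v. \<forall>i. \<bar>v i\<bar> \<le> int p \<and> (v i \<noteq> 0 \<longrightarrow> i \<in> {1..n})}" for v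
      using J[of v] that by (auto simp: cube_def lab_def)
  qed (use p anti in \<open>auto simp: cube_def\<close>)
  let ?j = "J v"
  have Jv: "?j \<in> {1..n}" "\<bar>H ?j (y v)\<bar> \<ge> \<mu>" and Jw: "J w \<in> {1..n}" "\<bar>H (J w) (y w)\<bar> \<ge> \<mu>" using J vw by auto
  have "J w = ?j" "H ?j (y v) > 0 \<longleftrightarrow> \<not> H (J w) (y w) > 0" using vw(4) Jv Jw by (auto simp: lab_def split: if_splits)
  then have "\<bar>H ?j (y v) - H ?j (y w)\<bar> \<ge> 2 * \<mu>" using Jv Jw by (auto simp: abs_if split: if_splits)
  moreover have "\<delta> \<le> d ?j" unfolding \<delta>_def using Jv by (intro Min_le) auto
  then have "dist (H ?j (y v)) (H ?j (y w)) < 2 * \<mu>" using d[OF Jv(1)] ydist[OF vw(1-3)] yA vw by fastforce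
  ultimately show False by (simp add: dist_real_def)
qed

section \<open>Hilbert spaces\<close>

lemma closed_subspace_projection:
  fixes M :: "'a::{real_inner,banach} set"
  assumes M: "subspace M" "closed M"
  obtains m where "m \<in> M" "\<And>y. y \<in> M \<Longrightarrow> inner (x - m) y = 0"
proof -
  define d where "d = Inf ((\<lambda>m. (norm (x - m))\<^sup>2) ` M)"
  have bdd: "bdd_below ((\<lambda>m. (norm (x - m))\<^sup>2) ` M)" by (intro bdd_belowI[of _ 0]) auto
  have ne: "M \<noteq> {}" using M(1) subspace_0 by blast
  have d_le: "d \<le> (norm (x - m))\<^sup>2" if "m \<in> M" for m
    unfolding d_def using bdd that by (intro cInf_lower) auto
  have "\<exists>m\<in>M. (norm (x - m))\<^sup>2 < d + 1 / real (Suc n)" for n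
    using cInf_lessD[of "(\<lambda>m. (norm (x - m))\<^sup>2) ` M" "d + 1 / real (Suc n)"] ne by (auto simp: d_def)
  then obtain m where m: "\<And>n. m n \<in> M" "\<And>n. (norm (x - m n))\<^sup>2 < d + 1 / real (Suc n)" by metis
  \<comment> \<open>The parallelogram law, with the midpoint in \<open>M\<close>: two
    near-minimisers are close to each other.\<close>
  have para: "(norm (m i - m j))\<^sup>2 \<le> 2 / real (Suc i) + 2 / real (Suc j)" for i j
  proof -
    have "(1/2) *\<^sub>R (m i + m j) \<in> M" using m(1) M(1) by (intro subspace_scale subspace_add) auto
    then have "4 * d \<le> 4 * (norm (x - (1/2) *\<^sub>R (m i + m j)))\<^sup>2" using d_le by simp
    also have "4 * (norm (x - (1/2) *\<^sub>R (m i + m j)))\<^sup>2 = 2 * (norm (x - m i))\<^sup>2 + 2 * (norm (x - m j))\<^sup>2 - (norm (m i - m j))\<^sup>2"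
      unfolding power2_norm_eq_inner by (simp add: inner_diff inner_add inner_commute algebra_simps)
    finally show ?thesis using m(2)[of i] m(2)[of j] by linarith
  qed
  have "Cauchy m"
  proof (rule metric_CauchyI)
    fix e :: real assume "e > 0"
    then obtain N :: nat where N: "4 / e\<^sup>2 < real N" using reals_Archimedean2 by blast
    have "dist (m i) (m j) < e" if "i \<ge> N" "j \<ge> N" for i j
    proof -
      have Np: "0 < real N" using N \<open>e > 0\<close> by (meson divide_pos_pos less_trans zero_less_numeral zero_less_power)
      have "2 / real (Suc i) + 2 / real (Suc j) \<le> 2 / real N + 2 / real N"
        using that Np by (intro add_mono divide_left_mono) auto
      also have "\<dots> < e\<^sup>2" using N Np \<open>e > 0\<close> by (simp add: field_simps)
      finally have "(norm (m i - m j))\<^sup>2 < e\<^sup>2" using para[of i j] by linarith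
      then show ?thesis using \<open>e > 0\<close> by (simp add: dist_norm power_less_imp_less_base)
    qed
    then show "\<exists>N. \<forall>i\<ge>N. \<forall>j\<ge>N. dist (m i) (m j) < e" by blast
  qed
  then obtain l where l: "m \<longlonglongrightarrow> l" using Cauchy_convergent convergent_def by blast
  have lM: "l \<in> M" using closed_sequentially[OF M(2)] m(1) l by blast
  have "(\<lambda>n. (norm (x - m n))\<^sup>2) \<longlonglongrightarrow> (norm (x - l))\<^sup>2" by (intro tendsto_intros l)
  moreover have "(\<lambda>n. d + 1 / real (Suc n)) \<longlonglongrightarrow> d + 0" by (intro tendsto_intros LIMSEQ_Suc[OF lim_1_over_n])
  ultimately have ld: "(norm (x - l))\<^sup>2 \<le> d" using m(2) by (intro LIMSEQ_le[of _ _ "\<lambda>n. d + 1 / real (Suc n)"]) (auto intro!: exI[of _ 0] less_imp_le)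
  have "inner (x - l) y = 0" if "y \<in> M" for y
  proof (rule ccontr)
    let ?a = "inner (x - l) y"
    assume a: "?a \<noteq> 0"
    then have y0: "(norm y)\<^sup>2 > 0" by auto
    \<comment> \<open>The minimiser of the quadratic in \<open>t\<close>; it would lower the squared
      distance by \<open>?a\<^sup>2 / (norm y)\<^sup>2\<close>.\<close>
    let ?t = "?a / (norm y)\<^sup>2"
    have "l + ?t *\<^sub>R y \<in> M" using lM that M(1) by (intro subspace_scale subspace_add) auto
    then have "d \<le> (norm (x - (l + ?t *\<^sub>R y)))\<^sup>2" by (rule d_le)
    also have "\<dots> = (norm (x - l))\<^sup>2 - 2 * ?t * ?a + ?t\<^sup>2 * (norm y)\<^sup>2"
    proof -
      have "(norm (x - (l + t *\<^sub>R y)))\<^sup>2 = (norm (x - l))\<^sup>2 - 2 * t * ?a + t\<^sup>2 * (norm y)\<^sup>2" for t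
        unfolding power2_norm_eq_inner by (simp add: inner_diff inner_add inner_commute algebra_simps power2_eq_square)
      then show ?thesis by blast
    qed
    also have "\<dots> = (norm (x - l))\<^sup>2 - ?a\<^sup>2 / (norm y)\<^sup>2" using y0 by (simp add: power2_eq_square)
    finally have "?a\<^sup>2 / (norm y)\<^sup>2 \<le> 0" using ld by linarith
    moreover have "?a\<^sup>2 / (norm y)\<^sup>2 > 0" using a y0 by simp
    ultimately show False by linarith
  qed
  with lM that show ?thesis by blast
qed

theorem riesz_representation:
  fixes f :: "'a::{real_inner,banach} \<Rightarrow> real"
  assumes f: "bounded_linear f"
  obtains z where "\<And>x. f x = inner z x"
proof (cases "\<forall>x. f x = 0")
  case True
  then show ?thesis using that[of 0] by simp
next
  case False
  then obtain x0 where x0: "f x0 \<noteq> 0" by blast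
  interpret f: bounded_linear f by fact
  let ?M = "{x. f x = 0}"
  have sub: "subspace ?M" by (auto simp: subspace_def f.add f.scaleR f.zero)
  have cl: "closed ?M" by (intro closed_Collect_eq continuous_intros f.continuous_on)
  obtain m where m': "m \<in> ?M" "\<And>y. y \<in> ?M \<Longrightarrow> inner (x0 - m) y = 0"
    using closed_subspace_projection[OF sub cl] by metis
  then have m: "f m = 0" "\<And>y. f y = 0 \<Longrightarrow> inner (x0 - m) y = 0" by simp_all
  let ?w = "x0 - m"
  have fw: "f ?w = f x0" using m by (simp add: f.diff)
  have w0: "(norm ?w)\<^sup>2 > 0" using fw x0 f.zero by auto
  have "f x = inner ((f ?w / (norm ?w)\<^sup>2) *\<^sub>R ?w) x" for x
  proof -
    have "f (x - (f x / f ?w) *\<^sub>R ?w) = 0" using fw x0 by (simp add: f.diff f.scaleR)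
    from m(2)[OF this] have "inner ?w x = (f x / f ?w) * (norm ?w)\<^sup>2"
      by (simp add: inner_diff_right power2_norm_eq_inner)
    then show ?thesis using w0 fw x0 by simp
  qed
  then show ?thesis by (rule that)
qed

section \<open>Weak convergence and uniform boundedness\<close>

lemma subspace_closure:
  fixes S :: "'a::real_normed_vector set"
  assumes "subspace S" shows "subspace (closure S)"
  unfolding subspace_def
proof (intro conjI ballI allI)
  show "0 \<in> closure S" using assms closure_subset subspace_0 by blast
  fix x assume x: "x \<in> closure S"
  then obtain f where f: "\<And>n. f n \<in> S" "f \<longlonglongrightarrow> x" by (auto simp: closure_sequential)
  show "x + y \<in> closure S" if y: "y \<in> closure S" for y
  proof -
    obtain g where g: "\<And>n. g n \<in> S" "g \<longlonglongrightarrow> y" using y by (auto simp: closure_sequential)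
    have "(\<lambda>n. f n + g n) \<longlonglongrightarrow> x + y" "\<And>n. f n + g n \<in> S" using f g assms by (auto intro: tendsto_add subspace_add)
    then show ?thesis unfolding closure_sequential by (intro exI[of _ "\<lambda>n. f n + g n"]) simp
  qed
  show "c *\<^sub>R x \<in> closure S" for c
  proof -
    have "(\<lambda>n. c *\<^sub>R f n) \<longlonglongrightarrow> c *\<^sub>R x" "\<And>n. c *\<^sub>R f n \<in> S" using f assms by (auto intro: tendsto_intros subspace_scale)
    then show ?thesis unfolding closure_sequential by (intro exI[of _ "\<lambda>n. c *\<^sub>R f n"]) simp
  qed
qed

text \<open>Stated as triviality of the orthogonal complement, the form in which it is verified for
  boxes and applied to limits of Galerkin solutions; density of the span follows by
  projection.\<close>

definition total_seq :: "(nat \<Rightarrow> 'a::real_inner) \<Rightarrow> bool" where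
  "total_seq d \<longleftrightarrow> (\<forall>x. (\<forall>i. inner x (d i) = 0) \<longrightarrow> x = 0)"

definition weakly :: "(nat \<Rightarrow> 'a::real_inner) \<Rightarrow> 'a \<Rightarrow> bool" where
  "weakly u l \<longleftrightarrow> (\<forall>x. (\<lambda>n. inner (u n) x) \<longlonglongrightarrow> inner l x)"

lemma total_seq_dense:
  fixes d :: "nat \<Rightarrow> 'a::{real_inner,banach}"
  assumes "total_seq d" shows "closure (span (range d)) = UNIV"
proof -
  have sub: "subspace (closure (span (range d)))" by (simp add: subspace_closure subspace_span)
  have "x \<in> closure (span (range d))" for x
  proof -
    obtain m where m: "m \<in> closure (span (range d))" "\<And>y. y \<in> closure (span (range d)) \<Longrightarrow> inner (x - m) y = 0"
      using closed_subspace_projection[OF sub closed_closure] by metis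
    have "inner (x - m) (d i) = 0" for i
      by (intro m(2) subsetD[OF closure_subset] span_base) auto
    then have "x - m = 0" using assms unfolding total_seq_def by blast
    then show ?thesis using m by simp
  qed
  then show ?thesis by blast
qed

lemma weakly_subseq: "weakly u l \<Longrightarrow> strict_mono r \<Longrightarrow> weakly (u \<circ> r) l"
  unfolding weakly_def using LIMSEQ_subseq_LIMSEQ[of "\<lambda>n. inner (u n) x" "inner l x" r for x]
  by (auto simp: o_def)

lemma weakly_diff: "weakly u l \<Longrightarrow> weakly v m \<Longrightarrow> weakly (\<lambda>n. u n - v n) (l - m)"
  unfolding weakly_def by (auto simp: inner_diff_left intro!: tendsto_diff)

lemma weakly_add: "weakly u l \<Longrightarrow> weakly v m \<Longrightarrow> weakly (\<lambda>n. u n + v n) (l + m)"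
  unfolding weakly_def by (auto simp: inner_add_left intro!: tendsto_add)

lemma weakly_const: "weakly (\<lambda>_. l) l" by (simp add: weakly_def)

lemma tendsto_imp_weakly: "u \<longlonglongrightarrow> l \<Longrightarrow> weakly u l"
  unfolding weakly_def by (auto intro!: tendsto_intros)

lemma weakly_norm_le:
  assumes "weakly u l" "\<And>n. norm (u n) \<le> R" shows "norm l \<le> R"
proof (cases "l = 0")
  case True then show ?thesis using order_trans[OF norm_ge_zero assms(2)[of 0]] by simp
next
  case False
  have "(\<lambda>n. inner (u n) l) \<longlonglongrightarrow> inner l l" using assms(1) by (simp add: weakly_def)
  moreover have "inner (u n) l \<le> R * norm l" for n
    using norm_cauchy_schwarz[of "u n" l] mult_right_mono[OF assms(2) norm_ge_zero[of l]] by (meson order_trans)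
  ultimately have "inner l l \<le> R * norm l" by (intro LIMSEQ_le_const2) auto
  then have "norm l * norm l \<le> R * norm l" by (simp add: dot_square_norm power2_eq_square)
  then show ?thesis using False by simp
qed

text \<open>A diagonal sequence converges against every \<open>d i\<close>, hence on their span,
  hence by boundedness on its closure; Riesz represents the limit functional.\<close>

lemma bounded_seq_weakly_convergent_subseq:
  fixes u d :: "nat \<Rightarrow> 'a::{real_inner,banach}"
  assumes tot: "total_seq d" and bd: "\<And>n. norm (u n) \<le> R"
  obtains r l where "strict_mono r" "weakly (u \<circ> r) l"
proof -
  interpret subseqs "\<lambda>i s. convergent (\<lambda>n. inner (u (s n)) (d i))"
  proof
    fix i and s :: "nat \<Rightarrow> nat" assume "strict_mono s"
    have "\<bar>inner (u (s n)) (d i)\<bar> \<le> R * norm (d i)" for n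
      using Cauchy_Schwarz_ineq2[of "u (s n)" "d i"] mult_right_mono[OF bd norm_ge_zero[of "d i"]] by (meson order_trans)
    then have "bounded (range (\<lambda>n. inner (u (s n)) (d i)))" by (auto simp: bounded_iff)
    then obtain r' l where "strict_mono r'" "((\<lambda>n. inner (u (s n)) (d i)) \<circ> r') \<longlonglongrightarrow> l"
      using bounded_imp_convergent_subsequence by blast
    then show "\<exists>r'. strict_mono r' \<and> convergent (\<lambda>n. inner (u ((s \<circ> r') n)) (d i))"
      by (auto simp: o_def convergent_def)
  qed
  let ?r = diagseq
  have cd: "convergent (\<lambda>n. inner (u (?r n)) (d i))" for i
  proof -
    have "convergent (\<lambda>n. inner (u ((?r \<circ> ((+) (Suc i))) n)) (d i))"
    proof (rule diagseq_holds)
      fix k s r assume "strict_mono (r :: nat \<Rightarrow> nat)" "convergent (\<lambda>n. inner (u (s n)) (d k))"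
      then show "convergent (\<lambda>n. inner (u ((s \<circ> r) n)) (d k))"
        using convergent_subseq_convergent[of "\<lambda>n. inner (u (s n)) (d k)" r] by (simp add: o_def)
    qed
    then have "convergent (\<lambda>n. inner (u (?r (n + Suc i))) (d i))" by (simp add: o_def add.commute)
    then show ?thesis using convergent_ignore_initial_segment[of "\<lambda>n. inner (u (?r n)) (d i)" "Suc i"] by simp
  qed
  have cs: "convergent (\<lambda>n. inner (u (?r n)) x)" if "x \<in> span (range d)" for x
    using that
  proof (induction rule: span_induct_alt)
    case base then show ?case by (simp add: convergent_const)
  next
    case (step c x y)
    then show ?case using cd by (auto simp: inner_add_right intro!: convergent_add convergent_mult convergent_const)
  qed
  have R0: "R \<ge> 0" using bd[of 0] norm_ge_zero[of "u 0"] by linarith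
  have c: "convergent (\<lambda>n. inner (u (?r n)) x)" for x
  proof (rule Cauchy_convergent, rule metric_CauchyI)
    fix e :: real assume e: "e > 0"
    let ?e = "(e / 3) / (R + 1)"
    have e': "?e > 0" using e R0 by simp
    obtain y where y: "y \<in> span (range d)" "dist y x < ?e"
      using total_seq_dense[OF tot] e' closure_approachable[of x "span (range d)"] by blast
    obtain N where N: "\<And>m n. m \<ge> N \<Longrightarrow> n \<ge> N \<Longrightarrow> dist (inner (u (?r m)) y) (inner (u (?r n)) y) < e / 3"
      using convergent_Cauchy[OF cs[OF y(1)]] e unfolding Cauchy_def by (meson divide_pos_pos zero_less_numeral)
    have b: "\<bar>inner (u n) x - inner (u n) y\<bar> \<le> e / 3" for n
    proof -
      have "\<bar>inner (u n) x - inner (u n) y\<bar> \<le> norm (u n) * norm (x - y)"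
        using Cauchy_Schwarz_ineq2[of "u n" "x - y"] by (simp add: inner_diff_right)
      also have "\<dots> \<le> (R + 1) * ?e" using bd[of n] y(2) R0 by (intro mult_mono) (auto simp: dist_norm norm_minus_commute)
      also have "\<dots> = e / 3"
      proof -
        have "R + 1 \<noteq> 0" using R0 by simp
        then show ?thesis by (metis nonzero_mult_div_cancel_left times_divide_eq_right)
      qed
      finally show ?thesis .
    qed
    have "dist (inner (u (?r m)) x) (inner (u (?r n)) x) < e" if "m \<ge> N" "n \<ge> N" for m n
      using b[of "?r m"] b[of "?r n"] N[OF that] unfolding dist_real_def by linarith
    then show "\<exists>N. \<forall>m\<ge>N. \<forall>n\<ge>N. dist (inner (u (?r m)) x) (inner (u (?r n)) x) < e" by blast
  qed
  let ?f = "\<lambda>x. lim (\<lambda>n. inner (u (?r n)) x)"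
  have f: "(\<lambda>n. inner (u (?r n)) x) \<longlonglongrightarrow> ?f x" for x using c convergent_LIMSEQ_iff by blast
  have "bounded_linear ?f"
  proof (rule bounded_linear_intro[where K = R])
    show "?f (x + y) = ?f x + ?f y" for x y
      using tendsto_add[OF f[of x] f[of y]] f[of "x + y"] by (auto simp: inner_add_right intro: LIMSEQ_unique)
    show "?f (a *\<^sub>R x) = a *\<^sub>R ?f x" for a x
      using tendsto_mult[OF tendsto_const f[of x], of a] f[of "a *\<^sub>R x"] by (auto intro: LIMSEQ_unique)
    have "\<bar>inner (u n) x\<bar> \<le> norm x * R" for n x
      using Cauchy_Schwarz_ineq2[of "u n" x] mult_right_mono[OF bd[of n] norm_ge_zero[of x]] by (simp add: mult.commute)
    then show "norm (?f x) \<le> norm x * R" for x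
      using tendsto_rabs[OF f[of x]] by (auto intro!: LIMSEQ_le_const2)
  qed
  then obtain z where "\<And>x. ?f x = inner z x" using riesz_representation by blast
  then have "weakly (u \<circ> ?r) z" using f by (simp add: weakly_def o_def)
  then show ?thesis using that subseq_diagseq by blast
qed

text \<open>Were \<open>A\<close> unbounded, a single vector \<open>l\<close> would have inner
  products with the \<open>a n\<close> growing like \<open>n\<close>. The sign of each step prevents
  cancellation with the earlier ones, and the later steps undo at most half of a hump.\<close>

theorem weakly_bounded_imp_bounded:
  fixes A :: "'a::{real_inner,banach} set"
  assumes "\<And>w. \<exists>B. \<forall>a\<in>A. \<bar>inner a w\<bar> \<le> B"
  shows "\<exists>B. \<forall>a\<in>A. norm a \<le> B"
proof (rule ccontr)
  assume "\<not> ?thesis"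
  then have "\<exists>a\<in>A. norm a > 2 * real (Suc n) * 3 ^ n" for n by (meson not_le)
  then obtain a where a: "\<And>n. a n \<in> A" "\<And>n. norm (a n) > 2 * real (Suc n) * 3 ^ n" by metis
  have na: "norm (a n) > 0" for n using a(2)[of n] by (meson less_trans mult_pos_pos of_nat_0_less_iff zero_less_Suc zero_less_numeral zero_less_power)
  text \<open>The gliding hump: the \<open>n\<close>-th step has length \<open>3\<^sup>-\<^sup>n\<close> and makes \<open>inner (a n) w\<close> large.\<close>
  define w where "w = rec_nat 0 (\<lambda>n v. v + ((if inner (a n) v \<ge> 0 then 1 else -1) * (1/3)^n / norm (a n)) *\<^sub>R a n)"
  have w0: "w (Suc n) = w n + ((if inner (a n) (w n) \<ge> 0 then 1 else -1) * (1/3)^n / norm (a n)) *\<^sub>R a n" for n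
    by (simp add: w_def)
  have step: "norm (w (Suc n) - w n) \<le> (1/3)^n" for n using na[of n] unfolding w0 by auto
  have far: "norm (w (n + k) - w n) \<le> (3/2) * (1/3)^n - (1/2) * (1/3)^n * (3 * (1/3)^k)" for n k
  proof (induction k)
    case (Suc k)
    have "norm (w (n + Suc k) - w n) \<le> norm (w (Suc (n + k)) - w (n + k)) + norm (w (n + k) - w n)"
      by (metis add_Suc_right diff_add_cancel norm_triangle_ineq add_diff_eq)
    also have "\<dots> \<le> (1/3)^(n + k) + ((3/2) * (1/3)^n - (1/2) * (1/3)^n * (3 * (1/3)^k))" using step Suc by (intro add_mono) auto
    finally show ?case by (simp add: power_add mult.commute)
  qed simp
  have far': "norm (w m - w n) \<le> (3/2) * (1/3)^n" if "n \<le> m" for m n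
  proof -
    have "0 \<le> (1/2) * (1/3)^n * (3 * (1/3::real)^(m - n))" by simp
    then show ?thesis using far[of n "m - n"] that by (smt (verit) le_add_diff_inverse)
  qed
  have "Cauchy w"
  proof (rule metric_CauchyI)
    fix e :: real assume "e > 0"
    then obtain N where N: "(1/3::real)^N < e / 3" using real_arch_pow_inv[of "e/3" "1/3"] by auto
    have "dist (w m) (w n) < e" if "m \<ge> N" "n \<ge> N" for m n
    proof -
      have "norm (w m - w n) \<le> norm (w m - w N) + norm (w n - w N)"
        by (metis norm_minus_commute norm_triangle_ineq diff_add_cancel add_diff_eq)
      then show ?thesis using far'[OF that(1)] far'[OF that(2)] N unfolding dist_norm by linarith
    qed
    then show "\<exists>N. \<forall>m\<ge>N. \<forall>n\<ge>N. dist (w m) (w n) < e" by blast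
  qed
  then obtain l where l: "w \<longlonglongrightarrow> l" using Cauchy_convergent convergent_def by blast
  have lw: "norm (l - w n) \<le> (3/2) * (1/3)^n" for n
  proof (rule LIMSEQ_le_const2)
    show "(\<lambda>m. norm (w m - w n)) \<longlonglongrightarrow> norm (l - w n)" by (intro tendsto_intros l)
  qed (use far' in auto)
  obtain B where B: "\<And>b. b \<in> A \<Longrightarrow> \<bar>inner b l\<bar> \<le> B" using assms by blast
  have "real (Suc n) \<le> B" for n
  proof -
    let ?s = "if inner (a n) (w n) \<ge> 0 then 1 else -1 :: real"
    define X where "X = (1/3)^n * norm (a n)"
    have X0: "X \<ge> 0" by (simp add: X_def)
    have "inner (a n) (w (Suc n)) = inner (a n) (w n) + ?s * X"
      unfolding w0 X_def using na[of n] by (simp add: inner_add_right dot_square_norm power2_eq_square)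
    then have 1: "\<bar>inner (a n) (w (Suc n))\<bar> \<ge> X" using X0 by (auto simp: abs_if)
    have "\<bar>inner (a n) l - inner (a n) (w (Suc n))\<bar> \<le> norm (a n) * norm (l - w (Suc n))"
      using Cauchy_Schwarz_ineq2[of "a n" "l - w (Suc n)"] by (simp add: inner_diff_right)
    \<comment> \<open>Only steps after the hump contribute, hence the exponent \<open>Suc n\<close>;
      with it the bound for the loss is exactly half of the hump \<open>X\<close>.\<close>
    also have "\<dots> \<le> norm (a n) * ((3/2) * (1/3)^Suc n)" by (intro mult_left_mono lw) auto
    also have "\<dots> = (1/2) * X" by (simp add: X_def)
    finally have 2: "\<bar>inner (a n) l - inner (a n) (w (Suc n))\<bar> \<le> (1/2) * X" .
    have "(1/3)^n * (2 * real (Suc n) * 3 ^ n) \<le> X" unfolding X_def using a(2)[of n] by (intro mult_left_mono) auto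
    also have "(1/3)^n * (2 * real (Suc n) * 3 ^ n) = 2 * real (Suc n)" by (simp add: power_one_over)
    finally have 3: "2 * real (Suc n) \<le> X" .
    have "\<bar>inner (a n) (w (Suc n))\<bar> \<le> \<bar>inner (a n) l\<bar> + \<bar>inner (a n) l - inner (a n) (w (Suc n))\<bar>" by arith
    then show ?thesis using 1 2 3 B[OF a(1)[of n]] by argo
  qed
  moreover obtain n :: nat where "B < real n" using reals_Archimedean2 by blast
  ultimately show False by (meson less_le_not_le less_imp_le_nat lessI of_nat_less_iff order_less_le_trans not_less)
qed

lemma weakly_imp_bounded:
  fixes u :: "nat \<Rightarrow> 'a::{real_inner,banach}"
  assumes "weakly u l" obtains B where "\<And>n. norm (u n) \<le> B"
proof -
  have "\<exists>B. \<forall>a\<in>range u. \<bar>inner a w\<bar> \<le> B" for w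
  proof -
    have "convergent (\<lambda>n. inner (u n) w)" using assms by (auto simp: weakly_def convergent_def)
    then have "Bseq (\<lambda>n. inner (u n) w)" by (rule convergent_imp_Bseq)
    then obtain B where "\<And>n. \<bar>inner (u n) w\<bar> \<le> B" by (auto simp: Bseq_def)
    then show ?thesis by (intro exI[of _ B]) auto
  qed
  from weakly_bounded_imp_bounded[OF this] show ?thesis using that by auto
qed

subsection \<open>The sign of an invertible symmetric operator\<close>

text \<open>Cauchy-Schwarz for a nonnegative form, by which a bound of the form becomes one of the
  operator.\<close>

lemma symmetric_form_bound:
  fixes A :: "'a::real_inner \<Rightarrow> 'a"
  assumes "linear A" and sym: "\<And>x y. inner (A x) y = inner x (A y)"
    and pos: "\<And>x. 0 \<le> inner (A x) x" and le: "\<And>x. inner (A x) x \<le> \<rho> * (norm x)\<^sup>2"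
  shows "norm (A x) \<le> \<rho> * norm x"
proof (cases "A x = 0")
  case True
  have "0 \<le> \<rho>" if "x \<noteq> 0" using order_trans[OF pos le, of x] that by (simp add: zero_le_mult_iff)
  then show ?thesis using True by (cases "x = 0") auto
next
  case False
  interpret linear A by fact
  let ?y = "A x"
  let ?s = "norm ?y / norm x"
  have x0: "x \<noteq> 0" using False zero by auto
  have s: "?s > 0" using False x0 by simp
  have "0 \<le> inner (A (?s *\<^sub>R x - ?y)) (?s *\<^sub>R x - ?y)" by (rule pos)
  also have "\<dots> = ?s\<^sup>2 * inner (A x) x - 2 * ?s * (norm ?y)\<^sup>2 + inner (A ?y) ?y"
  proof -
    have "inner (A (t *\<^sub>R x - y)) (t *\<^sub>R x - y) = t\<^sup>2 * inner (A x) x - 2 * t * inner (A x) y + inner (A y) y" for t y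
      using sym[of y x] by (simp add: diff scale inner_diff power2_eq_square inner_commute algebra_simps)
    then show ?thesis by (simp add: power2_norm_eq_inner)
  qed
  also have "\<dots> \<le> ?s\<^sup>2 * (\<rho> * (norm x)\<^sup>2) - 2 * ?s * (norm ?y)\<^sup>2 + \<rho> * (norm ?y)\<^sup>2"
    using le[of x] le[of ?y] by (intro add_mono diff_mono mult_left_mono) auto
  also have "?s\<^sup>2 * (\<rho> * (norm x)\<^sup>2) = \<rho> * (norm ?y)\<^sup>2" using x0 by (simp add: power_divide)
  finally have "2 * ?s * (norm ?y)\<^sup>2 \<le> 2 * \<rho> * (norm ?y)\<^sup>2" by simp
  then have "?s * (norm ?y)\<^sup>2 \<le> \<rho> * (norm ?y)\<^sup>2" by (simp only: mult.assoc mult_le_cancel_left)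
  moreover have "(norm ?y)\<^sup>2 > 0" using False by simp
  ultimately have "?s \<le> \<rho>" by (rule mult_right_le_imp_le)
  then show ?thesis using x0 by (simp add: field_simps)
qed

text \<open>For symmetric \<open>L\<close> the lower bound says that the spectrum avoids the open
  interval from \<open>- c\<close> to \<open>c\<close>; with \<open>K\<close> as upper bound,
  \<open>L / K\<close> starts the iteration with an error between 0 and
  \<open>1 - (c/K)\<^sup>2\<close> as a quadratic form.\<close>

locale symmetric_bounded_below =
  fixes L :: "'a::{real_inner,banach} \<Rightarrow> 'a" and c K :: real
  assumes lin: "bounded_linear L" and sym: "\<And>x y. inner (L x) y = inner x (L y)"
    and c: "c > 0" "\<And>x. norm (L x) \<ge> c * norm x"
    and K: "K > 0" "\<And>x. norm (L x) \<le> K * norm x" and cK: "c \<le> K"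
begin

text \<open>Newton's iteration \<open>S \<mapsto> S (3 - S\<^sup>2) / 2\<close> for the square root of the identity, started at \<open>L / K\<close>;
  the error \<open>E = 1 - S\<^sup>2\<close> obeys \<open>E \<mapsto> 3/4 E\<^sup>2 + 1/4 E\<^sup>3\<close>.\<close>

primrec newton :: "nat \<Rightarrow> 'a \<Rightarrow> 'a" where
  "newton 0 = (\<lambda>u. (1/K) *\<^sub>R L u)"
| "newton (Suc k) = (\<lambda>u. newton k u + (1/2) *\<^sub>R newton k (u - newton k (newton k u)))"

definition err :: "nat \<Rightarrow> 'a \<Rightarrow> 'a" where "err k u = u - newton k (newton k u)"

lemma newton_Suc: "newton (Suc k) u = newton k u + (1/2) *\<^sub>R newton k (err k u)"
  by (simp add: err_def)

declare newton.simps(2)[simp del]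

lemma newton_linear: "bounded_linear (newton k)"
proof (induction k)
  case 0 show ?case using bounded_linear_compose[OF bounded_linear_scaleR_right lin] by simp
next
  case (Suc k)
  show ?case unfolding newton.simps
    by (intro bounded_linear_add Suc bounded_linear_compose[OF bounded_linear_scaleR_right] bounded_linear_compose[OF Suc]
      bounded_linear_sub bounded_linear_ident)
qed

lemma newton_add: "newton k (x + y) = newton k x + newton k y"
  and newton_diff: "newton k (x - y) = newton k x - newton k y"
  and newton_scaleR: "newton k (r *\<^sub>R x) = r *\<^sub>R newton k x"
  using newton_linear[of k] by (simp_all add: bounded_linear.linear linear_add linear_diff linear_scale)

lemma newton_sym: "inner (newton k x) y = inner x (newton k y)"
proof (induction k arbitrary: x y)
  case (Suc k)
  show ?case unfolding newton.simps
    by (simp add: inner_add inner_diff Suc newton_diff)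
qed (simp add: sym)

lemma newton_L: "L (newton k x) = newton k (L x)"
proof (induction k arbitrary: x)
  case (Suc k)
  interpret bounded_linear L by (rule lin)
  show ?case unfolding newton.simps by (simp add: add diff scaleR Suc)
qed (use lin in \<open>simp add: bounded_linear.linear linear_scale\<close>)

lemma err_linear: "linear (err k)"
  by (auto intro!: linearI simp: err_def newton_add newton_scaleR scaleR_diff_right)

lemma err_sym: "inner (err k x) y = inner x (err k y)"
  by (simp add: err_def inner_diff newton_sym)

lemma err_newton: "err k (newton k x) = newton k (err k x)"
  by (simp add: err_def newton_diff)

text \<open>With \<open>S\<^sup>2 = 1 - E\<close> this is the expansion of
  \<open>1 - (1 - E) (1 + E / 2)\<^sup>2\<close>; all factors commute.\<close>

lemma err_Suc: "err (Suc k) x = (3/4) *\<^sub>R err k (err k x) + (1/4) *\<^sub>R err k (err k (err k x))"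
proof -
  interpret E: linear "err k" by (rule err_linear)
  have nn: "newton k (newton k y) = y - err k y" for y by (simp add: err_def)
  have "newton (Suc k) (newton (Suc k) x) = newton k (newton k x) + newton k (newton k (err k x)) + (1/4) *\<^sub>R newton k (newton k (err k (err k x)))"
    unfolding newton_Suc by (simp add: newton_add newton_scaleR E.add E.scale err_newton scaleR_add_right)
       (simp flip: scaleR_add_left)
  have q: "(3/4) *\<^sub>R y = y - (1/4) *\<^sub>R y" for y :: 'a
    using scaleR_left_diff_distrib[of 1 "1/4" y] by simp
  from \<open>newton (Suc k) (newton (Suc k) x) = _\<close> show ?thesis unfolding nn q
    by (simp add: err_def[of "Suc k"] scaleR_diff_right)
qed

text \<open>All errors are polynomials in \<open>err 0\<close> with nonnegative coefficients, hence nonnegative operators.\<close>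

inductive_set npoly :: "('a \<Rightarrow> 'a) set" where
  np_id: "(\<lambda>x. x) \<in> npoly"
| np_add: "A \<in> npoly \<Longrightarrow> B \<in> npoly \<Longrightarrow> (\<lambda>x. A x + B x) \<in> npoly"
| np_scale: "A \<in> npoly \<Longrightarrow> 0 \<le> r \<Longrightarrow> (\<lambda>x. r *\<^sub>R A x) \<in> npoly"
| np_err: "A \<in> npoly \<Longrightarrow> (\<lambda>x. A (err 0 x)) \<in> npoly"

lemma npoly_comp:
  assumes "A \<in> npoly" "B \<in> npoly" shows "(\<lambda>x. A (B x)) \<in> npoly"
  using assms(1)
proof (induction rule: npoly.induct)
  case (np_err A)
  have "B (err 0 x) = err 0 (B x)" for x
    using assms(2) by (induction arbitrary: x rule: npoly.induct) (simp_all add: linear_add linear_scale err_linear)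
  then show ?case using npoly.np_err[OF np_err.IH] by simp
qed (use assms(2) in \<open>auto intro: npoly.intros\<close>)

lemma err_npoly: "err k \<in> npoly"
proof (induction k)
  case 0 show ?case using npoly.np_err[OF npoly.np_id] by simp
next
  case (Suc k)
  have 2: "(\<lambda>x. err k (err k x)) \<in> npoly" by (rule npoly_comp[OF Suc Suc])
  have 3: "(\<lambda>x. err k (err k (err k x))) \<in> npoly" by (rule npoly_comp[OF Suc 2])
  have "(\<lambda>x. (3/4) *\<^sub>R err k (err k x) + (1/4) *\<^sub>R err k (err k (err k x))) \<in> npoly"
    using npoly.np_add[OF npoly.np_scale[OF 2, of "3/4"] npoly.np_scale[OF 3, of "1/4"]] by simp
  then show ?case using err_Suc by presburger
qed

lemma err_0_bounds: "0 \<le> inner (err 0 x) x" "inner (err 0 x) x \<le> (1 - (c/K)\<^sup>2) * (norm x)\<^sup>2"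
proof -
  have e: "inner (err 0 x) x = (norm x)\<^sup>2 - (norm (L x) / K)\<^sup>2"
  proof -
    have "inner (err 0 x) x = (norm x)\<^sup>2 - (norm (newton 0 x))\<^sup>2"
      unfolding err_def inner_diff_left newton_sym power2_norm_eq_inner ..
    then show ?thesis using K(1) by simp
  qed
  have "norm (L x) / K \<le> norm x" using K(2)[of x] K(1) by (simp add: field_simps)
  then show "0 \<le> inner (err 0 x) x" unfolding e using K(1) by (simp add: power_mono)
  have "c * norm x / K \<le> norm (L x) / K" using c(2)[of x] K(1) by (simp add: divide_right_mono)
  then have "(c * norm x / K)\<^sup>2 \<le> (norm (L x) / K)\<^sup>2" using c(1) K(1) by (intro power_mono) auto
  then show "inner (err 0 x) x \<le> (1 - (c/K)\<^sup>2) * (norm x)\<^sup>2" unfolding e by (simp add: power_divide power_mult_distrib algebra_simps)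
qed

text \<open>Even powers of \<open>err 0\<close> are squares of symmetric operators, odd ones are
  such squares with one nonnegative factor in the middle.\<close>

lemma npoly_pos: "A \<in> npoly \<Longrightarrow> 0 \<le> inner (A x) x"
proof -
  have pow_sym: "inner ((err 0 ^^ j) x) y = inner x ((err 0 ^^ j) y)" for j x y
    by (induction j arbitrary: x y) (simp_all add: err_sym funpow_swap1)
  have pow: "0 \<le> inner ((err 0 ^^ j) x) x" for j x
  proof (cases "even j")
    case True
    then obtain i where "j = i + i" by (metis evenE mult_2)
    then show ?thesis using pow_sym[of i "(err 0 ^^ i) x" x] by (simp add: funpow_add)
  next
    case False
    then obtain i where "j = i + Suc i" by (metis oddE mult_2 Suc_eq_plus1 add_Suc_right)
    then have "inner ((err 0 ^^ j) x) x = inner (err 0 ((err 0 ^^ i) x)) ((err 0 ^^ i) x)"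
      using pow_sym[of i "err 0 ((err 0 ^^ i) x)" x] by (simp add: funpow_add funpow_swap1)
    then show ?thesis using err_0_bounds by simp
  qed
  assume "A \<in> npoly"
  \<comment> \<open>Strengthened by an arbitrary power, since \<open>np_err\<close> inserts a
    further factor on the inside.\<close>
  then have "0 \<le> inner (A ((err 0 ^^ j) x)) x" for j x
  proof (induction arbitrary: j rule: npoly.induct)
    case (np_err A)
    show ?case using np_err.IH[of "Suc j"] by simp
  qed (simp_all add: pow inner_add_left)
  from this[of 0] show ?thesis by simp
qed

definition "\<rho> = 1 - (c/K)\<^sup>2"

lemma rho: "0 \<le> \<rho>" "\<rho> < 1"
  using c K cK by (auto simp: \<rho>_def power_le_one_iff)

text \<open>The square and the cube of the error are both bounded with two factors
  \<open>?r\<close>, and one of them is traded for \<open>\<rho>\<close>; the resulting geometric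
  rate makes the Newton steps summable.\<close>

lemma err_le: "norm (err k x) \<le> \<rho> ^ Suc k * norm x"
proof (induction k arbitrary: x)
  case 0
  show ?case using symmetric_form_bound[OF err_linear err_sym] err_0_bounds by (simp add: \<rho>_def)
next
  case (Suc k)
  let ?r = "\<rho> ^ Suc k"
  have r: "0 \<le> ?r" "?r \<le> \<rho>" "?r \<le> 1" using rho power_decreasing[of 1 "Suc k" \<rho>] by (auto intro: power_le_one)
  have 1: "norm (err k (err k x)) \<le> ?r * (?r * norm x)"
    using Suc[of "err k x"] mult_left_mono[OF Suc[of x] r(1)] by linarith
  have 2: "norm (err k (err k (err k x))) \<le> 1 * (?r * (?r * norm x))"
    using Suc[of "err k (err k x)"] mult_mono[OF r(3) 1] r by (meson norm_ge_zero order_trans zero_le_one)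
  have "norm (err (Suc k) x) \<le> (3/4) * norm (err k (err k x)) + (1/4) * norm (err k (err k (err k x)))"
    unfolding err_Suc by (rule order_trans[OF norm_triangle_ineq]) simp
  also have "\<dots> \<le> ?r * (?r * norm x)" using 1 2 by simp
  also have "\<dots> \<le> \<rho> * (?r * norm x)" using r by (intro mult_right_mono) auto
  finally show ?case by (simp add: mult.assoc)
qed

text \<open>Nonnegativity of the error means that the square of the iterate is at most the
  identity.\<close>

lemma newton_le: "norm (newton k x) \<le> 2 * norm x"
proof -
  have "(norm (newton k x))\<^sup>2 = inner (newton k (newton k x)) x" by (simp add: newton_sym power2_norm_eq_inner)
  also have "\<dots> = (norm x)\<^sup>2 - inner (err k x) x" by (simp add: err_def inner_diff power2_norm_eq_inner)
  also have "\<dots> \<le> (norm x)\<^sup>2 - 0" using npoly_pos[OF err_npoly] by (intro diff_left_mono) auto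
  also have "\<dots> \<le> (2 * norm x)\<^sup>2" by (simp add: power_mult_distrib)
  finally show ?thesis by (rule power2_le_imp_le) simp
qed

lemma newton_step: "norm (newton (Suc k) x - newton k x) \<le> \<rho> ^ Suc k * norm x"
proof -
  have "norm (newton (Suc k) x - newton k x) = (1/2) * norm (newton k (err k x))" by (simp add: newton_Suc)
  also have "\<dots> \<le> norm (err k x)" using newton_le[of k "err k x"] by simp
  finally show ?thesis using err_le order_trans by blast
qed

definition sgn_op :: "'a \<Rightarrow> 'a" where "sgn_op x = lim (\<lambda>k. newton k x)"

lemma newton_tendsto: "(\<lambda>k. newton k x) \<longlonglongrightarrow> sgn_op x"
proof -
  have "summable (\<lambda>k. \<rho> ^ Suc k * norm x)" using rho by (intro summable_mult2) (simp add: summable_Suc_iff summable_geometric)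
  then have "summable (\<lambda>k. newton (Suc k) x - newton k x)"
    by (rule summable_comparison_test'[of _ 0]) (use newton_step in auto)
  then have "convergent (\<lambda>k. \<Sum>i<k. newton (Suc i) x - newton i x)" by (simp add: summable_iff_convergent)
  moreover have "(\<Sum>i<k. newton (Suc i) x - newton i x) = newton k x - newton 0 x" for k
    by (rule sum_lessThan_telescope[of "\<lambda>i. newton i x"])
  ultimately obtain l where "(\<lambda>k. newton k x - newton 0 x) \<longlonglongrightarrow> l" by (auto simp: convergent_def)
  from tendsto_add[OF this tendsto_const[of "newton 0 x"]] have "(\<lambda>k. newton k x) \<longlonglongrightarrow> l + newton 0 x" by simp
  then show ?thesis unfolding sgn_op_def by (simp add: limI)
qed

lemma sgn_op_bounded_linear: "bounded_linear sgn_op"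
proof (rule bounded_linear_intro[where K = 2])
  show "sgn_op (x + y) = sgn_op x + sgn_op y" for x y
    using tendsto_add[OF newton_tendsto newton_tendsto] newton_tendsto[of "x + y"]
    by (auto simp: newton_add intro: LIMSEQ_unique)
  show "sgn_op (r *\<^sub>R x) = r *\<^sub>R sgn_op x" for r x
    using tendsto_scaleR[OF tendsto_const newton_tendsto] newton_tendsto[of "r *\<^sub>R x"]
    by (auto simp: newton_scaleR intro: LIMSEQ_unique)
  show "norm (sgn_op x) \<le> norm x * 2" for x
    using tendsto_norm[OF newton_tendsto[of x]] newton_le[of _ x] by (auto intro!: LIMSEQ_le_const2 simp: mult.commute)
qed

lemma sgn_op_sym: "inner (sgn_op x) y = inner x (sgn_op y)"
  using tendsto_inner[OF newton_tendsto[of x] tendsto_const[of y]] tendsto_inner[OF tendsto_const[of x] newton_tendsto[of y]]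
  by (auto simp: newton_sym intro: LIMSEQ_unique)

lemma sgn_op_L: "sgn_op (L x) = L (sgn_op x)"
  using bounded_linear.tendsto[OF lin newton_tendsto[of x]] newton_tendsto[of "L x"]
  by (auto simp: newton_L intro: LIMSEQ_unique)

lemma sgn_op_sgn_op: "sgn_op (sgn_op x) = x"
proof -
  have "(\<lambda>k. newton k (newton k x - sgn_op x)) \<longlonglongrightarrow> 0"
  proof (rule Lim_null_comparison)
    show "\<forall>\<^sub>F k in sequentially. norm (newton k (newton k x - sgn_op x)) \<le> 2 * norm (newton k x - sgn_op x)"
      using newton_le by simp
    show "(\<lambda>k. 2 * norm (newton k x - sgn_op x)) \<longlonglongrightarrow> 0"
      using newton_tendsto[of x] by (auto intro!: tendsto_mult_right_zero tendsto_norm_zero simp: LIM_zero)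
  qed
  from tendsto_add[OF this newton_tendsto[of "sgn_op x"]]
  have "(\<lambda>k. newton k (newton k x)) \<longlonglongrightarrow> sgn_op (sgn_op x)" by (simp add: newton_diff)
  moreover have "(\<lambda>k. err k x) \<longlonglongrightarrow> 0"
  proof (rule Lim_null_comparison)
    show "\<forall>\<^sub>F k in sequentially. norm (err k x) \<le> \<rho> ^ Suc k * norm x" using err_le by simp
    show "(\<lambda>k. \<rho> ^ Suc k * norm x) \<longlonglongrightarrow> 0"
      using rho LIMSEQ_Suc[OF LIMSEQ_realpow_zero[of \<rho>]] by (auto intro!: tendsto_mult_left_zero)
  qed
  from tendsto_diff[OF tendsto_const[of x] this] have "(\<lambda>k. newton k (newton k x)) \<longlonglongrightarrow> x"
    by (simp add: err_def)
  ultimately show ?thesis by (rule LIMSEQ_unique)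
qed

text \<open>Factors the iterate as \<open>L / K\<close> times \<open>1 + Q\<close> with
  \<open>Q\<close> nonnegative; this is what makes \<open>L\<close> times its sign coercive. The
  second alternative is the bare start of the iteration.\<close>

lemma newton_eq: "\<exists>Q\<in>npoly. \<forall>x. newton k x = (1/K) *\<^sub>R L (x + Q x) \<or> (k = 0 \<and> newton k x = (1/K) *\<^sub>R L x)"
proof (induction k)
  case 0 show ?case using npoly.np_id by auto
next
  case (Suc k)
  interpret bounded_linear L by (rule lin)
  have nk: "\<exists>Q\<in>npoly. \<forall>x. newton (Suc k) x = (1/K) *\<^sub>R L (x + Q x)"
  proof (cases k)
    case 0
    have "newton (Suc k) x = (1/K) *\<^sub>R L (x + (1/2) *\<^sub>R err k x)" for x
      unfolding newton_Suc 0 by (simp add: add scaleR algebra_simps)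
    then show ?thesis using npoly.np_scale[OF err_npoly, of "1/2" k] by (intro bexI[of _ "\<lambda>x. (1/2) *\<^sub>R err k x"]) auto
  next
    case (Suc k')
    then obtain Q where Q: "Q \<in> npoly" "\<And>x. newton k x = (1/K) *\<^sub>R L (x + Q x)" using Suc.IH by auto
    have "newton (Suc k) x = (1/K) *\<^sub>R L (x + (Q x + (1/2) *\<^sub>R (err k x + Q (err k x))))" for x
      unfolding newton_Suc Q(2) by (simp add: add scaleR algebra_simps)
    moreover have "(\<lambda>x. Q x + (1/2) *\<^sub>R (err k x + Q (err k x))) \<in> npoly"
      using npoly.np_add[OF Q(1) npoly.np_scale[OF npoly.np_add[OF err_npoly npoly_comp[OF Q(1) err_npoly]], of "1/2"]] by simp
    ultimately show ?thesis by (intro bexI[of _ "\<lambda>x. Q x + (1/2) *\<^sub>R (err k x + Q (err k x))"]) auto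
  qed
  then show ?case by blast
qed

text \<open>For every iterate the form is at least \<open>(norm (L x))\<^sup>2 / K\<close>, because
  \<open>Q\<close> is nonnegative and commutation lets it act on \<open>L x\<close>; the limit keeps
  the bound.\<close>

lemma sgn_op_coercive: "inner (L x) (sgn_op x) \<ge> (c\<^sup>2 / K) * (norm x)\<^sup>2"
proof (rule LIMSEQ_le_const)
  show "(\<lambda>k. inner (L x) (newton k x)) \<longlonglongrightarrow> inner (L x) (sgn_op x)" by (intro tendsto_intros newton_tendsto)
  have "(c\<^sup>2 / K) * (norm x)\<^sup>2 \<le> inner (L x) (newton k x)" for k
  proof -
    have Lx: "(c\<^sup>2 / K) * (norm x)\<^sup>2 \<le> (1/K) * (norm (L x))\<^sup>2"
      using power_mono[OF c(2)[of x], of 2] c(1) K(1) by (simp add: power_mult_distrib divide_right_mono)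
    obtain Q where Q: "Q \<in> npoly" "\<And>x. newton k x = (1/K) *\<^sub>R L (x + Q x) \<or> (k = 0 \<and> newton k x = (1/K) *\<^sub>R L x)"
      using newton_eq by blast
    show ?thesis
    proof (cases "k = 0")
      case True then show ?thesis using Lx by (simp add: dot_square_norm)
    next
      case False
      have "inner (L x) (newton k x) = inner x (newton k (L x))" using sym newton_L by metis
      also have "\<dots> = (1/K) * inner (L x) (L x + Q (L x))" using False Q(2)[of "L x"] sym[of x "L x + Q (L x)"] by simp
      also have "\<dots> \<ge> (1/K) * inner (L x) (L x)" using npoly_pos[OF Q(1), of "L x"] K(1)
        by (intro mult_left_mono) (auto simp: inner_add_right inner_commute)
      finally show ?thesis using Lx by (simp add: dot_square_norm)
    qed
  qed
  then show "\<exists>N. \<forall>k\<ge>N. (c\<^sup>2 / K) * (norm x)\<^sup>2 \<le> inner (L x) (newton k x)" by blast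
qed

end

section \<open>Critical points of strongly indefinite functionals\<close>

definition onset :: "'a::real_inner set \<Rightarrow> bool" where
  "onset B \<longleftrightarrow> finite B \<and> (\<forall>x\<in>B. \<forall>y\<in>B. inner x y = (if x = y then 1 else 0))"

lemma onset_inner_sum:
  assumes "onset B" "f \<in> B" shows "inner (\<Sum>g\<in>B. c g *\<^sub>R g) f = c f"
proof -
  have "inner (\<Sum>g\<in>B. c g *\<^sub>R g) f = (\<Sum>g\<in>B. if g = f then c f else 0)"
    unfolding inner_sum_left by (rule sum.cong) (use assms in \<open>auto simp: onset_def\<close>)
  then show ?thesis using assms by (simp add: onset_def)
qed

lemma onset_expand:
  assumes B: "onset B" and x: "x \<in> span B" shows "x = (\<Sum>f\<in>B. inner x f *\<^sub>R f)"
proof -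
  have "finite B" using B by (simp add: onset_def)
  then obtain c where "x = (\<Sum>f\<in>B. c f *\<^sub>R f)" using x span_finite by blast
  then show ?thesis using onset_inner_sum[OF B] by (auto intro!: sum.cong)
qed

lemma onset_inner_expand:
  assumes "onset B" "x \<in> span B" shows "inner x y = (\<Sum>f\<in>B. inner x f * inner f y)"
proof -
  have "inner x y = inner (\<Sum>f\<in>B. inner x f *\<^sub>R f) y" using onset_expand[OF assms] by simp
  then show ?thesis by (simp add: inner_sum_left)
qed

lemma onset_norm_expand:
  assumes "onset B" "x \<in> span B" shows "(norm x)\<^sup>2 = (\<Sum>f\<in>B. (inner x f)\<^sup>2)"
proof -
  have "inner x x = (\<Sum>f\<in>B. inner x f * inner f x)" by (rule onset_inner_expand[OF assms])
  also have "\<dots> = (\<Sum>f\<in>B. (inner x f)\<^sup>2)" by (rule sum.cong) (simp_all add: power2_eq_square inner_commute)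
  finally show ?thesis by (simp add: power2_norm_eq_inner)
qed

lemma limit_eventually_0:
  fixes f :: "nat \<Rightarrow> real"
  assumes "f \<longlonglongrightarrow> l" "\<forall>\<^sub>F n in sequentially. f n = 0" shows "l = 0"
  using LIMSEQ_unique[OF assms(1) tendsto_eventually[OF assms(2)]] .

text \<open>Gram-Schmidt that keeps the vectors already present, so that the Galerkin spaces can
  grow around a fixed core.\<close>

lemma onset_extend:
  assumes "onset B" "finite X"
  shows "\<exists>B'. onset B' \<and> B \<subseteq> B' \<and> span B' = span (B \<union> X)"
  using assms(2)
proof (induction X)
  case empty then show ?case using assms(1) by auto
next
  case (insert x X)
  then obtain B' where B': "onset B'" "B \<subseteq> B'" "span B' = span (B \<union> X)" by blast
  have sp: "span (insert x B') = span (B \<union> insert x X)"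
    using B'(3) by (metis Un_insert_right span_insert)
  show ?case
  proof (cases "x \<in> span B'")
    case True
    then show ?thesis using B' sp by (metis span_redundant)
  next
    case False
    define y where "y = x - (\<Sum>f\<in>B'. inner x f *\<^sub>R f)"
    have sumB: "(\<Sum>f\<in>B'. inner x f *\<^sub>R f) \<in> span B'" by (intro span_sum span_mul span_base)
    have y0: "y \<noteq> 0" using False sumB by (auto simp: y_def)
    have orth: "inner y f = 0" if "f \<in> B'" for f
      using onset_inner_sum[OF B'(1) that, of "\<lambda>f. inner x f"] by (simp add: y_def inner_diff_left)
    define z where "z = (1 / norm y) *\<^sub>R y"
    have z: "inner z z = 1" "\<And>f. f \<in> B' \<Longrightarrow> inner z f = 0"
      using y0 orth by (auto simp: z_def dot_square_norm power2_eq_square)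
    have zB: "z \<notin> B'" using z by fastforce
    have "onset (insert z B')" using B'(1) z zB unfolding onset_def by (auto simp: inner_commute)
    moreover have "span (insert z B') = span (insert x B')"
    proof (rule span_eq[THEN iffD2], intro conjI subsetI)
      fix v assume "v \<in> insert z B'"
      moreover have "y \<in> span (insert x B')" unfolding y_def
        by (intro span_diff span_base subsetD[OF span_mono sumB]) auto
      then have "z \<in> span (insert x B')" unfolding z_def by (rule span_mul)
      ultimately show "v \<in> span (insert x B')" by (auto intro: span_base)
    next
      fix v assume "v \<in> insert x B'"
      moreover have "x = norm y *\<^sub>R z + (\<Sum>f\<in>B'. inner x f *\<^sub>R f)" using y0 by (simp add: z_def y_def)
      moreover have "norm y *\<^sub>R z + (\<Sum>f\<in>B'. inner x f *\<^sub>R f) \<in> span (insert z B')"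
        using span_mono[of B' "insert z B'"] sumB by (intro span_add span_mul) (auto intro: span_base)
      ultimately have "x \<in> span (insert z B')" "v \<in> insert x B'" by simp_all
      then show "v \<in> span (insert z B')" by (auto intro: span_base)
    qed
    ultimately show ?thesis using B'(2) sp by (intro exI[of _ "insert z B'"]) auto
  qed
qed

lemma not_tendsto_subseq:
  fixes f :: "nat \<Rightarrow> 'a::metric_space"
  assumes "\<not> f \<longlonglongrightarrow> l"
  obtains e s where "e > 0" "strict_mono (s :: nat \<Rightarrow> nat)" "\<And>n. dist (f (s n)) l \<ge> e"
proof -
  obtain e where e: "e > 0" "\<And>N. \<exists>n\<ge>N. \<not> dist (f n) l < e" using assms unfolding lim_sequentially by blast
  let ?A = "{n. \<not> dist (f n) l < e}"
  have inf: "infinite ?A" using e(2) by (auto simp: infinite_nat_iff_unbounded_le)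
  have sm: "strict_mono (enumerate ?A)" using inf by (rule strict_mono_enumerate)
  have "dist (f (enumerate ?A n)) l \<ge> e" for n using enumerate_in_set[OF inf, of n] by simp
  with that[OF e(1) sm] show ?thesis by blast
qed

text \<open>\<open>Psi_quad\<close> makes \<open>\<psi>\<close> the gradient of
  \<open>\<Psi>\<close> with a second-order remainder uniform on balls; \<open>mu_le\<close> is the
  Ambrosetti-Rabinowitz condition; \<open>growth\<close> is what bounds approximate solutions;
  \<open>v\<close> shows that the positive space of \<open>L\<close> is
  infinite-dimensional.\<close>

locale indefinite_functional = symmetric_bounded_below L c K
  for L :: "'a::{real_inner,banach} \<Rightarrow> 'a" and c K +
  fixes \<psi> :: "'a \<Rightarrow> 'a" and \<Psi> :: "'a \<Rightarrow> real" and \<mu> c0 :: real and d v :: "nat \<Rightarrow> 'a"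
  assumes Psi_weak: "\<And>u l. weakly u l \<Longrightarrow> (\<lambda>n. \<Psi> (u n)) \<longlonglongrightarrow> \<Psi> l"
    and Psi_quad: "\<And>R. \<exists>C. \<forall>u h. norm u \<le> R \<longrightarrow> norm h \<le> 1 \<longrightarrow> \<bar>\<Psi> (u + h) - \<Psi> u - inner (\<psi> u) h\<bar> \<le> C * (norm h)\<^sup>2"
    and psi_odd: "\<And>u. \<psi> (- u) = - \<psi> u"
    and mu: "\<mu> > 2" and mu_le: "\<And>u. \<mu> * \<Psi> u \<le> inner (\<psi> u) u"
    and homog: "\<And>\<tau> u. \<tau> \<ge> 1 \<Longrightarrow> \<tau> powr \<mu> * \<Psi> u \<le> \<Psi> (\<tau> *\<^sub>R u)"
    and Psi_pos: "\<And>u. u \<noteq> 0 \<Longrightarrow> \<Psi> u > 0" and Psi_0: "\<Psi> 0 = 0"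
    and growth: "\<And>C \<epsilon>. \<epsilon> > 0 \<Longrightarrow> \<exists>R. \<forall>u. inner (\<psi> u) u \<le> C \<longrightarrow> norm u \<ge> R \<longrightarrow> norm (\<psi> u) \<le> \<epsilon> * norm u"
    and tot: "total_seq d"
    and v: "\<And>m n. inner (v m) (v n) = (if m = n then 1 else 0)" "c0 > 0" "\<And>n. inner (L (v n)) (v n) \<ge> c0"
begin

section \<open>Compactness of the gradient and ascent in finite dimensions\<close>

definition J :: "'a \<Rightarrow> real" where "J u = inner (L u) u / 2 - \<Psi> u"

text \<open>If \<open>\<psi> (u n)\<close> stayed at distance \<open>e\<close> from
  \<open>\<psi> l\<close>, a step of length \<open>\<epsilon>\<close> along the difference would
  change \<open>\<Psi>\<close> at \<open>u n\<close> and at \<open>l\<close> by amounts that differ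
  by \<open>\<epsilon> * e\<close>, up to a remainder of order \<open>\<epsilon>\<^sup>2\<close>.
  Weak continuity of \<open>\<Psi>\<close> makes the two changes agree in the limit.\<close>

lemma psi_compact:
  assumes ul: "weakly u l" shows "(\<lambda>n. \<psi> (u n)) \<longlonglongrightarrow> \<psi> l"
proof (rule ccontr)
  assume "\<not> ?thesis"
  then obtain e and s :: "nat \<Rightarrow> nat" where e: "e > 0" and s: "strict_mono s"
    and far: "\<And>n. dist (\<psi> (u (s n))) (\<psi> l) \<ge> e"
    by (metis not_tendsto_subseq)
  obtain R where R: "\<And>n. norm (u n) \<le> R" using weakly_imp_bounded[OF ul] by blast
  have Rl: "norm l \<le> R" using weakly_norm_le[OF ul R] .
  obtain C where C: "\<And>u h. norm u \<le> R \<Longrightarrow> norm h \<le> 1 \<Longrightarrow> \<bar>\<Psi> (u + h) - \<Psi> u - inner (\<psi> u) h\<bar> \<le> C * (norm h)\<^sup>2"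
    using Psi_quad by blast
  have C1: "\<bar>\<Psi> (u + h) - \<Psi> u - inner (\<psi> u) h\<bar> \<le> \<bar>C\<bar> * (norm h)\<^sup>2" if "norm u \<le> R" "norm h \<le> 1" for u h
    using order_trans[OF C[OF that] mult_right_mono[OF abs_ge_self]] by simp
  \<comment> \<open>Small enough for the first-order gain \<open>\<epsilon> * e\<close> to beat both
    remainders, \<open>2 * \<bar>C\<bar> * \<epsilon>\<^sup>2\<close>.\<close>
  define \<epsilon> where "\<epsilon> = min 1 (e / (2 * \<bar>C\<bar> + 1))"
  have eps: "0 < \<epsilon>" "\<epsilon> \<le> 1" using e by (auto simp: \<epsilon>_def)
  have "\<epsilon> \<le> e / (2 * \<bar>C\<bar> + 1)" by (simp add: \<epsilon>_def)
  then have "\<epsilon> * (2 * \<bar>C\<bar> + 1) \<le> e" by (simp add: pos_le_divide_eq)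
  then have eps': "2 * \<bar>C\<bar> * \<epsilon> < e" using eps(1) by (simp add: algebra_simps)
  let ?D = "\<lambda>n. \<psi> (u (s n)) - \<psi> l"
  define h where "h n = (\<epsilon> / norm (?D n)) *\<^sub>R ?D n" for n
  have D: "norm (?D n) \<ge> e" for n using far[of n] by (simp add: dist_norm)
  have Dp: "norm (?D n) > 0" for n using D[of n] e by linarith
  have nh: "norm (h n) = \<epsilon>" for n using Dp[of n] eps by (simp add: h_def)
  have ih: "inner (?D n) (h n) = \<epsilon> * norm (?D n)" for n
    using Dp[of n] by (simp add: h_def dot_square_norm power2_eq_square)
  obtain r m where r: "strict_mono r" and hm: "weakly (h \<circ> r) m"
    using bounded_seq_weakly_convergent_subseq[OF tot, of h \<epsilon>] nh by auto
  have us: "weakly (\<lambda>n. u (s (r n))) l"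
    using weakly_subseq[OF weakly_subseq[OF ul s] r] by (simp add: o_def)
  have hw: "weakly (\<lambda>n. h (r n)) m" using hm by (simp add: o_def)
  have "(\<lambda>n. \<Psi> (u (s (r n)) + h (r n)) - \<Psi> (u (s (r n))) - (\<Psi> (l + h (r n)) - \<Psi> l) + 2 * (\<bar>C\<bar> * \<epsilon>\<^sup>2))
     \<longlonglongrightarrow> \<Psi> (l + m) - \<Psi> l - (\<Psi> (l + m) - \<Psi> l) + 2 * (\<bar>C\<bar> * \<epsilon>\<^sup>2)"
    by (intro tendsto_add tendsto_diff tendsto_const Psi_weak weakly_add us hw weakly_const)
  moreover have "\<epsilon> * e \<le> \<Psi> (u (s (r n)) + h (r n)) - \<Psi> (u (s (r n))) - (\<Psi> (l + h (r n)) - \<Psi> l) + 2 * (\<bar>C\<bar> * \<epsilon>\<^sup>2)" for n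
  proof -
    have "\<bar>\<Psi> (u (s (r n)) + h (r n)) - \<Psi> (u (s (r n))) - inner (\<psi> (u (s (r n)))) (h (r n))\<bar> \<le> \<bar>C\<bar> * \<epsilon>\<^sup>2"
      using C1[OF R[of "s (r n)"], of "h (r n)"] nh[of "r n"] eps by simp
    moreover have "\<bar>\<Psi> (l + h (r n)) - \<Psi> l - inner (\<psi> l) (h (r n))\<bar> \<le> \<bar>C\<bar> * \<epsilon>\<^sup>2"
      using C1[OF Rl, of "h (r n)"] nh[of "r n"] eps by simp
    moreover have "\<epsilon> * e \<le> inner (?D (r n)) (h (r n))" using ih[of "r n"] D[of "r n"] eps by simp
    ultimately show ?thesis by (simp add: inner_diff_left)
  qed
  ultimately have "\<epsilon> * e \<le> \<Psi> (l + m) - \<Psi> l - (\<Psi> (l + m) - \<Psi> l) + 2 * (\<bar>C\<bar> * \<epsilon>\<^sup>2)"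
    by (intro LIMSEQ_le_const) auto
  then have "\<epsilon> * e \<le> \<epsilon> * (2 * \<bar>C\<bar> * \<epsilon>)" by (simp add: power2_eq_square algebra_simps)
  then show False using eps eps' by simp
qed

lemma continuous_on_psi: "continuous_on A \<psi>"
  unfolding continuous_on_sequentially by (auto simp: o_def intro!: psi_compact tendsto_imp_weakly)

lemma continuous_on_Psi: "continuous_on A \<Psi>"
  unfolding continuous_on_sequentially by (auto simp: o_def intro!: Psi_weak tendsto_imp_weakly)

lemma continuous_on_L: "continuous_on A L"
  by (intro bounded_linear.continuous_on[OF lin] continuous_on_id)

lemma continuous_on_J: "continuous_on A J"
  unfolding J_def by (intro continuous_intros continuous_on_L continuous_on_Psi) auto

lemma Psi_nonneg: "0 \<le> \<Psi> u" using Psi_pos[of u] Psi_0 by (cases "u = 0") auto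

lemma L_form_le: "\<bar>inner (L x) x\<bar> \<le> K * (norm x)\<^sup>2"
proof -
  have "\<bar>inner (L x) x\<bar> \<le> norm (L x) * norm x" by (rule Cauchy_Schwarz_ineq2)
  also have "\<dots> \<le> (K * norm x) * norm x" by (intro mult_right_mono K) auto
  finally show ?thesis by (simp add: power2_eq_square mult.assoc)
qed

text \<open>The share \<open>\<delta>\<close> of \<open>y\<close> seen by the finite set
  \<open>B\<close> keeps weak limits of the normalised vectors away from 0. There
  \<open>\<Psi>\<close> is positive, and its superquadratic growth pushes \<open>J\<close> below
  \<open>b\<close>.\<close>

lemma superlevel_bounded:
  assumes B: "onset B" and \<delta>: "\<delta> > 0"
  shows "\<exists>R\<ge>1. \<forall>y. \<delta> * (norm y)\<^sup>2 \<le> (\<Sum>f\<in>B. (inner y f)\<^sup>2) \<longrightarrow> b \<le> J y \<longrightarrow> norm y \<le> R"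
proof (rule ccontr)
  assume n: "\<not> ?thesis"
  have "\<exists>y. \<delta> * (norm y)\<^sup>2 \<le> (\<Sum>f\<in>B. (inner y f)\<^sup>2) \<and> b \<le> J y \<and> norm y > real (Suc n)" for n
  proof -
    have "real (Suc n) \<ge> 1" by simp
    then show ?thesis using n by (meson not_le)
  qed
  then obtain y where y: "\<And>n. \<delta> * (norm (y n))\<^sup>2 \<le> (\<Sum>f\<in>B. (inner (y n) f)\<^sup>2)" "\<And>n. b \<le> J (y n)"
    "\<And>n. norm (y n) > real (Suc n)" by metis
  have yp: "norm (y n) > 0" for n using y(3)[of n] by (meson less_trans of_nat_0_less_iff zero_less_Suc)
  define w where "w n = (1 / norm (y n)) *\<^sub>R y n" for n
  have nw: "norm (w n) = 1" for n using yp[of n] by (simp add: w_def)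
  have yw: "y n = norm (y n) *\<^sub>R w n" for n using yp[of n] by (simp add: w_def)
  obtain r l where r: "strict_mono r" and l: "weakly (w \<circ> r) l"
    using bounded_seq_weakly_convergent_subseq[OF tot, of w 1] nw by auto
  have "\<delta> \<le> (\<Sum>f\<in>B. (inner (w n) f)\<^sup>2)" for n
  proof -
    have "\<delta> = (\<delta> * (norm (y n))\<^sup>2) / (norm (y n))\<^sup>2" using yp[of n] by simp
    also have "\<dots> \<le> (\<Sum>f\<in>B. (inner (y n) f)\<^sup>2) / (norm (y n))\<^sup>2" by (intro divide_right_mono y) auto
    also have "\<dots> = (\<Sum>f\<in>B. (inner (w n) f)\<^sup>2)" by (simp add: w_def sum_divide_distrib power_divide)
    finally show ?thesis .
  qed
  moreover have "(\<lambda>n. \<Sum>f\<in>B. (inner (w (r n)) f)\<^sup>2) \<longlonglongrightarrow> (\<Sum>f\<in>B. (inner l f)\<^sup>2)"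
    using l by (intro tendsto_sum tendsto_power) (auto simp: weakly_def o_def)
  ultimately have "\<delta> \<le> (\<Sum>f\<in>B. (inner l f)\<^sup>2)" by (intro LIMSEQ_le_const) auto
  then have "l \<noteq> 0" using \<delta> by auto
  then have p0: "\<Psi> l > 0" by (rule Psi_pos)
  have "(\<lambda>n. \<Psi> (w (r n))) \<longlonglongrightarrow> \<Psi> l" using Psi_weak[OF l] by (simp add: o_def)
  then have "\<forall>\<^sub>F n in sequentially. \<Psi> l / 2 < \<Psi> (w (r n))" by (rule order_tendstoD) (use p0 in auto)
  then obtain N where N: "\<And>n. n \<ge> N \<Longrightarrow> \<Psi> l / 2 < \<Psi> (w (r n))" unfolding eventually_sequentially by blast
  \<comment> \<open>Chosen so that \<open>X * ?s\<^sup>2 \<le> ?s powr \<mu>\<close> turns into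
    \<open>J (y (r n)) \<le> - (\<bar>b\<bar> + 1) * ?s\<^sup>2\<close>.\<close>
  define X where "X = (K + 2 * (\<bar>b\<bar> + 1)) / \<Psi> l"
  have X0: "X > 0" using K p0 by (simp add: X_def)
  obtain n0 :: nat where n0: "X powr (1 / (\<mu> - 2)) < real n0" using reals_Archimedean2 by blast
  define n where "n = max N n0"
  let ?s = "norm (y (r n))"
  have "n0 \<le> r n" using seq_suble[OF r, of n] by (simp add: n_def)
  then have s: "X powr (1 / (\<mu> - 2)) \<le> ?s" "1 \<le> ?s" using n0 y(3)[of "r n"] by auto
  have "X = (X powr (1 / (\<mu> - 2))) powr (\<mu> - 2)" using X0 mu by (simp add: powr_powr)
  also have "\<dots> \<le> ?s powr (\<mu> - 2)" using s mu by (intro powr_mono2) auto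
  finally have "X * ?s\<^sup>2 \<le> ?s powr (\<mu> - 2) * ?s\<^sup>2" by (intro mult_right_mono) auto
  also have "\<dots> = ?s powr \<mu>" using s powr_add[of ?s "\<mu> - 2" 2] by (simp add: powr_numeral)
  finally have s\<mu>: "X * ?s\<^sup>2 \<le> ?s powr \<mu>" .
  have "(K + 2 * (\<bar>b\<bar> + 1)) / 2 * ?s\<^sup>2 = (X * ?s\<^sup>2) * (\<Psi> l / 2)" using p0 by (simp add: X_def)
  also have "\<dots> \<le> ?s powr \<mu> * \<Psi> (w (r n))" using s\<mu> N[of n] p0 by (intro mult_mono) (auto simp: n_def)
  also have "\<dots> \<le> \<Psi> (?s *\<^sub>R w (r n))" by (rule homog[OF s(2)])
  also have "?s *\<^sub>R w (r n) = y (r n)" using yw[of "r n"] by simp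
  finally have "J (y (r n)) \<le> K * ?s\<^sup>2 / 2 - (K + 2 * (\<bar>b\<bar> + 1)) / 2 * ?s\<^sup>2"
    using L_form_le[of "y (r n)"] unfolding J_def by linarith
  also have "\<dots> = - (\<bar>b\<bar> + 1) * ?s\<^sup>2" by (simp add: field_simps)
  also have "\<dots> \<le> - (\<bar>b\<bar> + 1) * 1" using s(2) by (intro mult_left_mono_neg) (auto simp: one_le_power)
  also have "\<dots> < b" using abs_ge_minus_self[of b] by simp
  finally show False using y(2)[of "r n"] by simp
qed

text \<open>Otherwise the gradient \<open>X\<close> of \<open>J\<close> along \<open>span B\<close>
  is bounded away from 0 between the levels, and finitely many explicit ascent steps lift the whole
  sphere above \<open>\<beta>\<close>. The iterated step is odd, so Borsuk-Ulam finds a lifted point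
  orthogonal to \<open>z 1, ..., z N\<close>, where \<open>J\<close> is at most
  \<open>\<beta>\<close>.\<close>

lemma finite_dim_critical_point:
  fixes z :: "nat \<Rightarrow> 'a" and N :: nat
  assumes B: "onset B" and zB: "\<And>j. j \<le> N \<Longrightarrow> z j \<in> span B"
    and zo: "\<And>i j. i \<le> N \<Longrightarrow> j \<le> N \<Longrightarrow> inner (z i) (z j) = (if i = j then 1 else 0)"
    and r: "r > 0" and low: "\<And>x. x \<in> sphere 0 r \<inter> span (z ` {..N}) \<Longrightarrow> b \<le> J x"
    and up: "\<And>x. x \<in> span B \<Longrightarrow> (\<And>j. j \<in> {1..N} \<Longrightarrow> inner x (z j) = 0) \<Longrightarrow> J x \<le> \<beta>"
  obtains u where "u \<in> span B" "\<And>e. e \<in> span B \<Longrightarrow> inner (L u - \<psi> u) e = 0" "b \<le> J u" "J u \<le> \<beta>"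
proof (rule ccontr)
  assume nt: "\<not> thesis"
  note hit = that
  define X where "X u = (\<Sum>e\<in>B. inner (L u - \<psi> u) e *\<^sub>R e)" for u
  have finB: "finite B" using B by (simp add: onset_def)
  have XE: "X u \<in> span B" for u unfolding X_def by (intro span_sum span_mul span_base)
  have Xin: "inner (X u) h = inner (L u - \<psi> u) h" if "h \<in> span B" for u h
  proof -
    have "inner h (L u - \<psi> u) = (\<Sum>f\<in>B. inner h f * inner f (L u - \<psi> u))" by (rule onset_inner_expand[OF B that])
    also have "\<dots> = inner (X u) h" unfolding X_def inner_sum_left
      by (rule sum.cong) (simp_all add: inner_commute mult.commute)
    finally show ?thesis by (simp add: inner_commute)
  qed
  have Xcont: "continuous_on A X" for A
    unfolding X_def by (intro continuous_intros continuous_on_L continuous_on_psi)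
  have Xodd: "X (- u) = - X u" for u
  proof -
    have "L (- u) - \<psi> (- u) = - (L u - \<psi> u)" using lin by (simp add: psi_odd bounded_linear.linear linear_neg)
    then show ?thesis by (simp add: X_def sum_negf del: minus_diff_eq)
  qed
  \<comment> \<open>Compact by \<open>superlevel_bounded\<close> and invariant under ascent, so that
    all constants below are uniform along the iteration.\<close>
  define C0 where "C0 = {x \<in> span B. b \<le> J x}"
  obtain R where R: "R \<ge> 1" "\<And>y. 1 * (norm y)\<^sup>2 \<le> (\<Sum>f\<in>B. (inner y f)\<^sup>2) \<Longrightarrow> b \<le> J y \<Longrightarrow> norm y \<le> R"
    using superlevel_bounded[OF B, of 1 b] by auto
  have C0R: "norm x \<le> R" if "x \<in> C0" for x
  proof (rule R(2))
    show "1 * (norm x)\<^sup>2 \<le> (\<Sum>f\<in>B. (inner x f)\<^sup>2)"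
      using onset_norm_expand[OF B, of x] that by (simp add: C0_def)
  qed (use that in \<open>auto simp: C0_def\<close>)
  have cE: "compact (span B \<inter> cball 0 R)"
    by (rule compact_span_ball) (use B in \<open>auto simp: onset_def\<close>)
  have clJ: "closed {x. b \<le> J x}" "closed {x. J x \<le> \<beta>}"
    by (intro closed_Collect_le continuous_on_J continuous_on_const)+
  have "C0 = (span B \<inter> cball 0 R) \<inter> {x. b \<le> J x}" using C0R by (auto simp: C0_def)
  then have cC0: "compact C0" using compact_Int_closed[OF cE clJ(1)] by simp
  have cC1: "compact (C0 \<inter> {x. J x \<le> \<beta>})" by (rule compact_Int_closed[OF cC0 clJ(2)])
  have X0: "X x \<noteq> 0" if x: "x \<in> C0 \<inter> {x. J x \<le> \<beta>}" for x
  proof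
    assume "X x = 0"
    then have "inner (L x - \<psi> x) e = 0" if "e \<in> span B" for e using Xin[OF that, of x] by simp
    then show False using hit[of x] x nt by (auto simp: C0_def)
  qed
  obtain \<delta> where \<delta>: "\<delta> > 0" "\<And>x. x \<in> C0 \<Longrightarrow> J x \<le> \<beta> \<Longrightarrow> \<delta> \<le> norm (X x)"
  proof (cases "C0 \<inter> {x. J x \<le> \<beta>} = {}")
    case True
    then show ?thesis using that[of 1] by auto
  next
    case False
    obtain x0 where "x0 \<in> C0 \<inter> {x. J x \<le> \<beta>}" "\<And>x. x \<in> C0 \<inter> {x. J x \<le> \<beta>} \<Longrightarrow> norm (X x0) \<le> norm (X x)"
      using continuous_attains_inf[OF cC1 False, of "\<lambda>x. norm (X x)"] Xcont by (auto intro: continuous_on_norm)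
    then show ?thesis using X0[of x0] that[of "norm (X x0)"] by auto
  qed
  have "compact (X ` C0)" by (intro compact_continuous_image Xcont cC0)
  then obtain Mx where Mx: "Mx > 0" "\<And>x. x \<in> C0 \<Longrightarrow> norm (X x) \<le> Mx"
    using compact_imp_bounded bounded_pos by (metis imageI)
  obtain C where C: "\<And>u h. norm u \<le> R \<Longrightarrow> norm h \<le> 1 \<Longrightarrow> \<bar>\<Psi> (u + h) - \<Psi> u - inner (\<psi> u) h\<bar> \<le> C * (norm h)\<^sup>2"
    using Psi_quad by blast
  define Q where "Q = K / 2 + \<bar>C\<bar>"
  have Q: "Q > 0" using K by (simp add: Q_def add_pos_nonneg)
  \<comment> \<open>The first bound keeps steps within the length 1 allowed by
    \<open>Psi_quad\<close>; the second limits the quadratic loss, with constant \<open>Q\<close>,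
    to half of the first-order gain.\<close>
  define \<tau> where "\<tau> = min (1 / Mx) (1 / (2 * Q))"
  have tau: "\<tau> > 0" "\<tau> * Mx \<le> 1" "\<tau> * Q \<le> 1/2"
    using Mx(1) Q by (auto simp: \<tau>_def min_def field_simps)
  define T where "T u = u + \<tau> *\<^sub>R X u" for u
  have JT: "J (T u) \<ge> J u + \<tau> / 2 * (norm (X u))\<^sup>2" if u: "u \<in> C0" for u
  proof -
    let ?h = "\<tau> *\<^sub>R X u"
    interpret bounded_linear L by (rule lin)
    have nh: "norm ?h = \<tau> * norm (X u)" using tau by simp
    have "\<tau> * norm (X u) \<le> \<tau> * Mx" using Mx(2)[OF u] tau by (intro mult_left_mono) auto
    then have h1: "norm ?h \<le> 1" using tau nh by linarith
    have 1: "\<Psi> (T u) \<le> \<Psi> u + inner (\<psi> u) ?h + C * (norm ?h)\<^sup>2"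
      using C[OF C0R[OF u] h1] unfolding T_def by linarith
    have 2: "inner (L (u + h)) (u + h) = inner (L u) u + 2 * inner (L u) h + inner (L h) h" for h
      using sym[of h u] by (simp add: add inner_add inner_commute)
    have 3: "inner (L u) ?h - inner (\<psi> u) ?h = \<tau> * (norm (X u))\<^sup>2"
      using Xin[OF XE, of u u] by (simp add: power2_norm_eq_inner inner_diff_left right_diff_distrib)
    have 4: "inner (L ?h) ?h \<ge> - (K * (norm ?h)\<^sup>2)" using L_form_le[of ?h] by linarith
    have 5: "C * (norm ?h)\<^sup>2 \<le> \<bar>C\<bar> * (norm ?h)\<^sup>2" by (intro mult_right_mono) auto
    have 6: "Q * (norm ?h)\<^sup>2 = K * (norm ?h)\<^sup>2 / 2 + \<bar>C\<bar> * (norm ?h)\<^sup>2" by (simp add: Q_def algebra_simps)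
    have "J (T u) \<ge> J u + \<tau> * (norm (X u))\<^sup>2 - Q * (norm ?h)\<^sup>2"
      using 1 2[of ?h] 3 4 5 6 unfolding J_def T_def by argo
    moreover have "Q * (norm ?h)\<^sup>2 = (\<tau> * Q) * (\<tau> * (norm (X u))\<^sup>2)" unfolding nh by (simp add: power2_eq_square)
    moreover have "(\<tau> * Q) * (\<tau> * (norm (X u))\<^sup>2) \<le> 1/2 * (\<tau> * (norm (X u))\<^sup>2)"
      using tau by (intro mult_right_mono) auto
    ultimately show ?thesis by linarith
  qed
  have pos: "0 \<le> \<tau> / 2 * (norm (X u))\<^sup>2" for u using tau by simp
  have TE: "T u \<in> C0" if "u \<in> C0" for u
  proof -
    have "b \<le> J (T u)" using JT[OF that] pos[of u] that by (simp add: C0_def)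
    moreover have "T u \<in> span B" unfolding T_def using that XE by (auto simp: C0_def intro!: span_add span_mul)
    ultimately show ?thesis by (simp add: C0_def)
  qed
  have iter: "(T ^^ m) x \<in> C0 \<and> (J ((T ^^ m) x) > \<beta> \<or> J ((T ^^ m) x) \<ge> b + m * (\<tau> / 2 * \<delta>\<^sup>2))" if "x \<in> C0" for m x
  proof (induction m)
    case 0 then show ?case using that by (simp add: C0_def)
  next
    case (Suc m)
    let ?y = "(T ^^ m) x"
    have y: "?y \<in> C0" using Suc by blast
    have ge: "J (T ?y) \<ge> J ?y" using JT[OF y] pos[of ?y] by linarith
    show ?case
    proof (cases "J ?y > \<beta>")
      case True then show ?thesis using ge TE[OF y] by auto
    next
      case False
      then have "\<delta> \<le> norm (X ?y)" using \<delta>(2)[OF y] by simp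
      then have "\<delta>\<^sup>2 \<le> (norm (X ?y))\<^sup>2" using \<delta>(1) by (intro power_mono) auto
      then have "\<tau> / 2 * \<delta>\<^sup>2 \<le> \<tau> / 2 * (norm (X ?y))\<^sup>2" using tau by (intro mult_left_mono) auto
      then have "J (T ?y) \<ge> b + m * (\<tau> / 2 * \<delta>\<^sup>2) + \<tau> / 2 * \<delta>\<^sup>2" using JT[OF y] Suc False by linarith
      moreover have "b + Suc m * (\<tau> / 2 * \<delta>\<^sup>2) = b + m * (\<tau> / 2 * \<delta>\<^sup>2) + \<tau> / 2 * \<delta>\<^sup>2" by (simp add: distrib_right add_divide_distrib)
      ultimately have "b + Suc m * (\<tau> / 2 * \<delta>\<^sup>2) \<le> J (T ?y)" by linarith
      then show ?thesis using TE[OF y] by simp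
    qed
  qed
  obtain m :: nat where "(\<beta> - b) / (\<tau> / 2 * \<delta>\<^sup>2) < real m" using reals_Archimedean2 by blast
  then have m: "\<beta> < b + m * (\<tau> / 2 * \<delta>\<^sup>2)" using tau \<delta>(1) by (simp add: field_simps)
  have Tc: "continuous_on UNIV (T ^^ n)" for n
  proof (induction n)
    case (Suc n)
    have "continuous_on A T" for A unfolding T_def by (intro continuous_intros Xcont)
    then show ?case unfolding funpow.simps by (intro continuous_on_compose[OF Suc])
  qed (simp add: continuous_on_id)
  have Todd: "(T ^^ n) (- x) = - (T ^^ n) x" for n x
    by (induction n) (simp_all add: T_def Xodd)
  obtain x where x: "x \<in> sphere 0 r \<inter> span (z ` {..N})" "\<And>j. j \<in> {1..N} \<Longrightarrow> inner ((T ^^ m) x) (z j) = 0"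
  proof (rule borsuk_ulam[of N z r "\<lambda>j x. inner ((T ^^ m) x) (z j)"])
    show "continuous_on (sphere 0 r \<inter> span (z ` {..N})) (\<lambda>x. inner ((T ^^ m) x) (z j))" for j
      by (intro continuous_on_inner continuous_on_const continuous_on_subset[OF Tc]) auto
  qed (use zo r Todd in auto)
  have "span (z ` {..N}) \<subseteq> span B" using zB by (intro span_minimal) (auto simp: subspace_span)
  then have "x \<in> C0" using x low[OF x(1)] by (auto simp: C0_def)
  then have "(T ^^ m) x \<in> C0" "J ((T ^^ m) x) > \<beta>" using iter[of x m] m by auto
  then show False using up[of "(T ^^ m) x"] x(2) by (auto simp: C0_def)
qed

section \<open>Splitting of the space by the sign of \<open>L\<close>\<close>

definition pp :: "'a \<Rightarrow> 'a" where "pp x = (1/2) *\<^sub>R (x + sgn_op x)"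
definition pm :: "'a \<Rightarrow> 'a" where "pm x = (1/2) *\<^sub>R (x - sgn_op x)"
definition a0 :: real where "a0 = c\<^sup>2 / K"

lemma a0: "a0 > 0" using c K by (simp add: a0_def)

lemma sgn_lin: "linear sgn_op" using sgn_op_bounded_linear by (simp add: bounded_linear.linear)

lemma pp_pm: "pp x + pm x = x"
proof -
  have "pp x + pm x = (1/2) *\<^sub>R ((x + sgn_op x) + (x - sgn_op x))" by (simp only: pp_def pm_def scaleR_add_right)
  then show ?thesis by (simp flip: scaleR_2)
qed

lemma sgn_pp: "sgn_op (pp x) = pp x"
  by (simp add: pp_def linear_scale[OF sgn_lin] linear_add[OF sgn_lin] sgn_op_sgn_op add.commute)

lemma sgn_pm: "sgn_op (pm x) = - pm x"
proof -
  have "sgn_op (pm x) = (1/2) *\<^sub>R (- (x - sgn_op x))"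
    by (simp add: pm_def linear_scale[OF sgn_lin] linear_diff[OF sgn_lin] sgn_op_sgn_op)
  then show ?thesis by (simp only: pm_def scaleR_minus_right)
qed

lemma linear_pp: "linear pp"
  by (intro linearI) (simp_all add: pp_def linear_add[OF sgn_lin] linear_scale[OF sgn_lin] algebra_simps)

lemma plus_minus_orth: "sgn_op x = x \<Longrightarrow> sgn_op y = - y \<Longrightarrow> inner x y = 0"
  using sgn_op_sym[of x y] by simp

lemma pp_sym: "inner (pp x) y = inner x (pp y)"
  by (simp add: pp_def inner_add sgn_op_sym)

lemma pp_plus: "sgn_op x = x \<Longrightarrow> pp x = x" and pp_minus: "sgn_op x = - x \<Longrightarrow> pp x = 0"
  by (simp_all add: pp_def flip: scaleR_2)

text \<open>\<open>L\<close> commutes with its sign, so the cross terms pair vectors of opposite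
  sign and vanish.\<close>

lemma form_split: "inner (L x) x = inner (L (pp x)) (pp x) + inner (L (pm x)) (pm x)"
proof -
  interpret L: bounded_linear L by (rule lin)
  have "sgn_op (L (pp x)) = L (pp x)" "sgn_op (L (pm x)) = - L (pm x)" by (simp_all add: sgn_op_L sgn_pp sgn_pm linear_neg[OF L.linear])
  then have "inner (L (pp x)) (pm x) = 0" "inner (L (pm x)) (pp x) = 0"
    using plus_minus_orth[of "L (pp x)" "pm x"] plus_minus_orth[of "pp x" "L (pm x)"] by (auto simp: sgn_pp sgn_pm inner_commute)
  then have "inner (L (pp x + pm x)) (pp x + pm x) = inner (L (pp x)) (pp x) + inner (L (pm x)) (pm x)"
    by (simp add: L.add inner_add)
  then show ?thesis by (simp add: pp_pm)
qed

lemma norm_split: "(norm x)\<^sup>2 = (norm (pp x))\<^sup>2 + (norm (pm x))\<^sup>2"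
proof -
  have "inner (pp x) (pm x) = 0" by (intro plus_minus_orth sgn_pp sgn_pm)
  then have "inner (pp x + pm x) (pp x + pm x) = (norm (pp x))\<^sup>2 + (norm (pm x))\<^sup>2"
    by (simp add: inner_add inner_commute power2_norm_eq_inner)
  then show ?thesis by (simp add: pp_pm power2_norm_eq_inner)
qed

lemma form_plus: "sgn_op x = x \<Longrightarrow> inner (L x) x \<ge> a0 * (norm x)\<^sup>2"
  using sgn_op_coercive[of x] by (simp add: a0_def)

lemma form_minus: "inner (L (pm x)) (pm x) \<le> - (a0 * (norm (pm x))\<^sup>2)"
  using sgn_op_coercive[of "pm x"] by (simp add: a0_def sgn_pm)

lemma norm_sgn_op: "norm (sgn_op x) = norm x"
  using sgn_op_sym[of "sgn_op x" x] by (simp add: sgn_op_sgn_op norm_eq_sqrt_inner)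

lemma subspace_plus: "subspace {x. sgn_op x = x}" and subspace_minus: "subspace {x. sgn_op x = - x}"
  by (auto simp: subspace_def linear_add[OF sgn_lin] linear_scale[OF sgn_lin] linear_0[OF sgn_lin])

text \<open>Were all positive parts of the orthonormal \<open>v n\<close> in \<open>span B\<close>,
  their coordinates would tend to 0 along a subsequence, because \<open>v n\<close> does so weakly;
  but \<open>c0 \<le> inner (L (v n)) (v n)\<close> keeps the norm of the positive part above a
  fixed bound.\<close>

lemma ex_unit_plus:
  assumes B: "onset B" "\<And>f. f \<in> B \<Longrightarrow> sgn_op f = f"
  shows "\<exists>e. sgn_op e = e \<and> norm e = 1 \<and> (\<forall>f\<in>B. inner e f = 0)"
proof -
  have "\<exists>n. pp (v n) \<notin> span B"
  proof (rule ccontr)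
    assume "\<not> ?thesis"
    then have sp: "pp (v n) \<in> span B" for n by blast
    have "norm (v n) = 1" for n using v(1)[of n n] by (simp add: norm_eq_sqrt_inner)
    then obtain r l where r: "strict_mono r" and l: "weakly (v \<circ> r) l"
      using bounded_seq_weakly_convergent_subseq[OF tot, of v 1] by auto
    have lv: "inner l (v m) = 0" for m
    proof -
      have "(\<lambda>n. inner (v (r n)) (v m)) \<longlonglongrightarrow> inner l (v m)" using l by (simp add: weakly_def o_def)
      moreover have "\<forall>\<^sub>F n in sequentially. inner (v (r n)) (v m) = 0"
        unfolding eventually_sequentially
      proof (intro exI[of _ "Suc m"] allI impI)
        fix n assume "Suc m \<le> n"
        then have "r n \<noteq> m" using seq_suble[OF r, of n] by linarith
        then show "inner (v (r n)) (v m) = 0" by (simp add: v(1))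
      qed
      ultimately show ?thesis by (rule limit_eventually_0)
    qed
    have "(\<lambda>n. inner (v (r n)) l) \<longlonglongrightarrow> inner l l" using l by (simp add: weakly_def o_def)
    then have l0: "l = 0" using lv by (simp add: inner_commute LIMSEQ_const_iff)
    have "(\<lambda>n. \<Sum>f\<in>B. (inner (v (r n)) f)\<^sup>2) \<longlonglongrightarrow> (\<Sum>f\<in>B. (inner l f)\<^sup>2)"
      using l by (intro tendsto_sum tendsto_power) (auto simp: weakly_def o_def)
    then have lim: "(\<lambda>n. \<Sum>f\<in>B. (inner (v (r n)) f)\<^sup>2) \<longlonglongrightarrow> 0" by (simp add: l0)
    have "c0 / K \<le> (\<Sum>f\<in>B. (inner (v n) f)\<^sup>2)" for n
    proof -
      have "inner (pp (v n)) f = inner (v n) f" if "f \<in> B" for f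
        using pp_sym[of "v n" f] pp_plus[OF B(2)[OF that]] by simp
      then have eq: "(norm (pp (v n)))\<^sup>2 = (\<Sum>f\<in>B. (inner (v n) f)\<^sup>2)"
        unfolding onset_norm_expand[OF B(1) sp] by (intro sum.cong) auto
      have "0 \<le> a0 * (norm (pm (v n)))\<^sup>2" using a0 by simp
      then have "inner (L (pm (v n))) (pm (v n)) \<le> 0"
        using form_minus[of "v n"] by linarith
      then have "c0 \<le> inner (L (pp (v n))) (pp (v n))" using v(3)[of n] form_split[of "v n"] by linarith
      also have "\<dots> \<le> K * (norm (pp (v n)))\<^sup>2" using L_form_le[of "pp (v n)"] by linarith
      finally show ?thesis using K eq by (simp add: field_simps)
    qed
    then have "c0 / K \<le> 0" using lim by (intro LIMSEQ_le_const[OF lim]) auto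
    then show False using v(2) K by (simp add: divide_le_0_iff)
  qed
  then obtain n where n: "pp (v n) \<notin> span B" by blast
  define y where "y = pp (v n) - (\<Sum>f\<in>B. inner (pp (v n)) f *\<^sub>R f)"
  have "(\<Sum>f\<in>B. inner (pp (v n)) f *\<^sub>R f) \<in> span B" by (intro span_sum span_mul span_base)
  then have y0: "y \<noteq> 0" using n by (auto simp: y_def)
  have "(\<Sum>f\<in>B. inner (pp (v n)) f *\<^sub>R f) \<in> {x. sgn_op x = x}"
    by (intro subspace_sum subspace_plus subspace_scale) (use B(2) in auto)
  then have "sgn_op y = y" by (simp add: y_def linear_diff[OF sgn_lin] sgn_pp)
  moreover have "inner y f = 0" if "f \<in> B" for f
    using onset_inner_sum[OF B(1) that, of "inner (pp (v n))"] by (simp add: y_def inner_diff_left)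
  ultimately show ?thesis using y0
    by (intro exI[of _ "(1 / norm y) *\<^sub>R y"]) (auto simp: linear_scale[OF sgn_lin])
qed

text \<open>Vectors of a ball orthogonal to more and more \<open>d i\<close> can only tend weakly to
  0, where \<open>\<Psi>\<close> is weakly continuous with value 0.\<close>

lemma Psi_small:
  assumes "\<epsilon> > 0"
  shows "\<exists>k. \<forall>z. norm z \<le> r \<longrightarrow> (\<forall>i<k. inner z (d i) = 0) \<longrightarrow> \<Psi> z \<le> \<epsilon>"
proof (rule ccontr)
  assume "\<not> ?thesis"
  then have "\<exists>z. norm z \<le> r \<and> (\<forall>i<k. inner z (d i) = 0) \<and> \<Psi> z > \<epsilon>" for k :: nat by (meson not_le)
  then obtain z where z: "\<And>k. norm (z k) \<le> r" "\<And>k i. i < k \<Longrightarrow> inner (z k) (d i) = 0" "\<And>k. \<Psi> (z k) > \<epsilon>" by metis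
  obtain s l where s: "strict_mono s" and l: "weakly (z \<circ> s) l"
    using bounded_seq_weakly_convergent_subseq[OF tot, of z r] z(1) by auto
  have "inner l (d i) = 0" for i
  proof -
    have "(\<lambda>n. inner (z (s n)) (d i)) \<longlonglongrightarrow> inner l (d i)" using l by (simp add: weakly_def o_def)
    moreover have "\<forall>\<^sub>F n in sequentially. inner (z (s n)) (d i) = 0"
      unfolding eventually_sequentially
    proof (intro exI[of _ "Suc i"] allI impI z(2))
      fix n assume "Suc i \<le> n"
      then show "i < s n" using seq_suble[OF s, of n] by linarith
    qed
    ultimately show ?thesis by (rule limit_eventually_0)
  qed
  then have "l = 0" using tot by (simp add: total_seq_def)
  then have "(\<lambda>n. \<Psi> (z (s n))) \<longlonglongrightarrow> 0" using Psi_weak[OF l] by (simp add: o_def Psi_0)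
  then have "\<epsilon> \<le> 0" by (rule LIMSEQ_le_const) (use z(3) in \<open>auto intro: less_imp_le\<close>)
  then show False using assms by simp
qed

text \<open>Borsuk-Ulam links the sphere of \<open>Z\<close> (high modes of the positive space) with the complement of its
  higher modes, on which \<open>J\<close> is bounded above by a constant that does not depend on \<open>n\<close>.\<close>

lemma galerkin_critical_points:
  obtains \<beta> where "\<And>n. \<exists>u. (\<forall>i<n. inner (L u - \<psi> u) (d i) = 0) \<and> inner (L u - \<psi> u) u = 0
     \<and> inner (L u - \<psi> u) (sgn_op u) = 0 \<and> M \<le> J u \<and> J u \<le> \<beta>"
proof -
  \<comment> \<open>On the sphere of this radius in the positive space half of the quadratic form is
    at least \<open>\<bar>M\<bar> + 1\<close>, which leaves \<open>M\<close> after subtracting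
    \<open>\<Psi> \<le> 1\<close>.\<close>
  define r where "r = sqrt (2 * (\<bar>M\<bar> + 1) / a0)"
  have r: "r > 0" "a0 * r\<^sup>2 / 2 = \<bar>M\<bar> + 1" using a0 by (auto simp: r_def)
  obtain k where k: "\<And>z. norm z \<le> r \<Longrightarrow> (\<And>i. i < k \<Longrightarrow> inner z (d i) = 0) \<Longrightarrow> \<Psi> z \<le> 1"
    using Psi_small[of 1 r] by auto
  have low: "M \<le> J z" if z: "norm z = r" "sgn_op z = z" "\<And>i. i < k \<Longrightarrow> inner z (d i) = 0" for z
  proof -
    have "\<Psi> z \<le> 1" using k[of z] z by simp
    moreover have "a0 * r\<^sup>2 \<le> inner (L z) z" using form_plus[OF z(2)] z(1) by simp
    ultimately show ?thesis using r unfolding J_def by linarith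
  qed
  \<comment> \<open>Orthogonality to these finitely many positive parts makes a positive vector
    orthogonal to \<open>d i\<close> for \<open>i < k\<close>.\<close>
  obtain BF where BF: "onset BF" "span BF = span (pp ` d ` {..<k})"
    using onset_extend[of "{}" "pp ` d ` {..<k}"] by (auto simp: onset_def)
  have spp: "span (pp ` Y) \<subseteq> {x. sgn_op x = x}" for Y
    by (rule span_minimal[OF _ subspace_plus]) (auto simp: sgn_pp)
  have spm: "span (pm ` Y) \<subseteq> {x. sgn_op x = - x}" for Y
    by (rule span_minimal[OF _ subspace_minus]) (auto simp: sgn_pm)
  have BFp: "sgn_op f = f" if "f \<in> BF" for f using span_base[OF that] BF(2) spp by blast
  \<comment> \<open>One positive direction outside the low modes. It becomes \<open>z 0\<close>: the
    span of the sphere gets one dimension more than there are orthogonality conditions.\<close>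
  obtain e where e: "sgn_op e = e" "norm e = 1" "\<And>f. f \<in> BF \<Longrightarrow> inner e f = 0" using ex_unit_plus[OF BF(1) BFp] by blast
  define BW where "BW = insert e BF"
  have ee: "inner e e = 1" using e(2) by (simp add: dot_square_norm)
  have eBF: "e \<notin> BF" using e(3)[of e] ee by auto
  have BW: "onset BW" using BF(1) e(3) ee eBF unfolding BW_def onset_def by (auto simp: inner_commute)
  have BWp: "sgn_op f = f" if "f \<in> BW" for f using that BFp e by (auto simp: BW_def)
  \<comment> \<open>If \<open>J y \<ge> 0\<close>, the positive part carries at least this share of
    the squared norm of \<open>y\<close>.\<close>
  define \<delta> where "\<delta> = a0 / (a0 + K)"
  have \<delta>: "\<delta> > 0" using a0 K by (simp add: \<delta>_def)
  obtain R where R: "R \<ge> 1" "\<And>y. \<delta> * (norm y)\<^sup>2 \<le> (\<Sum>f\<in>BW. (inner y f)\<^sup>2) \<Longrightarrow> 0 \<le> J y \<Longrightarrow> norm y \<le> R"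
    using superlevel_bounded[OF BW \<delta>, of 0] by auto
  \<comment> \<open>Depends on \<open>BW\<close> alone, hence not on the dimension of the Galerkin
    space.\<close>
  define \<beta> where "\<beta> = K * R\<^sup>2 / 2"
  have up: "J y \<le> \<beta>" if y: "pp y \<in> span BW" for y
  proof (cases "0 \<le> J y")
    case False
    have "0 \<le> \<beta>" using K by (simp add: \<beta>_def)
    then show ?thesis using False by simp
  next
    case True
    have "inner (pp y) f = inner y f" if "f \<in> BW" for f
      using pp_sym[of y f] pp_plus[OF BWp[OF that]] by simp
    then have eq: "(norm (pp y))\<^sup>2 = (\<Sum>f\<in>BW. (inner y f)\<^sup>2)"
      unfolding onset_norm_expand[OF BW y] by (intro sum.cong) auto
    have "a0 * (norm (pm y))\<^sup>2 \<le> K * (norm (pp y))\<^sup>2"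
      using True Psi_nonneg[of y] form_split[of y] form_minus[of y] L_form_le[of "pp y"] unfolding J_def by (simp add: abs_le_iff)
    then have "a0 * (norm y)\<^sup>2 \<le> (a0 + K) * (norm (pp y))\<^sup>2" unfolding norm_split[of y] by (simp add: algebra_simps)
    then have "\<delta> * (norm y)\<^sup>2 \<le> (norm (pp y))\<^sup>2" using a0 K by (simp add: \<delta>_def field_simps)
    then have "norm y \<le> R" using R(2) True eq by simp
    then have "(norm y)\<^sup>2 \<le> R\<^sup>2" by (intro power_mono) auto
    then have "K * (norm y)\<^sup>2 \<le> K * R\<^sup>2" using K by (intro mult_left_mono) auto
    then show ?thesis using L_form_le[of y] Psi_nonneg[of y] unfolding J_def \<beta>_def by (simp add: abs_le_iff)
  qed
  have "\<exists>u. (\<forall>i<n. inner (L u - \<psi> u) (d i) = 0) \<and> inner (L u - \<psi> u) u = 0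
     \<and> inner (L u - \<psi> u) (sgn_op u) = 0 \<and> M \<le> J u \<and> J u \<le> \<beta>" for n
  proof -
    obtain B1 where B1: "onset B1" "BW \<subseteq> B1" "span B1 = span (BW \<union> pp ` d ` {..<n})"
      using onset_extend[OF BW, of "pp ` d ` {..<n}"] by auto
    obtain B2 where B2: "onset B2" "span B2 = span (pm ` d ` {..<n})"
      using onset_extend[of "{}" "pm ` d ` {..<n}"] by (auto simp: onset_def)
    have "span (BW \<union> pp ` d ` {..<n}) \<subseteq> {x. sgn_op x = x}"
      by (rule span_minimal[OF _ subspace_plus]) (auto simp: sgn_pp BWp)
    then have B1p: "sgn_op f = f" if "f \<in> B1" for f using span_base[OF that] B1(3) by blast
    have B2m: "sgn_op f = - f" if "f \<in> B2" for f using span_base[OF that] B2(2) spm by blast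
    have orth: "inner f g = 0" if "f \<in> B1" "g \<in> B2" for f g
      by (rule plus_minus_orth[OF B1p[OF that(1)] B2m[OF that(2)]])
    define B where "B = B1 \<union> B2"
    have nB: "f \<notin> B2" if "f \<in> B1" for f
      using orth[OF that] that B1(1) unfolding onset_def by (metis zero_neq_one)
    have orth': "inner g f = 0" if "f \<in> B1" "g \<in> B2" for f g using orth[OF that] by (simp add: inner_commute)
    have B: "onset B" using B1(1) B2(1) orth orth' nB unfolding B_def onset_def by auto
    have finD: "finite (B1 - BW)" using B1(1) by (simp add: onset_def)
    obtain h where h: "bij_betw h {1..card (B1 - BW)} (B1 - BW)"
      using ex_bij_betw_nat_finite_1[OF finD] by blast
    let ?N = "card (B1 - BW)"
    \<comment> \<open>Besides \<open>e\<close> these are the positive basis vectors outside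
      \<open>BW\<close>; a vector of \<open>span B\<close> orthogonal to
      \<open>z 1, z 2, ...\<close> has its positive part in \<open>span BW\<close>, where
      \<open>up\<close> applies.\<close>
    define z where "z j = (if j = 0 then e else h j)" for j
    have hj: "h j \<in> B1 - BW" if "j \<in> {1..?N}" for j using h that by (auto simp: bij_betw_def)
    have zB1: "z j \<in> B1 - BF" if "j \<le> ?N" for j
      using hj[of j] that B1(2) eBF by (auto simp: z_def BW_def)
    have zinj: "z i = z j \<longleftrightarrow> i = j" if "i \<le> ?N" "j \<le> ?N" for i j
    proof -
      have "h i \<noteq> e \<and> e \<noteq> h i" if "i \<in> {1..?N}" for i using hj[OF that] by (auto simp: BW_def)
      moreover have "h i = h j \<longleftrightarrow> i = j" if "i \<in> {1..?N}" "j \<in> {1..?N}"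
        by (rule inj_on_eq_iff[OF bij_betw_imp_inj_on[OF h] that])
      ultimately show ?thesis using that by (cases "i = 0"; cases "j = 0") (simp_all add: z_def)
    qed
    obtain u where u: "u \<in> span B" "\<And>e. e \<in> span B \<Longrightarrow> inner (L u - \<psi> u) e = 0" "M \<le> J u" "J u \<le> \<beta>"
    proof (rule finite_dim_critical_point[OF B, of ?N z r M \<beta>])
      show "z j \<in> span B" if "j \<le> ?N" for j using zB1[OF that] by (auto simp: B_def intro: span_base)
      show "inner (z i) (z j) = (if i = j then 1 else 0)" if "i \<le> ?N" "j \<le> ?N" for i j
        using zB1[of i] zB1[of j] zinj[OF that] that B1(1) by (auto simp: onset_def)
      show "M \<le> J x" if x: "x \<in> sphere 0 r \<inter> span (z ` {..?N})" for x
      proof (rule low)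
        show "norm x = r" using x by simp
        have "span (z ` {..?N}) \<subseteq> {x. sgn_op x = x}"
          by (rule span_minimal[OF _ subspace_plus]) (use zB1 B1p in auto)
        then show xp: "sgn_op x = x" using x by blast
        have "orthogonal x f" if "f \<in> BF" for f
        proof -
          have "orthogonal f x"
          proof (rule orthogonal_to_span)
            show "x \<in> span (z ` {..?N})" using x by simp
            fix y assume "y \<in> z ` {..?N}"
            then have "y \<in> B1 - BF" using zB1 by auto
            moreover have "f \<in> B1" using that B1(2) by (auto simp: BW_def)
            ultimately show "orthogonal f y" using B1(1) that by (auto simp: onset_def orthogonal_def)
          qed
          then show ?thesis by (simp add: orthogonal_commute)
        qed
        then have sp: "orthogonal x y" if "y \<in> span BF" for y using orthogonal_to_span[OF that, of x] by blast
        show "inner x (d i) = 0" if "i < k" for i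
        proof -
          have "pp (d i) \<in> span BF" unfolding BF(2) using that by (auto intro: span_base)
          then have "inner x (pp (d i)) = 0" using sp by (simp add: orthogonal_def)
          then show ?thesis using pp_sym[of x "d i"] pp_plus[OF xp] by simp
        qed
      qed
      show "J x \<le> \<beta>" if x: "x \<in> span B" and 0: "\<And>j. j \<in> {1..?N} \<Longrightarrow> inner x (z j) = 0" for x
      proof (rule up)
        have x0: "inner x f = 0" if "f \<in> B1 - BW" for f
        proof -
          have "f \<in> h ` {1..?N}" using h that by (simp add: bij_betw_def)
          then obtain j where "j \<in> {1..?N}" "h j = f" by blast
          then show ?thesis using 0[of j] by (simp add: z_def)
        qed
        have "pp x = pp (\<Sum>f\<in>B. inner x f *\<^sub>R f)" using onset_expand[OF B x] by simp
        also have "\<dots> = (\<Sum>f\<in>B. inner x f *\<^sub>R pp f)" by (simp add: linear_sum[OF linear_pp] linear_scale[OF linear_pp])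
        also have "\<dots> \<in> span BW"
        proof (intro span_sum)
          fix f assume f: "f \<in> B"
          consider "f \<in> BW" | "f \<in> B1 - BW" | "f \<in> B2" using f by (auto simp: B_def)
          then show "inner x f *\<^sub>R pp f \<in> span BW"
          proof cases
            case 1 then show ?thesis using pp_plus[OF BWp[OF 1]] by (auto intro: span_mul span_base)
          next
            case 2 then show ?thesis using x0 by (simp add: span_zero)
          next
            case 3 then show ?thesis using pp_minus[OF B2m[OF 3]] by (simp add: span_zero)
          qed
        qed
        finally show "pp x \<in> span BW" .
      qed
    qed (use r in auto)
    have dB: "d i \<in> span B" if "i < n" for i
    proof -
      have "pp (d i) \<in> span B1" unfolding B1(3) using that by (auto intro: span_base)
      moreover have "pm (d i) \<in> span B2" unfolding B2(2) using that by (auto intro: span_base)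
      ultimately have "pp (d i) + pm (d i) \<in> span B" unfolding B_def
        by (intro span_add) (use span_mono[of B1 "B1 \<union> B2"] span_mono[of B2 "B1 \<union> B2"] in auto)
      then show ?thesis by (simp add: pp_pm)
    qed
    \<comment> \<open>The basis consists of eigenvectors of the sign, so the sign of
      \<open>u\<close> is an admissible test vector.\<close>
    have "sgn_op u = (\<Sum>f\<in>B. inner u f *\<^sub>R sgn_op f)"
      using arg_cong[OF onset_expand[OF B u(1)], of sgn_op] by (simp add: linear_sum[OF sgn_lin] linear_scale[OF sgn_lin])
    also have "\<dots> \<in> span B"
    proof (intro span_sum span_mul)
      fix f assume "f \<in> B"
      then have "f \<in> span B" "sgn_op f = f \<or> sgn_op f = - f" using B1p B2m by (auto simp: B_def intro: span_base)
      then show "sgn_op f \<in> span B" by (auto intro: span_neg)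
    qed
    finally have "sgn_op u \<in> span B" .
    then show ?thesis using u dB by blast
  qed
  then show ?thesis by (rule that)
qed

text \<open>The test with \<open>u\<close> and \<open>mu_le\<close> bound
  \<open>inner (\<psi> u) u\<close>; the test with the sign of \<open>u\<close> then bounds
  \<open>u\<close> by means of \<open>growth\<close>. A weak limit solves the equation against each
  \<open>d i\<close>, and compactness of \<open>\<psi>\<close> carries the level over.\<close>

theorem critical_points_of_arbitrarily_high_level: "\<exists>u. L u = \<psi> u \<and> M \<le> J u"
proof -
  obtain \<beta> where "\<And>n. \<exists>u. (\<forall>i<n. inner (L u - \<psi> u) (d i) = 0) \<and> inner (L u - \<psi> u) u = 0
     \<and> inner (L u - \<psi> u) (sgn_op u) = 0 \<and> M \<le> J u \<and> J u \<le> \<beta>"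
    using galerkin_critical_points[of M] by blast
  then obtain u where u: "\<And>n i. i < n \<Longrightarrow> inner (L (u n) - \<psi> (u n)) (d i) = 0" "\<And>n. inner (L (u n) - \<psi> (u n)) (u n) = 0"
     "\<And>n. inner (L (u n) - \<psi> (u n)) (sgn_op (u n)) = 0" "\<And>n. M \<le> J (u n)" "\<And>n. J (u n) \<le> \<beta>" by metis
  have Ju: "J (u n) = inner (\<psi> (u n)) (u n) / 2 - \<Psi> (u n)" for n
    using u(2)[of n] by (simp add: J_def inner_diff_left)
  have bd: "inner (\<psi> (u n)) (u n) \<le> \<beta> / (1/2 - 1/\<mu>)" for n
  proof -
    have "\<Psi> (u n) \<le> inner (\<psi> (u n)) (u n) / \<mu>" using mu_le[of "u n"] mu by (simp add: field_simps)
    then have "(1/2 - 1/\<mu>) * inner (\<psi> (u n)) (u n) \<le> \<beta>" using u(5)[of n] unfolding Ju by (simp add: algebra_simps)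
    moreover have "1/2 - 1/\<mu> > 0" using mu by (simp add: field_simps)
    ultimately show ?thesis by (simp add: pos_le_divide_eq mult.commute)
  qed
  obtain R where R: "\<And>u. inner (\<psi> u) u \<le> \<beta> / (1/2 - 1/\<mu>) \<Longrightarrow> R \<le> norm u \<Longrightarrow> norm (\<psi> u) \<le> a0 / 2 * norm u"
    using growth[of "a0 / 2"] a0 by (metis half_gt_zero)
  have nu: "norm (u n) \<le> max R 1" for n
  proof (rule ccontr)
    assume n: "\<not> ?thesis"
    \<comment> \<open>Testing with the sign yields coercivity on the left although the form of
      \<open>L\<close> is indefinite; sublinear growth with constant \<open>a0 / 2\<close> then
      contradicts a large norm.\<close>
    have "a0 * (norm (u n))\<^sup>2 \<le> inner (\<psi> (u n)) (sgn_op (u n))"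
      using sgn_op_coercive[of "u n"] u(3)[of n] by (simp add: a0_def inner_diff_left)
    also have "\<dots> \<le> norm (\<psi> (u n)) * norm (u n)" using norm_cauchy_schwarz norm_sgn_op by metis
    also have "\<dots> \<le> a0 / 2 * norm (u n) * norm (u n)" using R[OF bd] n by (intro mult_right_mono) auto
    finally have "a0 * (norm (u n))\<^sup>2 \<le> a0 / 2 * (norm (u n))\<^sup>2" by (simp add: power2_eq_square)
    moreover have "norm (u n) > 0" using n by (auto simp: not_le)
    then have "(norm (u n))\<^sup>2 > 0" by simp
    ultimately show False using a0 by (simp add: field_simps)
  qed
  define Rm where "Rm = max R 1"
  have "norm (u n) \<le> Rm" for n using nu by (simp add: Rm_def)
  then obtain r l where r: "strict_mono r" and l: "weakly (u \<circ> r) l"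
    using bounded_seq_weakly_convergent_subseq[OF tot, of u Rm] by auto
  have psi: "(\<lambda>n. \<psi> (u (r n))) \<longlonglongrightarrow> \<psi> l" using psi_compact[OF l] by (simp add: o_def)
  have lw: "(\<lambda>n. inner (u (r n)) x) \<longlonglongrightarrow> inner l x" for x using l by (simp add: weakly_def o_def)
  have "inner (L l - \<psi> l) (d i) = 0" for i
  proof -
    have "(\<lambda>n. inner (u (r n)) (L (d i)) - inner (\<psi> (u (r n))) (d i)) \<longlonglongrightarrow> inner l (L (d i)) - inner (\<psi> l) (d i)"
      by (intro tendsto_diff tendsto_inner tendsto_const lw psi)
    moreover have "\<forall>\<^sub>F n in sequentially. inner (u (r n)) (L (d i)) - inner (\<psi> (u (r n))) (d i) = 0"
      unfolding eventually_sequentially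
    proof (intro exI[of _ "Suc i"] allI impI)
      fix n assume "Suc i \<le> n"
      then have "i < r n" using seq_suble[OF r, of n] by linarith
      from u(1)[OF this] show "inner (u (r n)) (L (d i)) - inner (\<psi> (u (r n))) (d i) = 0" by (simp add: inner_diff_left sym)
    qed
    ultimately have "inner l (L (d i)) - inner (\<psi> l) (d i) = 0" by (rule limit_eventually_0)
    then show ?thesis by (simp add: inner_diff_left sym)
  qed
  then have crit: "L l = \<psi> l" using tot unfolding total_seq_def by (metis eq_iff_diff_eq_0)
  \<comment> \<open>By \<open>Ju\<close> the level of a Galerkin solution involves only
    \<open>\<Psi>\<close> and the pairing of the strongly convergent \<open>\<psi> (u (r n))\<close>
    with the weakly convergent \<open>u (r n)\<close>.\<close>
  have "(\<lambda>n. inner (\<psi> (u (r n)) - \<psi> l) (u (r n))) \<longlonglongrightarrow> 0"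
  proof (rule Lim_null_comparison)
    show "\<forall>\<^sub>F n in sequentially. norm (inner (\<psi> (u (r n)) - \<psi> l) (u (r n))) \<le> norm (\<psi> (u (r n)) - \<psi> l) * max R 1"
    proof (intro always_eventually allI)
      fix n show "norm (inner (\<psi> (u (r n)) - \<psi> l) (u (r n))) \<le> norm (\<psi> (u (r n)) - \<psi> l) * max R 1"
        using order_trans[OF Cauchy_Schwarz_ineq2 mult_left_mono[OF nu norm_ge_zero]] by simp
    qed
    show "(\<lambda>n. norm (\<psi> (u (r n)) - \<psi> l) * max R 1) \<longlonglongrightarrow> 0"
      using psi by (intro tendsto_mult_left_zero tendsto_norm_zero) (simp add: LIM_zero)
  qed
  moreover have "(\<lambda>n. inner (\<psi> l) (u (r n))) \<longlonglongrightarrow> inner (\<psi> l) l" using lw[of "\<psi> l"] by (simp add: inner_commute)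
  ultimately have "(\<lambda>n. inner (\<psi> (u (r n)) - \<psi> l) (u (r n)) + inner (\<psi> l) (u (r n))) \<longlonglongrightarrow> 0 + inner (\<psi> l) l" by (rule tendsto_add)
  then have "(\<lambda>n. inner (\<psi> (u (r n))) (u (r n))) \<longlonglongrightarrow> inner (\<psi> l) l" by (simp add: inner_diff_left)
  moreover have "(\<lambda>n. \<Psi> (u (r n))) \<longlonglongrightarrow> \<Psi> l" using Psi_weak[OF l] by (simp add: o_def)
  ultimately have "(\<lambda>n. J (u (r n))) \<longlonglongrightarrow> inner (\<psi> l) l / 2 - \<Psi> l" unfolding Ju by (intro tendsto_diff tendsto_divide tendsto_const) auto
  then have "(\<lambda>n. J (u (r n))) \<longlonglongrightarrow> J l" by (simp add: J_def crit)
  then have "M \<le> J l" using u(4) by (intro LIMSEQ_le_const) auto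
  with crit show ?thesis by blast
qed

end

section \<open>The Hilbert space of square integrable functions\<close>

text \<open>Borel functions and \<open>lborel\<close>, so that product measures and Fubini apply
  directly; \<open>lebesgue_integral_eq\<close> translates to the Lebesgue integrals of the
  statement.\<close>

definition l2fun :: "(R3 \<Rightarrow> real) \<Rightarrow> bool" where
  "l2fun f \<longleftrightarrow> f \<in> borel_measurable borel \<and> integrable lborel (\<lambda>x. (f x)\<^sup>2)"

lemma l2fun_measurable[measurable_dest, simp]: "l2fun f \<Longrightarrow> f \<in> borel_measurable borel"
  by (simp add: l2fun_def)

lemma l2fun_integrable_sq: "l2fun f \<Longrightarrow> integrable lborel (\<lambda>x. (f x)\<^sup>2)"
  by (simp add: l2fun_def)

lemma l2fun_dominated:
  assumes "l2fun g" "f \<in> borel_measurable borel" "\<And>x. \<bar>f x\<bar> \<le> C * \<bar>g x\<bar>"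
  shows "l2fun f"
  unfolding l2fun_def
proof
  show "integrable lborel (\<lambda>x. (f x)\<^sup>2)"
  proof (rule Bochner_Integration.integrable_bound)
    show "integrable lborel (\<lambda>x. C\<^sup>2 * (g x)\<^sup>2)" using assms(1) by (simp add: l2fun_def)
    show "AE x in lborel. norm ((f x)\<^sup>2) \<le> norm (C\<^sup>2 * (g x)\<^sup>2)"
    proof (rule AE_I2)
      show "norm ((f x)\<^sup>2) \<le> norm (C\<^sup>2 * (g x)\<^sup>2)" for x
        using power_mono[OF assms(3)[of x] abs_ge_zero, of 2] by (simp add: power_mult_distrib)
    qed
  qed (use assms(2) in simp)
qed (fact assms(2))

lemma sum_sq_le: "(a + b)\<^sup>2 \<le> 2 * a\<^sup>2 + 2 * (b::real)\<^sup>2"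
  using zero_le_power2[of "a - b"] by (simp add: power2_eq_square algebra_simps)

lemma l2fun_add: assumes "l2fun f" "l2fun g" shows "l2fun (\<lambda>x. f x + g x)"
  unfolding l2fun_def
proof
  show "integrable lborel (\<lambda>x. (f x + g x)\<^sup>2)"
  proof (rule Bochner_Integration.integrable_bound)
    show "integrable lborel (\<lambda>x. 2 * (f x)\<^sup>2 + 2 * (g x)\<^sup>2)" using assms by (simp add: l2fun_def)
    show "AE x in lborel. norm ((f x + g x)\<^sup>2) \<le> norm (2 * (f x)\<^sup>2 + 2 * (g x)\<^sup>2)"
      using sum_sq_le by (intro AE_I2) (simp add: order_trans[OF _ abs_ge_self])
  qed (use assms in simp)
qed (use assms in simp)

lemma l2fun_scale: "l2fun f \<Longrightarrow> l2fun (\<lambda>x. c * f x)"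
  by (rule l2fun_dominated[of f _ "\<bar>c\<bar>"]) (auto simp: abs_mult)

lemma l2fun_uminus: "l2fun f \<Longrightarrow> l2fun (\<lambda>x. - f x)"
  using l2fun_scale[of f "-1"] by simp

lemma l2fun_diff: "l2fun f \<Longrightarrow> l2fun g \<Longrightarrow> l2fun (\<lambda>x. f x - g x)"
  using l2fun_add[OF _ l2fun_uminus, of f g] by simp

lemma l2fun_0: "l2fun (\<lambda>_. 0)" by (simp add: l2fun_def)

lemma l2fun_mult_integrable:
  assumes "l2fun f" "l2fun g" shows "integrable lborel (\<lambda>x. f x * g x)"
proof (rule Bochner_Integration.integrable_bound)
  show "integrable lborel (\<lambda>x. (f x)\<^sup>2 + (g x)\<^sup>2)" using assms by (simp add: l2fun_def)
  show "AE x in lborel. norm (f x * g x) \<le> norm ((f x)\<^sup>2 + (g x)\<^sup>2)"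
  proof (rule AE_I2)
    fix x
    have "2 * \<bar>f x * g x\<bar> \<le> (f x)\<^sup>2 + (g x)\<^sup>2"
      using zero_le_power2[of "\<bar>f x\<bar> - \<bar>g x\<bar>"] by (simp add: power2_eq_square abs_mult algebra_simps)
    then show "norm (f x * g x) \<le> norm ((f x)\<^sup>2 + (g x)\<^sup>2)" by simp
  qed
qed (use assms in simp)

text \<open>Elements of \<open>l2\<close> are canonical representatives of classes of almost everywhere equal functions, so that
  equality in \<open>l2\<close> is equality almost everywhere.\<close>

definition canon :: "(R3 \<Rightarrow> real) \<Rightarrow> R3 \<Rightarrow> real" where
  "canon f = (SOME g. l2fun g \<and> (AE x in lborel. g x = f x))"

lemma canon: assumes "l2fun f" shows "l2fun (canon f)" "AE x in lborel. canon f x = f x"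
proof -
  have "l2fun f \<and> (AE x in lborel. f x = f x)" using assms by simp
  from someI[of "\<lambda>g. l2fun g \<and> (AE x in lborel. g x = f x)", OF this]
  show "l2fun (canon f)" "AE x in lborel. canon f x = f x" unfolding canon_def by auto
qed

lemma canon_eq:
  assumes "AE x in lborel. f x = g x" shows "canon f = canon g"
proof -
  have "(AE x in lborel. h x = f x) \<longleftrightarrow> (AE x in lborel. h x = g x)" for h
    using assms by (auto elim: AE_mp)
  then show ?thesis by (simp add: canon_def)
qed

typedef l2 = "{h. \<exists>f. l2fun f \<and> h = canon f}" morphisms fn Abs_l2
  using l2fun_0 by blast

text \<open>Depends only on the almost everywhere class, so it may also be applied to Lebesgue
  measurable functions; see \<open>fn_mk_sq_int\<close>.\<close>

definition mk :: "(R3 \<Rightarrow> real) \<Rightarrow> l2" where "mk f = Abs_l2 (canon f)"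

lemma l2fun_fn[simp]: "l2fun (fn h)" using fn[of h] canon(1) by auto

lemma fn_measurable[measurable, simp]: "fn h \<in> borel_measurable borel"
  using l2fun_fn by (rule l2fun_measurable)

lemma fn_mk: "l2fun f \<Longrightarrow> AE x in lborel. fn (mk f) x = f x"
proof -
  assume f: "l2fun f"
  then have "fn (mk f) = canon f" unfolding mk_def by (intro Abs_l2_inverse) blast
  then show ?thesis using canon(2)[OF f] by simp
qed

lemma mk_fn[simp]: "mk (fn h) = h"
proof -
  obtain f where f: "l2fun f" "fn h = canon f" using fn[of h] by auto
  have "canon (fn h) = fn h" unfolding f(2) by (rule canon_eq[OF canon(2)[OF f(1)]])
  then show ?thesis by (simp add: mk_def fn_inverse)
qed

lemma mk_cong: "AE x in lborel. f x = g x \<Longrightarrow> mk f = mk g"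
  by (simp add: mk_def canon_eq)

lemma mk_eqD: "l2fun f \<Longrightarrow> l2fun g \<Longrightarrow> mk f = mk g \<Longrightarrow> AE x in lborel. f x = g x"
  using fn_mk[of f] fn_mk[of g] by (auto elim!: AE_mp)

lemma l2_eqI: "AE x in lborel. fn f x = fn g x \<Longrightarrow> f = g"
  using mk_cong[of "fn f" "fn g"] by simp

lemma mk_eqI: "l2fun f \<Longrightarrow> AE x in lborel. f x = fn h x \<Longrightarrow> mk f = h"
  using mk_cong[of f "fn h"] by simp

instantiation l2 :: real_inner
begin

definition "0 = mk (\<lambda>_. 0)"
definition "f + g = mk (\<lambda>x. fn f x + fn g x)"
definition "- f = mk (\<lambda>x. - fn f x)"
definition "f - g = mk (\<lambda>x. fn f x - fn g x)"
definition "c *\<^sub>R f = mk (\<lambda>x. c * fn f x)"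
definition "inner f g = (LINT x|lborel. fn f x * fn g x)"
definition "norm (f::l2) = sqrt (inner f f)"
definition "sgn (f::l2) = inverse (norm f) *\<^sub>R f"
definition "dist (f::l2) g = norm (f - g)"
definition [code del]: "(uniformity :: (l2 \<times> l2) filter) = (INF e\<in>{0 <..}. principal {(x, y). dist x y < e})"
definition [code del]: "open (U :: l2 set) \<longleftrightarrow> (\<forall>x\<in>U. eventually (\<lambda>(x', y). x' = x \<longrightarrow> y \<in> U) uniformity)"

lemma fn_zero: "AE x in lborel. fn 0 x = 0"
  and fn_add: "AE x in lborel. fn (f + g) x = fn f x + fn g x"
  and fn_uminus: "AE x in lborel. fn (- f) x = - fn f x"
  and fn_diff: "AE x in lborel. fn (f - g) x = fn f x - fn g x"
  and fn_scaleR: "AE x in lborel. fn (c *\<^sub>R f) x = c * fn f x"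
  unfolding zero_l2_def plus_l2_def uminus_l2_def minus_l2_def scaleR_l2_def
  by (intro fn_mk l2fun_0 l2fun_add l2fun_uminus l2fun_diff l2fun_scale l2fun_fn)+

lemma inner_cong:
  assumes "AE x in lborel. fn f x = f' x" "f' \<in> borel_measurable borel"
  shows "inner f g = (LINT x|lborel. f' x * fn g x)"
  unfolding inner_l2_def by (rule integral_cong_AE) (use assms in auto)

instance
proof
  fix a b c :: l2 and r s :: real
  show "a + b + c = a + (b + c)"
    by (rule l2_eqI) (use fn_add[of "a + b" c] fn_add[of a b] fn_add[of a "b + c"] fn_add[of b c] in \<open>eventually_elim; simp\<close>)
  show "a + b = b + a" by (simp add: plus_l2_def add.commute)
  show "0 + a = a"
    by (rule l2_eqI) (use fn_add[of 0 a] fn_zero in \<open>eventually_elim; simp\<close>)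
  show "- a + a = 0"
    by (rule l2_eqI) (use fn_add[of "- a" a] fn_zero fn_uminus[of a] in \<open>eventually_elim; simp\<close>)
  show "a - b = a + - b"
    by (rule l2_eqI) (use fn_diff[of a b] fn_add[of a "- b"] fn_uminus[of b] in \<open>eventually_elim; simp\<close>)
  show "r *\<^sub>R (a + b) = r *\<^sub>R a + r *\<^sub>R b"
    by (rule l2_eqI) (use fn_scaleR[of r "a + b"] fn_add[of a b] fn_add[of "r *\<^sub>R a" "r *\<^sub>R b"] fn_scaleR[of r a] fn_scaleR[of r b]
        in \<open>eventually_elim; simp add: algebra_simps\<close>)
  show "(r + s) *\<^sub>R a = r *\<^sub>R a + s *\<^sub>R a"
    by (rule l2_eqI) (use fn_scaleR[of "r + s" a] fn_add[of "r *\<^sub>R a" "s *\<^sub>R a"] fn_scaleR[of r a] fn_scaleR[of s a]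
        in \<open>eventually_elim; simp add: algebra_simps\<close>)
  show "r *\<^sub>R s *\<^sub>R a = (r * s) *\<^sub>R a"
    by (rule l2_eqI) (use fn_scaleR[of r "s *\<^sub>R a"] fn_scaleR[of s a] fn_scaleR[of "r * s" a] in \<open>eventually_elim; simp\<close>)
  show "1 *\<^sub>R a = a" by (rule l2_eqI) (use fn_scaleR[of 1 a] in \<open>eventually_elim; simp\<close>)
  show "dist a b = norm (a - b)" by (rule dist_l2_def)
  show "sgn a = inverse (norm a) *\<^sub>R a" by (rule sgn_l2_def)
  show "(uniformity :: (l2 \<times> l2) filter) = (INF e\<in>{0 <..}. principal {(x, y). dist x y < e})" by (rule uniformity_l2_def)
  show "open U \<longleftrightarrow> (\<forall>x\<in>U. eventually (\<lambda>(x', y). x' = x \<longrightarrow> y \<in> U) uniformity)" for U :: "l2 set" by (rule open_l2_def)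
  show "inner a b = inner b a" by (simp add: inner_l2_def mult.commute)
  show "inner (a + b) c = inner a c + inner b c"
  proof -
    have "inner (a + b) c = (LINT x|lborel. (fn a x + fn b x) * fn c x)" by (rule inner_cong[OF fn_add]) simp
    then show ?thesis by (simp add: inner_l2_def distrib_right l2fun_mult_integrable)
  qed
  show "inner (r *\<^sub>R a) b = r * inner a b"
  proof -
    have "inner (r *\<^sub>R a) b = (LINT x|lborel. (r * fn a x) * fn b x)" by (rule inner_cong[OF fn_scaleR]) simp
    then show ?thesis by (simp add: inner_l2_def mult.assoc)
  qed
  show "0 \<le> inner a a" by (simp add: inner_l2_def)
  show "inner a a = 0 \<longleftrightarrow> a = 0"
  proof
    assume "inner a a = 0"
    then have "AE x in lborel. fn a x * fn a x = 0"
      unfolding inner_l2_def using l2fun_mult_integrable[OF l2fun_fn[of a] l2fun_fn[of a]]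
      by (subst (asm) integral_nonneg_eq_0_iff_AE) auto
    then have "AE x in lborel. fn a x = fn 0 x" using fn_zero by eventually_elim simp
    then show "a = 0" by (rule l2_eqI)
  next
    assume "a = 0"
    then have "inner a a = (LINT x|lborel. 0 * fn 0 x)" using inner_cong[OF fn_zero, of 0] by simp
    then show "inner a a = 0" by simp
  qed
  show "norm a = sqrt (inner a a)" by (rule norm_l2_def)
qed

end

lemma mk_add: "l2fun f \<Longrightarrow> l2fun g \<Longrightarrow> mk (\<lambda>x. f x + g x) = mk f + mk g"
  by (rule mk_eqI) (use fn_add[of "mk f" "mk g"] fn_mk[of f] fn_mk[of g] in \<open>auto intro: l2fun_add elim!: AE_mp\<close>)

lemma mk_diff: "l2fun f \<Longrightarrow> l2fun g \<Longrightarrow> mk (\<lambda>x. f x - g x) = mk f - mk g"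
  by (rule mk_eqI) (use fn_diff[of "mk f" "mk g"] fn_mk[of f] fn_mk[of g] in \<open>auto intro: l2fun_diff elim!: AE_mp\<close>)

lemma mk_scale: "l2fun f \<Longrightarrow> mk (\<lambda>x. c * f x) = c *\<^sub>R mk f"
  by (rule mk_eqI) (use fn_scaleR[of c "mk f"] fn_mk[of f] in \<open>auto intro: l2fun_scale elim!: AE_mp\<close>)

lemma inner_mk: "l2fun f \<Longrightarrow> inner (mk f) h = (LINT x|lborel. f x * fn h x)"
  by (rule inner_cong[OF fn_mk]) auto

lemma inner_mk_right: "l2fun f \<Longrightarrow> inner h (mk f) = (LINT x|lborel. fn h x * f x)"
  by (subst inner_commute) (simp add: inner_mk mult.commute)

lemma inner_mk_mk: "l2fun f \<Longrightarrow> l2fun g \<Longrightarrow> inner (mk f) (mk g) = (LINT x|lborel. f x * g x)"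
  unfolding inner_mk by (rule integral_cong_AE) (use fn_mk[of g] in \<open>auto elim!: AE_mp\<close>)

lemma norm_sq_l2: "(norm h)\<^sup>2 = (LINT x|lborel. (fn h x)\<^sup>2)"
  by (simp only: power2_norm_eq_inner inner_l2_def) (simp add: power2_eq_square)

lemma norm_sq_mk: "l2fun f \<Longrightarrow> (norm (mk f))\<^sup>2 = (LINT x|lborel. (f x)\<^sup>2)"
  by (simp only: power2_norm_eq_inner inner_mk_mk) (simp add: power2_eq_square)

subsection \<open>Completeness\<close>

lemma nn_integral_sq_fn: "(\<integral>\<^sup>+x. ennreal ((fn h x)\<^sup>2) \<partial>lborel) = ennreal ((norm h)\<^sup>2)"
  unfolding norm_sq_l2 by (rule nn_integral_eq_integral) (auto intro: l2fun_integrable_sq)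

text \<open>Riesz-Fischer. The weights \<open>2^k\<close> still leave the sum of the squared
  increments integrable, so almost everywhere the increments are of order
  \<open>(1 / sqrt 2)^k\<close> and the sequence converges; Fatou's lemma turns this into
  convergence in norm.\<close>

lemma fast_Cauchy_l2_convergent:
  fixes h :: "nat \<Rightarrow> l2"
  assumes fast: "\<And>k m. k \<le> m \<Longrightarrow> norm (h m - h k) \<le> (1/2)^k"
  shows "convergent h"
proof -
  let ?g = "\<lambda>k. fn (h (Suc k) - h k)"
  have "(\<integral>\<^sup>+x. (\<Sum>k. ennreal (2^k * (?g k x)\<^sup>2)) \<partial>lborel) = (\<Sum>k. \<integral>\<^sup>+x. ennreal (2^k * (?g k x)\<^sup>2) \<partial>lborel)"
    by (rule nn_integral_suminf) simp
  also have "\<dots> = (\<Sum>k. ennreal (2^k * (norm (h (Suc k) - h k))\<^sup>2))"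
    by (simp add: ennreal_mult nn_integral_cmult nn_integral_sq_fn)
  also have "\<dots> \<le> (\<Sum>k. ennreal ((1/2)^k))"
  proof (intro suminf_le ennreal_leI allI)
    fix k
    have "(norm (h (Suc k) - h k))\<^sup>2 \<le> ((1/2)^k)\<^sup>2" using fast[of k "Suc k"] by (intro power_mono) auto
    then have "2^k * (norm (h (Suc k) - h k))\<^sup>2 \<le> 2^k * ((1/2)^k)\<^sup>2" by (intro mult_left_mono) auto
    also have "\<dots> = (1/2)^k" by (simp add: power2_eq_square power_divide)
    finally show "2^k * (norm (h (Suc k) - h k))\<^sup>2 \<le> (1/2)^k" .
  qed auto
  also have "\<dots> = ennreal (\<Sum>k. (1/2)^k)" by (rule suminf_ennreal2) (auto intro: summable_geometric)
  also have "\<dots> < \<infinity>" by simp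
  finally have "AE x in lborel. (\<Sum>k. ennreal (2^k * (?g k x)\<^sup>2)) \<noteq> \<infinity>"
    by (intro nn_integral_PInf_AE) auto
  then have conv: "AE x in lborel. summable (\<lambda>k. ?g k x)"
  proof eventually_elim
    case (elim x)
    then have "summable (\<lambda>k. 2^k * (?g k x)\<^sup>2)" by (intro summable_suminf_not_top) auto
    then have "(\<lambda>k. 2^k * (?g k x)\<^sup>2) \<longlonglongrightarrow> 0" by (rule summable_LIMSEQ_zero)
    then obtain C where C: "\<And>k. \<bar>2^k * (?g k x)\<^sup>2\<bar> \<le> C"
      using convergent_imp_Bseq[of "\<lambda>k. 2^k * (?g k x)\<^sup>2"] by (auto simp: convergent_def Bseq_def)
    have "\<bar>?g k x\<bar> \<le> sqrt C * (1 / sqrt 2)^k" for k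
    proof -
      have "sqrt (2^k * (?g k x)\<^sup>2) \<le> sqrt C" using C[of k] by (intro real_sqrt_le_mono) auto
      then have "sqrt 2 ^ k * \<bar>?g k x\<bar> \<le> sqrt C" by (simp only: real_sqrt_mult real_sqrt_abs real_sqrt_power[of 2 k])
      then show ?thesis by (simp add: power_divide field_simps)
    qed
    then have b: "norm (?g k x) \<le> sqrt C * (1 / sqrt 2)^k" for k by simp
    have "1 < sqrt (2::real)" by simp
    then have "summable (\<lambda>k. sqrt C * (1 / sqrt 2)^k)" by (intro summable_mult summable_geometric) simp
    then show ?case by (rule summable_comparison_test'[where N = 0]) (rule b)
  qed
  have steps: "AE x in lborel. \<forall>k. ?g k x = fn (h (Suc k)) x - fn (h k) x"
    by (subst AE_all_countable) (use fn_diff in blast)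
  define f where "f x = lim (\<lambda>k. fn (h k) x)" for x
  have fm: "f \<in> borel_measurable borel"
    unfolding f_def by (intro borel_measurable_lim_metric) simp
  have lim: "AE x in lborel. (\<lambda>k. fn (h k) x) \<longlonglongrightarrow> f x"
    using conv steps
  proof eventually_elim
    case (elim x)
    then have "convergent (\<lambda>n. \<Sum>k<n. fn (h (Suc k)) x - fn (h k) x)" by (simp add: summable_iff_convergent)
    moreover have "(\<Sum>k<n. fn (h (Suc k)) x - fn (h k) x) = fn (h n) x - fn (h 0) x" for n
      by (rule sum_lessThan_telescope)
    ultimately obtain l where "(\<lambda>n. fn (h n) x - fn (h 0) x) \<longlonglongrightarrow> l" by (auto simp: convergent_def)
    from tendsto_add[OF this tendsto_const[of "fn (h 0) x"]] have "(\<lambda>n. fn (h n) x) \<longlonglongrightarrow> l + fn (h 0) x" by simp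
    then show ?case by (simp add: f_def limI)
  qed
  have fatou: "(\<integral>\<^sup>+x. ennreal ((f x - fn (h k) x)\<^sup>2) \<partial>lborel) \<le> ennreal (((1/2)^k)\<^sup>2)" for k
  proof -
    have "(\<integral>\<^sup>+x. ennreal ((f x - fn (h k) x)\<^sup>2) \<partial>lborel) = (\<integral>\<^sup>+x. liminf (\<lambda>m. ennreal ((fn (h m) x - fn (h k) x)\<^sup>2)) \<partial>lborel)"
    proof (rule nn_integral_cong_AE, use lim in eventually_elim)
      case (elim x)
      have "(\<lambda>m. ennreal ((fn (h m) x - fn (h k) x)\<^sup>2)) \<longlonglongrightarrow> ennreal ((f x - fn (h k) x)\<^sup>2)"
        by (intro tendsto_intros elim)
      then show ?case using lim_imp_Liminf[OF sequentially_bot] by metis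
    qed
    also have "\<dots> \<le> liminf (\<lambda>m. \<integral>\<^sup>+x. ennreal ((fn (h m) x - fn (h k) x)\<^sup>2) \<partial>lborel)"
      by (rule nn_integral_liminf) simp
    also have "\<dots> \<le> ennreal (((1/2)^k)\<^sup>2)"
    proof (rule Liminf_le)
      show "\<forall>\<^sub>F m in sequentially. (\<integral>\<^sup>+x. ennreal ((fn (h m) x - fn (h k) x)\<^sup>2) \<partial>lborel) \<le> ennreal (((1/2)^k)\<^sup>2)"
        unfolding eventually_sequentially
      proof (intro exI[of _ k] allI impI)
        fix m assume "k \<le> m"
        have "(\<integral>\<^sup>+x. ennreal ((fn (h m) x - fn (h k) x)\<^sup>2) \<partial>lborel) = (\<integral>\<^sup>+x. ennreal ((fn (h m - h k) x)\<^sup>2) \<partial>lborel)"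
          by (rule nn_integral_cong_AE) (use fn_diff[of "h m" "h k"] in \<open>eventually_elim; simp\<close>)
        also have "\<dots> \<le> ennreal (((1/2)^k)\<^sup>2)" unfolding nn_integral_sq_fn
          using fast[OF \<open>k \<le> m\<close>] by (intro ennreal_leI power_mono) auto
        finally show "(\<integral>\<^sup>+x. ennreal ((fn (h m) x - fn (h k) x)\<^sup>2) \<partial>lborel) \<le> ennreal (((1/2)^k)\<^sup>2)" .
      qed
    qed simp
    finally show ?thesis .
  qed
  have dk: "l2fun (\<lambda>x. f x - fn (h k) x)" for k
    unfolding l2fun_def
  proof
    show "(\<lambda>x. f x - fn (h k) x) \<in> borel_measurable borel" using fm by simp
    show "integrable lborel (\<lambda>x. (f x - fn (h k) x)\<^sup>2)"
    proof (rule integrableI_nonneg)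
      show "(\<integral>\<^sup>+x. ennreal ((f x - fn (h k) x)\<^sup>2) \<partial>lborel) < \<infinity>"
        using fatou[of k] by (rule order_le_less_trans) simp
    qed (use fm in auto)
  qed
  have f2: "l2fun f" using l2fun_add[OF dk[of 0] l2fun_fn[of "h 0"]] by simp
  have "norm (h k - mk f) \<le> (1/2)^k" for k
  proof -
    have mkd: "mk (\<lambda>x. f x - fn (h k) x) = mk f - h k" using mk_diff[OF f2 l2fun_fn[of "h k"]] by simp
    have eq: "ennreal ((norm (mk f - h k))\<^sup>2) = (\<integral>\<^sup>+x. ennreal ((f x - fn (h k) x)\<^sup>2) \<partial>lborel)"
      unfolding mkd[symmetric] nn_integral_sq_fn[symmetric]
      by (rule nn_integral_cong_AE) (use fn_mk[OF dk[of k]] in \<open>eventually_elim; simp\<close>)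
    have "ennreal ((norm (mk f - h k))\<^sup>2) \<le> ennreal (((1/2)^k)\<^sup>2)" unfolding eq by (rule fatou)
    then have "(norm (mk f - h k))\<^sup>2 \<le> ((1/2)^k)\<^sup>2" by (subst (asm) ennreal_le_iff) simp_all
    then have "norm (mk f - h k) \<le> (1/2)^k" by (rule power2_le_imp_le) simp
    then show ?thesis by (simp add: norm_minus_commute)
  qed
  then have "(\<lambda>k. h k - mk f) \<longlonglongrightarrow> 0"
    by (intro Lim_null_comparison[OF always_eventually LIMSEQ_realpow_zero[of "1/2"]]) auto
  then show ?thesis unfolding convergent_def using LIM_zero_cancel by blast
qed

instance l2 :: banach
proof
  fix X :: "nat \<Rightarrow> l2" assume X: "Cauchy X"
  have "\<exists>N. \<forall>m\<ge>N. \<forall>n\<ge>N. dist (X m) (X n) < (1/2)^k" for k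
    using X unfolding Cauchy_def by simp
  then obtain N where N: "\<And>k m n. N k \<le> m \<Longrightarrow> N k \<le> n \<Longrightarrow> dist (X m) (X n) < (1/2)^k" by metis
  \<comment> \<open>Strictly increasing because of the summand \<open>k\<close>, and at least
    \<open>N k\<close> because \<open>N k\<close> is one of the summands.\<close>
  define r where "r k = k + (\<Sum>j\<le>k. N j)" for k
  have sm: "strict_mono r" unfolding strict_mono_Suc_iff by (simp add: r_def)
  have rN: "N k \<le> r k" for k using member_le_sum[of k "{..k}" N] by (simp add: r_def)
  have "convergent (X \<circ> r)"
  proof (rule fast_Cauchy_l2_convergent)
    fix k m :: nat assume "k \<le> m"
    then have "r k \<le> r m" using sm by (simp add: strict_mono_less_eq)
    then show "norm ((X \<circ> r) m - (X \<circ> r) k) \<le> (1/2)^k"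
      using N[of k "r m" "r k"] rN[of k] by (simp add: dist_norm)
  qed
  then obtain l where "(X \<circ> r) \<longlonglongrightarrow> l" by (auto simp: convergent_def)
  then show "convergent X" using Cauchy_converges_subseq[OF X sm] by (auto simp: convergent_def)
qed

subsection \<open>Multiplication operators\<close>

definition mult_op :: "(R3 \<Rightarrow> real) \<Rightarrow> l2 \<Rightarrow> l2" where
  "mult_op m h = mk (\<lambda>x. m x * fn h x)"

definition bmeas :: "(R3 \<Rightarrow> real) \<Rightarrow> bool" where
  "bmeas m \<longleftrightarrow> m \<in> borel_measurable borel \<and> (\<exists>C. \<forall>x. \<bar>m x\<bar> \<le> C)"

lemma bmeas_measurable[measurable_dest, simp]: "bmeas m \<Longrightarrow> m \<in> borel_measurable borel" by (simp add: bmeas_def)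

lemma l2fun_mult: "bmeas m \<Longrightarrow> l2fun f \<Longrightarrow> l2fun (\<lambda>x. m x * f x)"
proof -
  assume m: "bmeas m" and f: "l2fun f"
  obtain C where "\<And>x. \<bar>m x\<bar> \<le> C" using m by (auto simp: bmeas_def)
  then show "l2fun (\<lambda>x. m x * f x)"
    by (intro l2fun_dominated[OF f, of _ C]) (use m f in \<open>auto simp: abs_mult intro!: mult_right_mono\<close>)
qed

lemma fn_mult_op: "bmeas m \<Longrightarrow> AE x in lborel. fn (mult_op m h) x = m x * fn h x"
  unfolding mult_op_def by (intro fn_mk l2fun_mult l2fun_fn)

lemma mult_op_mk: "bmeas m \<Longrightarrow> l2fun f \<Longrightarrow> mult_op m (mk f) = mk (\<lambda>x. m x * f x)"
  unfolding mult_op_def using fn_mk[of f] by (intro mk_cong) auto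

lemma mult_op_norm:
  assumes "bmeas m" "\<And>x. \<bar>m x\<bar> \<le> C" shows "norm (mult_op m h) \<le> C * norm h"
proof -
  have C: "0 \<le> C" using assms(2)[of 0] by linarith
  have "(norm (mult_op m h))\<^sup>2 = (LINT x|lborel. (m x * fn h x)\<^sup>2)"
    unfolding mult_op_def by (intro norm_sq_mk l2fun_mult assms l2fun_fn)
  also have "\<dots> \<le> (LINT x|lborel. C\<^sup>2 * (fn h x)\<^sup>2)"
  proof (rule integral_mono)
    show "integrable lborel (\<lambda>x. (m x * fn h x)\<^sup>2)" using l2fun_mult[OF assms(1) l2fun_fn[of h]] by (rule l2fun_integrable_sq)
    show "(m x * fn h x)\<^sup>2 \<le> C\<^sup>2 * (fn h x)\<^sup>2" for x
      using power_mono[OF assms(2) abs_ge_zero, of x 2] unfolding power_mult_distrib by (intro mult_right_mono) auto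
  qed (auto intro: l2fun_integrable_sq)
  also have "\<dots> = (C * norm h)\<^sup>2" by (simp add: norm_sq_l2 power_mult_distrib)
  finally show ?thesis by (rule power2_le_imp_le) (simp add: C)
qed

lemma mult_op_bounded_linear: assumes "bmeas m" shows "bounded_linear (mult_op m)"
proof -
  obtain C where C: "\<And>x. \<bar>m x\<bar> \<le> C" using assms by (auto simp: bmeas_def)
  show ?thesis
  proof (rule bounded_linear_intro[where K = C])
    show "mult_op m (f + g) = mult_op m f + mult_op m g" for f g
    proof -
      have "mult_op m (f + g) = mk (\<lambda>x. m x * fn f x + m x * fn g x)"
        unfolding mult_op_def by (rule mk_cong) (use fn_add[of f g] in \<open>eventually_elim; simp add: distrib_left\<close>)
      then show ?thesis unfolding mult_op_def by (simp add: mk_add l2fun_mult assms)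
    qed
    show "mult_op m (r *\<^sub>R f) = r *\<^sub>R mult_op m f" for r f
    proof -
      have "mult_op m (r *\<^sub>R f) = mk (\<lambda>x. r * (m x * fn f x))"
        unfolding mult_op_def by (rule mk_cong) (use fn_scaleR[of r f] in \<open>eventually_elim; simp\<close>)
      then show ?thesis unfolding mult_op_def by (simp add: mk_scale l2fun_mult assms)
    qed
    show "norm (mult_op m h) \<le> norm h * C" for h using mult_op_norm[OF assms C, of h] by (simp add: mult.commute)
  qed
qed

lemma inner_mult_op: "bmeas m \<Longrightarrow> inner (mult_op m f) g = (LINT x|lborel. m x * fn f x * fn g x)"
  unfolding mult_op_def by (simp add: inner_mk l2fun_mult)

lemma mult_op_sym: "bmeas m \<Longrightarrow> inner (mult_op m f) g = inner f (mult_op m g)"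
  unfolding inner_commute[of f] inner_mult_op by (simp add: mult.assoc mult.left_commute mult.commute)

subsection \<open>A countable total family\<close>

definition rat_points :: "R3 set" where "rat_points = {a. \<forall>i\<in>Basis. a \<bullet> i \<in> \<rat>}"

lemma countable_rat_points: "countable rat_points"
proof -
  have "rat_points \<subseteq> (\<lambda>f. \<Sum>i\<in>Basis. f i *\<^sub>R i) ` (Basis \<rightarrow>\<^sub>E \<rat>)"
  proof
    fix a :: R3 assume a: "a \<in> rat_points"
    have "a = (\<Sum>i\<in>Basis. (restrict (\<lambda>i. a \<bullet> i) Basis) i *\<^sub>R i)" by (simp add: euclidean_representation)
    moreover have "restrict (\<lambda>i. a \<bullet> i) Basis \<in> Basis \<rightarrow>\<^sub>E \<rat>" using a by (auto simp: rat_points_def)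
    ultimately show "a \<in> (\<lambda>f. \<Sum>i\<in>Basis. f i *\<^sub>R i) ` (Basis \<rightarrow>\<^sub>E \<rat>)" by blast
  qed
  then show ?thesis by (rule countable_subset) (intro countable_image countable_PiE finite_Basis countable_rat)
qed

definition rat_boxes :: "R3 set set" where "rat_boxes = (\<lambda>(a, b). box a b) ` (rat_points \<times> rat_points)"

lemma countable_rat_boxes: "countable rat_boxes"
  unfolding rat_boxes_def by (intro countable_image countable_SIGMA countable_rat_points)

lemma rat_boxes_Int: assumes "A \<in> rat_boxes" "B \<in> rat_boxes" shows "A \<inter> B \<in> rat_boxes"
proof -
  obtain a b c d where ab: "A = box a b" "B = box c d" "a \<in> rat_points" "b \<in> rat_points" "c \<in> rat_points" "d \<in> rat_points"
    using assms by (auto simp: rat_boxes_def)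
  let ?l = "\<Sum>i\<in>Basis. max (a \<bullet> i) (c \<bullet> i) *\<^sub>R i" and ?u = "\<Sum>i\<in>Basis. min (b \<bullet> i) (d \<bullet> i) *\<^sub>R i"
  have "A \<inter> B = box ?l ?u" unfolding ab by (rule box_Int_box)
  moreover have "?l \<in> rat_points" "?u \<in> rat_points" using ab by (auto simp: rat_points_def max_def min_def)
  ultimately show ?thesis by (auto simp: rat_boxes_def)
qed

lemma rat_boxes_basis: "topological_basis rat_boxes"
proof (rule topological_basisI)
  fix A assume "A \<in> rat_boxes" then show "open A" by (auto simp: rat_boxes_def)
next
  fix U :: "R3 set" and x assume "open U" "x \<in> U"
  then obtain e where e: "e > 0" "ball x e \<subseteq> U" by (meson open_contains_ball)
  then obtain a b where "\<forall>i\<in>Basis. a \<bullet> i \<in> \<rat> \<and> b \<bullet> i \<in> \<rat>" "x \<in> box a b" "box a b \<subseteq> ball x e"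
    using rational_boxes[OF e(1)] by blast
  then show "\<exists>B'\<in>rat_boxes. x \<in> B' \<and> B' \<subseteq> U" using e(2)
    by (intro bexI[of _ "box a b"]) (auto simp: rat_boxes_def rat_points_def)
qed

lemma l2fun_indicator: "B \<in> sets borel \<Longrightarrow> emeasure lborel B < \<infinity> \<Longrightarrow> l2fun (indicator B)"
proof -
  assume B: "B \<in> sets borel" "emeasure lborel B < \<infinity>"
  have "(\<lambda>x. (indicator B x)\<^sup>2) = (indicator B :: R3 \<Rightarrow> real)" by (auto simp: indicator_def fun_eq_iff)
  then show ?thesis using B by (simp add: l2fun_def integrable_real_indicator)
qed

lemma l2fun_indicator_box: "l2fun (indicator (box a b))"
  by (intro l2fun_indicator) (auto simp: emeasure_lborel_box_eq)

text \<open>The positive and negative parts are densities of two measures that agree on the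
  intersection-stable rational boxes, hence everywhere.\<close>

lemma l2_eq_0_if_box_integrals_0:
  assumes "\<And>B. B \<in> rat_boxes \<Longrightarrow> inner h (mk (indicator B)) = 0"
  shows "h = 0"
proof -
  let ?f = "fn h"
  let ?p = "\<lambda>x. max 0 (?f x)" and ?m = "\<lambda>x. max 0 (- ?f x)"
  let ?M = "density lborel (\<lambda>x. ennreal (?p x))" and ?N = "density lborel (\<lambda>x. ennreal (?m x))"
  have box: "emeasure ?M B = emeasure ?N B \<and> emeasure ?M B \<noteq> \<infinity>" if B: "B \<in> rat_boxes" for B
  proof -
    obtain a b where ab: "B = box a b" using B by (auto simp: rat_boxes_def)
    have sB: "B \<in> sets borel" unfolding ab by simp
    have l2B: "l2fun (indicator B)" unfolding ab by (rule l2fun_indicator_box)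
    have int: "integrable lborel (\<lambda>x. ?f x * indicator B x)" using l2fun_mult_integrable[OF l2fun_fn l2B] .
    have ip: "integrable lborel (\<lambda>x. ?p x * indicator B x)" and im: "integrable lborel (\<lambda>x. ?m x * indicator B x)"
      by (rule Bochner_Integration.integrable_bound[OF int]; use sB in \<open>auto simp: indicator_def\<close>)+
    have "(LINT x|lborel. ?p x * indicator B x) - (LINT x|lborel. ?m x * indicator B x) = (LINT x|lborel. ?p x * indicator B x - ?m x * indicator B x)"
      using ip im by simp
    also have "\<dots> = (LINT x|lborel. ?f x * indicator B x)" by (intro Bochner_Integration.integral_cong) (auto simp: indicator_def)
    also have "\<dots> = 0" using assms[OF B] inner_mk_right[OF l2B] by simp
    finally have eq: "(LINT x|lborel. ?p x * indicator B x) = (LINT x|lborel. ?m x * indicator B x)" by simp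
    have "emeasure ?M B = (\<integral>\<^sup>+x. ennreal (?p x * indicator B x) \<partial>lborel)"
      using sB by (subst emeasure_density) (auto intro!: nn_integral_cong simp: indicator_def)
    also have "\<dots> = ennreal (LINT x|lborel. ?p x * indicator B x)" by (rule nn_integral_eq_integral[OF ip]) auto
    finally have 1: "emeasure ?M B = ennreal (LINT x|lborel. ?p x * indicator B x)" .
    have "emeasure ?N B = (\<integral>\<^sup>+x. ennreal (?m x * indicator B x) \<partial>lborel)"
      using sB by (subst emeasure_density) (auto intro!: nn_integral_cong simp: indicator_def)
    also have "\<dots> = ennreal (LINT x|lborel. ?m x * indicator B x)" by (rule nn_integral_eq_integral[OF im]) auto
    finally show ?thesis using 1 eq by simp
  qed
  let ?A = "\<lambda>n::nat. box (- (\<Sum>i\<in>Basis. real n *\<^sub>R i)) (\<Sum>i\<in>Basis. real n *\<^sub>R i) :: R3 set"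
  have A: "?A n \<in> rat_boxes" for n
    unfolding rat_boxes_def by (rule image_eqI[of _ _ "(_, _)"]) (auto simp: rat_points_def)
  have UA: "(\<Union>n. ?A n) = UNIV"
  proof -
    have "\<exists>n. x \<in> ?A n" for x :: R3
    proof -
      obtain n :: nat where n: "norm x < real n" using reals_Archimedean2 by blast
      have "\<bar>x \<bullet> i\<bar> < real n" if "i \<in> Basis" for i using Basis_le_norm[OF that, of x] n by linarith
      then show ?thesis by (intro exI[of _ n]) (auto simp: mem_box abs_less_iff minus_less_iff)
    qed
    then show ?thesis by blast
  qed
  have sig: "sets (borel :: R3 measure) = sigma_sets UNIV rat_boxes"
    unfolding borel_eq_countable_basis[OF countable_rat_boxes rat_boxes_basis] by (rule sets_measure_of) simp
  have "?M = ?N"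
  proof (rule measure_eqI_generator_eq[where E = rat_boxes and \<Omega> = UNIV and A = ?A])
    show "Int_stable rat_boxes" by (auto simp: Int_stable_def rat_boxes_Int)
    show "range ?A \<subseteq> rat_boxes" using A by blast
    show "emeasure ?M (?A n) \<noteq> \<infinity>" for n using box[OF A] by blast
  qed (use box sig UA in auto)
  then have "AE x in lborel. ennreal (?p x) = ennreal (?m x)"
    by (intro sigma_finite_measure.density_unique[OF sigma_finite_lborel]) auto
  then have "AE x in lborel. ?f x = fn 0 x"
    using fn_zero
  proof eventually_elim
    case (elim x)
    then have "?p x = ?m x" by (subst (asm) ennreal_inj) auto
    then show ?case using elim by (auto simp: max_def split: if_splits)
  qed
  then show ?thesis by (rule l2_eqI)
qed

text \<open>The total sequence \<open>d\<close> of the abstract theory.\<close>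

definition box_seq :: "nat \<Rightarrow> l2" where "box_seq n = mk (indicator (from_nat_into rat_boxes n))"

lemma total_box_seq: "total_seq box_seq"
  unfolding total_seq_def
proof (intro allI impI)
  fix h assume 0: "\<forall>i. inner h (box_seq i) = 0"
  show "h = 0"
  proof (rule l2_eq_0_if_box_integrals_0)
    fix B assume "B \<in> rat_boxes"
    then obtain i where "from_nat_into rat_boxes i = B" using from_nat_into_surj[OF countable_rat_boxes] by blast
    then show "inner h (mk (indicator B)) = 0" using 0 by (auto simp: box_seq_def)
  qed
qed

section \<open>The Hartley transform on square integrable functions\<close>

text \<open>The Hartley kernel \<open>cas = cos + sin\<close> turns the Fourier transform of real functions into a
  symmetric real involution.\<close>

definition cas :: "real \<Rightarrow> real" where "cas a = cos a + sin a"

lemma cas_bound: "\<bar>cas a\<bar> \<le> 2"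
  unfolding cas_def using abs_cos_le_one[of a] abs_sin_le_one[of a] by linarith

text \<open>The second term is odd in the frequency when \<open>a\<close> and \<open>b\<close> are
  linear in it, so even weights remove it and leave a function of the difference only.\<close>

lemma cas_mult: "cas a * cas b = cos (a - b) + sin (a + b)"
  by (simp add: cas_def cos_diff sin_add algebra_simps)

lemma cas_measurable[measurable]: "cas \<in> borel_measurable borel"
  unfolding cas_def by measurable

lemma cas_inner_measurable: "(\<lambda>p::R3 \<times> R3. cas (fst p \<bullet> snd p)) \<in> borel_measurable borel"
  unfolding cas_def by (intro borel_measurable_continuous_onI continuous_intros)

section \<open>Gaussian integrals and the Gaussian approximate identity\<close>

definition gau :: "R3 \<Rightarrow> real" where "gau x = exp (- ((norm x)\<^sup>2) / 2)"

lemma gau_measurable[measurable]: "gau \<in> borel_measurable borel" unfolding gau_def by measurable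
lemma gau_pos: "0 < gau x" and gau_le_1: "gau x \<le> 1" and gau_minus: "gau (- x) = gau x" by (simp_all add: gau_def)

lemma integral_affine:
  fixes F :: "R3 \<Rightarrow> 'b::{banach, second_countable_topology}"
  assumes [measurable]: "F \<in> borel_measurable borel" and c: "c \<noteq> 0"
  shows "(LINT y|lborel. F y) = \<bar>c\<bar> ^ 3 *\<^sub>R (LINT z|lborel. F (a + c *\<^sub>R z))"
    and "integrable lborel F \<longleftrightarrow> integrable lborel (\<lambda>z. F (a + c *\<^sub>R z))"
proof -
  let ?D = "distr lborel borel (\<lambda>z. a + c *\<^sub>R z)"
  have lb: "(lborel :: R3 measure) = density ?D (\<lambda>_. ennreal (\<bar>c\<bar> ^ 3))"
    using lborel_affine[OF c, of a] by (simp add: ennreal_power)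
  have "(LINT y|lborel. F y) = (LINT y|density ?D (\<lambda>_. ennreal (\<bar>c\<bar> ^ 3)). F y)" using lb by simp
  also have "\<dots> = (LINT y|?D. \<bar>c\<bar> ^ 3 *\<^sub>R F y)" by (rule integral_density) auto
  also have "\<dots> = (LINT z|lborel. \<bar>c\<bar> ^ 3 *\<^sub>R F (a + c *\<^sub>R z))" by (rule integral_distr) auto
  finally show "(LINT y|lborel. F y) = \<bar>c\<bar> ^ 3 *\<^sub>R (LINT z|lborel. F (a + c *\<^sub>R z))" by simp
  have "integrable lborel F \<longleftrightarrow> integrable (density ?D (\<lambda>_. ennreal (\<bar>c\<bar> ^ 3))) F" using lb by simp
  also have "\<dots> \<longleftrightarrow> integrable ?D (\<lambda>y. \<bar>c\<bar> ^ 3 *\<^sub>R F y)" by (rule integrable_density) auto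
  also have "\<dots> \<longleftrightarrow> integrable lborel (\<lambda>z. \<bar>c\<bar> ^ 3 *\<^sub>R F (a + c *\<^sub>R z))" by (rule integrable_distr_eq) auto
  also have "\<dots> \<longleftrightarrow> integrable lborel (\<lambda>z. F (a + c *\<^sub>R z))"
  proof
    assume "integrable lborel (\<lambda>z. \<bar>c\<bar> ^ 3 *\<^sub>R F (a + c *\<^sub>R z))"
    then have "integrable lborel (\<lambda>z. (1 / \<bar>c\<bar> ^ 3) *\<^sub>R (\<bar>c\<bar> ^ 3 *\<^sub>R F (a + c *\<^sub>R z)))" by (rule integrable_scaleR_right)
    moreover have "1 / \<bar>c\<bar> ^ 3 * \<bar>c\<bar> ^ 3 = 1" using c by simp
    ultimately show "integrable lborel (\<lambda>z. F (a + c *\<^sub>R z))" by (simp only: scaleR_scaleR scaleR_one)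
  qed (intro integrable_scaleR_right, simp)
  finally show "integrable lborel F \<longleftrightarrow> integrable lborel (\<lambda>z. F (a + c *\<^sub>R z))" .
qed

lemma integral_reflect:
  fixes F :: "R3 \<Rightarrow> 'b::{banach, second_countable_topology}"
  assumes "F \<in> borel_measurable borel"
  shows "(LINT y|lborel. F (- y)) = (LINT y|lborel. F y)" "integrable lborel (\<lambda>y. F (- y)) \<longleftrightarrow> integrable lborel F"
  using integral_affine[OF assms, of "-1" 0] by simp_all

text \<open>Read off from the characteristic function of the standard normal distribution;
  \<open>gauss_cis\<close> follows by taking products over the coordinates.\<close>

lemma gauss_exp_1D:
  "integrable lborel (\<lambda>s. exp (complex_of_real (- (s\<^sup>2) / 2) + \<i> * complex_of_real (t * s)))"
  "(LINT s|lborel. exp (complex_of_real (- (s\<^sup>2) / 2) + \<i> * complex_of_real (t * s))) = complex_of_real (sqrt (2 * pi) * exp (- (t\<^sup>2) / 2))"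
proof -
  have e: "exp (complex_of_real (- (s\<^sup>2) / 2) + \<i> * complex_of_real (t * s)) = sqrt (2 * pi) *\<^sub>R (std_normal_density s *\<^sub>R iexp (t * s))" for s
    by (simp only: std_normal_density_def exp_add exp_of_real) (simp add: scaleR_conv_of_real)
  have int: "integrable lborel (\<lambda>s. std_normal_density s *\<^sub>R iexp (t * s))"
  proof (rule Bochner_Integration.integrable_bound)
    show "integrable lborel std_normal_density" by simp
    show "AE s in lborel. norm (std_normal_density s *\<^sub>R iexp (t * s)) \<le> norm (std_normal_density s)" by simp
  qed simp
  then show "integrable lborel (\<lambda>s. exp (complex_of_real (- (s\<^sup>2) / 2) + \<i> * complex_of_real (t * s)))"
    unfolding e by (rule integrable_scaleR_right)
  have "(LINT s|lborel. std_normal_density s *\<^sub>R iexp (t * s)) = char std_normal_distribution t"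
    unfolding char_def by (subst integral_density) auto
  then show "(LINT s|lborel. exp (complex_of_real (- (s\<^sup>2) / 2) + \<i> * complex_of_real (t * s))) = complex_of_real (sqrt (2 * pi) * exp (- (t\<^sup>2) / 2))"
    unfolding e by (simp add: char_std_normal_distribution scaleR_conv_of_real)
qed

lemma gauss_cis:
  fixes z :: R3
  shows "integrable lborel (\<lambda>\<xi>. exp (complex_of_real (- ((norm \<xi>)\<^sup>2) / 2) + \<i> * complex_of_real (z \<bullet> \<xi>)))"
    "(LINT \<xi>|lborel. exp (complex_of_real (- ((norm \<xi>)\<^sup>2) / 2) + \<i> * complex_of_real (z \<bullet> \<xi>))) = complex_of_real (sqrt (2 * pi) ^ 3 * gau z)"
proof -
  let ?P = "\<Pi>\<^sub>M b\<in>(Basis :: R3 set). (lborel :: real measure)"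
  let ?g = "\<lambda>i s. exp (complex_of_real (- (s\<^sup>2) / 2) + \<i> * complex_of_real ((z \<bullet> i) * s))"
  let ?F = "\<lambda>\<xi>. exp (complex_of_real (- ((norm \<xi>)\<^sup>2) / 2) + \<i> * complex_of_real (z \<bullet> \<xi>))"
  let ?e = "\<lambda>f. \<Sum>b\<in>Basis. f b *\<^sub>R b :: R3"
  interpret product_sigma_finite "\<lambda>_::R3. lborel :: real measure" by standard
  have nsq: "(norm x)\<^sup>2 = (\<Sum>i\<in>Basis. (x \<bullet> i)\<^sup>2)" for x :: R3
    unfolding power2_norm_eq_inner by (subst euclidean_inner) (simp add: power2_eq_square)
  have F: "?F x = (\<Prod>i\<in>Basis. ?g i (x \<bullet> i))" for x
    unfolding exp_sum[OF finite_Basis, symmetric] nsq euclidean_inner[of z x]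
    by (simp add: sum.distrib sum_subtractf sum_divide_distrib sum_distrib_left sum_negf)
  have F': "?F (?e f) = (\<Prod>i\<in>Basis. ?g i (f i))" for f
    unfolding F by (rule prod.cong) (auto simp: inner_sum_left inner_Basis if_distrib sum.If_cases cong: if_cong)
  have Fm: "?F \<in> borel_measurable borel" by measurable
  have em: "?e \<in> measurable ?P borel" by measurable
  have FE: "(\<lambda>f. ?F (?e f)) = (\<lambda>f. \<Prod>i\<in>Basis. ?g i (f i))" by (rule ext) (rule F')
  have "integrable ?P (\<lambda>f. \<Prod>i\<in>Basis. ?g i (f i))" using product_integrable_prod[OF finite_Basis gauss_exp_1D(1)] .
  then have "integrable ?P (\<lambda>f. ?F (?e f))" by (simp only: FE)
  then have "integrable (distr ?P borel ?e) ?F" by (simp only: integrable_distr_eq[OF em Fm])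
  then show "integrable lborel ?F" by (simp only: lborel_eq[symmetric])
  have "(LINT \<xi>|lborel. ?F \<xi>) = (LINT \<xi>|distr ?P borel ?e. ?F \<xi>)" by (simp only: lborel_eq[symmetric])
  also have "\<dots> = (LINT f|?P. ?F (?e f))" by (rule integral_distr[OF em Fm])
  also have "\<dots> = (LINT f|?P. (\<Prod>i\<in>Basis. ?g i (f i)))" by (simp only: FE)
  also have "\<dots> = (\<Prod>i\<in>Basis. LINT s|lborel. ?g i s)" using product_integral_prod[OF finite_Basis gauss_exp_1D(1)] .
  also have "\<dots> = (\<Prod>i\<in>(Basis::R3 set). complex_of_real (sqrt (2 * pi) * exp (- ((z \<bullet> i)\<^sup>2) / 2)))" by (simp only: gauss_exp_1D)
  also have "\<dots> = complex_of_real (\<Prod>i\<in>(Basis::R3 set). sqrt (2 * pi) * exp (- ((z \<bullet> i)\<^sup>2) / 2))" by simp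
  also have "(\<Prod>i\<in>(Basis::R3 set). sqrt (2 * pi) * exp (- ((z \<bullet> i)\<^sup>2) / 2)) = sqrt (2 * pi) ^ 3 * gau z"
    unfolding prod.distrib exp_sum[OF finite_Basis, symmetric] gau_def nsq by (simp add: sum_divide_distrib sum_negf)
  finally show "(LINT \<xi>|lborel. ?F \<xi>) = complex_of_real (sqrt (2 * pi) ^ 3 * gau z)" .
qed

lemma gau_cos_sin:
  shows gau_integrable: "integrable lborel gau"
    and gau_cos: "(LINT \<xi>|lborel. gau \<xi> * cos (z \<bullet> \<xi>)) = sqrt (2 * pi) ^ 3 * gau z"
    and gau_sin: "(LINT \<xi>|lborel. gau \<xi> * sin (z \<bullet> \<xi>)) = 0"
proof -
  let ?F = "\<lambda>z \<xi>. exp (complex_of_real (- ((norm \<xi>)\<^sup>2) / 2) + \<i> * complex_of_real (z \<bullet> \<xi>))"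
  have re: "Re (?F z \<xi>) = gau \<xi> * cos (z \<bullet> \<xi>)" "Im (?F z \<xi>) = gau \<xi> * sin (z \<bullet> \<xi>)" for z \<xi> :: R3
    by (simp_all add: exp_add Re_exp Im_exp gau_def)
  have "integrable lborel (\<lambda>\<xi>. gau \<xi> * cos (0 \<bullet> \<xi>))" using integrable_Re[OF gauss_cis(1)[of 0]] unfolding re .
  then show "integrable lborel gau" by simp
  have "(LINT \<xi>|lborel. Re (?F z \<xi>)) = Re (LINT \<xi>|lborel. ?F z \<xi>)" using gauss_cis(1) by (rule integral_Re)
  then show "(LINT \<xi>|lborel. gau \<xi> * cos (z \<bullet> \<xi>)) = sqrt (2 * pi) ^ 3 * gau z" unfolding re gauss_cis(2) by simp
  have "(LINT \<xi>|lborel. Im (?F z \<xi>)) = Im (LINT \<xi>|lborel. ?F z \<xi>)" using gauss_cis(1) by (rule integral_Im)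
  then show "(LINT \<xi>|lborel. gau \<xi> * sin (z \<bullet> \<xi>)) = 0" unfolding re gauss_cis(2) by simp
qed

text \<open>The value of \<open>2 * pi\<close> to the power \<open>-3/2\<close>, which makes the
  transform an isometry; its square is the Plancherel factor in the definitions of the norms and
  forms.\<close>

definition c3 :: real where "c3 = 1 / sqrt (2 * pi) ^ 3"

lemma c3_pos: "c3 > 0" by (simp add: c3_def)

text \<open>The Gaussian approximate identity of width \<open>1 / n\<close>, up to constants the
  transform of the weight \<open>gau ((1 / n) *\<^sub>R \<xi>)\<close>.\<close>

definition gam :: "nat \<Rightarrow> R3 \<Rightarrow> real" where "gam n z = c3 * real n ^ 3 * gau (real n *\<^sub>R z)"

lemma gam_measurable[measurable]: "gam n \<in> borel_measurable borel" unfolding gam_def by measurable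
lemma gam_nonneg: "0 \<le> gam n z" using c3_pos gau_pos[of "real n *\<^sub>R z"] by (simp add: gam_def)
lemma gam_minus: "gam n (x - y) = gam n (y - x)" using gau_minus[of "real n *\<^sub>R (x - y)"] by (simp add: gam_def algebra_simps)

lemma gam_substitute:
  assumes [measurable]: "\<phi> \<in> borel_measurable borel" and n: "n > 0"
  shows "(LINT y|lborel. \<phi> y * gam n (x - y)) = (LINT z|lborel. \<phi> (x + (1 / real n) *\<^sub>R z) * (c3 * gau z))"
    and "integrable lborel (\<lambda>y. \<phi> y * gam n (x - y)) \<longleftrightarrow> integrable lborel (\<lambda>z. \<phi> (x + (1 / real n) *\<^sub>R z) * (c3 * gau z))"
proof -
  have g: "gam n (x - (x + (1 / real n) *\<^sub>R z)) = real n ^ 3 * (c3 * gau z)" for z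
    using n gau_minus[of z] by (simp add: gam_def)
  have m: "(\<lambda>y. \<phi> y * gam n (x - y)) \<in> borel_measurable borel" by measurable
  have n1: "1 / real n \<noteq> 0" using n by simp
  have "(LINT y|lborel. \<phi> y * gam n (x - y)) = \<bar>1 / real n\<bar> ^ 3 *\<^sub>R (LINT z|lborel. \<phi> (x + (1 / real n) *\<^sub>R z) * gam n (x - (x + (1 / real n) *\<^sub>R z)))"
    by (rule integral_affine(1)[OF m n1])
  also have "\<dots> = \<bar>1 / real n\<bar> ^ 3 *\<^sub>R (LINT z|lborel. real n ^ 3 * (\<phi> (x + (1 / real n) *\<^sub>R z) * (c3 * gau z)))"
    unfolding g by (simp add: mult_ac)
  also have "\<dots> = (LINT z|lborel. \<phi> (x + (1 / real n) *\<^sub>R z) * (c3 * gau z))" using n by (simp add: power_divide)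
  finally show "(LINT y|lborel. \<phi> y * gam n (x - y)) = (LINT z|lborel. \<phi> (x + (1 / real n) *\<^sub>R z) * (c3 * gau z))" .
  have "integrable lborel (\<lambda>y. \<phi> y * gam n (x - y)) \<longleftrightarrow> integrable lborel (\<lambda>z. \<phi> (x + (1 / real n) *\<^sub>R z) * gam n (x - (x + (1 / real n) *\<^sub>R z)))"
    by (rule integral_affine(2)[OF m n1])
  also have "\<dots> \<longleftrightarrow> integrable lborel (\<lambda>z. real n ^ 3 * (\<phi> (x + (1 / real n) *\<^sub>R z) * (c3 * gau z)))"
    unfolding g by (simp add: mult_ac)
  also have "\<dots> \<longleftrightarrow> integrable lborel (\<lambda>z. \<phi> (x + (1 / real n) *\<^sub>R z) * (c3 * gau z))" using n by simp
  finally show "integrable lborel (\<lambda>y. \<phi> y * gam n (x - y)) \<longleftrightarrow> integrable lborel (\<lambda>z. \<phi> (x + (1 / real n) *\<^sub>R z) * (c3 * gau z))" .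
qed

lemma c3_gau: "integrable lborel (\<lambda>z. c3 * gau z)" "(LINT z|lborel. c3 * gau z) = 1"
proof -
  have "gau 0 = 1" by (simp add: gau_def)
  then show "integrable lborel (\<lambda>z. c3 * gau z)" "(LINT z|lborel. c3 * gau z) = 1"
    using gau_integrable gau_cos[of 0] by (simp_all add: c3_def)
qed

lemma gam_integral: assumes "n > 0" shows "integrable lborel (\<lambda>y. gam n (x - y))" "(LINT y|lborel. gam n (x - y)) = 1"
  using gam_substitute[of "\<lambda>_. 1" n x] assms c3_gau by simp_all

section \<open>The transform of integrable functions\<close>

definition hart :: "(R3 \<Rightarrow> real) \<Rightarrow> R3 \<Rightarrow> real" where
  "hart f \<xi> = c3 * (LINT x|lborel. f x * cas (x \<bullet> \<xi>))"

lemma integrable_mult_bounded: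
  fixes f b :: "'a \<Rightarrow> real"
  assumes "integrable M f" "b \<in> borel_measurable M" "\<And>x. \<bar>b x\<bar> \<le> C"
  shows "integrable M (\<lambda>x. f x * b x)"
proof (rule Bochner_Integration.integrable_bound)
  show "integrable M (\<lambda>x. C * f x)" using assms by simp
  have "0 \<le> C" using assms(3)[of undefined] by linarith
  have "norm (f x * b x) \<le> norm (C * f x)" for x
    using mult_left_mono[OF assms(3)[of x] abs_ge_zero[of "f x"]] \<open>0 \<le> C\<close> by (simp add: abs_mult mult.commute)
  then show "AE x in M. norm (f x * b x) \<le> norm (C * f x)" by simp
qed (use assms in auto)

lemma hart_integrable: "integrable lborel f \<Longrightarrow> integrable lborel (\<lambda>x. f x * cas (x \<bullet> \<xi>))"
  by (rule integrable_mult_bounded[of _ _ _ 2]) (auto intro: cas_bound)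

lemma hart_measurable: assumes [measurable]: "f \<in> borel_measurable borel" shows "hart f \<in> borel_measurable borel"
  unfolding hart_def by measurable

lemma hart_bound:
  assumes "integrable lborel f" shows "\<bar>hart f \<xi>\<bar> \<le> c3 * (LINT x|lborel. 2 * \<bar>f x\<bar>)"
proof -
  have "\<bar>LINT x|lborel. f x * cas (x \<bullet> \<xi>)\<bar> \<le> (LINT x|lborel. \<bar>f x * cas (x \<bullet> \<xi>)\<bar>)" by (rule integral_abs_bound)
  also have "\<dots> \<le> (LINT x|lborel. 2 * \<bar>f x\<bar>)"
  proof (rule integral_mono)
    show "\<bar>f x * cas (x \<bullet> \<xi>)\<bar> \<le> 2 * \<bar>f x\<bar>" for x
      using mult_left_mono[OF cas_bound[of "x \<bullet> \<xi>"] abs_ge_zero[of "f x"]] by (simp add: abs_mult mult.commute)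
  qed (use assms hart_integrable[OF assms] in auto)
  finally show ?thesis using c3_pos by (simp add: hart_def abs_mult)
qed

lemma hart_diff: "integrable lborel f \<Longrightarrow> integrable lborel g \<Longrightarrow> hart (\<lambda>x. f x - g x) \<xi> = hart f \<xi> - hart g \<xi>"
  using hart_integrable[of f \<xi>] hart_integrable[of g \<xi>] by (simp add: hart_def left_diff_distrib right_diff_distrib)

lemma integrable_pair_kernel:
  fixes f g :: "R3 \<Rightarrow> real" and m :: "R3 \<times> R3 \<Rightarrow> real"
  assumes f: "integrable lborel f" and g: "integrable lborel g"
    and [measurable]: "m \<in> borel_measurable borel" and m: "\<And>p. \<bar>m p\<bar> \<le> C"
  shows "integrable (lborel \<Otimes>\<^sub>M lborel) (\<lambda>(x, y). f x * g y * m (x, y))"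
proof -
  have [measurable]: "f \<in> borel_measurable borel" "g \<in> borel_measurable borel" using f g by auto
  have [measurable]: "m \<in> borel_measurable (borel \<Otimes>\<^sub>M borel)" using assms(3) by (simp add: borel_prod)
  have fg: "integrable (lborel \<Otimes>\<^sub>M lborel) (\<lambda>p. f (fst p) * g (snd p))"
    by (rule lborel_pair.Fubini_integrable) (use f g in \<open>auto simp: abs_mult intro!: integrable_mult_left integrable_mult_right integrable_abs\<close>)
  have "integrable (lborel \<Otimes>\<^sub>M lborel) (\<lambda>p. (f (fst p) * g (snd p)) * m p)"
    by (rule integrable_mult_bounded[OF fg _ m]) simp
  then show ?thesis by (simp add: case_prod_unfold)
qed

text \<open>The Gaussian weight makes the integrals absolutely convergent, so Fubini applies twice;
  by \<open>cas_mult\<close> the frequency integral of the weight against two kernels is a Gaussian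
  in \<open>x - y\<close>.\<close>

lemma hart_weighted_sq:
  assumes f: "integrable lborel f" and n: "n > 0"
  shows "integrable lborel (\<lambda>\<xi>. gau ((1 / real n) *\<^sub>R \<xi>) * (hart f \<xi>)\<^sup>2)"
    and "(LINT \<xi>|lborel. gau ((1 / real n) *\<^sub>R \<xi>) * (hart f \<xi>)\<^sup>2) = (LINT x|lborel. f x * (LINT y|lborel. f y * gam n (x - y)))"
proof -
  have [measurable]: "f \<in> borel_measurable borel" using f by auto
  have hm[measurable]: "hart f \<in> borel_measurable borel" by (rule hart_measurable) simp
  let ?w = "\<lambda>\<xi>. gau ((1 / real n) *\<^sub>R \<xi>)"
  let ?B = "c3 * (LINT x|lborel. 2 * \<bar>f x\<bar>)"
  have w: "integrable lborel ?w" using integral_affine(2)[OF gau_measurable, of "1 / real n" 0] gau_integrable n by simp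
  have wh: "integrable lborel (\<lambda>\<xi>. ?w \<xi> * hart f \<xi>)"
    by (rule integrable_mult_bounded[OF w _ hart_bound[OF f]]) simp
  show "integrable lborel (\<lambda>\<xi>. ?w \<xi> * (hart f \<xi>)\<^sup>2)"
    using integrable_mult_bounded[OF wh _ hart_bound[OF f]] by (simp add: power2_eq_square mult.assoc)
  have cm: "(\<lambda>p::R3 \<times> R3. cas (fst p \<bullet> snd p)) \<in> borel_measurable borel" by (rule cas_inner_measurable)
  have K: "(LINT \<xi>|lborel. ?w \<xi> * (cas (x \<bullet> \<xi>) * cas (y \<bullet> \<xi>))) = real n ^ 3 * (sqrt (2 * pi) ^ 3 * gau (real n *\<^sub>R (x - y)))" for x y
  proof -
    have "(LINT \<xi>|lborel. ?w \<xi> * (cas (x \<bullet> \<xi>) * cas (y \<bullet> \<xi>)))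
       = \<bar>real n\<bar> ^ 3 *\<^sub>R (LINT z|lborel. ?w (0 + real n *\<^sub>R z) * (cas (x \<bullet> (0 + real n *\<^sub>R z)) * cas (y \<bullet> (0 + real n *\<^sub>R z))))"
    proof (rule integral_affine(1))
      show "real n \<noteq> 0" using n by simp
    qed measurable
    also have "\<dots> = real n ^ 3 * (LINT z|lborel. gau z * cos ((real n *\<^sub>R (x - y)) \<bullet> z) + gau z * sin ((real n *\<^sub>R (x + y)) \<bullet> z))"
      using n by (simp add: cas_mult distrib_left inner_diff_left inner_add_left right_diff_distrib)
    also have "(LINT z|lborel. gau z * cos ((real n *\<^sub>R (x - y)) \<bullet> z) + gau z * sin ((real n *\<^sub>R (x + y)) \<bullet> z))
       = sqrt (2 * pi) ^ 3 * gau (real n *\<^sub>R (x - y))"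
    proof -
      have "integrable lborel (\<lambda>\<xi>. gau \<xi> * cos (z \<bullet> \<xi>))" "integrable lborel (\<lambda>\<xi>. gau \<xi> * sin (z \<bullet> \<xi>))" for z
        by (rule integrable_mult_bounded[OF gau_integrable, of _ 1]; simp)+
      then show ?thesis by (simp only: Bochner_Integration.integral_add gau_cos gau_sin)
    qed
    finally show ?thesis .
  qed
  have inner_eq: "(LINT \<xi>|lborel. ?w \<xi> * hart f \<xi> * cas (x \<bullet> \<xi>)) * c3 = (LINT y|lborel. f y * gam n (x - y))" for x
  proof -
    have wc: "integrable lborel (\<lambda>\<xi>. ?w \<xi> * cas (x \<bullet> \<xi>))"
      by (rule integrable_mult_bounded[OF w _ cas_bound]) simp
    have I: "integrable (lborel \<Otimes>\<^sub>M lborel) (\<lambda>(y, \<xi>). f y * (?w \<xi> * cas (x \<bullet> \<xi>)) * cas (y \<bullet> \<xi>))"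
      using integrable_pair_kernel[OF f wc cm, of 2] cas_bound by simp
    have "(LINT \<xi>|lborel. ?w \<xi> * hart f \<xi> * cas (x \<bullet> \<xi>)) = (LINT \<xi>|lborel. c3 * (LINT y|lborel. f y * (?w \<xi> * cas (x \<bullet> \<xi>)) * cas (y \<bullet> \<xi>)))"
      by (simp add: hart_def mult_ac flip: integral_mult_right_zero)
    also have "\<dots> = c3 * (LINT \<xi>|lborel. (LINT y|lborel. f y * (?w \<xi> * cas (x \<bullet> \<xi>)) * cas (y \<bullet> \<xi>)))" by simp
    also have "(LINT \<xi>|lborel. (LINT y|lborel. f y * (?w \<xi> * cas (x \<bullet> \<xi>)) * cas (y \<bullet> \<xi>)))
       = (LINT y|lborel. (LINT \<xi>|lborel. f y * (?w \<xi> * cas (x \<bullet> \<xi>)) * cas (y \<bullet> \<xi>)))"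
      by (rule lborel_pair.Fubini_integral[OF I])
    also have "\<dots> = (LINT y|lborel. f y * (real n ^ 3 * (sqrt (2 * pi) ^ 3 * gau (real n *\<^sub>R (x - y)))))"
      unfolding K[symmetric] by (simp add: mult_ac flip: integral_mult_right_zero)
    finally have "(LINT \<xi>|lborel. ?w \<xi> * hart f \<xi> * cas (x \<bullet> \<xi>)) * c3 = (LINT y|lborel. c3 * c3 * (f y * (real n ^ 3 * (sqrt (2 * pi) ^ 3 * gau (real n *\<^sub>R (x - y))))))"
      by simp
    also have "\<dots> = (LINT y|lborel. f y * gam n (x - y))"
    proof (rule Bochner_Integration.integral_cong[OF refl])
      fix y
      have "c3 * sqrt (2 * pi) ^ 3 = 1" by (simp add: c3_def)
      then have "c3 * c3 * (f y * (real n ^ 3 * (sqrt (2 * pi) ^ 3 * X))) = f y * (c3 * real n ^ 3 * X)" for X by algebra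
      then show "c3 * c3 * (f y * (real n ^ 3 * (sqrt (2 * pi) ^ 3 * gau (real n *\<^sub>R (x - y))))) = f y * gam n (x - y)"
        by (simp add: gam_def)
    qed
    finally show ?thesis .
  qed
  have I: "integrable (lborel \<Otimes>\<^sub>M lborel) (\<lambda>(x, \<xi>). f x * (?w \<xi> * hart f \<xi>) * cas (x \<bullet> \<xi>))"
    using integrable_pair_kernel[OF f wh cm, of 2] cas_bound by simp
  have "(LINT \<xi>|lborel. ?w \<xi> * (hart f \<xi>)\<^sup>2) = (LINT \<xi>|lborel. c3 * (LINT x|lborel. f x * (?w \<xi> * hart f \<xi>) * cas (x \<bullet> \<xi>)))"
  proof (rule Bochner_Integration.integral_cong[OF refl])
    fix \<xi>
    have "(LINT x|lborel. f x * (?w \<xi> * hart f \<xi>) * cas (x \<bullet> \<xi>)) = (?w \<xi> * hart f \<xi>) * (LINT x|lborel. f x * cas (x \<bullet> \<xi>))"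
      by (simp add: mult_ac flip: integral_mult_right_zero)
    then show "?w \<xi> * (hart f \<xi>)\<^sup>2 = c3 * (LINT x|lborel. f x * (?w \<xi> * hart f \<xi>) * cas (x \<bullet> \<xi>))"
      by (simp add: hart_def power2_eq_square)
  qed
  also have "\<dots> = c3 * (LINT \<xi>|lborel. (LINT x|lborel. f x * (?w \<xi> * hart f \<xi>) * cas (x \<bullet> \<xi>)))" by simp
  also have "(LINT \<xi>|lborel. (LINT x|lborel. f x * (?w \<xi> * hart f \<xi>) * cas (x \<bullet> \<xi>)))
     = (LINT x|lborel. (LINT \<xi>|lborel. f x * (?w \<xi> * hart f \<xi>) * cas (x \<bullet> \<xi>)))"
    by (rule lborel_pair.Fubini_integral[OF I])
  also have "c3 * \<dots> = (LINT x|lborel. f x * ((LINT \<xi>|lborel. ?w \<xi> * hart f \<xi> * cas (x \<bullet> \<xi>)) * c3))"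
    by (simp add: mult_ac flip: integral_mult_right_zero)
  also have "\<dots> = (LINT x|lborel. f x * (LINT y|lborel. f y * gam n (x - y)))" unfolding inner_eq ..
  finally show "(LINT \<xi>|lborel. ?w \<xi> * (hart f \<xi>)\<^sup>2) = (LINT x|lborel. f x * (LINT y|lborel. f y * gam n (x - y)))" .
qed

text \<open>Schur's test for the kernel \<open>gam n (x - y)\<close>.\<close>
lemma gam_form_le:
  assumes f: "l2fun f" and n: "n > 0"
  shows "(LINT x|lborel. f x * (LINT y|lborel. f y * gam n (x - y))) \<le> (LINT x|lborel. (f x)\<^sup>2)"
proof -
  have [measurable]: "f \<in> borel_measurable borel" using f by simp
  have f2: "integrable lborel (\<lambda>x. (f x)\<^sup>2)" using f by (rule l2fun_integrable_sq)
  let ?L = "lborel \<Otimes>\<^sub>M lborel :: (R3 \<times> R3) measure"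
  have A: "integrable ?L (\<lambda>(x, y). (f x)\<^sup>2 * gam n (x - y))"
    by (rule lborel_pair.Fubini_integrable)
      (use f2 gam_integral[OF n] in \<open>auto simp: abs_mult gam_nonneg abs_of_nonneg intro!: integrable_mult_right\<close>)
  have A': "(LINT p|?L. (case p of (x, y) \<Rightarrow> (f x)\<^sup>2 * gam n (x - y))) = (LINT x|lborel. (f x)\<^sup>2)"
    using lborel_pair.integral_fst[OF A] by (simp add: gam_integral[OF n])
  have B: "integrable ?L (\<lambda>(x, y). (f y)\<^sup>2 * gam n (x - y))"
    using lborel_pair.integrable_product_swap[OF A] gam_minus by (simp add: case_prod_beta)
  have B': "(LINT p|?L. (case p of (x, y) \<Rightarrow> (f y)\<^sup>2 * gam n (x - y))) = (LINT x|lborel. (f x)\<^sup>2)"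
    using lborel_pair.integral_snd[OF B] gam_minus[of n] by (simp add: gam_integral[OF n])
  let ?P = "\<lambda>p. (1/2) * ((case p of (x, y) \<Rightarrow> (f x)\<^sup>2 * gam n (x - y)) + (case p of (x, y) \<Rightarrow> (f y)\<^sup>2 * gam n (x - y)))"
  have P: "integrable ?L ?P" using A B by simp
  have dom: "\<bar>f x * f y * gam n (x - y)\<bar> \<le> ?P (x, y)" for x y
  proof -
    have "\<bar>f x * f y\<bar> \<le> (1/2) * ((f x)\<^sup>2 + (f y)\<^sup>2)"
      using zero_le_power2[of "\<bar>f x\<bar> - \<bar>f y\<bar>"] by (simp add: power2_eq_square abs_mult algebra_simps)
    then have "\<bar>f x * f y\<bar> * gam n (x - y) \<le> (1/2) * ((f x)\<^sup>2 + (f y)\<^sup>2) * gam n (x - y)"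
      by (intro mult_right_mono gam_nonneg)
    then show ?thesis using gam_nonneg[of n "x - y"] by (simp add: abs_mult algebra_simps)
  qed
  have Q: "integrable ?L (\<lambda>(x, y). f x * f y * gam n (x - y))"
  proof (rule Bochner_Integration.integrable_bound[OF P])
    show "AE p in ?L. norm (case p of (x, y) \<Rightarrow> f x * f y * gam n (x - y)) \<le> norm (?P p)"
    proof (rule AE_I2)
      fix p :: "R3 \<times> R3" show "norm (case p of (x, y) \<Rightarrow> f x * f y * gam n (x - y)) \<le> norm (?P p)"
        using order_trans[OF dom[of "fst p" "snd p"] abs_ge_self] by (simp add: case_prod_beta)
    qed
  qed measurable
  have "(LINT x|lborel. f x * (LINT y|lborel. f y * gam n (x - y))) = (LINT p|?L. (case p of (x, y) \<Rightarrow> f x * f y * gam n (x - y)))"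
    using lborel_pair.integral_fst[OF Q] by (simp add: mult.assoc)
  also have "\<dots> \<le> (LINT p|?L. ?P p)"
  proof (rule integral_mono[OF Q P])
    fix p :: "R3 \<times> R3" show "(case p of (x, y) \<Rightarrow> f x * f y * gam n (x - y)) \<le> ?P p"
      using order_trans[OF abs_ge_self dom[of "fst p" "snd p"]] by (simp add: case_prod_beta)
  qed
  also have "\<dots> = (LINT x|lborel. (f x)\<^sup>2)" using A B A' B' by simp
  finally show ?thesis .
qed

lemma gau_scaled_tendsto: "(\<lambda>n. gau ((1 / real n) *\<^sub>R \<xi>)) \<longlonglongrightarrow> 1"
proof -
  have "(\<lambda>n. exp (- ((1 / real n)\<^sup>2 * (norm \<xi>)\<^sup>2) / 2)) \<longlonglongrightarrow> exp (- (0\<^sup>2 * (norm \<xi>)\<^sup>2) / 2)"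
    by (intro tendsto_intros lim_1_over_n) simp
  then show ?thesis by (simp add: gau_def power_mult_distrib power_divide)
qed

text \<open>Combines \<open>hart_weighted_sq\<close> and Schur's test, uniformly in the width, with
  Fatou's lemma. Only the inequality comes out at this stage; equality is first shown for boxes, in
  \<open>HT_norm_box\<close>.\<close>

lemma hart_contraction:
  assumes f: "l2fun f" "integrable lborel f"
  shows "l2fun (hart f)" "norm (mk (hart f)) \<le> norm (mk f)"
proof -
  have [measurable]: "hart f \<in> borel_measurable borel" using f by (intro hart_measurable) simp
  let ?I = "LINT x|lborel. (f x)\<^sup>2"
  let ?w = "\<lambda>n \<xi>. gau ((1 / real (Suc n)) *\<^sub>R \<xi>)"
  have le: "(\<integral>\<^sup>+\<xi>. ennreal (?w n \<xi> * (hart f \<xi>)\<^sup>2) \<partial>lborel) \<le> ennreal ?I" for n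
  proof -
    have "(\<integral>\<^sup>+\<xi>. ennreal (?w n \<xi> * (hart f \<xi>)\<^sup>2) \<partial>lborel) = ennreal (LINT \<xi>|lborel. ?w n \<xi> * (hart f \<xi>)\<^sup>2)"
      by (rule nn_integral_eq_integral[OF hart_weighted_sq(1)[OF f(2)]])
        (simp, intro AE_I2 mult_nonneg_nonneg less_imp_le[OF gau_pos] zero_le_power2)
    also have "\<dots> \<le> ennreal ?I"
      using hart_weighted_sq(2)[OF f(2), of "Suc n"] gam_form_le[OF f(1), of "Suc n"] by (intro ennreal_leI) simp
    finally show ?thesis .
  qed
  have "(\<integral>\<^sup>+\<xi>. ennreal ((hart f \<xi>)\<^sup>2) \<partial>lborel) = (\<integral>\<^sup>+\<xi>. liminf (\<lambda>n. ennreal (?w n \<xi> * (hart f \<xi>)\<^sup>2)) \<partial>lborel)"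
  proof (rule nn_integral_cong)
    fix \<xi>
    have "(\<lambda>n. ennreal (?w n \<xi> * (hart f \<xi>)\<^sup>2)) \<longlonglongrightarrow> ennreal (1 * (hart f \<xi>)\<^sup>2)"
      by (intro tendsto_ennrealI tendsto_mult tendsto_const LIMSEQ_Suc[OF gau_scaled_tendsto])
    from lim_imp_Liminf[OF sequentially_bot this]
    show "ennreal ((hart f \<xi>)\<^sup>2) = liminf (\<lambda>n. ennreal (?w n \<xi> * (hart f \<xi>)\<^sup>2))" by simp
  qed
  also have "\<dots> \<le> liminf (\<lambda>n. \<integral>\<^sup>+\<xi>. ennreal (?w n \<xi> * (hart f \<xi>)\<^sup>2) \<partial>lborel)" by (rule nn_integral_liminf) simp
  also have "\<dots> \<le> ennreal ?I" by (rule Liminf_le) (use le in auto)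
  finally have fin: "(\<integral>\<^sup>+\<xi>. ennreal ((hart f \<xi>)\<^sup>2) \<partial>lborel) \<le> ennreal ?I" .
  then have "integrable lborel (\<lambda>\<xi>. (hart f \<xi>)\<^sup>2)"
    by (intro integrableI_nonneg) (auto intro: order_le_less_trans)
  then show l2: "l2fun (hart f)" by (simp add: l2fun_def)
  have "ennreal (LINT \<xi>|lborel. (hart f \<xi>)\<^sup>2) = (\<integral>\<^sup>+\<xi>. ennreal ((hart f \<xi>)\<^sup>2) \<partial>lborel)"
    by (rule nn_integral_eq_integral[symmetric]) (use l2 in \<open>auto simp: l2fun_def\<close>)
  then have "ennreal ((norm (mk (hart f)))\<^sup>2) \<le> ennreal ((norm (mk f))\<^sup>2)" using fin l2 f by (simp only: norm_sq_mk)
  then have "(norm (mk (hart f)))\<^sup>2 \<le> (norm (mk f))\<^sup>2" by (subst (asm) ennreal_le_iff) simp_all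
  then show "norm (mk (hart f)) \<le> norm (mk f)" by (rule power2_le_imp_le) simp
qed

text \<open>The truncation used in \<open>is_fourier\<close>, so that both transforms are limits
  over the same sequence.\<close>

definition cut :: "nat \<Rightarrow> (R3 \<Rightarrow> real) \<Rightarrow> R3 \<Rightarrow> real" where
  "cut n f x = indicator (ball 0 (real n)) x * f x"

lemma l2fun_cut: "l2fun f \<Longrightarrow> l2fun (cut n f)"
  by (rule l2fun_dominated[of f _ 1]) (auto simp: cut_def[abs_def] indicator_def)

lemma integrable_cut: assumes "l2fun f" shows "integrable lborel (cut n f)"
proof -
  have "emeasure lborel (ball (0::R3) (real n)) < \<infinity>"
    using emeasure_bounded_finite[of "ball (0::R3) (real n)"] by simp
  then have "l2fun (indicator (ball 0 (real n)))" by (intro l2fun_indicator) auto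
  then show ?thesis unfolding cut_def[abs_def] using assms by (rule l2fun_mult_integrable)
qed

lemma cut_tendsto: "(\<lambda>n. mk (cut n (fn h))) \<longlonglongrightarrow> h"
proof -
  have d: "l2fun (\<lambda>x. cut n (fn h) x - fn h x)" for n by (intro l2fun_diff l2fun_cut l2fun_fn)
  have "(\<lambda>n. LINT x|lborel. (cut n (fn h) x - fn h x)\<^sup>2) \<longlonglongrightarrow> (LINT x|(lborel :: R3 measure). (0::real))"
  proof (rule integral_dominated_convergence[where f = "\<lambda>_. 0" and w = "\<lambda>x. (fn h x)\<^sup>2"])
    show "integrable lborel (\<lambda>x. (fn h x)\<^sup>2)" by (simp add: l2fun_integrable_sq)
    show "AE x in lborel. (\<lambda>n. (cut n (fn h) x - fn h x)\<^sup>2) \<longlonglongrightarrow> 0"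
    proof (rule AE_I2, rule tendsto_eventually)
      fix x :: R3
      obtain N :: nat where N: "norm x < real N" using reals_Archimedean2 by blast
      show "\<forall>\<^sub>F n in sequentially. (cut n (fn h) x - fn h x)\<^sup>2 = 0"
        unfolding eventually_sequentially by (rule exI[of _ N]) (use N in \<open>auto simp: cut_def indicator_def\<close>)
    qed
    show "AE x in lborel. norm ((cut n (fn h) x - fn h x)\<^sup>2) \<le> (fn h x)\<^sup>2" for n
      by (rule AE_I2) (auto simp: cut_def indicator_def)
    show "(\<lambda>x. (cut n (fn h) x - fn h x)\<^sup>2) \<in> borel_measurable lborel" for n using l2fun_measurable[OF d[of n]] by simp
  qed simp
  then have "(\<lambda>n. (norm (mk (cut n (fn h)) - h))\<^sup>2) \<longlonglongrightarrow> 0"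
    using norm_sq_mk[OF d] mk_diff[OF l2fun_cut l2fun_fn, of "fn h"] by simp
  then have "(\<lambda>n. sqrt ((norm (mk (cut n (fn h)) - h))\<^sup>2)) \<longlonglongrightarrow> sqrt 0" by (rule tendsto_real_sqrt)
  then have "(\<lambda>n. mk (cut n (fn h)) - h) \<longlonglongrightarrow> 0" by (simp add: tendsto_norm_zero_iff)
  then show ?thesis by (rule LIM_zero_cancel)
qed

section \<open>Extension of the transform to all of L2 and its inversion\<close>

definition HT :: "l2 \<Rightarrow> l2" where "HT h = lim (\<lambda>n. mk (hart (cut n (fn h))))"

lemma hart_mk_diff:
  assumes "l2fun f" "integrable lborel f" "l2fun g" "integrable lborel g"
  shows "norm (mk (hart f) - mk (hart g)) \<le> norm (mk f - mk g)"
proof -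
  have "mk (hart f) - mk (hart g) = mk (hart (\<lambda>x. f x - g x))"
  proof -
    have e: "hart (\<lambda>x. f x - g x) = (\<lambda>\<xi>. hart f \<xi> - hart g \<xi>)" by (rule ext) (rule hart_diff[OF assms(2,4)])
    show ?thesis unfolding e by (rule mk_diff[symmetric, OF hart_contraction(1)[OF assms(1,2)] hart_contraction(1)[OF assms(3,4)]])
  qed
  moreover have "norm (mk (hart (\<lambda>x. f x - g x))) \<le> norm (mk (\<lambda>x. f x - g x))"
    by (intro hart_contraction l2fun_diff Bochner_Integration.integrable_diff assms)
  ultimately show ?thesis using assms by (simp add: mk_diff)
qed

lemma HT_cut_tendsto: "(\<lambda>n. mk (hart (cut n (fn h)))) \<longlonglongrightarrow> HT h"
proof -
  have "Cauchy (\<lambda>n. mk (hart (cut n (fn h))))"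
  proof (rule metric_CauchyI)
    fix e :: real assume "e > 0"
    then obtain M where M: "\<And>m n. m \<ge> M \<Longrightarrow> n \<ge> M \<Longrightarrow> dist (mk (cut m (fn h))) (mk (cut n (fn h))) < e"
      using LIMSEQ_imp_Cauchy[OF cut_tendsto[of h]] unfolding Cauchy_def by blast
    have "dist (mk (hart (cut m (fn h)))) (mk (hart (cut n (fn h)))) < e" if "m \<ge> M" "n \<ge> M" for m n
      using hart_mk_diff[of "cut m (fn h)" "cut n (fn h)"] M[OF that] by (simp add: l2fun_cut integrable_cut dist_norm)
    then show "\<exists>M. \<forall>m\<ge>M. \<forall>n\<ge>M. dist (mk (hart (cut m (fn h)))) (mk (hart (cut n (fn h)))) < e" by blast
  qed
  then show ?thesis unfolding HT_def by (simp add: Cauchy_convergent_iff convergent_LIMSEQ_iff)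
qed

lemma HT_mk: assumes f: "l2fun f" "integrable lborel f" shows "HT (mk f) = mk (hart f)"
proof -
  have "(\<lambda>n. mk (hart (cut n (fn (mk f)))) - mk (hart f)) \<longlonglongrightarrow> 0"
  proof (rule Lim_null_comparison)
    show "\<forall>\<^sub>F n in sequentially. norm (mk (hart (cut n (fn (mk f)))) - mk (hart f)) \<le> norm (mk (cut n (fn (mk f))) - mk f)"
      by (intro always_eventually allI hart_mk_diff) (simp_all add: l2fun_cut integrable_cut f)
    show "(\<lambda>n. norm (mk (cut n (fn (mk f))) - mk f)) \<longlonglongrightarrow> 0"
      using cut_tendsto[of "mk f"] by (intro tendsto_norm_zero) (simp add: LIM_zero)
  qed
  then have "(\<lambda>n. mk (hart (cut n (fn (mk f))))) \<longlonglongrightarrow> mk (hart f)" by (rule LIM_zero_cancel)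
  then show ?thesis using HT_cut_tendsto LIMSEQ_unique by blast
qed

lemma HT_norm_le: "norm (HT h) \<le> norm h"
proof (rule LIMSEQ_le)
  show "(\<lambda>n. norm (mk (hart (cut n (fn h))))) \<longlonglongrightarrow> norm (HT h)" by (intro tendsto_norm HT_cut_tendsto)
  show "(\<lambda>n. norm (mk (cut n (fn h)))) \<longlonglongrightarrow> norm h" by (intro tendsto_norm cut_tendsto)
  show "\<exists>N. \<forall>n\<ge>N. norm (mk (hart (cut n (fn h)))) \<le> norm (mk (cut n (fn h)))"
    by (auto intro!: hart_contraction l2fun_cut integrable_cut)
qed

lemma HT_sym: "inner (HT f) g = inner f (HT g)"
proof -
  have eq: "inner (mk (hart a)) (mk b) = inner (mk a) (mk (hart b))"
    if a: "l2fun a" "integrable lborel a" and b: "l2fun b" "integrable lborel b" for a b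
  proof -
    have cm: "(\<lambda>p::R3 \<times> R3. cas (fst p \<bullet> snd p)) \<in> borel_measurable borel" by (rule cas_inner_measurable)
    have I: "integrable (lborel \<Otimes>\<^sub>M lborel) (\<lambda>(x, \<xi>). a x * b \<xi> * cas (x \<bullet> \<xi>))"
      using integrable_pair_kernel[OF a(2) b(2) cm, of 2] cas_bound by simp
    have "inner (mk (hart a)) (mk b) = (LINT \<xi>|lborel. hart a \<xi> * b \<xi>)"
      by (intro inner_mk_mk hart_contraction a b)
    also have "\<dots> = (LINT \<xi>|lborel. c3 * (LINT x|lborel. a x * b \<xi> * cas (x \<bullet> \<xi>)))"
      by (simp add: hart_def mult_ac flip: integral_mult_right_zero)
    also have "\<dots> = c3 * (LINT \<xi>|lborel. (LINT x|lborel. a x * b \<xi> * cas (x \<bullet> \<xi>)))" by simp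
    also have "(LINT \<xi>|lborel. (LINT x|lborel. a x * b \<xi> * cas (x \<bullet> \<xi>))) = (LINT x|lborel. (LINT \<xi>|lborel. a x * b \<xi> * cas (x \<bullet> \<xi>)))"
      by (rule lborel_pair.Fubini_integral[OF I])
    also have "c3 * \<dots> = (LINT x|lborel. a x * hart b x)"
      by (simp add: hart_def inner_commute mult_ac flip: integral_mult_right_zero)
    also have "\<dots> = inner (mk a) (mk (hart b))" by (intro inner_mk_mk[symmetric] hart_contraction a b)
    finally show ?thesis .
  qed
  have "(\<lambda>n. inner (mk (hart (cut n (fn f)))) (mk (cut n (fn g)))) \<longlonglongrightarrow> inner (HT f) g"
    by (intro tendsto_inner HT_cut_tendsto cut_tendsto)
  moreover have "(\<lambda>n. inner (mk (cut n (fn f))) (mk (hart (cut n (fn g))))) \<longlonglongrightarrow> inner f (HT g)"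
    by (intro tendsto_inner HT_cut_tendsto cut_tendsto)
  moreover have "inner (mk (hart (cut n (fn f)))) (mk (cut n (fn g))) = inner (mk (cut n (fn f))) (mk (hart (cut n (fn g))))" for n
    by (intro eq l2fun_cut integrable_cut l2fun_fn)
  ultimately show ?thesis using LIMSEQ_unique by simp
qed

lemma HT_add: "HT (f + g) = HT f + HT g" and HT_scaleR: "HT (r *\<^sub>R f) = r *\<^sub>R HT f"
proof -
  have "inner (HT (f + g) - (HT f + HT g)) x = 0" for x
    by (simp add: inner_diff_left inner_add_left HT_sym)
  from this[of "HT (f + g) - (HT f + HT g)"] show "HT (f + g) = HT f + HT g" by simp
  have "inner (HT (r *\<^sub>R f) - r *\<^sub>R HT f) x = 0" for x
    by (simp add: inner_diff_left HT_sym)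
  from this[of "HT (r *\<^sub>R f) - r *\<^sub>R HT f"] show "HT (r *\<^sub>R f) = r *\<^sub>R HT f" by simp
qed

lemma HT_bounded_linear: "bounded_linear HT"
  by (rule bounded_linear_intro[where K = 1]) (simp_all add: HT_add HT_scaleR HT_norm_le)

text \<open>For an indicator the Gaussian averages tend to 1 inside the box, so the regularised
  square integrals of the transform tend to the volume while staying below the full one.\<close>

lemma HT_norm_box: "norm (HT (mk (indicator (box a b)))) = norm (mk (indicator (box a b)))"
proof (rule antisym[OF HT_norm_le])
  let ?B = "box a b :: R3 set"
  let ?f = "indicator ?B :: R3 \<Rightarrow> real"
  have f: "l2fun ?f" by (rule l2fun_indicator_box)
  have fi: "integrable lborel ?f" by (intro integrable_real_indicator) (auto simp: emeasure_lborel_box_eq)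
  have h2: "l2fun (hart ?f)" by (intro hart_contraction f fi)
  let ?i = "\<lambda>n x. LINT y|lborel. ?f y * gam (Suc n) (x - y)"
  have i_eq: "?i n x = (LINT z|lborel. ?f (x + (1 / real (Suc n)) *\<^sub>R z) * (c3 * gau z))" for n x
    by (rule gam_substitute) auto
  have i_lim: "(\<lambda>n. ?i n x) \<longlonglongrightarrow> 1" if x: "x \<in> ?B" for x
  proof -
    have "(\<lambda>n. LINT z|lborel. ?f (x + (1 / real (Suc n)) *\<^sub>R z) * (c3 * gau z)) \<longlonglongrightarrow> (LINT z|lborel. c3 * gau z)"
    proof (rule integral_dominated_convergence[where w = "\<lambda>z. c3 * gau z"])
      show "AE z in lborel. (\<lambda>n. ?f (x + (1 / real (Suc n)) *\<^sub>R z) * (c3 * gau z)) \<longlonglongrightarrow> c3 * gau z"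
      proof (rule AE_I2, rule tendsto_eventually)
        fix z :: R3
        have "(\<lambda>n. x + (1 / real (Suc n)) *\<^sub>R z) \<longlonglongrightarrow> x + 0 *\<^sub>R z" by (intro tendsto_intros LIMSEQ_Suc[OF lim_1_over_n])
        then have "\<forall>\<^sub>F n in sequentially. x + (1 / real (Suc n)) *\<^sub>R z \<in> ?B"
          using topological_tendstoD[OF _ open_box, of _ "x + 0 *\<^sub>R z"] x by simp
        then show "\<forall>\<^sub>F n in sequentially. ?f (x + (1 / real (Suc n)) *\<^sub>R z) * (c3 * gau z) = c3 * gau z"
          by eventually_elim simp
      qed
      show "AE z in lborel. norm (?f (x + (1 / real (Suc n)) *\<^sub>R z) * (c3 * gau z)) \<le> c3 * gau z" for n
        using c3_pos gau_pos by (intro AE_I2) (auto simp: indicator_def less_imp_le)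
    qed (use c3_gau in auto)
    then show ?thesis unfolding i_eq c3_gau(2) .
  qed
  have i_bound: "\<bar>?i n x\<bar> \<le> 1" for n x
  proof -
    have "\<bar>?i n x\<bar> \<le> (LINT y|lborel. \<bar>?f y * gam (Suc n) (x - y)\<bar>)" by (rule integral_abs_bound)
    also have "\<dots> \<le> (LINT y|lborel. gam (Suc n) (x - y))"
    proof (rule integral_mono)
      have "integrable lborel (\<lambda>y. gam (Suc n) (x - y) * ?f y)"
        by (rule integrable_mult_bounded[where C = 1, OF gam_integral(1)]) (auto simp: indicator_def)
      then show "integrable lborel (\<lambda>y. \<bar>?f y * gam (Suc n) (x - y)\<bar>)" by (simp add: mult.commute)
      show "\<bar>?f y * gam (Suc n) (x - y)\<bar> \<le> gam (Suc n) (x - y)" for y using gam_nonneg by (auto simp: indicator_def)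
    qed (simp add: gam_integral)
    also have "\<dots> = 1" by (simp add: gam_integral)
    finally show ?thesis .
  qed
  have "(\<lambda>n. LINT x|lborel. ?f x * ?i n x) \<longlonglongrightarrow> (LINT x|lborel. ?f x)"
  proof (rule integral_dominated_convergence[where w = ?f])
    show "AE x in lborel. (\<lambda>n. ?f x * ?i n x) \<longlonglongrightarrow> ?f x"
    proof (rule AE_I2)
      fix x show "(\<lambda>n. ?f x * ?i n x) \<longlonglongrightarrow> ?f x"
        using i_lim[of x] by (cases "x \<in> ?B") auto
    qed
    show "AE x in lborel. norm (?f x * ?i n x) \<le> ?f x" for n
      using i_bound by (intro AE_I2) (auto simp: indicator_def)
  qed (use fi in auto)
  moreover have "(LINT x|lborel. ?f x * ?i n x) \<le> (LINT \<xi>|lborel. (hart ?f \<xi>)\<^sup>2)" for n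
  proof -
    have "(LINT x|lborel. ?f x * ?i n x) = (LINT \<xi>|lborel. gau ((1 / real (Suc n)) *\<^sub>R \<xi>) * (hart ?f \<xi>)\<^sup>2)"
      by (rule hart_weighted_sq(2)[OF fi, symmetric]) simp
    also have "\<dots> \<le> (LINT \<xi>|lborel. (hart ?f \<xi>)\<^sup>2)"
    proof (rule integral_mono)
      show "gau ((1 / real (Suc n)) *\<^sub>R \<xi>) * (hart ?f \<xi>)\<^sup>2 \<le> (hart ?f \<xi>)\<^sup>2" for \<xi>
        by (intro mult_left_le_one_le less_imp_le[OF gau_pos] gau_le_1 zero_le_power2)
    qed (use hart_weighted_sq(1)[OF fi, of "Suc n"] h2 in \<open>simp_all add: l2fun_def\<close>)
    finally show ?thesis .
  qed
  ultimately have "(LINT x|lborel. ?f x) \<le> (LINT \<xi>|lborel. (hart ?f \<xi>)\<^sup>2)" by (intro LIMSEQ_le_const2) auto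
  moreover have "(LINT x|lborel. (?f x)\<^sup>2) = (LINT x|lborel. ?f x)"
    by (rule Bochner_Integration.integral_cong) (auto simp: indicator_def)
  ultimately have "(norm (mk ?f))\<^sup>2 \<le> (norm (HT (mk ?f)))\<^sup>2" by (simp add: HT_mk f fi norm_sq_mk h2)
  then show "norm (mk ?f) \<le> norm (HT (mk ?f))" by (rule power2_le_imp_le) simp
qed

text \<open>A symmetric contraction \<open>T\<close> with \<open>norm (T g) = norm g\<close>
  satisfies \<open>T (T g) = g\<close>, by expanding the square of \<open>T (T g) - g\<close>. This
  applies to boxes, and symmetry carries it over to \<open>h\<close> because boxes are
  total.\<close>

theorem HT_HT: "HT (HT h) = h"
proof -
  have fix_box: "HT (HT g) = g" if "norm (HT g) = norm g" for g
  proof -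
    have "norm (HT (HT g)) \<le> norm g" using HT_norm_le[of "HT g"] HT_norm_le[of g] by linarith
    then have "(norm (HT (HT g)))\<^sup>2 \<le> (norm g)\<^sup>2" by (intro power_mono) auto
    moreover have "inner (HT (HT g)) g = (norm g)\<^sup>2" using that by (simp add: HT_sym[of "HT g"] dot_square_norm)
    ultimately have "inner (HT (HT g) - g) (HT (HT g) - g) \<le> 0"
      by (simp add: inner_diff inner_commute power2_norm_eq_inner)
    then show ?thesis by (metis eq_iff_diff_eq_0 inner_ge_zero inner_eq_zero_iff order_antisym)
  qed
  have "HT (HT h) - h = 0"
  proof (rule l2_eq_0_if_box_integrals_0)
    fix B assume "B \<in> rat_boxes"
    then obtain a b where B: "B = box a b" by (auto simp: rat_boxes_def)
    have "inner (HT (HT h)) (mk (indicator B)) = inner h (HT (HT (mk (indicator B))))" by (simp add: HT_sym)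
    also have "\<dots> = inner h (mk (indicator B))" unfolding B by (simp add: fix_box HT_norm_box)
    finally show "inner (HT (HT h) - h) (mk (indicator B)) = 0" by (simp add: inner_diff_left)
  qed
  then show ?thesis by simp
qed

lemma inner_HT_HT: "inner (HT f) (HT g) = inner f g" by (simp add: HT_sym HT_HT)

lemma norm_HT: "norm (HT f) = norm f" by (simp add: norm_eq_sqrt_inner inner_HT_HT)

section \<open>Fourier transform, Sobolev and Bessel spaces in terms of the Hartley transform\<close>

lemma lebesgue_integral_eq:
  fixes F G :: "R3 \<Rightarrow> 'b::{banach, second_countable_topology}"
  assumes F: "F \<in> borel_measurable lebesgue" and G: "G \<in> borel_measurable borel" and eq: "AE x in lborel. F x = G x"
  shows "(LINT x|lebesgue. F x) = (LINT x|lborel. G x)" "integrable lebesgue F \<longleftrightarrow> integrable lborel G"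
proof -
  have G': "G \<in> borel_measurable lborel" using G by simp
  have GL: "G \<in> borel_measurable lebesgue" using G' by (rule measurable_completion)
  have eq': "AE x in lebesgue. F x = G x" using eq by (rule AE_completion)
  have "(LINT x|lebesgue. F x) = (LINT x|lebesgue. G x)" by (rule integral_cong_AE[OF F GL eq'])
  then show "(LINT x|lebesgue. F x) = (LINT x|lborel. G x)" using integral_completion[OF G'] by simp
  have "integrable lebesgue F \<longleftrightarrow> integrable lebesgue G" by (rule integrable_cong_AE[OF F GL eq'])
  then show "integrable lebesgue F \<longleftrightarrow> integrable lborel G" using integrable_completion[OF G'] by simp
qed

lemma borel_imp_lebesgue: "f \<in> borel_measurable borel \<Longrightarrow> f \<in> borel_measurable lebesgue"
  by (rule measurable_completion) simp

lemma measurable_of_real_fun: "f \<in> borel_measurable M \<Longrightarrow> (\<lambda>x. complex_of_real (f x)) \<in> borel_measurable M"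
  by (rule measurable_compose[OF _ borel_measurable_of_real])

lemma measurable_norm_fun: "f \<in> borel_measurable M \<Longrightarrow> (\<lambda>x. norm (f x :: 'b::real_normed_vector)) \<in> borel_measurable M"
  by (rule measurable_compose[OF _ borel_measurable_norm])

lemma measurable_cnj_fun: "f \<in> borel_measurable M \<Longrightarrow> (\<lambda>x. cnj (f x)) \<in> borel_measurable M"
  by (erule measurable_compose) (intro borel_measurable_continuous_onI continuous_intros)

lemma AE_lborel_iff: "(AE x in lebesgue. P x) \<longleftrightarrow> (AE x in lborel. P x)"
  by (rule AE_completion_iff)

lemma sq_int_real:
  fixes u :: "R3 \<Rightarrow> real"
  assumes "sq_int u" shows "\<exists>g. l2fun g \<and> (AE x in lborel. u x = g x)"
proof -
  have um: "u \<in> borel_measurable lebesgue" and ui: "integrable lebesgue (\<lambda>x. (norm (u x))\<^sup>2)" using assms by (auto simp: sq_int_def)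
  obtain g where g: "g \<in> borel_measurable lborel" "AE x in lborel. u x = g x"
    using completion_ex_borel_measurable_real[OF um] by blast
  have "integrable lborel (\<lambda>x. (g x)\<^sup>2)"
  proof -
    have "AE x in lborel. (norm (u x))\<^sup>2 = (g x)\<^sup>2" using g(2) by eventually_elim simp
    moreover have "(\<lambda>x. (norm (u x))\<^sup>2) \<in> borel_measurable lebesgue" using um by (intro borel_measurable_power measurable_norm_fun)
    ultimately show ?thesis using lebesgue_integral_eq(2)[of "\<lambda>x. (norm (u x))\<^sup>2" "\<lambda>x. (g x)\<^sup>2"] ui g(1) by simp
  qed
  then show ?thesis using g by (intro exI[of _ g]) (auto simp: l2fun_def)
qed

lemma fn_mk_sq_int: fixes u :: "R3 \<Rightarrow> real" assumes "sq_int u" shows "AE x in lborel. fn (mk u) x = u x"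
proof -
  obtain g where g: "l2fun g" "AE x in lborel. u x = g x" using sq_int_real[OF assms] by blast
  show ?thesis unfolding mk_cong[OF g(2)] using fn_mk[OF g(1)] g(2) by eventually_elim simp
qed

lemma l2fun_sq_int: "l2fun f \<Longrightarrow> sq_int f"
  using lebesgue_integral_eq(2)[of "\<lambda>x. (norm (f x))\<^sup>2" "\<lambda>x. (f x)\<^sup>2"]
  by (simp add: sq_int_def borel_imp_lebesgue l2fun_integrable_sq)

lemma inner_mk_sq_int:
  assumes "sq_int u" "sq_int v" shows "inner (mk u) (mk v) = (LINT x|lebesgue. u x * v x)"
proof -
  have [measurable]: "u \<in> borel_measurable lebesgue" "v \<in> borel_measurable lebesgue" using assms by (auto simp: sq_int_def)
  have "(LINT x|lebesgue. u x * v x) = (LINT x|lborel. fn (mk u) x * fn (mk v) x)"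
    by (rule lebesgue_integral_eq(1)) (use fn_mk_sq_int[OF assms(1)] fn_mk_sq_int[OF assms(2)] in \<open>auto elim!: AE_mp\<close>)
  then show ?thesis by (simp add: inner_l2_def)
qed

lemma AE_reflect:
  assumes "f \<in> borel_measurable borel" "g \<in> borel_measurable borel" "AE x in lborel. f x = (g x :: real)"
  shows "AE x in lborel. f (- x :: R3) = g (- x)"
proof -
  have lb: "(lborel :: R3 measure) = distr lborel borel uminus"
    using lborel_affine[of "-1" "0::R3"] by (simp add: density_1)
  have "AE x in distr lborel borel uminus. f x = (g x :: real)" using assms(3) by (simp only: lb[symmetric])
  then show ?thesis by (subst (asm) AE_distr_iff) (use assms in auto)
qed

text \<open>The Fourier transform of a function with Hartley transform \<open>a\<close>.\<close>
definition cx :: "(R3 \<Rightarrow> real) \<Rightarrow> R3 \<Rightarrow> complex" where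
  "cx a \<xi> = Complex ((a \<xi> + a (- \<xi>)) / (2 * c3)) (- (a \<xi> - a (- \<xi>)) / (2 * c3))"

lemma cx_measurable[measurable]: "a \<in> borel_measurable borel \<Longrightarrow> cx a \<in> borel_measurable borel"
proof -
  assume a: "a \<in> borel_measurable borel"
  have r: "(\<lambda>x::R3. a (- x)) \<in> borel_measurable borel"
    by (rule measurable_compose[OF _ a]) (intro borel_measurable_continuous_onI continuous_intros)
  show ?thesis unfolding borel_measurable_complex_iff using a r by (simp add: cx_def)
qed

lemma cmod_cx_sq: "(cmod (cx a \<xi>))\<^sup>2 = ((a \<xi>)\<^sup>2 + (a (- \<xi>))\<^sup>2) / (2 * c3\<^sup>2)"
proof -
  have "(cmod (cx a \<xi>))\<^sup>2 = ((a \<xi> + a (- \<xi>))\<^sup>2 + (a \<xi> - a (- \<xi>))\<^sup>2) / (4 * c3\<^sup>2)"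
    unfolding cmod_power2 cx_def complex.sel power_divide power_mult_distrib power2_minus by (simp add: add_divide_distrib)
  then show ?thesis using c3_pos by (simp add: power2_eq_square field_simps)
qed

lemma Re_cx_cnj: "Re (cx a \<xi> * cnj (cx b \<xi>)) = (a \<xi> * b \<xi> + a (- \<xi>) * b (- \<xi>)) / (2 * c3\<^sup>2)"
  using c3_pos by (simp add: cx_def power2_eq_square field_simps)

lemma cx_inj: "a \<xi> = c3 * (Re (cx a \<xi>) - Im (cx a \<xi>))"
  using c3_pos by (simp add: cx_def field_simps)

lemma cx_diff: "cx a \<xi> - cx b \<xi> = cx (\<lambda>\<xi>. a \<xi> - b \<xi>) \<xi>"
  by (simp add: cx_def complex_eq_iff diff_divide_distrib add_divide_distrib)

lemma cx_mult_even: "p (- \<xi>) = p \<xi> \<Longrightarrow> cx (\<lambda>\<xi>. p \<xi> * a \<xi>) \<xi> = complex_of_real (p \<xi>) * cx a \<xi>"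
  by (simp add: cx_def complex_eq_iff algebra_simps)

lemma cx_AE_cong:
  assumes "a \<in> borel_measurable borel" "b \<in> borel_measurable borel" "AE x in lborel. a x = b x"
  shows "AE x in lborel. cx a x = cx b x"
  using assms(3) AE_reflect[OF assms] by eventually_elim (simp add: cx_def)

lemma cmod_cx_integral:
  assumes a: "l2fun a"
  shows "integrable lborel (\<lambda>\<xi>. (cmod (cx a \<xi>))\<^sup>2)" "(LINT \<xi>|lborel. (cmod (cx a \<xi>))\<^sup>2) = (LINT \<xi>|lborel. (a \<xi>)\<^sup>2) / c3\<^sup>2"
proof -
  have m: "(\<lambda>\<xi>. (a \<xi>)\<^sup>2) \<in> borel_measurable borel" using a by simp
  have 1: "integrable lborel (\<lambda>\<xi>. (a \<xi>)\<^sup>2)" using a by (rule l2fun_integrable_sq)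
  have 2: "integrable lborel (\<lambda>\<xi>. (a (- \<xi>))\<^sup>2)" using integral_reflect(2)[OF m] 1 by simp
  show "integrable lborel (\<lambda>\<xi>. (cmod (cx a \<xi>))\<^sup>2)" unfolding cmod_cx_sq using 1 2 by simp
  show "(LINT \<xi>|lborel. (cmod (cx a \<xi>))\<^sup>2) = (LINT \<xi>|lborel. (a \<xi>)\<^sup>2) / c3\<^sup>2"
    unfolding cmod_cx_sq using 1 2 integral_reflect(1)[OF m] by simp
qed

text \<open>The cosine and sine integrals are the even and odd parts of the Hartley
  transform.\<close>

lemma fourier1_cut:
  assumes u: "sq_int u"
  shows "fourier1 (\<lambda>x. indicator (ball 0 (real n)) x * u x) \<xi> = cx (hart (cut n (fn (mk u)))) \<xi>"
proof -
  let ?f = "cut n (fn (mk u))"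
  have um: "u \<in> borel_measurable lebesgue" using u by (simp add: sq_int_def)
  have fi: "integrable lborel ?f" by (intro integrable_cut l2fun_fn)
  have fm: "?f \<in> borel_measurable borel" using fi by auto
  have i1: "integrable lborel (\<lambda>x. ?f x * cos (x \<bullet> \<xi>))" and i2: "integrable lborel (\<lambda>x. ?f x * sin (x \<bullet> \<xi>))"
    by (rule integrable_mult_bounded[OF fi, of _ 1]; simp)+
  have ic: "integrable lborel (\<lambda>x. complex_of_real (?f x) * cis (- (x \<bullet> \<xi>)))"
  proof (rule Bochner_Integration.integrable_bound[OF fi])
    show "(\<lambda>x. complex_of_real (?f x) * cis (- (x \<bullet> \<xi>))) \<in> borel_measurable lborel"
      using fm unfolding cis_conv_exp by measurable
  qed (simp add: norm_mult)
  have eqs: "complex_of_real (indicator (ball 0 (real n)) x * u x) * cis (- (x \<bullet> \<xi>)) = complex_of_real (?f x) * cis (- (x \<bullet> \<xi>))"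
    if "fn (mk u) x = u x" for x using that by (simp add: cut_def)
  have "fourier1 (\<lambda>x. indicator (ball 0 (real n)) x * u x) \<xi> = (LINT x|lborel. complex_of_real (?f x) * cis (- (x \<bullet> \<xi>)))"
    unfolding fourier1_def
  proof (rule lebesgue_integral_eq(1))
    show "(\<lambda>x. complex_of_real (indicator (ball 0 (real n)) x * u x) * cis (- (x \<bullet> \<xi>))) \<in> borel_measurable lebesgue"
    proof -
      have 1: "(\<lambda>x. indicator (ball 0 (real n)) x :: real) \<in> borel_measurable lebesgue" by (rule borel_imp_lebesgue[OF borel_measurable_indicator]) simp
      have 2: "(\<lambda>x. cis (- (x \<bullet> \<xi>))) \<in> borel_measurable lebesgue" unfolding cis_conv_exp by (rule borel_imp_lebesgue) measurable
      show ?thesis using um 1 2 by (intro borel_measurable_times measurable_of_real_fun) auto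
    qed
    show "AE x in lborel. complex_of_real (indicator (ball 0 (real n)) x * u x) * cis (- (x \<bullet> \<xi>)) = complex_of_real (?f x) * cis (- (x \<bullet> \<xi>))"
      using fn_mk_sq_int[OF u] by eventually_elim (rule eqs)
  qed (use ic in auto)
  also have "\<dots> = cx (hart ?f) \<xi>"
  proof (rule complex_eqI)
    have "(LINT x|lborel. ?f x * cos (x \<bullet> \<xi>)) = (hart ?f \<xi> + hart ?f (- \<xi>)) / (2 * c3)"
      using i1 i2 c3_pos by (simp add: hart_def cas_def distrib_left right_diff_distrib field_simps)
    then show "Re (LINT x|lborel. complex_of_real (?f x) * cis (- (x \<bullet> \<xi>))) = Re (cx (hart ?f) \<xi>)"
      using integral_Re[OF ic] by (simp add: cx_def)
    have "(LINT x|lborel. ?f x * sin (x \<bullet> \<xi>)) = (hart ?f \<xi> - hart ?f (- \<xi>)) / (2 * c3)"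
      using i1 i2 c3_pos by (simp add: hart_def cas_def distrib_left right_diff_distrib field_simps)
    then show "Im (LINT x|lborel. complex_of_real (?f x) * cis (- (x \<bullet> \<xi>))) = Im (cx (hart ?f) \<xi>)"
      using integral_Im[OF ic] by (simp add: cx_def minus_divide_left)
  qed
  finally show ?thesis .
qed

lemma cx_hart_cut_tendsto:
  "(\<lambda>n. LINT \<xi>|lborel. (cmod (cx (fn (HT h)) \<xi> - cx (hart (cut n (fn h))) \<xi>))\<^sup>2) \<longlonglongrightarrow> 0"
proof -
  have hl: "l2fun (hart (cut n (fn h)))" for n by (intro hart_contraction l2fun_cut integrable_cut l2fun_fn)
  have "(LINT \<xi>|lborel. (cmod (cx (fn (HT h)) \<xi> - cx (hart (cut n (fn h))) \<xi>))\<^sup>2) = (norm (HT h - mk (hart (cut n (fn h)))))\<^sup>2 / c3\<^sup>2" for n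
    unfolding cx_diff using cmod_cx_integral(2)[OF l2fun_diff[OF l2fun_fn[of "HT h"] hl[of n]]]
      norm_sq_mk[OF l2fun_diff[OF l2fun_fn[of "HT h"] hl[of n]]] mk_diff[OF l2fun_fn[of "HT h"] hl[of n]] by simp
  moreover have "(\<lambda>n. (norm (HT h - mk (hart (cut n (fn h)))))\<^sup>2 / c3\<^sup>2) \<longlonglongrightarrow> (norm (HT h - HT h))\<^sup>2 / c3\<^sup>2"
    using c3_pos by (intro tendsto_intros HT_cut_tendsto) auto
  ultimately show ?thesis by simp
qed

section \<open>The Fourier transform on L2 and Plancherel's formula\<close>

lemma is_fourier_cx:
  assumes u: "sq_int u" shows "is_fourier u (cx (fn (HT (mk u))))"
  unfolding is_fourier_def
proof (intro conjI)
  let ?H = "fn (HT (mk u))"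
  have hl: "l2fun (hart (cut n (fn (mk u))))" for n by (intro hart_contraction l2fun_cut integrable_cut l2fun_fn)
  have Fm: "cx ?H \<in> borel_measurable borel" by simp
  show "sq_int u" by fact
  show "sq_int (cx ?H)" unfolding sq_int_def
    using lebesgue_integral_eq(2)[of "\<lambda>\<xi>. (cmod (cx ?H \<xi>))\<^sup>2" "\<lambda>\<xi>. (cmod (cx ?H \<xi>))\<^sup>2"] Fm cmod_cx_integral(1)[OF l2fun_fn]
    by (auto simp: borel_imp_lebesgue)
  have "(LINT \<xi>|lebesgue. (cmod (cx ?H \<xi> - fourier1 (\<lambda>x. indicator (ball 0 (real n)) x * u x) \<xi>))\<^sup>2)
     = (LINT \<xi>|lborel. (cmod (cx ?H \<xi> - cx (hart (cut n (fn (mk u)))) \<xi>))\<^sup>2)" for n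
    unfolding fourier1_cut[OF u] by (rule lebesgue_integral_eq(1)) (use hl in \<open>auto intro!: borel_imp_lebesgue\<close>)
  then show "(\<lambda>n. LINT \<xi>|lebesgue. (cmod (cx ?H \<xi> - fourier1 (\<lambda>x. indicator (ball 0 (real n)) x * u x) \<xi>))\<^sup>2) \<longlonglongrightarrow> 0"
    using cx_hart_cut_tendsto by simp
qed

text \<open>Both functions are limits in L2 of the same truncated transforms. Since
  \<open>fourier\<close> is an arbitrary choice, almost everywhere statements are all that can be
  known about it.\<close>

lemma is_fourier_unique:
  assumes F: "is_fourier u F" shows "AE \<xi> in lborel. F \<xi> = cx (fn (HT (mk u))) \<xi>"
proof -
  let ?H = "fn (HT (mk u))"
  let ?h = "\<lambda>n. hart (cut n (fn (mk u)))"
  have u: "sq_int u" and Fs: "sq_int F" using F by (auto simp: is_fourier_def)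
  have hl: "l2fun (?h n)" for n by (intro hart_contraction l2fun_cut integrable_cut l2fun_fn)
  have Fm: "F \<in> borel_measurable lebesgue" and Fi: "integrable lebesgue (\<lambda>\<xi>. (cmod (F \<xi>))\<^sup>2)" using Fs by (auto simp: sq_int_def)
  have cxm: "cx a \<in> borel_measurable lebesgue" if "l2fun a" for a using that by (intro borel_imp_lebesgue cx_measurable) simp
  have cxi: "integrable lebesgue (\<lambda>\<xi>. (cmod (cx a \<xi>))\<^sup>2)" if "l2fun a" for a
    using lebesgue_integral_eq(2)[of "\<lambda>\<xi>. (cmod (cx a \<xi>))\<^sup>2" "\<lambda>\<xi>. (cmod (cx a \<xi>))\<^sup>2"] cmod_cx_integral(1)[OF that] cxm[OF that] that
    by auto
  have tri: "(cmod (a + b))\<^sup>2 \<le> 2 * (cmod a)\<^sup>2 + 2 * (cmod b)\<^sup>2" for a b :: complex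
    using order_trans[OF power_mono[OF norm_triangle_ineq[of a b] norm_ge_zero, of 2] sum_sq_le[of "cmod a" "cmod b"]] .
  have di: "integrable lebesgue (\<lambda>\<xi>. (cmod (F \<xi> - cx a \<xi>))\<^sup>2)" if a: "l2fun a" for a
  proof (rule Bochner_Integration.integrable_bound)
    show "integrable lebesgue (\<lambda>\<xi>. 2 * (cmod (F \<xi>))\<^sup>2 + 2 * (cmod (cx a \<xi>))\<^sup>2)" using Fi cxi[OF a] by simp
    show "AE \<xi> in lebesgue. norm ((cmod (F \<xi> - cx a \<xi>))\<^sup>2) \<le> norm (2 * (cmod (F \<xi>))\<^sup>2 + 2 * (cmod (cx a \<xi>))\<^sup>2)"
      using tri[of "F _" "- cx a _"] by (intro AE_I2) simp
  qed (use Fm cxm[OF a] in simp)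
  have "(LINT \<xi>|lebesgue. (cmod (F \<xi> - cx ?H \<xi>))\<^sup>2) \<le> 2 * (LINT \<xi>|lebesgue. (cmod (F \<xi> - cx (?h n) \<xi>))\<^sup>2)
     + 2 * (LINT \<xi>|lborel. (cmod (cx ?H \<xi> - cx (?h n) \<xi>))\<^sup>2)" for n
  proof -
    have e: "(LINT \<xi>|lborel. (cmod (cx ?H \<xi> - cx (?h n) \<xi>))\<^sup>2) = (LINT \<xi>|lebesgue. (cmod (cx ?H \<xi> - cx (?h n) \<xi>))\<^sup>2)"
      by (rule lebesgue_integral_eq(1)[symmetric]) (use hl in \<open>auto intro!: borel_imp_lebesgue\<close>)
    have i: "integrable lebesgue (\<lambda>\<xi>. (cmod (cx ?H \<xi> - cx (?h n) \<xi>))\<^sup>2)" unfolding cx_diff by (intro cxi l2fun_diff hl l2fun_fn)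
    have "(LINT \<xi>|lebesgue. (cmod (F \<xi> - cx ?H \<xi>))\<^sup>2) \<le> (LINT \<xi>|lebesgue. 2 * (cmod (F \<xi> - cx (?h n) \<xi>))\<^sup>2 + 2 * (cmod (cx ?H \<xi> - cx (?h n) \<xi>))\<^sup>2)"
    proof (rule integral_mono)
      fix \<xi> show "(cmod (F \<xi> - cx ?H \<xi>))\<^sup>2 \<le> 2 * (cmod (F \<xi> - cx (?h n) \<xi>))\<^sup>2 + 2 * (cmod (cx ?H \<xi> - cx (?h n) \<xi>))\<^sup>2"
        using tri[of "F \<xi> - cx (?h n) \<xi>" "cx (?h n) \<xi> - cx ?H \<xi>"] by (simp add: norm_minus_commute[of "cx ?H \<xi>"])
    qed (use di[OF hl] di[OF l2fun_fn] i in auto)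
    then show ?thesis unfolding e using di[OF hl] i by simp
  qed
  moreover have "(\<lambda>n. 2 * (LINT \<xi>|lebesgue. (cmod (F \<xi> - cx (?h n) \<xi>))\<^sup>2)
     + 2 * (LINT \<xi>|lborel. (cmod (cx ?H \<xi> - cx (?h n) \<xi>))\<^sup>2)) \<longlonglongrightarrow> 2 * 0 + 2 * 0"
    using F unfolding is_fourier_def fourier1_cut[OF u] by (intro tendsto_intros cx_hart_cut_tendsto) auto
  ultimately have "(LINT \<xi>|lebesgue. (cmod (F \<xi> - cx ?H \<xi>))\<^sup>2) \<le> 2 * 0 + 2 * 0" by (intro LIMSEQ_le_const) auto
  then have "(LINT \<xi>|lebesgue. (cmod (F \<xi> - cx ?H \<xi>))\<^sup>2) = 0" by (intro antisym) auto
  then have "AE \<xi> in lebesgue. (cmod (F \<xi> - cx ?H \<xi>))\<^sup>2 = 0"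
    using integral_nonneg_eq_0_iff_AE[OF di[OF l2fun_fn]] by auto
  then show ?thesis unfolding AE_lborel_iff by eventually_elim simp
qed

lemma is_fourier_fourier: "sq_int u \<Longrightarrow> is_fourier u (fourier u)"
  unfolding fourier_def by (rule someI[of "is_fourier u", OF is_fourier_cx])

lemma fourier_measurable: "sq_int u \<Longrightarrow> fourier u \<in> borel_measurable lebesgue"
  using is_fourier_fourier[of u] by (auto simp: is_fourier_def sq_int_def)

lemma fourier_AE: "sq_int u \<Longrightarrow> AE \<xi> in lborel. fourier u \<xi> = cx (fn (HT (mk u))) \<xi>"
  by (rule is_fourier_unique[OF is_fourier_fourier])

text \<open>The real part of the product is the mean of \<open>a * b\<close> and its reflection,
  divided by \<open>c3\<^sup>2\<close>; since \<open>p\<close> is even, reflecting the variable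
  merges the two.\<close>

lemma plancherel_weighted:
  assumes u: "sq_int u" "HT (mk u) = mk a" "l2fun a" and v: "sq_int v" "HT (mk v) = mk b" "l2fun b"
    and p: "p \<in> borel_measurable borel" "\<And>\<xi>. p (- \<xi>) = p \<xi>" "\<And>\<xi>. 0 \<le> p \<xi>"
    and ia: "integrable lborel (\<lambda>\<xi>. p \<xi> * (a \<xi>)\<^sup>2)" and ib: "integrable lborel (\<lambda>\<xi>. p \<xi> * (b \<xi>)\<^sup>2)"
  shows "(2 * pi) powr (-3) * Re (LINT \<xi>|lebesgue. complex_of_real (p \<xi>) * fourier u \<xi> * cnj (fourier v \<xi>)) = (LINT \<xi>|lborel. p \<xi> * a \<xi> * b \<xi>)"
proof -
  have [measurable]: "a \<in> borel_measurable borel" "b \<in> borel_measurable borel" "p \<in> borel_measurable borel" using u v p by auto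
  have Fu: "AE \<xi> in lborel. fourier u \<xi> = cx a \<xi>" if "sq_int u" "HT (mk u) = mk a" "l2fun a" for u a
    using fourier_AE[OF that(1)] cx_AE_cong[OF fn_measurable _ fn_mk[OF that(3)]] that by (auto elim!: AE_mp)
  have int: "integrable lborel (\<lambda>\<xi>. p \<xi> * (a \<xi> * b \<xi>))"
  proof (rule Bochner_Integration.integrable_bound)
    show "integrable lborel (\<lambda>\<xi>. p \<xi> * (a \<xi>)\<^sup>2 + p \<xi> * (b \<xi>)\<^sup>2)" using ia ib by simp
    show "AE \<xi> in lborel. norm (p \<xi> * (a \<xi> * b \<xi>)) \<le> norm (p \<xi> * (a \<xi>)\<^sup>2 + p \<xi> * (b \<xi>)\<^sup>2)"
    proof (rule AE_I2)
      fix \<xi>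
      have "2 * \<bar>a \<xi> * b \<xi>\<bar> \<le> (a \<xi>)\<^sup>2 + (b \<xi>)\<^sup>2"
        using zero_le_power2[of "\<bar>a \<xi>\<bar> - \<bar>b \<xi>\<bar>"] by (simp add: power2_diff abs_mult)
      then have "\<bar>a \<xi> * b \<xi>\<bar> \<le> (a \<xi>)\<^sup>2 + (b \<xi>)\<^sup>2" using abs_ge_zero[of "a \<xi> * b \<xi>"] by linarith
      from mult_left_mono[OF this p(3)[of \<xi>]] show "norm (p \<xi> * (a \<xi> * b \<xi>)) \<le> norm (p \<xi> * (a \<xi>)\<^sup>2 + p \<xi> * (b \<xi>)\<^sup>2)"
        using p(3)[of \<xi>] by (simp add: abs_mult distrib_left)
    qed
  qed simp
  have int': "integrable lborel (\<lambda>\<xi>. p \<xi> * (a (- \<xi>) * b (- \<xi>)))"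
    using integral_reflect(2)[of "\<lambda>\<xi>. p \<xi> * (a \<xi> * b \<xi>)"] int by (simp add: p(2))
  let ?G = "\<lambda>\<xi>. complex_of_real (p \<xi>) * cx a \<xi> * cnj (cx b \<xi>)"
  have Gi: "integrable lborel ?G"
  proof (rule Bochner_Integration.integrable_bound)
    have r: "integrable lborel (\<lambda>\<xi>. p \<xi> * (a (- \<xi>))\<^sup>2)" "integrable lborel (\<lambda>\<xi>. p \<xi> * (b (- \<xi>))\<^sup>2)"
      using integral_reflect(2)[of "\<lambda>\<xi>. p \<xi> * (a \<xi>)\<^sup>2"] integral_reflect(2)[of "\<lambda>\<xi>. p \<xi> * (b \<xi>)\<^sup>2"] ia ib by (simp_all add: p(2))
    have e: "p \<xi> * ((cmod (cx a \<xi>))\<^sup>2 + (cmod (cx b \<xi>))\<^sup>2)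
       = (p \<xi> * (a \<xi>)\<^sup>2 + p \<xi> * (a (- \<xi>))\<^sup>2 + (p \<xi> * (b \<xi>)\<^sup>2 + p \<xi> * (b (- \<xi>))\<^sup>2)) / (2 * c3\<^sup>2)" for \<xi>
      by (simp add: cmod_cx_sq algebra_simps add_divide_distrib)
    show "integrable lborel (\<lambda>\<xi>. p \<xi> * ((cmod (cx a \<xi>))\<^sup>2 + (cmod (cx b \<xi>))\<^sup>2))" unfolding e using r ia ib by simp
    show "AE \<xi> in lborel. norm (?G \<xi>) \<le> norm (p \<xi> * ((cmod (cx a \<xi>))\<^sup>2 + (cmod (cx b \<xi>))\<^sup>2))"
    proof (rule AE_I2)
      fix \<xi>
      have "cmod (cx a \<xi>) * cmod (cx b \<xi>) \<le> (cmod (cx a \<xi>))\<^sup>2 + (cmod (cx b \<xi>))\<^sup>2"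
        using zero_le_power2[of "cmod (cx a \<xi>) - cmod (cx b \<xi>)"] zero_le_power2[of "cmod (cx a \<xi>)"] zero_le_power2[of "cmod (cx b \<xi>)"]
          mult_nonneg_nonneg[OF norm_ge_zero[of "cx a \<xi>"] norm_ge_zero[of "cx b \<xi>"]] unfolding power2_diff by linarith
      from mult_left_mono[OF this p(3)[of \<xi>]] show "norm (?G \<xi>) \<le> norm (p \<xi> * ((cmod (cx a \<xi>))\<^sup>2 + (cmod (cx b \<xi>))\<^sup>2))"
        using p(3)[of \<xi>] by (simp add: norm_mult mult.assoc)
    qed
  qed (auto intro!: borel_measurable_times measurable_of_real_fun measurable_cnj_fun)
  have "(LINT \<xi>|lebesgue. complex_of_real (p \<xi>) * fourier u \<xi> * cnj (fourier v \<xi>)) = (LINT \<xi>|lborel. ?G \<xi>)"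
  proof (rule lebesgue_integral_eq(1))
    show "(\<lambda>\<xi>. complex_of_real (p \<xi>) * fourier u \<xi> * cnj (fourier v \<xi>)) \<in> borel_measurable lebesgue"
    proof -
      have c: "(\<lambda>\<xi>. cnj (fourier v \<xi>)) \<in> borel_measurable lebesgue"
        by (rule measurable_cnj_fun[OF fourier_measurable[OF v(1)]])
      show ?thesis by (intro borel_measurable_times c fourier_measurable u measurable_of_real_fun borel_imp_lebesgue p)
    qed
    show "AE \<xi> in lborel. complex_of_real (p \<xi>) * fourier u \<xi> * cnj (fourier v \<xi>) = ?G \<xi>"
      using Fu[OF u] Fu[OF v] by eventually_elim simp
  qed (use Gi in auto)
  also have "Re \<dots> = (LINT \<xi>|lborel. Re (?G \<xi>))" using integral_Re[OF Gi] by simp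
  also have "\<dots> = (LINT \<xi>|lborel. (p \<xi> * (a \<xi> * b \<xi>) + p \<xi> * (a (- \<xi>) * b (- \<xi>))) / (2 * c3\<^sup>2))"
  proof (rule Bochner_Integration.integral_cong[OF refl])
    fix \<xi>
    have "Re (?G \<xi>) = p \<xi> * Re (cx a \<xi> * cnj (cx b \<xi>))" by (simp add: mult.assoc Re_complex_of_real)
    then show "Re (?G \<xi>) = (p \<xi> * (a \<xi> * b \<xi>) + p \<xi> * (a (- \<xi>) * b (- \<xi>))) / (2 * c3\<^sup>2)"
      unfolding Re_cx_cnj by (simp add: distrib_left)
  qed
  also have "\<dots> = (LINT \<xi>|lborel. p \<xi> * (a \<xi> * b \<xi>)) / c3\<^sup>2"
    using int int' integral_reflect(1)[of "\<lambda>\<xi>. p \<xi> * (a \<xi> * b \<xi>)"] by (simp add: p(2))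
  also have "(2 * pi) powr (-3) * \<dots> = (LINT \<xi>|lborel. p \<xi> * a \<xi> * b \<xi>)"
  proof -
    have "(2 * pi) powr (-3) = c3\<^sup>2"
    proof -
      have "sqrt (2 * pi) ^ 6 = (sqrt (2 * pi) ^ 2) ^ 3" by (simp only: power_mult[symmetric]) simp
      then show ?thesis by (simp add: c3_def powr_minus_divide powr_numeral power_divide flip: power_mult)
    qed
    then show ?thesis using c3_pos by (simp add: mult.assoc)
  qed
  finally show ?thesis .
qed

section \<open>Bessel multipliers and the function spaces of the statement\<close>

definition jm :: "real \<Rightarrow> R3 \<Rightarrow> real" where "jm t \<xi> = (1 + (norm \<xi>)\<^sup>2) powr (- t / 2)"

lemma jm_measurable[measurable]: "jm t \<in> borel_measurable borel" unfolding jm_def by measurable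
lemma one_le_bracket: "1 \<le> 1 + (norm (\<xi>::R3))\<^sup>2" by simp
lemma bracket_pos[simp]: "0 < 1 + (norm (\<xi>::R3))\<^sup>2" and bracket_neq_0[simp]: "1 + (norm (\<xi>::R3))\<^sup>2 \<noteq> 0"
  using one_le_bracket[of \<xi>] by linarith+
lemma jm_pos: "0 < jm t \<xi>" using one_le_bracket[of \<xi>] by (simp add: jm_def add_pos_nonneg)
lemma jm_le_1: "0 \<le> t \<Longrightarrow> jm t \<xi> \<le> 1" using powr_mono[of "- t / 2" 0 "1 + (norm \<xi>)\<^sup>2"] by (simp add: jm_def add_pos_nonneg)
lemma jm_even: "jm t (- \<xi>) = jm t \<xi>" by (simp add: jm_def)
lemma jm_sq: "(1 + (norm \<xi>)\<^sup>2) powr t * (jm t \<xi>)\<^sup>2 = 1"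
proof -
  have "(jm t \<xi>)\<^sup>2 = (1 + (norm \<xi>)\<^sup>2) powr (- t)" by (simp add: jm_def power2_eq_square flip: powr_add)
  then show ?thesis using one_le_bracket[of \<xi>] by (simp flip: powr_add add: add_pos_nonneg)
qed
lemma jm_bmeas: "0 \<le> t \<Longrightarrow> bmeas (jm t)"
  using jm_pos jm_le_1 by (auto simp: bmeas_def abs_of_pos intro!: exI[of _ 1])

text \<open>The function whose Hartley transform is \<open>k\<close> times the Bessel multiplier. Up
  to null sets this maps L2 isometrically onto \<open>Hs t\<close> and \<open>Lt2 t\<close>
  (\<open>Hs_iff\<close>, \<open>Hs_norm_eq\<close>, \<open>Lt2_iff\<close>,
  \<open>Lt2_inner_eq\<close>).\<close>

definition Js :: "real \<Rightarrow> l2 \<Rightarrow> l2" where "Js t k = HT (mult_op (jm t) k)"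

lemma HT_Js: "HT (Js t k) = mult_op (jm t) k" by (simp add: Js_def HT_HT)

lemma Js_eqD:
  assumes "sq_int u" "mk u = Js t k" "0 \<le> t"
  shows "HT (mk u) = mk (\<lambda>\<xi>. jm t \<xi> * fn k \<xi>)" "l2fun (\<lambda>\<xi>. jm t \<xi> * fn k \<xi>)"
  using assms by (auto simp: HT_Js mult_op_def intro: l2fun_mult jm_bmeas)

lemma weight_jm: "(1 + (norm \<xi>)\<^sup>2) powr t * (jm t \<xi> * x)\<^sup>2 = x\<^sup>2"
  using jm_sq[of \<xi> t] by (simp add: power_mult_distrib mult.assoc[symmetric])

lemma Hs_iff:
  assumes s: "0 \<le> s" shows "u \<in> Hs s \<longleftrightarrow> sq_int u \<and> (\<exists>k. mk u = Js s k)"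
proof
  assume "u \<in> Hs s"
  then obtain F where u: "sq_int u" and F: "is_fourier u F"
    and i: "integrable lebesgue (\<lambda>\<xi>. (1 + (norm \<xi>)\<^sup>2) powr s * (cmod (F \<xi>))\<^sup>2)" by (auto simp: Hs_def)
  let ?a = "fn (HT (mk u))"
  let ?w = "\<lambda>\<xi>::R3. (1 + (norm \<xi>)\<^sup>2) powr s"
  have Fm: "F \<in> borel_measurable lebesgue" using F by (simp add: is_fourier_def sq_int_def)
  have wm: "?w \<in> borel_measurable borel" by measurable
  have m1: "(\<lambda>\<xi>. ?w \<xi> * (cmod (F \<xi>))\<^sup>2) \<in> borel_measurable lebesgue"
    using Fm borel_imp_lebesgue[OF wm] by (intro borel_measurable_times borel_measurable_power measurable_norm_fun)
  have m2: "(\<lambda>\<xi>. ?w \<xi> * (cmod (cx ?a \<xi>))\<^sup>2) \<in> borel_measurable borel"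
    by (intro borel_measurable_times borel_measurable_power measurable_norm_fun cx_measurable wm) simp
  have e: "AE \<xi> in lborel. ?w \<xi> * (cmod (F \<xi>))\<^sup>2 = ?w \<xi> * (cmod (cx ?a \<xi>))\<^sup>2"
    using is_fourier_unique[OF F] by eventually_elim simp
  have "integrable lborel (\<lambda>\<xi>. ?w \<xi> * (cmod (cx ?a \<xi>))\<^sup>2)"
    using lebesgue_integral_eq(2)[OF m1 m2 e] i by blast
  then have "integrable lborel (\<lambda>\<xi>. (2 * c3\<^sup>2) * (?w \<xi> * (cmod (cx ?a \<xi>))\<^sup>2))" by simp
  then have "integrable lborel (\<lambda>\<xi>. ?w \<xi> * (?a \<xi>)\<^sup>2)"
  proof (rule Bochner_Integration.integrable_bound)
    show "AE \<xi> in lborel. norm (?w \<xi> * (?a \<xi>)\<^sup>2) \<le> norm ((2 * c3\<^sup>2) * (?w \<xi> * (cmod (cx ?a \<xi>))\<^sup>2))"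
      using c3_pos by (intro AE_I2) (simp add: cmod_cx_sq mult_left_mono abs_mult)
  qed (use wm in simp)
  moreover have "((1 + (norm \<xi>)\<^sup>2) powr (s/2))\<^sup>2 = ?w \<xi>" for \<xi> :: R3 by (simp add: power2_eq_square flip: powr_add)
  ultimately have k: "l2fun (\<lambda>\<xi>. (1 + (norm \<xi>)\<^sup>2) powr (s/2) * ?a \<xi>)" by (simp add: l2fun_def power_mult_distrib)
  have one: "jm s \<xi> * (1 + (norm \<xi>)\<^sup>2) powr (s/2) = 1" for \<xi>
    using one_le_bracket[of \<xi>] by (simp add: jm_def add_pos_nonneg flip: powr_add)
  have "mult_op (jm s) (mk (\<lambda>\<xi>. (1 + (norm \<xi>)\<^sup>2) powr (s/2) * ?a \<xi>)) = mk ?a"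
    unfolding mult_op_mk[OF jm_bmeas[OF s] k] using one by (simp add: mult.assoc[symmetric])
  then have "mk u = Js s (mk (\<lambda>\<xi>. (1 + (norm \<xi>)\<^sup>2) powr (s/2) * ?a \<xi>))" by (simp add: Js_def HT_HT)
  then show "sq_int u \<and> (\<exists>k. mk u = Js s k)" using u by blast
next
  assume "sq_int u \<and> (\<exists>k. mk u = Js s k)"
  then obtain k where u: "sq_int u" and k: "mk u = Js s k" by blast
  let ?w = "\<lambda>\<xi>::R3. (1 + (norm \<xi>)\<^sup>2) powr s"
  let ?b = "\<lambda>\<xi>. jm s \<xi> * fn k \<xi>"
  have wm: "?w \<in> borel_measurable borel" by measurable
  have "AE \<xi> in lborel. fn (HT (mk u)) \<xi> = ?b \<xi>" unfolding Js_eqD(1)[OF u k s] by (rule fn_mk[OF Js_eqD(2)[OF u k s]])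
  then have F: "AE \<xi> in lborel. cx (fn (HT (mk u))) \<xi> = cx ?b \<xi>" by (intro cx_AE_cong) auto
  have ws: "?w \<xi> * (cmod (cx ?b \<xi>))\<^sup>2 = ((fn k \<xi>)\<^sup>2 + (fn k (- \<xi>))\<^sup>2) / (2 * c3\<^sup>2)" for \<xi>
    using weight_jm[of \<xi> s "fn k \<xi>"] weight_jm[of \<xi> s "fn k (- \<xi>)"] by (simp add: cmod_cx_sq jm_even distrib_left)
  have "integrable lborel (\<lambda>\<xi>. ?w \<xi> * (cmod (cx ?b \<xi>))\<^sup>2)"
    unfolding ws using cmod_cx_integral(1)[OF l2fun_fn[of k]] unfolding cmod_cx_sq .
  then have "integrable lebesgue (\<lambda>\<xi>. ?w \<xi> * (cmod (cx (fn (HT (mk u))) \<xi>))\<^sup>2)"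
  proof -
    have m: "(\<lambda>\<xi>. ?w \<xi> * (cmod (cx a \<xi>))\<^sup>2) \<in> borel_measurable borel" if "a \<in> borel_measurable borel" for a
      by (intro borel_measurable_times borel_measurable_power measurable_norm_fun cx_measurable wm that)
    have e: "AE \<xi> in lborel. ?w \<xi> * (cmod (cx (fn (HT (mk u))) \<xi>))\<^sup>2 = ?w \<xi> * (cmod (cx ?b \<xi>))\<^sup>2"
      using F by eventually_elim simp
    assume "integrable lborel (\<lambda>\<xi>. ?w \<xi> * (cmod (cx ?b \<xi>))\<^sup>2)"
    then show ?thesis using lebesgue_integral_eq(2)[OF borel_imp_lebesgue[OF m] m e] by simp
  qed
  then show "u \<in> Hs s" using u is_fourier_cx[OF u] by (auto simp: Hs_def)
qed

lemma Hs_norm_eq: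
  assumes "sq_int u" "mk u = Js s k" "0 \<le> s" shows "Hs_norm s u = norm k"
proof -
  let ?w = "\<lambda>\<xi>::R3. (1 + (norm \<xi>)\<^sup>2) powr s"
  let ?b = "\<lambda>\<xi>. jm s \<xi> * fn k \<xi>"
  have wm: "?w \<in> borel_measurable borel" by measurable
  have b: "HT (mk u) = mk ?b" "l2fun ?b" using Js_eqD[OF assms] by auto
  have i: "integrable lborel (\<lambda>\<xi>. ?w \<xi> * (?b \<xi>)\<^sup>2)" unfolding weight_jm by (rule l2fun_integrable_sq[OF l2fun_fn])
  have "(2 * pi) powr (-3) * Re (LINT \<xi>|lebesgue. complex_of_real (?w \<xi>) * fourier u \<xi> * cnj (fourier u \<xi>)) = (LINT \<xi>|lborel. ?w \<xi> * ?b \<xi> * ?b \<xi>)"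
    by (rule plancherel_weighted[OF assms(1) b assms(1) b wm _ _ i i]) auto
  moreover have "(\<lambda>\<xi>. complex_of_real (?w \<xi>) * fourier u \<xi> * cnj (fourier u \<xi>)) = (\<lambda>\<xi>. complex_of_real (?w \<xi> * (cmod (fourier u \<xi>))\<^sup>2))"
    by (simp add: fun_eq_iff mult.assoc flip: complex_norm_square)
  moreover have "Re (LINT \<xi>|lebesgue. complex_of_real (?w \<xi> * (cmod (fourier u \<xi>))\<^sup>2)) = (LINT \<xi>|lebesgue. ?w \<xi> * (cmod (fourier u \<xi>))\<^sup>2)"
    by (simp only: integral_complex_of_real Re_complex_of_real)
  moreover have "(\<lambda>\<xi>. ?w \<xi> * ?b \<xi> * ?b \<xi>) = (\<lambda>\<xi>. (fn k \<xi>)\<^sup>2)" using weight_jm by (simp add: fun_eq_iff power2_eq_square mult.assoc)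
  ultimately have "(2 * pi) powr (-3) * (LINT \<xi>|lebesgue. ?w \<xi> * (cmod (fourier u \<xi>))\<^sup>2) = (norm k)\<^sup>2" by (simp only: norm_sq_l2)
  then show ?thesis by (simp add: Hs_norm_def)
qed

text \<open>The symbol of the fractional form in the variable \<open>k\<close>; the substitution has
  made it bounded by 1.\<close>

definition am :: "real \<Rightarrow> R3 \<Rightarrow> real" where "am s \<xi> = norm \<xi> powr (2 * s) * (jm s \<xi>)\<^sup>2"

lemma am_measurable[measurable]: "am s \<in> borel_measurable borel" unfolding am_def by measurable
lemma am_nonneg: "0 \<le> am s \<xi>" by (simp add: am_def)
lemma am_le_1: assumes "0 < s" shows "am s \<xi> \<le> 1"
proof -
  have "norm \<xi> powr (2 * s) = ((norm \<xi>)\<^sup>2) powr s"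
    by (cases "\<xi> = 0") (use assms in \<open>auto simp: powr_powr simp flip: powr_numeral\<close>)
  also have "\<dots> \<le> (1 + (norm \<xi>)\<^sup>2) powr s" using assms by (intro powr_mono2) auto
  finally have "am s \<xi> \<le> (1 + (norm \<xi>)\<^sup>2) powr s * (jm s \<xi>)\<^sup>2" unfolding am_def by (intro mult_right_mono) auto
  then show ?thesis by (simp add: jm_sq)
qed
lemma am_bmeas: "0 < s \<Longrightarrow> bmeas (am s)"
  using am_nonneg am_le_1 by (auto simp: bmeas_def intro!: exI[of _ 1])

lemma frac_form_eq:
  assumes u: "sq_int u" "mk u = Js s k" and v: "sq_int v" "mk v = Js s l" and s: "0 < s"
  shows "frac_form s u v = inner (mult_op (am s) k) l"
proof -
  let ?b = "\<lambda>k \<xi>. jm s \<xi> * fn k \<xi>"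
  have s0: "0 \<le> s" using s by simp
  have e: "norm \<xi> powr (2 * s) * (?b k \<xi>)\<^sup>2 = am s \<xi> * (fn k \<xi>)\<^sup>2" for k \<xi> by (simp add: am_def power_mult_distrib)
  have i: "integrable lborel (\<lambda>\<xi>. norm \<xi> powr (2 * s) * (?b k \<xi>)\<^sup>2)" for k
    unfolding e using l2fun_mult_integrable[OF l2fun_mult[OF am_bmeas[OF s] l2fun_fn[of k]] l2fun_fn[of k]] by (simp add: power2_eq_square mult.assoc)
  have "frac_form s u v = (LINT \<xi>|lborel. norm \<xi> powr (2 * s) * ?b k \<xi> * ?b l \<xi>)"
    unfolding frac_form_def
    by (rule plancherel_weighted[OF u(1) Js_eqD[OF u s0] v(1) Js_eqD[OF v s0] _ _ _ i i]) auto
  also have "\<dots> = inner (mult_op (am s) k) l"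
    unfolding inner_mult_op[OF am_bmeas[OF s]] by (rule Bochner_Integration.integral_cong) (auto simp: am_def power2_eq_square)
  finally show ?thesis .
qed

lemma Lt2_inner_eq:
  assumes u: "sq_int u" "mk u = Js t k" and v: "sq_int v" "mk v = Js t l" and t: "0 \<le> t"
  shows "Lt2_inner t u v = inner k l"
proof -
  let ?b = "\<lambda>k \<xi>. jm t \<xi> * fn k \<xi>"
  have i: "integrable lborel (\<lambda>\<xi>. (1 + (norm \<xi>)\<^sup>2) powr t * (?b k \<xi>)\<^sup>2)" for k
    unfolding weight_jm by (rule l2fun_integrable_sq[OF l2fun_fn])
  have "Lt2_inner t u v = (LINT \<xi>|lborel. (1 + (norm \<xi>)\<^sup>2) powr t * ?b k \<xi> * ?b l \<xi>)"
    unfolding Lt2_inner_def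
    by (rule plancherel_weighted[OF u(1) Js_eqD[OF u t] v(1) Js_eqD[OF v t] _ _ _ i i]) auto
  also have "\<dots> = inner k l" unfolding inner_l2_def
  proof (rule Bochner_Integration.integral_cong[OF refl])
    fix \<xi>
    have "(1 + (norm \<xi>)\<^sup>2) powr t * ?b k \<xi> * ?b l \<xi> = ((1 + (norm \<xi>)\<^sup>2) powr t * (jm t \<xi>)\<^sup>2) * (fn k \<xi> * fn l \<xi>)"
      by (simp only: power2_eq_square mult_ac)
    then show "(1 + (norm \<xi>)\<^sup>2) powr t * ?b k \<xi> * ?b l \<xi> = fn k \<xi> * fn l \<xi>" by (simp only: jm_sq mult_1)
  qed
  finally show ?thesis .
qed

lemma Lt2_iff:
  assumes t: "0 \<le> t" shows "f \<in> Lt2 t \<longleftrightarrow> sq_int f \<and> (\<exists>k. mk f = Js t k)"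
proof
  assume "f \<in> Lt2 t"
  then obtain h where f: "sq_int f" and h: "sq_int h"
    and eq: "AE \<xi> in lborel. fourier f \<xi> = complex_of_real (jm t \<xi>) * fourier h \<xi>"
    unfolding Lt2_def jm_def AE_lborel_iff by blast
  let ?a = "fn (HT (mk f))" and ?b = "fn (HT (mk h))"
  have "AE \<xi> in lborel. fn (HT (mk f)) \<xi> = jm t \<xi> * ?b \<xi>"
    using eq fourier_AE[OF f] fourier_AE[OF h]
  proof eventually_elim
    case (elim \<xi>)
    then have "cx ?a \<xi> = cx (\<lambda>\<xi>. jm t \<xi> * ?b \<xi>) \<xi>" using cx_mult_even[of "jm t" \<xi> ?b] jm_even[of t \<xi>] by simp
    then show ?case using cx_inj[of ?a \<xi>] cx_inj[of "\<lambda>\<xi>. jm t \<xi> * ?b \<xi>" \<xi>] by simp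
  qed
  from mk_cong[OF this] have "HT (mk f) = mult_op (jm t) (HT (mk h))" by (simp add: mult_op_def)
  then have "mk f = Js t (HT (mk h))" unfolding Js_def by (metis HT_HT)
  then show "sq_int f \<and> (\<exists>k. mk f = Js t k)" using f by blast
next
  assume "sq_int f \<and> (\<exists>k. mk f = Js t k)"
  then obtain k where f: "sq_int f" and k: "mk f = Js t k" by blast
  let ?h = "fn (HT k)"
  have h: "sq_int ?h" by (intro l2fun_sq_int l2fun_fn)
  have "AE \<xi> in lborel. cx (fn (HT (mk f))) \<xi> = cx (\<lambda>\<xi>. jm t \<xi> * fn k \<xi>) \<xi>"
    by (intro cx_AE_cong) (use fn_mk[OF Js_eqD(2)[OF f k t]] Js_eqD(1)[OF f k t] in auto)
  then have "AE \<xi> in lborel. fourier f \<xi> = complex_of_real (jm t \<xi>) * fourier ?h \<xi>"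
    using fourier_AE[OF f] fourier_AE[OF h]
    by eventually_elim (simp add: HT_HT cx_mult_even jm_even)
  then show "f \<in> Lt2 t" using f h unfolding Lt2_def jm_def AE_lborel_iff by blast
qed

lemma sq_int_fn: "sq_int (fn h)" by (intro l2fun_sq_int l2fun_fn)

section \<open>Sobolev embedding and weighted compactness\<close>

lemma ennreal_le_suminf: "h j \<le> (\<Sum>j. h j)" for h :: "nat \<Rightarrow> ennreal"
  using sum_le_suminf[OF summableI, of "{j}" h] by simp

locale sobolev =
  fixes s :: real
  assumes s: "3/4 < s" "s < 1"
begin

section \<open>The critical exponent and the splitting into low and high frequencies\<close>

definition ps :: real where "ps = 6 / (3 - 2 * s)"

text \<open>The first part is where \<open>3/4 < s\<close> enters: it makes the fourth power
  subcritical. The second is the matching of exponents that closes the embedding estimate.\<close>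

lemma ps: "ps > 4" "(3 - 2 * s) * (ps - 2) / 2 = 2 * s"
proof -
  define a where "a = 3 - 2 * s"
  have a: "0 < a" "a < 3 / 2" using s by (auto simp: a_def)
  have p: "ps = 6 / a" by (simp add: ps_def a_def)
  show "ps > 4" unfolding p using a by (simp add: less_divide_eq)
  have "a * (6 / a - 2) / 2 = 3 - a" using a by (simp add: right_diff_distrib)
  then show "(3 - 2 * s) * (ps - 2) / 2 = 2 * s" unfolding p a_def[symmetric] by (simp add: a_def)
qed

definition lowf :: "real \<Rightarrow> l2 \<Rightarrow> R3 \<Rightarrow> real" where
  "lowf A k \<xi> = indicator (ball 0 A) \<xi> * (jm s \<xi> * fn k \<xi>)"

text \<open>Given by an absolutely convergent integral, so it has a meaningful value at every point
  and can be bounded pointwise.\<close>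

definition low :: "real \<Rightarrow> l2 \<Rightarrow> R3 \<Rightarrow> real" where "low A k = hart (lowf A k)"

definition U :: "l2 \<Rightarrow> R3 \<Rightarrow> real" where "U k = fn (Js s k)"

lemma U_measurable[measurable, simp]: "U k \<in> borel_measurable borel" by (simp add: U_def)
lemma l2fun_U[simp]: "l2fun (U k)" by (simp add: U_def)
lemma mk_U[simp]: "mk (U k) = Js s k" by (simp add: U_def)

lemma jm_fn: "l2fun (\<lambda>\<xi>. jm s \<xi> * fn k \<xi>)" using s by (intro l2fun_mult jm_bmeas l2fun_fn) simp

lemma bmeas_ball: "bmeas (indicator (ball 0 A))"
  unfolding bmeas_def
proof
  show "\<exists>C. \<forall>x::R3. \<bar>indicator (ball 0 A) x :: real\<bar> \<le> C" by (intro exI[of _ 1]) (simp add: indicator_def)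
qed (intro borel_measurable_indicator borel_open open_ball)

lemma l2fun_ball: "l2fun (indicator (ball 0 A))"
  using emeasure_bounded_finite[of "ball (0::R3) A"] by (intro l2fun_indicator) auto

lemma lowf_l2: "l2fun (lowf A k)"
  unfolding lowf_def[abs_def] by (intro l2fun_mult bmeas_ball jm_fn)

lemma lowf_integrable: "integrable lborel (lowf A k)"
  unfolding lowf_def[abs_def] by (intro l2fun_mult_integrable l2fun_ball jm_fn)

lemma low_l2: "l2fun (low A k)" unfolding low_def by (intro hart_contraction lowf_l2 lowf_integrable)

lemma low_measurable[measurable, simp]: "low A k \<in> borel_measurable borel" using low_l2 by simp

lemma high_norm:
  "(LINT x|lborel. (U k x - low A k x)\<^sup>2) = (LINT \<xi>|lborel. (jm s \<xi> * fn k \<xi>)\<^sup>2 * indicator (- ball 0 A) \<xi>)"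
proof -
  have "(LINT x|lborel. (U k x - low A k x)\<^sup>2) = (norm (Js s k - mk (low A k)))\<^sup>2"
    using norm_sq_mk[OF l2fun_diff[OF l2fun_U low_l2], of k A k] mk_diff[OF l2fun_U low_l2, of k A k] by simp
  also have "Js s k - mk (low A k) = HT (mult_op (jm s) k - mk (lowf A k))"
    by (simp add: Js_def low_def HT_mk lowf_l2 lowf_integrable bounded_linear.linear[OF HT_bounded_linear] linear_diff)
  also have "norm \<dots> = norm (mult_op (jm s) k - mk (lowf A k))" by (rule norm_HT)
  also have "mult_op (jm s) k - mk (lowf A k) = mk (\<lambda>\<xi>. jm s \<xi> * fn k \<xi> - lowf A k \<xi>)"
    unfolding mult_op_def by (rule mk_diff[OF jm_fn lowf_l2, symmetric])
  also have "(norm \<dots>)\<^sup>2 = (LINT \<xi>|lborel. (jm s \<xi> * fn k \<xi> - lowf A k \<xi>)\<^sup>2)"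
    by (rule norm_sq_mk[OF l2fun_diff[OF jm_fn lowf_l2]])
  also have "\<dots> = (LINT \<xi>|lborel. (jm s \<xi> * fn k \<xi>)\<^sup>2 * indicator (- ball 0 A) \<xi>)"
    by (rule Bochner_Integration.integral_cong) (auto simp: lowf_def indicator_def)
  finally show ?thesis .
qed

definition jI :: "real \<Rightarrow> real" where "jI A = (LINT \<xi>|lborel. (jm s \<xi>)\<^sup>2 * indicator (ball 0 A) \<xi>)"

lemma jm_le_powr: assumes "0 < a" "a \<le> norm \<xi>" shows "(jm s \<xi>)\<^sup>2 \<le> a powr (- 2 * s)"
proof -
  have "a\<^sup>2 \<le> (norm \<xi>)\<^sup>2" using assms by (intro power_mono) auto
  then have "a\<^sup>2 \<le> 1 + (norm \<xi>)\<^sup>2" by simp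
  then have "(1 + (norm \<xi>)\<^sup>2) powr (- s) \<le> (a\<^sup>2) powr (- s)" using assms s by (intro powr_mono2') auto
  moreover have "(a\<^sup>2) powr (- s) = a powr (- 2 * s)" using assms by (simp add: powr_powr flip: powr_numeral)
  moreover have "(jm s \<xi>)\<^sup>2 = (1 + (norm \<xi>)\<^sup>2) powr (- s)" by (simp add: jm_def power2_eq_square flip: powr_add)
  ultimately show ?thesis by simp
qed

lemma jm_sq_le_1: "(jm s \<xi>)\<^sup>2 \<le> 1"
  using jm_le_1[of s \<xi>] jm_pos[of s \<xi>] s by (auto intro: power_le_one less_imp_le)

lemma ball_integrable: "integrable lborel (indicator (ball (0::R3) A) :: R3 \<Rightarrow> real)"
  using emeasure_bounded_finite[of "ball (0::R3) A"] by (intro integrable_real_indicator) auto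

lemma ball_integral: "0 \<le> A \<Longrightarrow> (LINT x|lborel. indicator (ball (0::R3) A) x) = unit_ball_vol 3 * A ^ 3"
  using content_ball[of A "0::R3"] by simp

lemma jI_integrable: "integrable lborel (\<lambda>\<xi>. (jm s \<xi>)\<^sup>2 * indicator (ball 0 A) \<xi>)"
proof -
  have "integrable lborel (\<lambda>\<xi>. indicator (ball (0::R3) A) \<xi> * (jm s \<xi>)\<^sup>2)"
    by (rule integrable_mult_bounded[where C = 1, OF ball_integrable]) (use jm_sq_le_1 in auto)
  then show ?thesis by (simp add: mult.commute)
qed

lemma jI_nonneg: "0 \<le> jI A" unfolding jI_def by (rule Bochner_Integration.integral_nonneg) simp

lemma jI_mono: "A \<le> B \<Longrightarrow> jI A \<le> jI B"
  unfolding jI_def by (rule integral_mono[OF jI_integrable jI_integrable]) (auto simp: indicator_def)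

lemma jI_le_vol: "0 \<le> A \<Longrightarrow> jI A \<le> unit_ball_vol 3 * A ^ 3"
  unfolding jI_def ball_integral[symmetric]
  by (rule integral_mono[OF jI_integrable ball_integrable]) (use jm_sq_le_1 in \<open>auto simp: indicator_def\<close>)

definition \<theta> :: real where "\<theta> = 2 powr (3 - 2 * s)"

lemma theta: "\<theta> > 1" unfolding \<theta>_def using s by (intro gr_one_powr) auto

text \<open>Doubling the radius adds a shell of volume of order \<open>8 ^ j\<close> on which the
  weight is at most \<open>(2 ^ j) powr (- 2 * s)\<close>; as \<open>3 - 2 * s > 0\<close>, the
  contributions grow geometrically and the last ones dominate.\<close>

lemma jI_dyadic: "\<exists>C>0. \<forall>j. jI (2 ^ j) \<le> C * \<theta> ^ j"
proof -
  let ?V = "unit_ball_vol 3"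
  have V: "?V > 0" by simp
  \<comment> \<open>The first summand settles \<open>j = 0\<close>; the second makes one shell,
    \<open>8 * ?V * \<theta> ^ j\<close>, at most the increment from \<open>C * \<theta> ^ j\<close>
    to \<open>C * \<theta> ^ Suc j\<close>.\<close>
  define C where "C = ?V + 8 * ?V / (\<theta> - 1)"
  have d: "0 < 8 * ?V / (\<theta> - 1)" using V theta by (intro divide_pos_pos) auto
  have "C * (\<theta> - 1) = ?V * (\<theta> - 1) + 8 * ?V" using theta by (simp add: C_def distrib_right)
  moreover have "0 \<le> ?V * (\<theta> - 1)" using V theta by (intro mult_nonneg_nonneg) auto
  ultimately have C: "C > 0" "?V \<le> C" "8 * ?V \<le> C * (\<theta> - 1)" using V d unfolding C_def by linarith+
  have "jI (2 ^ j) \<le> C * \<theta> ^ j" for j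
  proof (induction j)
    case 0 show ?case using jI_le_vol[of 1] C by simp
  next
    case (Suc j)
    let ?a = "2 ^ j :: real" and ?b = "2 ^ Suc j :: real"
    have i: "integrable lborel (\<lambda>\<xi>. ?a powr (- 2 * s) * indicator (ball (0::R3) ?b) \<xi>)" using ball_integrable by simp
    have "jI ?b \<le> (LINT \<xi>|lborel. (jm s \<xi>)\<^sup>2 * indicator (ball 0 ?a) \<xi> + ?a powr (- 2 * s) * indicator (ball (0::R3) ?b) \<xi>)"
      unfolding jI_def
    proof (rule integral_mono)
      fix \<xi> :: R3
      show "(jm s \<xi>)\<^sup>2 * indicator (ball 0 ?b) \<xi> \<le> (jm s \<xi>)\<^sup>2 * indicator (ball 0 ?a) \<xi> + ?a powr (- 2 * s) * indicator (ball (0::R3) ?b) \<xi>"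
        using jm_le_powr[of ?a \<xi>] by (auto simp: indicator_def)
    qed (use i jI_integrable in auto)
    also have "\<dots> = jI ?a + ?a powr (- 2 * s) * (?V * ?b ^ 3)"
      using i jI_integrable ball_integral[of ?b] by (simp add: jI_def)
    also have "?a powr (- 2 * s) * (?V * ?b ^ 3) = 8 * ?V * \<theta> ^ j"
    proof -
      have "\<theta> ^ j = 2 powr (real j * (3 - 2 * s))" by (simp add: \<theta>_def powr_powr mult.commute flip: powr_realpow)
      also have "\<dots> = 2 powr (real j * (- 2 * s)) * 2 powr (real (j * 3))" by (simp add: algebra_simps flip: powr_add)
      also have "2 powr (real (j * 3)) = ?a ^ 3" by (simp only: powr_realpow power_mult zero_less_numeral)
      also have "2 powr (real j * (- 2 * s)) = ?a powr (- 2 * s)" by (simp add: powr_powr flip: powr_realpow)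
      finally show ?thesis by (simp add: power_mult_distrib)
    qed
    also have "jI ?a + 8 * ?V * \<theta> ^ j \<le> C * \<theta> ^ j + C * (\<theta> - 1) * \<theta> ^ j"
      using Suc C theta by (intro add_mono mult_right_mono) auto
    also have "\<dots> = C * \<theta> ^ Suc j" by (simp add: algebra_simps)
    finally show ?case by simp
  qed
  then show ?thesis using C by blast
qed

lemma jI_bound: "\<exists>C>0. \<forall>A>0. jI A \<le> C * A powr (3 - 2 * s)"
proof -
  obtain C where C: "C > 0" "\<And>j. jI (2 ^ j) \<le> C * \<theta> ^ j" using jI_dyadic by blast
  let ?V = "unit_ball_vol 3"
  have "jI A \<le> (?V + C * \<theta>) * A powr (3 - 2 * s)" if A: "A > 0" for A
  proof (cases "A \<le> 1")
    case True
    have "A ^ 3 = A powr 3" using A by (simp add: powr_numeral)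
    also have "\<dots> \<le> A powr (3 - 2 * s)" using A True s by (intro powr_mono') auto
    finally have "?V * A ^ 3 \<le> ?V * A powr (3 - 2 * s)" by (intro mult_left_mono) auto
    also have "\<dots> \<le> (?V + C * \<theta>) * A powr (3 - 2 * s)" using C theta by (intro mult_right_mono) auto
    finally show ?thesis using jI_le_vol[of A] A by simp
  next
    case False
    define j where "j = nat \<lfloor>log 2 A\<rfloor>"
    have "log 2 A \<ge> 0" using False by (simp add: zero_le_log_cancel_iff)
    then have j: "real j \<le> log 2 A" "log 2 A \<le> real (Suc j)" unfolding j_def by linarith+
    have "A = 2 powr (log 2 A)" using A by simp
    also have "\<dots> \<le> 2 powr (real (Suc j))" using j by (intro powr_mono) auto
    finally have "A \<le> 2 ^ Suc j" by (simp only: powr_realpow zero_less_numeral)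
    then have "jI A \<le> C * \<theta> ^ Suc j" using jI_mono C(2) order_trans by blast
    also have "\<theta> ^ Suc j = \<theta> * 2 powr (real j * (3 - 2 * s))" by (simp add: \<theta>_def powr_powr mult.commute flip: powr_realpow)
    also have "C * \<dots> \<le> C * (\<theta> * 2 powr (log 2 A * (3 - 2 * s)))"
      using C theta j s by (intro mult_left_mono powr_mono mult_right_mono) auto
    also have "2 powr (log 2 A * (3 - 2 * s)) = A powr (3 - 2 * s)" using A by (simp flip: powr_powr)
    also have "C * (\<theta> * A powr (3 - 2 * s)) \<le> (?V + C * \<theta>) * A powr (3 - 2 * s)" by (simp add: algebra_simps)
    finally show ?thesis .
  qed
  moreover have "?V + C * \<theta> > 0" using C theta by (intro add_pos_pos mult_pos_pos) auto
  ultimately show ?thesis by blast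
qed

text \<open>The vector representing evaluation of the low-frequency part at \<open>x\<close>. It
  gives pointwise bounds by Cauchy-Schwarz and pointwise convergence along weakly convergent
  sequences.\<close>

definition wave :: "real \<Rightarrow> R3 \<Rightarrow> R3 \<Rightarrow> real" where
  "wave A x \<xi> = c3 * (indicator (ball 0 A) \<xi> * (jm s \<xi> * cas (x \<bullet> \<xi>)))"

lemma cas_inner_measurable: "(\<lambda>\<xi>. cas (x \<bullet> \<xi>)) \<in> borel_measurable borel"
  unfolding cas_def by (intro borel_measurable_continuous_onI continuous_intros)

lemma jm_measurable: "jm s \<in> borel_measurable borel" using jm_bmeas s by (auto simp: bmeas_def)

lemma wave_l2: "l2fun (wave A x)"
proof (rule l2fun_dominated[OF l2fun_ball[of A], of _ "2 * c3"])
  show "wave A x \<in> borel_measurable borel" 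
    unfolding wave_def[abs_def]
    by (intro borel_measurable_times borel_measurable_const borel_measurable_indicator cas_inner_measurable jm_measurable open_ball borel_open)
  fix \<xi>
  have "\<bar>jm s \<xi> * cas (x \<bullet> \<xi>)\<bar> \<le> 1 * 2" unfolding abs_mult
    using jm_le_1[of s \<xi>] jm_pos[of s \<xi>] cas_bound s by (intro mult_mono) auto
  then show "\<bar>wave A x \<xi>\<bar> \<le> 2 * c3 * \<bar>indicator (ball 0 A) \<xi>\<bar>"
    using c3_pos by (auto simp: wave_def abs_mult indicator_def)
qed

lemma low_eq: "low A k x = inner k (mk (wave A x))"
proof -
  have "inner k (mk (wave A x)) = (LINT \<xi>|lborel. c3 * (lowf A k \<xi> * cas (\<xi> \<bullet> x)))"
    unfolding inner_mk_right[OF wave_l2] by (rule Bochner_Integration.integral_cong) (auto simp: wave_def lowf_def inner_commute mult_ac)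
  then show ?thesis by (simp add: low_def hart_def)
qed

lemma wave_norm: "norm (mk (wave A x)) \<le> 2 * c3 * sqrt (jI A)"
proof -
  have "(norm (mk (wave A x)))\<^sup>2 = (LINT \<xi>|lborel. (wave A x \<xi>)\<^sup>2)" by (rule norm_sq_mk[OF wave_l2])
  also have "\<dots> \<le> (LINT \<xi>|lborel. (2 * c3)\<^sup>2 * ((jm s \<xi>)\<^sup>2 * indicator (ball 0 A) \<xi>))"
  proof (rule integral_mono)
    fix \<xi>
    have "(cas (x \<bullet> \<xi>))\<^sup>2 \<le> 2\<^sup>2" using power_mono[OF cas_bound abs_ge_zero, of "x \<bullet> \<xi>" 2] by simp
    then have "(c3 * jm s \<xi>)\<^sup>2 * (cas (x \<bullet> \<xi>))\<^sup>2 \<le> (c3 * jm s \<xi>)\<^sup>2 * 2\<^sup>2" by (intro mult_left_mono) auto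
    then show "(wave A x \<xi>)\<^sup>2 \<le> (2 * c3)\<^sup>2 * ((jm s \<xi>)\<^sup>2 * indicator (ball 0 A) \<xi>)"
      by (auto simp: wave_def indicator_def power_mult_distrib mult_ac)
  qed (use wave_l2 jI_integrable in \<open>auto intro: l2fun_integrable_sq\<close>)
  also have "\<dots> = (2 * c3)\<^sup>2 * jI A" by (simp add: jI_def)
  also have "\<dots> = (2 * c3 * sqrt (jI A))\<^sup>2"
    by (simp only: power_mult_distrib real_sqrt_pow2 jI_nonneg)
  finally show ?thesis by (rule power2_le_imp_le) (use c3_pos jI_nonneg[of A] in simp)
qed

lemma low_bound: "norm k \<le> B \<Longrightarrow> \<bar>low A k x\<bar> \<le> B * (2 * c3 * sqrt (jI A))"
  unfolding low_eq using wave_norm[of A x] by (intro order_trans[OF Cauchy_Schwarz_ineq2] mult_mono) (auto intro: order_trans[OF norm_ge_zero])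

lemma Js_norm_le: "norm (Js s k) \<le> norm k"
  unfolding Js_def norm_HT using mult_op_norm[of "jm s" 1 k] jm_bmeas[of s] jm_le_1[of s] jm_pos[of s] s by (simp add: abs_of_pos)

text \<open>The critical embedding, by cutting the frequencies at a level adapted to the dyadic size of \<open>U k x\<close>
  (Chemin and Xu).\<close>

theorem sobolev_bound: "\<exists>C. \<forall>k. norm k \<le> B \<longrightarrow> (\<integral>\<^sup>+x. ennreal (\<bar>U k x\<bar> powr ps) \<partial>lborel) \<le> ennreal C"
proof (cases "B > 0")
  case False
  have "(\<integral>\<^sup>+x. ennreal (\<bar>U k x\<bar> powr ps) \<partial>lborel) \<le> ennreal 0" if "norm k \<le> B" for k
  proof -
    have "norm k = 0" using that False norm_ge_zero[of k] by linarith
    then have "Js s k = 0" using Js_norm_le[of k] by simp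
    then have "U k = fn 0" by (simp only: U_def)
    then have "(\<integral>\<^sup>+x. ennreal (\<bar>U k x\<bar> powr ps) \<partial>lborel) = (\<integral>\<^sup>+x. 0 \<partial>(lborel :: R3 measure))"
      by (intro nn_integral_cong_AE) (use fn_zero in \<open>eventually_elim; simp\<close>)
    then show ?thesis by simp
  qed
  then show ?thesis by blast
next
  case B: True
  obtain C1 where C1: "C1 > 0" "\<And>A. A > 0 \<Longrightarrow> jI A \<le> C1 * A powr (3 - 2 * s)" using jI_bound by blast
  \<comment> \<open>Together with \<open>A j\<close> below it is fixed so that frequencies below
    \<open>A j\<close> contribute at most \<open>2 ^ j / 2\<close> at every point.\<close>
  define c where "c = 4 * B * c3 * sqrt C1"
  have c: "c > 0" using B C1 c3_pos by (simp add: c_def)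
  let ?e = "2 / (3 - 2 * s)"
  have e: "?e > 0" using s by simp
  define A where "A j = (2 ^ j / c) powr ?e" for j :: nat
  have A: "A j > 0" for j using c by (simp add: A_def)
  have low: "\<bar>low (A j) k x\<bar> \<le> 2 ^ j / 2" if "norm k \<le> B" for j k x
  proof -
    have "?e * (3 - 2 * s) = 2" using e by (metis nonzero_eq_divide_eq divide_eq_0_iff less_irrefl)
    then have "A j powr (3 - 2 * s) = (2 ^ j / c) powr 2" unfolding A_def powr_powr by (rule arg_cong)
    also have "\<dots> = (2 ^ j / c)\<^sup>2" using c by (intro powr_numeral) simp
    finally have "jI (A j) \<le> C1 * (2 ^ j / c)\<^sup>2" using C1(2)[OF A[of j]] by simp
    then have "sqrt (jI (A j)) \<le> sqrt (C1 * (2 ^ j / c)\<^sup>2)" by (rule real_sqrt_le_mono)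
    also have "\<dots> = sqrt C1 * (2 ^ j / c)" using c by (simp add: real_sqrt_mult)
    finally have "B * (2 * c3 * sqrt (jI (A j))) \<le> B * (2 * c3 * (sqrt C1 * (2 ^ j / c)))"
      using B c3_pos by (intro mult_left_mono) auto
    also have "\<dots> = 2 ^ j / 2" using c B c3_pos C1 by (simp add: c_def field_simps)
    finally show ?thesis using low_bound[OF that, of "A j" x] by linarith
  qed
  let ?q = "ps - 2"
  have q: "?q > 2" using ps by simp
  let ?h = "\<lambda>k j x. (2 powr (real j * ?q)) * (U k x - low (A j) k x)\<^sup>2"
  \<comment> \<open>Where \<open>\<bar>U k x\<bar>\<close> lies between \<open>2 ^ j\<close> and
    \<open>2 ^ (j + 1)\<close>, the high part is at least half of it. Two of the \<open>ps\<close>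
    powers are measured by the high part and the others by \<open>2 ^ j\<close>; summing over all
    \<open>j\<close> removes the dependence of \<open>j\<close> on \<open>x\<close>. Small values
    are left to the square.\<close>
  have pt: "ennreal (\<bar>U k x\<bar> powr ps) \<le> ennreal ((U k x)\<^sup>2) + ennreal (2 powr ps) * (\<Sum>j. ennreal (?h k j x))" if k: "norm k \<le> B" for k x
  proof (cases "\<bar>U k x\<bar> \<le> 1")
    case True
    have "\<bar>U k x\<bar> powr ps \<le> (U k x)\<^sup>2"
    proof (cases "U k x = 0")
      case False
      then have "\<bar>U k x\<bar> powr ps \<le> \<bar>U k x\<bar> powr 2" using True ps by (intro powr_mono') auto
      then show ?thesis using False by (simp add: powr_numeral)
    qed simp
    then have "ennreal (\<bar>U k x\<bar> powr ps) \<le> ennreal ((U k x)\<^sup>2) + 0" by (simp add: ennreal_leI)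
    also have "\<dots> \<le> ennreal ((U k x)\<^sup>2) + ennreal (2 powr ps) * (\<Sum>j. ennreal (?h k j x))" by (intro add_left_mono) simp
    finally show ?thesis .
  next
    case False
    let ?u = "\<bar>U k x\<bar>"
    define j where "j = nat \<lfloor>log 2 ?u\<rfloor>"
    have "log 2 ?u \<ge> 0" using False by (simp add: zero_le_log_cancel_iff)
    then have j: "real j \<le> log 2 ?u" "log 2 ?u \<le> real j + 1" unfolding j_def by linarith+
    have u: "?u = 2 powr (log 2 ?u)" using False by simp
    have j1: "2 ^ j \<le> ?u" using u powr_mono[OF j(1), of 2] by (simp add: powr_realpow)
    have j2: "?u / 2 \<le> 2 powr (real j)" using u powr_mono[OF j(2), of 2] by (simp add: powr_add)
    have "?u / 2 \<le> \<bar>U k x - low (A j) k x\<bar>" using low[OF k, of j x] j1 by linarith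
    then have "(?u / 2)\<^sup>2 \<le> \<bar>U k x - low (A j) k x\<bar>\<^sup>2" by (intro power_mono) auto
    moreover have "(?u / 2) powr ?q \<le> (2 powr (real j)) powr ?q" using j2 q by (intro powr_mono2) auto
    ultimately have "(?u / 2) powr ?q * (?u / 2)\<^sup>2 \<le> ?h k j x" by (simp add: powr_powr mult_mono)
    moreover have "(?u / 2) powr ?q * (?u / 2)\<^sup>2 = (?u / 2) powr ps"
      using False powr_add[of "?u / 2" ?q 2] by (simp add: powr_numeral)
    moreover have "(?u / 2) powr ps = ?u powr ps / 2 powr ps" by (rule powr_divide)
    ultimately have "?u powr ps / 2 powr ps \<le> ?h k j x" by simp
    then have "?u powr ps \<le> 2 powr ps * ?h k j x" using pos_divide_le_eq[of "2 powr ps" "?u powr ps" "?h k j x"] by (simp only: powr_gt_zero mult.commute[of "2 powr ps"])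
    then have "ennreal (?u powr ps) \<le> ennreal (2 powr ps) * ennreal (?h k j x)" 
    proof -
      have "ennreal (2 powr ps) * ennreal (?h k j x) = ennreal (2 powr ps * ?h k j x)" by (rule ennreal_mult[symmetric]) simp_all
      then show ?thesis using \<open>?u powr ps \<le> _\<close> by (simp only: ennreal_leI)
    qed
    also have "\<dots> \<le> ennreal (2 powr ps) * (\<Sum>j. ennreal (?h k j x))"
      by (intro mult_left_mono zero_le ennreal_le_suminf)
    also have "\<dots> \<le> ennreal ((U k x)\<^sup>2) + ennreal (2 powr ps) * (\<Sum>j. ennreal (?h k j x))" by (rule add_increasing) simp_all
    finally show ?thesis .
  qed
  define D where "D = 2 powr ?q * (c powr ?q) / (2 powr ?q - 1)"
  have q1: "2 powr ?q > 1" using q by (intro gr_one_powr) auto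
  \<comment> \<open>Only levels with \<open>A j\<close> at most \<open>norm \<xi>\<close>
    contribute, and the largest of them dominates the geometric sum; up to constants it has the size
    of \<open>norm \<xi>\<close> to the power
    \<open>(3 - 2 * s) * (ps - 2) / 2 = 2 * s\<close>.\<close>
  have geo: "(\<Sum>j. ennreal (2 powr (real j * ?q) * indicator (- ball 0 (A j)) \<xi>)) \<le> ennreal (D * norm \<xi> powr (2 * s))" for \<xi> :: R3
  proof (rule suminf_le_const)
    fix n :: nat
    let ?S = "{j. j < n \<and> A j \<le> norm \<xi>}"
    have sum: "(\<Sum>j<n. ennreal (2 powr (real j * ?q) * indicator (- ball 0 (A j)) \<xi>)) = ennreal (\<Sum>j\<in>?S. (2 powr ?q) ^ j)"
    proof -
      have "(\<Sum>j<n. 2 powr (real j * ?q) * indicator (- ball 0 (A j)) \<xi>) = (\<Sum>j<n. if A j \<le> norm \<xi> then (2 powr ?q) ^ j else 0)"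
        by (rule sum.cong) (auto simp: indicator_def powr_powr mult.commute simp flip: powr_realpow)
      also have "\<dots> = (\<Sum>j\<in>?S. (2 powr ?q) ^ j)" by (subst sum.If_cases) (auto intro!: sum.cong)
      finally show ?thesis by (simp add: sum_ennreal)
    qed
    show "(\<Sum>j<n. ennreal (2 powr (real j * ?q) * indicator (- ball 0 (A j)) \<xi>)) \<le> ennreal (D * norm \<xi> powr (2 * s))"
    proof (cases "?S = {}")
      case True show ?thesis unfolding sum unfolding True by simp
    next
      case False
      define m where "m = Max ?S"
      have fin: "finite ?S" by simp
      have m: "m \<in> ?S" unfolding m_def by (rule Max_in[OF fin False])
      have "?S \<subseteq> {..m}" using Max_ge[OF fin] by (auto simp: m_def)
      then have "(\<Sum>j\<in>?S. (2 powr ?q) ^ j) \<le> (\<Sum>j\<in>{..m}. (2 powr ?q) ^ j)" by (intro sum_mono2) auto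
      also have "\<dots> = ((2 powr ?q) ^ Suc m - 1) / (2 powr ?q - 1)"
        using q1 geometric_sum[of "2 powr ?q" "Suc m"] unfolding lessThan_Suc_atMost by argo
      also have "\<dots> \<le> (2 powr ?q) ^ Suc m / (2 powr ?q - 1)" using q1 by (intro divide_right_mono) auto
      also have "\<dots> \<le> D * norm \<xi> powr (2 * s)"
      proof -
        have "A m \<le> norm \<xi>" using m by simp
        then have "A m powr ((3 - 2 * s) / 2) \<le> norm \<xi> powr ((3 - 2 * s) / 2)" using A[of m] s by (intro powr_mono2) auto
        moreover have "A m powr ((3 - 2 * s) / 2) = 2 ^ m / c" 
        proof -
          have "?e * (3 - 2 * s) = 2" using e by (metis nonzero_eq_divide_eq divide_eq_0_iff less_irrefl)
          then have "?e * ((3 - 2 * s) / 2) = 1" by simp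
          then have "A m powr ((3 - 2 * s) / 2) = (2 ^ m / c) powr 1" unfolding A_def powr_powr by (rule arg_cong)
          then show ?thesis using c by simp
        qed
        ultimately have "2 ^ m / c \<le> norm \<xi> powr ((3 - 2 * s) / 2)" by simp
        then have "2 ^ m \<le> c * norm \<xi> powr ((3 - 2 * s) / 2)" using c by (simp only: pos_divide_le_eq mult.commute[of c])
        then have "(2 ^ m) powr ?q \<le> (c * norm \<xi> powr ((3 - 2 * s) / 2)) powr ?q" using q by (intro powr_mono2) auto
        also have "\<dots> = c powr ?q * norm \<xi> powr (2 * s)" using c ps(2) by (simp add: powr_mult powr_powr)
        also have "(2 ^ m) powr ?q = (2 powr ?q) ^ m" by (simp add: powr_powr mult.commute flip: powr_realpow)
        finally have "2 powr ?q * (2 powr ?q) ^ m \<le> 2 powr ?q * (c powr ?q * norm \<xi> powr (2 * s))" by (intro mult_left_mono) auto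
        then have "(2 powr ?q) ^ Suc m / (2 powr ?q - 1) \<le> 2 powr ?q * (c powr ?q * norm \<xi> powr (2 * s)) / (2 powr ?q - 1)"
          using q1 by (intro divide_right_mono) auto
        then show ?thesis by (simp add: D_def mult.assoc)
      qed
      finally show ?thesis unfolding sum by (rule ennreal_leI)
    qed
  qed auto
  have "(\<integral>\<^sup>+x. ennreal (\<bar>U k x\<bar> powr ps) \<partial>lborel) \<le> ennreal (B\<^sup>2 + 2 powr ps * (D * B\<^sup>2))" if k: "norm k \<le> B" for k
  proof -
    have D: "0 \<le> D" using q1 by (simp add: D_def)
    have kB: "(norm k)\<^sup>2 \<le> B\<^sup>2" using k by (intro power_mono) auto
    have mh: "(\<lambda>x. ennreal (?h k j x)) \<in> borel_measurable lborel" for j by simp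
    have hj: "(\<integral>\<^sup>+x. ennreal (?h k j x) \<partial>lborel) = (\<integral>\<^sup>+\<xi>. ennreal (2 powr (real j * ?q) * indicator (- ball 0 (A j)) \<xi>) * ennreal ((jm s \<xi> * fn k \<xi>)\<^sup>2) \<partial>lborel)" for j
    proof -
      have i1: "integrable lborel (\<lambda>x. (U k x - low (A j) k x)\<^sup>2)" by (intro l2fun_integrable_sq l2fun_diff l2fun_U low_l2)
      have i2: "integrable lborel (\<lambda>\<xi>. (jm s \<xi> * fn k \<xi>)\<^sup>2 * indicator (- ball 0 (A j)) \<xi>)"
        by (intro integrable_real_mult_indicator l2fun_integrable_sq[OF jm_fn]) (simp_all add: borel_comp borel_open)
      have "(\<integral>\<^sup>+x. ennreal (?h k j x) \<partial>lborel) = ennreal (2 powr (real j * ?q)) * (\<integral>\<^sup>+x. ennreal ((U k x - low (A j) k x)\<^sup>2) \<partial>lborel)"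
        by (simp add: ennreal_mult nn_integral_cmult)
      also have "(\<integral>\<^sup>+x. ennreal ((U k x - low (A j) k x)\<^sup>2) \<partial>lborel) = ennreal (LINT x|lborel. (U k x - low (A j) k x)\<^sup>2)"
        by (rule nn_integral_eq_integral[OF i1]) simp
      also have "\<dots> = (\<integral>\<^sup>+\<xi>. ennreal ((jm s \<xi> * fn k \<xi>)\<^sup>2 * indicator (- ball 0 (A j)) \<xi>) \<partial>lborel)"
        unfolding high_norm by (rule nn_integral_eq_integral[OF i2, symmetric]) (auto simp: indicator_def)
      also have "ennreal (2 powr (real j * ?q)) * \<dots> = (\<integral>\<^sup>+\<xi>. ennreal (2 powr (real j * ?q)) * ennreal ((jm s \<xi> * fn k \<xi>)\<^sup>2 * indicator (- ball 0 (A j)) \<xi>) \<partial>lborel)"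
        by (rule nn_integral_cmult[symmetric]) simp
      also have "\<dots> = (\<integral>\<^sup>+\<xi>. ennreal (2 powr (real j * ?q) * indicator (- ball 0 (A j)) \<xi>) * ennreal ((jm s \<xi> * fn k \<xi>)\<^sup>2) \<partial>lborel)"
        by (rule nn_integral_cong) (auto simp: indicator_def ennreal_mult)
      finally show ?thesis .
    qed
    have "(\<integral>\<^sup>+x. ennreal (\<bar>U k x\<bar> powr ps) \<partial>lborel) \<le> (\<integral>\<^sup>+x. ennreal ((U k x)\<^sup>2) + ennreal (2 powr ps) * (\<Sum>j. ennreal (?h k j x)) \<partial>lborel)"
      by (rule nn_integral_mono) (rule pt[OF k])
    also have "\<dots> = (\<integral>\<^sup>+x. ennreal ((U k x)\<^sup>2) \<partial>lborel) + ennreal (2 powr ps) * (\<Sum>j. \<integral>\<^sup>+x. ennreal (?h k j x) \<partial>lborel)"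
    proof -
      have ms: "(\<lambda>x. \<Sum>j. ennreal (?h k j x)) \<in> borel_measurable lborel" by (rule borel_measurable_suminf_order) (rule mh)
      have mu: "(\<lambda>x. ennreal ((U k x)\<^sup>2)) \<in> borel_measurable lborel" by simp
      show ?thesis
        unfolding nn_integral_add[OF mu borel_measurable_times_ennreal[OF borel_measurable_const ms]] nn_integral_cmult[OF ms] nn_integral_suminf[OF mh] ..
    qed
    also have "(\<Sum>j. \<integral>\<^sup>+x. ennreal (?h k j x) \<partial>lborel) = (\<integral>\<^sup>+\<xi>. (\<Sum>j. ennreal (2 powr (real j * ?q) * indicator (- ball 0 (A j)) \<xi>) * ennreal ((jm s \<xi> * fn k \<xi>)\<^sup>2)) \<partial>lborel)"
      unfolding hj by (rule nn_integral_suminf[symmetric]) simp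
    also have "\<dots> \<le> (\<integral>\<^sup>+\<xi>. ennreal (D * (fn k \<xi>)\<^sup>2) \<partial>lborel)"
    proof (rule nn_integral_mono)
      fix \<xi>
      have "(\<Sum>j. ennreal (2 powr (real j * ?q) * indicator (- ball 0 (A j)) \<xi>) * ennreal ((jm s \<xi> * fn k \<xi>)\<^sup>2))
         = (\<Sum>j. ennreal (2 powr (real j * ?q) * indicator (- ball 0 (A j)) \<xi>)) * ennreal ((jm s \<xi> * fn k \<xi>)\<^sup>2)"
        by (rule ennreal_suminf_multc)
      also have "\<dots> \<le> ennreal (D * norm \<xi> powr (2 * s)) * ennreal ((jm s \<xi> * fn k \<xi>)\<^sup>2)" by (intro mult_right_mono geo) simp
      \<comment> \<open>The power of the frequency is exactly the one that
        \<open>(jm s \<xi>)\<^sup>2\<close> absorbs.\<close>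
      also have "\<dots> = ennreal (D * (am s \<xi> * (fn k \<xi>)\<^sup>2))"
        using D by (simp add: ennreal_mult[symmetric] am_def power_mult_distrib mult_ac)
      also have "\<dots> \<le> ennreal (D * (1 * (fn k \<xi>)\<^sup>2))"
        using D am_le_1[of s \<xi>] s by (intro ennreal_leI mult_left_mono mult_right_mono) auto
      finally show "(\<Sum>j. ennreal (2 powr (real j * ?q) * indicator (- ball 0 (A j)) \<xi>) * ennreal ((jm s \<xi> * fn k \<xi>)\<^sup>2)) \<le> ennreal (D * (fn k \<xi>)\<^sup>2)" by simp
    qed
    also have "\<dots> = ennreal (D * (norm k)\<^sup>2)" using D by (simp add: ennreal_mult nn_integral_cmult nn_integral_sq_fn)
    also have "(\<integral>\<^sup>+x. ennreal ((U k x)\<^sup>2) \<partial>lborel) = ennreal ((norm (Js s k))\<^sup>2)" unfolding U_def by (rule nn_integral_sq_fn)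
    also have "ennreal ((norm (Js s k))\<^sup>2) \<le> ennreal ((norm k)\<^sup>2)" by (intro ennreal_leI power_mono Js_norm_le norm_ge_zero)
    finally have "(\<integral>\<^sup>+x. ennreal (\<bar>U k x\<bar> powr ps) \<partial>lborel) \<le> ennreal ((norm k)\<^sup>2) + ennreal (2 powr ps) * ennreal (D * (norm k)\<^sup>2)"
      by - (simp add: add_mono mult_left_mono)
    also have "\<dots> = ennreal ((norm k)\<^sup>2 + 2 powr ps * (D * (norm k)\<^sup>2))" using D by (simp add: ennreal_mult ennreal_plus)
    also have "\<dots> \<le> ennreal (B\<^sup>2 + 2 powr ps * (D * B\<^sup>2))" using kB D by (intro ennreal_leI add_mono mult_left_mono) auto
    finally show ?thesis .
  qed
  then show ?thesis by blast
qed

lemma sobolev: "\<exists>C\<ge>0. \<forall>k. norm k \<le> B \<longrightarrow> integrable lborel (\<lambda>x. \<bar>U k x\<bar> powr ps) \<and> (LINT x|lborel. \<bar>U k x\<bar> powr ps) \<le> C"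
proof -
  obtain C where C: "\<And>k. norm k \<le> B \<Longrightarrow> (\<integral>\<^sup>+x. ennreal (\<bar>U k x\<bar> powr ps) \<partial>lborel) \<le> ennreal C" using sobolev_bound by blast
  have "integrable lborel (\<lambda>x. \<bar>U k x\<bar> powr ps) \<and> (LINT x|lborel. \<bar>U k x\<bar> powr ps) \<le> \<bar>C\<bar>" if k: "norm k \<le> B" for k
  proof
    have fin: "(\<integral>\<^sup>+x. ennreal (\<bar>U k x\<bar> powr ps) \<partial>lborel) \<le> ennreal \<bar>C\<bar>" using C[OF k] by (rule order_trans) (simp add: ennreal_leI)
    show i: "integrable lborel (\<lambda>x. \<bar>U k x\<bar> powr ps)"
      by (rule integrableI_nonneg) (use fin in \<open>auto intro: order_le_less_trans\<close>)
    have "ennreal (LINT x|lborel. \<bar>U k x\<bar> powr ps) \<le> ennreal \<bar>C\<bar>" using nn_integral_eq_integral[OF i] fin by simp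
    then show "(LINT x|lborel. \<bar>U k x\<bar> powr ps) \<le> \<bar>C\<bar>" by (subst (asm) ennreal_le_iff) auto
  qed
  then show ?thesis by (intro exI[of _ "\<bar>C\<bar>"]) auto
qed

text \<open>High frequencies are uniformly small in L2 along the bounded sequence. The low-frequency
  parts converge to 0 at every point and are uniformly bounded, so dominated convergence applies on
  the ball.\<close>

lemma local_compactness:
  assumes w: "weakly k 0"
  shows "(\<lambda>n. LINT x|lborel. indicator (ball 0 R) x * (U (k n) x)\<^sup>2) \<longlonglongrightarrow> 0"
proof (rule LIMSEQ_I)
  fix r :: real assume r: "r > 0"
  obtain B0 where B0: "\<And>n. norm (k n) \<le> B0" using weakly_imp_bounded[OF w] by blast
  define B where "B = max B0 1"
  have B: "\<And>n. norm (k n) \<le> B" "B > 0" using B0 by (auto simp: B_def le_max_iff_disj)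
  \<comment> \<open>The exponent makes \<open>A powr (- 2 * s)\<close> at most
    \<open>r / (4 * B\<^sup>2)\<close>, so that the squared high part integrates to at most
    \<open>r / 4\<close>.\<close>
  define A where "A = max 1 ((r / (4 * B\<^sup>2)) powr (- 1 / (2 * s)))"
  have A: "A > 0" by (simp add: A_def)
  have A2: "A powr (- 2 * s) \<le> r / (4 * B\<^sup>2)"
  proof -
    let ?y = "r / (4 * B\<^sup>2)"
    have y: "?y > 0" using r B by simp
    have "A powr (- 2 * s) \<le> (?y powr (- 1 / (2 * s))) powr (- 2 * s)" using y s by (intro powr_mono2') (auto simp: A_def)
    also have "\<dots> = ?y powr 1"
    proof -
      have "- 1 / (2 * s) * (- 2 * s) = 1" using s by simp
      then show ?thesis by (simp only: powr_powr)
    qed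
    also have "\<dots> = ?y" using y by (intro powr_one) simp
    finally show ?thesis .
  qed
  let ?I = "indicator (ball 0 R) :: R3 \<Rightarrow> real"
  have m: "(\<lambda>x. ?I x * (f x)\<^sup>2) \<in> borel_measurable lborel" if "f \<in> borel_measurable borel" for f
    using that by (simp add: borel_measurable_times borel_measurable_indicator borel_measurable_power)
  have hi: "(LINT x|lborel. (U (k n) x - low A (k n) x)\<^sup>2) \<le> r / 4" for n
  proof -
    have "(LINT x|lborel. (U (k n) x - low A (k n) x)\<^sup>2) \<le> (LINT \<xi>|lborel. A powr (- 2 * s) * (fn (k n) \<xi>)\<^sup>2)"
      unfolding high_norm
    proof (rule integral_mono)
      show "integrable lborel (\<lambda>\<xi>. (jm s \<xi> * fn (k n) \<xi>)\<^sup>2 * indicator (- ball 0 A) \<xi>)"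
        by (intro integrable_real_mult_indicator l2fun_integrable_sq[OF jm_fn]) (simp_all add: borel_comp borel_open)
      show "(jm s \<xi> * fn (k n) \<xi>)\<^sup>2 * indicator (- ball 0 A) \<xi> \<le> A powr (- 2 * s) * (fn (k n) \<xi>)\<^sup>2" for \<xi>
        using mult_right_mono[OF jm_le_powr[OF A, of \<xi>], of "(fn (k n) \<xi>)\<^sup>2"] by (auto simp: indicator_def power_mult_distrib)
    qed (auto intro: l2fun_integrable_sq)
    also have "\<dots> = A powr (- 2 * s) * (norm (k n))\<^sup>2" by (simp add: norm_sq_l2)
    also have "\<dots> \<le> r / (4 * B\<^sup>2) * B\<^sup>2" using A2 B r by (intro mult_mono power_mono) auto
    also have "\<dots> = r / 4" using B by simp
    finally show ?thesis .
  qed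
  define M where "M = B * (2 * c3 * sqrt (jI A))"
  have lowM: "\<bar>low A (k n) x\<bar> \<le> M" for n x unfolding M_def by (rule low_bound[OF B(1)])
  have M0: "0 \<le> M" using lowM[of 0 0] by linarith
  have lim: "(\<lambda>n. LINT x|lborel. ?I x * (low A (k n) x)\<^sup>2) \<longlonglongrightarrow> (LINT x|(lborel::R3 measure). 0)"
  proof (rule integral_dominated_convergence[where f = "\<lambda>_. 0" and w = "\<lambda>x. M\<^sup>2 * ?I x"])
    show "AE x in lborel. (\<lambda>n. ?I x * (low A (k n) x)\<^sup>2) \<longlonglongrightarrow> 0"
    proof (rule AE_I2)
      fix x
      have "(\<lambda>n. inner (k n) (mk (wave A x))) \<longlonglongrightarrow> inner 0 (mk (wave A x))" using w unfolding weakly_def by blast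
      then have "(\<lambda>n. low A (k n) x) \<longlonglongrightarrow> 0" by (simp add: low_eq)
      then have "(\<lambda>n. ?I x * (low A (k n) x)\<^sup>2) \<longlonglongrightarrow> ?I x * 0\<^sup>2" by (intro tendsto_intros)
      then show "(\<lambda>n. ?I x * (low A (k n) x)\<^sup>2) \<longlonglongrightarrow> 0" by simp
    qed
    show "AE x in lborel. norm (?I x * (low A (k n) x)\<^sup>2) \<le> M\<^sup>2 * ?I x" for n
    proof (rule AE_I2)
      fix x show "norm (?I x * (low A (k n) x)\<^sup>2) \<le> M\<^sup>2 * ?I x"
        using power_mono[OF lowM abs_ge_zero, of n x 2] by (auto simp: indicator_def)
    qed
    show "integrable lborel (\<lambda>x. M\<^sup>2 * ?I x)" using ball_integrable by simp
    show "(\<lambda>x. ?I x * (low A (k n) x)\<^sup>2) \<in> borel_measurable lborel" for n by (rule m) simp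
  qed simp
  then obtain N where N: "\<And>n. n \<ge> N \<Longrightarrow> \<bar>LINT x|lborel. ?I x * (low A (k n) x)\<^sup>2\<bar> < r / 4"
    using LIMSEQ_D[OF lim, of "r / 4"] r by auto
  have "norm ((LINT x|lborel. ?I x * (U (k n) x)\<^sup>2) - 0) < r" if n: "n \<ge> N" for n
  proof -
    have i2: "integrable lborel (\<lambda>x. (U (k n) x - low A (k n) x)\<^sup>2)" by (intro l2fun_integrable_sq l2fun_diff l2fun_U low_l2)
    have ib: "integrable lborel (\<lambda>x. ?I x * (f x)\<^sup>2)" if "l2fun f" for f
    proof -
      have "integrable lborel (\<lambda>x. (f x)\<^sup>2 * ?I x)"
        by (intro integrable_real_mult_indicator l2fun_integrable_sq[OF that]) (simp_all add: borel_comp borel_open)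
      then show ?thesis by (subst mult.commute)
    qed
    have "(LINT x|lborel. ?I x * (U (k n) x)\<^sup>2) \<le> (LINT x|lborel. 2 * (?I x * (low A (k n) x)\<^sup>2) + 2 * (U (k n) x - low A (k n) x)\<^sup>2)"
    proof (rule integral_mono)
      fix x show "?I x * (U (k n) x)\<^sup>2 \<le> 2 * (?I x * (low A (k n) x)\<^sup>2) + 2 * (U (k n) x - low A (k n) x)\<^sup>2"
        using sum_sq_le[of "low A (k n) x" "U (k n) x - low A (k n) x"] by (auto simp: indicator_def)
    qed (use i2 ib[OF l2fun_U] ib[OF low_l2] in auto)
    also have "\<dots> = 2 * (LINT x|lborel. ?I x * (low A (k n) x)\<^sup>2) + 2 * (LINT x|lborel. (U (k n) x - low A (k n) x)\<^sup>2)"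
      using i2 ib[OF low_l2] by simp
    also have "\<dots> < r" using N[OF n] hi[of n] by linarith
    finally have "(LINT x|lborel. ?I x * (U (k n) x)\<^sup>2) < r" .
    moreover have "0 \<le> (LINT x|lborel. ?I x * (U (k n) x)\<^sup>2)" by (rule Bochner_Integration.integral_nonneg) auto
    ultimately show ?thesis by simp
  qed
  then show "\<exists>N. \<forall>n\<ge>N. norm ((LINT x|lborel. ?I x * (U (k n) x)\<^sup>2) - 0) < r" by blast
qed

end

text \<open>The exponent \<open>ps / (ps - p)\<close> of the weight is conjugate to \<open>ps / p\<close>.\<close>

locale sobolev_weight = sobolev +
  fixes W :: "R3 \<Rightarrow> real" and p :: real
  assumes W[measurable]: "W \<in> borel_measurable borel" and W0: "\<And>x. 0 \<le> W x"
    and p: "2 \<le> p" "p < ps" and Wr: "integrable lborel (\<lambda>x. W x powr (ps / (ps - p)))"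
begin

definition r where "r = ps / (ps - p)"
definition r' where "r' = ps / p"

lemma r: "r > 1" "r' > 1" "1 / r + 1 / r' = 1"
  using p by (simp_all add: r_def r'_def field_simps)

lemma young: assumes "0 \<le> a" "0 \<le> (b::real)" shows "a * b powr p \<le> a powr r + b powr ps"
proof -
  have "a * b powr p \<le> a powr r / r + (b powr p) powr r' / r'"
    using Youngs_inequality[of r r' a "b powr p"] r assms by simp
  also have "(b powr p) powr r' = b powr ps" using p by (simp add: powr_powr r'_def)
  also have "a powr r / r + b powr ps / r' \<le> a powr r + b powr ps"
    using r by (intro add_mono) (auto simp: divide_le_eq mult_le_cancel_left1)
  finally show ?thesis .
qed

lemma weighted_bound:
  "\<exists>C\<ge>0. \<forall>k. norm k \<le> B \<longrightarrow> integrable lborel (\<lambda>x. W x * \<bar>U k x\<bar> powr p) \<and> (LINT x|lborel. W x * \<bar>U k x\<bar> powr p) \<le> C"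
proof -
  obtain C where C: "C \<ge> 0" "\<And>k. norm k \<le> B \<Longrightarrow> integrable lborel (\<lambda>x. \<bar>U k x\<bar> powr ps)" "\<And>k. norm k \<le> B \<Longrightarrow> (LINT x|lborel. \<bar>U k x\<bar> powr ps) \<le> C"
    using sobolev[of B] by blast
  have Wr': "integrable lborel (\<lambda>x. W x powr r)" using Wr by (simp add: r_def)
  have "integrable lborel (\<lambda>x. W x * \<bar>U k x\<bar> powr p) \<and> (LINT x|lborel. W x * \<bar>U k x\<bar> powr p) \<le> (LINT x|lborel. W x powr r) + C"
    if k: "norm k \<le> B" for k
  proof
    have le: "W x * \<bar>U k x\<bar> powr p \<le> W x powr r + \<bar>U k x\<bar> powr ps" for x by (rule young[OF W0]) simp
    have iS: "integrable lborel (\<lambda>x. W x powr r + \<bar>U k x\<bar> powr ps)" using Wr' C(2)[OF k] by simp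
    show i: "integrable lborel (\<lambda>x. W x * \<bar>U k x\<bar> powr p)"
    proof (rule Bochner_Integration.integrable_bound[OF iS])
      show "AE x in lborel. norm (W x * \<bar>U k x\<bar> powr p) \<le> norm (W x powr r + \<bar>U k x\<bar> powr ps)"
        using le W0 by (intro AE_I2) (simp add: abs_mult)
    qed measurable
    have "(LINT x|lborel. W x * \<bar>U k x\<bar> powr p) \<le> (LINT x|lborel. W x powr r + \<bar>U k x\<bar> powr ps)" by (rule integral_mono[OF i iS le])
    also have "\<dots> \<le> (LINT x|lborel. W x powr r) + C" using Wr' C(2,3)[OF k] by simp
    finally show "(LINT x|lborel. W x * \<bar>U k x\<bar> powr p) \<le> (LINT x|lborel. W x powr r) + C" .
  qed
  moreover have "0 \<le> (LINT x|lborel. W x powr r) + C" using C(1) by (intro add_nonneg_nonneg Bochner_Integration.integral_nonneg) auto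
  ultimately show ?thesis by blast
qed

lemma weighted_integrable: "integrable lborel (\<lambda>x. W x * \<bar>U k x\<bar> powr p)"
  using weighted_bound[of "norm k"] by blast

text \<open>Far out or where the weight exceeds \<open>R\<close>, Young's inequality with a small
  factor on the critical power leaves a tail of \<open>W powr r\<close>. Elsewhere values above
  \<open>\<tau>\<close> are controlled by the critical power, as \<open>p < ps\<close>, and those
  below by the local square.\<close>

theorem weighted_compactness:
  assumes w: "weakly k 0" shows "(\<lambda>n. LINT x|lborel. W x * \<bar>U (k n) x\<bar> powr p) \<longlonglongrightarrow> 0"
proof (rule LIMSEQ_I)
  fix e :: real assume e: "e > 0"
  obtain B where B: "\<And>n. norm (k n) \<le> B" using weakly_imp_bounded[OF w] by blast
  obtain C where C0: "C \<ge> 0" and C: "\<And>k. norm k \<le> B \<Longrightarrow> integrable lborel (\<lambda>x. \<bar>U k x\<bar> powr ps)" "\<And>k. norm k \<le> B \<Longrightarrow> (LINT x|lborel. \<bar>U k x\<bar> powr ps) \<le> C"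
    using sobolev[of B] by blast
  have Wr': "integrable lborel (\<lambda>x. W x powr r)" using Wr by (simp add: r_def)
  \<comment> \<open>Fixed before \<open>R\<close>: the critical power with factor
    \<open>\<eta> powr r'\<close> costs at most \<open>e / 5\<close>, whereas the large factor
    \<open>\<eta> powr (- r)\<close> is compensated by the choice of \<open>R\<close>.\<close>
  define \<eta> where "\<eta> = (e / (5 * (C + 1))) powr (1 / r')"
  have eta: "\<eta> > 0" "\<eta> powr r' * C \<le> e / 5"
  proof -
    define y where "y = e / (5 * (C + 1))"
    have y: "y > 0" using e C0 unfolding y_def by (intro divide_pos_pos) auto
    have eta_y: "\<eta> = y powr (1 / r')" by (simp add: \<eta>_def y_def)
    show "\<eta> > 0" using y by (simp add: eta_y)
    have "1 / r' * r' = 1" using r by simp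
    then have "\<eta> powr r' = y" using y unfolding eta_y powr_powr by simp
    then have "\<eta> powr r' * C \<le> y * (C + 1)" using y C0 by (intro mult_mono) auto
    also have "\<dots> = e / 5"
    proof -
      have "C + 1 \<noteq> 0" using C0 by linarith
      then show ?thesis unfolding y_def by (simp only: times_divide_eq_left divide_divide_eq_left[symmetric] nonzero_mult_div_cancel_right mult.commute[of 5] not_False_eq_True)
    qed
    finally show "\<eta> powr r' * C \<le> e / 5" .
  qed
  let ?G = "\<lambda>R. {x. norm x < R \<and> W x \<le> R}"
  have Gm[measurable]: "?G R \<in> sets borel" for R by measurable
  let ?W2 = "\<lambda>R x. W x powr r * indicator (- ?G R) x"
  have "(\<lambda>n. LINT x|lborel. ?W2 (real n) x) \<longlonglongrightarrow> (LINT x|(lborel::R3 measure). 0)"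
  proof (rule integral_dominated_convergence[where f = "\<lambda>_. 0" and w = "\<lambda>x. W x powr r"])
    show "AE x in lborel. (\<lambda>n. ?W2 (real n) x) \<longlonglongrightarrow> 0"
    proof (rule AE_I2, rule tendsto_eventually)
      fix x :: R3
      obtain N :: nat where N: "max (norm x) (W x) < real N" using reals_Archimedean2 by blast
      show "\<forall>\<^sub>F n in sequentially. ?W2 (real n) x = 0"
        unfolding eventually_sequentially by (rule exI[of _ N]) (use N in \<open>auto simp: indicator_def\<close>)
    qed
  qed (use Wr' in \<open>auto simp: indicator_def\<close>)
  moreover have "\<eta> powr r * e / 5 > 0" using e eta by simp
  ultimately have "\<exists>N. \<forall>n\<ge>N. norm ((LINT x|lborel. ?W2 (real n) x) - (LINT x|(lborel::R3 measure). 0)) < \<eta> powr r * e / 5" by (rule LIMSEQ_D)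
  then obtain n0 :: nat where n0: "\<bar>LINT x|lborel. ?W2 (real n0) x\<bar> < \<eta> powr r * e / 5" by auto
  define R where "R = real n0"
  have R0: "0 \<le> R" by (simp add: R_def)
  \<comment> \<open>Makes \<open>R * (\<tau> powr (p - ps) * C)\<close> at most
    \<open>e / 5\<close>; the exponent is negative, so a high threshold helps.\<close>
  define \<tau> where "\<tau> = (e / (5 * (R * C + 1))) powr (- 1 / (ps - p))"
  have tau: "\<tau> > 0" "R * (\<tau> powr (p - ps) * C) \<le> e / 5"
  proof -
    have RC: "0 \<le> R * C" using R0 C0 by simp
    define y where "y = e / (5 * (R * C + 1))"
    have y: "y > 0" using e RC unfolding y_def by (intro divide_pos_pos) auto
    have tau_y: "\<tau> = y powr (- 1 / (ps - p))" by (simp add: \<tau>_def y_def)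
    show "\<tau> > 0" using y by (simp add: tau_y)
    define D where "D = ps - p"
    have D: "p - ps = - D" "ps - p = D" "D \<noteq> 0" using p by (simp_all add: D_def)
    have "- 1 / (ps - p) * (p - ps) = 1" unfolding D(1,2) using D(3) by simp
    then have "\<tau> powr (p - ps) = y" using y unfolding tau_y powr_powr by simp
    then have "R * (\<tau> powr (p - ps) * C) = y * (R * C)" by simp
    also have "\<dots> \<le> y * (R * C + 1)" using y by (intro mult_left_mono) auto
    also have "\<dots> = e / 5"
    proof -
      have "R * C + 1 \<noteq> 0" using RC by linarith
      then show ?thesis unfolding y_def by (simp only: times_divide_eq_left divide_divide_eq_left[symmetric] nonzero_mult_div_cancel_right mult.commute[of 5] not_False_eq_True)
    qed
    finally show "R * (\<tau> powr (p - ps) * C) \<le> e / 5" .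
  qed
  have pt: "W x * u powr p \<le> \<eta> powr (- r) * ?W2 R x + \<eta> powr r' * u powr ps + R * (\<tau> powr (p - ps) * u powr ps) + R * \<tau> powr (p - 2) * (indicator (ball 0 R) x * u\<^sup>2)"
    if u: "0 \<le> u" for x u
  proof (cases "x \<in> ?G R")
    case False
    have "W x * u powr p = (W x / \<eta>) * (\<eta> powr (1 / p) * u) powr p"
      using eta u p by (simp add: powr_mult powr_powr)
    also have "\<dots> \<le> (W x / \<eta>) powr r + (\<eta> powr (1 / p) * u) powr ps" using W0[of x] eta u by (intro young) auto
    also have "(\<eta> powr (1 / p) * u) powr ps = \<eta> powr r' * u powr ps" using eta u by (simp add: powr_mult powr_powr r'_def)
    also have "(W x / \<eta>) powr r = \<eta> powr (- r) * ?W2 R x" using False W0[of x] eta by (simp add: powr_divide powr_minus field_simps)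
    finally show ?thesis using R0 u by (intro order_trans[OF _ add_increasing2[OF _ add_increasing2[OF _ order_refl]]]) auto
  next
    case True
    have "u powr p \<le> \<tau> powr (p - ps) * u powr ps + \<tau> powr (p - 2) * u\<^sup>2"
    proof (cases "u \<ge> \<tau>")
      case True
      have "u powr p = u powr (p - ps) * u powr ps" using True tau by (simp flip: powr_add)
      also have "\<dots> \<le> \<tau> powr (p - ps) * u powr ps" using True tau p by (intro mult_right_mono powr_mono2') auto
      finally show ?thesis by (simp add: add_increasing2)
    next
      case False
      show ?thesis
      proof (cases "u = 0")
        case True then show ?thesis by simp
      next
        case u0: False
        have "u powr p = u powr (p - 2) * u\<^sup>2" using u0 u powr_add[of u "p - 2" 2] by (simp add: powr_numeral)
        also have "\<dots> \<le> \<tau> powr (p - 2) * u\<^sup>2" using False u p by (intro mult_right_mono powr_mono2) auto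
        finally show ?thesis by (simp add: add_increasing)
      qed
    qed
    then have "R * u powr p \<le> R * (\<tau> powr (p - ps) * u powr ps + \<tau> powr (p - 2) * u\<^sup>2)" using R0 by (intro mult_left_mono)
    moreover have "W x * u powr p \<le> R * u powr p" using True by (intro mult_right_mono) auto
    moreover have "0 \<le> \<eta> powr r' * u powr ps" by simp
    ultimately have "W x * u powr p \<le> \<eta> powr r' * u powr ps + R * (\<tau> powr (p - ps) * u powr ps) + R * (\<tau> powr (p - 2) * u\<^sup>2)"
      unfolding distrib_left by linarith
    then show ?thesis using True by (simp add: mult.assoc)
  qed
  have lc: "(\<lambda>n. R * \<tau> powr (p - 2) * (LINT x|lborel. indicator (ball 0 R) x * (U (k n) x)\<^sup>2)) \<longlonglongrightarrow> R * \<tau> powr (p - 2) * 0"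
    by (intro tendsto_mult tendsto_const local_compactness w)
  have e5: "e / 5 > 0" using e by simp
  obtain N where N: "\<And>n. n \<ge> N \<Longrightarrow> norm (R * \<tau> powr (p - 2) * (LINT x|lborel. indicator (ball 0 R) x * (U (k n) x)\<^sup>2) - R * \<tau> powr (p - 2) * 0) < e / 5"
    using LIMSEQ_D[OF lc e5] by blast
  have "norm ((LINT x|lborel. W x * \<bar>U (k n) x\<bar> powr p) - 0) < e" if n: "n \<ge> N" for n
  proof -
    let ?u = "\<lambda>x. \<bar>U (k n) x\<bar>"
    have i1: "integrable lborel (?W2 R)" by (intro integrable_real_mult_indicator Wr') (simp_all add: borel_comp borel_open)
    have i2: "integrable lborel (\<lambda>x. ?u x powr ps)" by (rule C(1)[OF B])
    have i3: "integrable lborel (\<lambda>x. indicator (ball 0 R) x * (U (k n) x)\<^sup>2)"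
    proof -
      have "integrable lborel (\<lambda>x. (U (k n) x)\<^sup>2 * indicator (ball 0 R) x)"
        by (intro integrable_real_mult_indicator l2fun_integrable_sq[OF l2fun_U]) (simp_all add: borel_comp borel_open)
      then show ?thesis by (subst mult.commute)
    qed
    have "(LINT x|lborel. W x * ?u x powr p) \<le> (LINT x|lborel. \<eta> powr (- r) * ?W2 R x + \<eta> powr r' * ?u x powr ps + R * (\<tau> powr (p - ps) * ?u x powr ps) + R * \<tau> powr (p - 2) * (indicator (ball 0 R) x * (U (k n) x)\<^sup>2))"
      by (rule integral_mono[OF weighted_integrable]) (use i1 i2 i3 pt[of "?u _"] in auto)
    also have "\<dots> = \<eta> powr (- r) * (LINT x|lborel. ?W2 R x) + \<eta> powr r' * (LINT x|lborel. ?u x powr ps) + R * (\<tau> powr (p - ps) * (LINT x|lborel. ?u x powr ps))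
       + R * \<tau> powr (p - 2) * (LINT x|lborel. indicator (ball 0 R) x * (U (k n) x)\<^sup>2)"
      using i1 i2 i3 by simp
    also have "\<dots> \<le> e / 5 + e / 5 + e / 5 + e / 5"
    proof (intro add_mono)
      have "\<eta> powr (- r) * (LINT x|lborel. ?W2 R x) \<le> \<eta> powr (- r) * (\<eta> powr r * e / 5)"
        using n0 by (intro mult_left_mono) (auto simp: R_def)
      also have "\<dots> = e / 5" using eta by (simp add: powr_minus)
      finally show "\<eta> powr (- r) * (LINT x|lborel. ?W2 R x) \<le> e / 5" .
      have CC: "(LINT x|lborel. ?u x powr ps) \<le> C" by (rule C(2)[OF B])
      have "\<eta> powr r' * (LINT x|lborel. ?u x powr ps) \<le> \<eta> powr r' * C" by (intro mult_left_mono CC) auto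
      then show "\<eta> powr r' * (LINT x|lborel. ?u x powr ps) \<le> e / 5" using eta(2) by linarith
      have "R * (\<tau> powr (p - ps) * (LINT x|lborel. ?u x powr ps)) \<le> R * (\<tau> powr (p - ps) * C)"
        using R0 by (intro mult_left_mono CC) auto
      then show "R * (\<tau> powr (p - ps) * (LINT x|lborel. ?u x powr ps)) \<le> e / 5" using tau(2) by linarith
      show "R * \<tau> powr (p - 2) * (LINT x|lborel. indicator (ball 0 R) x * (U (k n) x)\<^sup>2) \<le> e / 5" using N[OF n] by simp
    qed
    also have "\<dots> < e" using e by simp
    finally have "(LINT x|lborel. W x * ?u x powr p) < e" .
    moreover have "0 \<le> (LINT x|lborel. W x * ?u x powr p)" using W0 by (intro Bochner_Integration.integral_nonneg) auto
    ultimately show ?thesis by simp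
  qed
  then show "\<exists>N. \<forall>n\<ge>N. norm ((LINT x|lborel. W x * \<bar>U (k n) x\<bar> powr p) - 0) < e" by blast
qed

end

section \<open>The linear operator\<close>

lemma le_powr_self: assumes "0 \<le> y" "y \<le> 1" "0 < s" "s \<le> (1::real)" shows "y \<le> y powr s"
proof (cases "y = 0")
  case False
  then have "y powr 1 \<le> y powr s" using assms by (intro powr_mono') auto
  then show ?thesis using False assms by simp
qed simp

text \<open>With \<open>n = (norm \<xi>)\<^sup>2\<close> the two terms are the powers with exponent
  \<open>s\<close> of \<open>n / (1 + n)\<close> and \<open>1 / (1 + n)\<close>, numbers in the unit
  interval with sum 1; such powers are not smaller than the numbers.\<close>

lemma am_add_jm_ge: assumes s: "0 < s" "s \<le> 1" shows "1 \<le> am s \<xi> + (jm s \<xi>)\<^sup>2"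
proof -
  define n where "n = (norm \<xi>)\<^sup>2"
  have n: "0 \<le> n" by (simp add: n_def)
  have j: "(jm s \<xi>)\<^sup>2 = (1 / (1 + n)) powr s"
  proof -
    have "(jm s \<xi>)\<^sup>2 = (1 + n) powr (- s)" by (simp add: jm_def n_def power2_eq_square flip: powr_add)
    then show ?thesis using n by (simp add: powr_minus_divide powr_divide)
  qed
  have "norm \<xi> powr (2 * s) = n powr s"
  proof (cases "\<xi> = 0")
    case False
    then have "n = norm \<xi> powr 2" by (simp add: n_def powr_numeral)
    then have "n powr s = norm \<xi> powr (2 * s)" by (simp only: powr_powr)
    then show ?thesis by simp
  qed (simp add: n_def)
  then have "am s \<xi> = n powr s * (1 / (1 + n)) powr s" unfolding am_def j by simp
  also have "\<dots> = (n * (1 / (1 + n))) powr s" using n by (intro powr_mult[symmetric]) 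
  finally have a: "am s \<xi> = (n / (1 + n)) powr s" by simp
  have "n / (1 + n) \<le> (n / (1 + n)) powr s" "1 / (1 + n) \<le> (1 / (1 + n)) powr s"
    using n s by (intro le_powr_self; simp)+
  moreover have "n / (1 + n) + 1 / (1 + n) = 1" using n by (simp flip: add_divide_distrib)
  ultimately show ?thesis unfolding a j by linarith
qed

lemma bounded_linear_Js: assumes "0 \<le> t" shows "bounded_linear (Js t)"
proof -
  have "bounded_linear (\<lambda>k. HT (mult_op (jm t) k))"
    by (rule bounded_linear_compose[OF HT_bounded_linear mult_op_bounded_linear[OF jm_bmeas[OF assms]]])
  then show ?thesis by (simp add: Js_def[abs_def])
qed

locale schroedinger = sobolev +
  fixes V :: "R3 \<Rightarrow> real" and M :: real
  assumes V: "V \<in> borel_measurable borel" "\<And>x. \<bar>V x\<bar> \<le> M" and gap: "zero_in_gap s V"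
begin

lemma s0: "0 < s" "0 \<le> s" using s by auto

lemma bmeas_V: "bmeas V" using V by (auto simp: bmeas_def)
lemma bmeas_am: "bmeas (am s)" using am_bmeas s0 by blast
lemma bmeas_jm: "bmeas (jm s)" using jm_bmeas s0 by blast
lemma M0: "0 \<le> M" using V(2)[of 0] by linarith

definition Jt :: "l2 \<Rightarrow> l2" where "Jt w = mult_op (jm s) (HT w)"

lemma Js_adjoint: "inner (Js s k) w = inner k (Jt w)"
  by (simp add: Js_def Jt_def HT_sym mult_op_sym[OF bmeas_jm])

text \<open>The operator of \<open>form_A\<close> with respect to the inner product of the variables
  \<open>k\<close>; see \<open>form_A_eq\<close>.\<close>

definition L :: "l2 \<Rightarrow> l2" where "L k = mult_op (am s) k + Jt (mult_op V (Js s k))"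

lemma Js_bounded_linear: "bounded_linear (Js s)" by (rule bounded_linear_Js[OF s0(2)])

lemma Jt_bounded_linear: "bounded_linear Jt"
proof -
  have "bounded_linear (\<lambda>k. mult_op (jm s) (HT k))"
    by (rule bounded_linear_compose[OF mult_op_bounded_linear[OF bmeas_jm] HT_bounded_linear])
  then show ?thesis by (simp add: Jt_def[abs_def])
qed

lemma L_bounded_linear: "bounded_linear L"
  unfolding L_def[abs_def]
  by (intro bounded_linear_add mult_op_bounded_linear bmeas_am bounded_linear_compose[OF Jt_bounded_linear]
      bounded_linear_compose[OF mult_op_bounded_linear[OF bmeas_V]] Js_bounded_linear)

lemma inner_L: "inner (L k) l = inner (mult_op (am s) k) l + inner (mult_op V (Js s k)) (Js s l)"
proof -
  have "inner (Jt (mult_op V (Js s k))) l = inner (Js s l) (mult_op V (Js s k))"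
    unfolding Js_adjoint by (rule inner_commute)
  then show ?thesis unfolding L_def inner_add_left by (simp only: inner_commute)
qed

lemma L_sym: "inner (L k) l = inner k (L l)"
proof -
  have "inner (mult_op (am s) k) l = inner (mult_op (am s) l) k"
    using mult_op_sym[OF bmeas_am, of k l] inner_commute[of k "mult_op (am s) l"] by simp
  moreover have "inner (mult_op V (Js s k)) (Js s l) = inner (mult_op V (Js s l)) (Js s k)"
    using mult_op_sym[OF bmeas_V, of "Js s k" "Js s l"] inner_commute[of "Js s k" "mult_op V (Js s l)"] by simp
  ultimately show ?thesis using inner_L[of k l] inner_L[of l k] inner_commute[of k "L l"] by simp
qed

lemma L_norm_le: "norm (L k) \<le> (1 + M) * norm k"
proof -
  have "norm (Jt w) \<le> norm w" for w
    unfolding Jt_def using mult_op_norm[OF bmeas_jm, of 1 "HT w"] jm_le_1[OF s0(2)] jm_pos[of s] by (simp add: norm_HT abs_of_pos)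
  then have "norm (Jt (mult_op V (Js s k))) \<le> norm (mult_op V (Js s k))" .
  also have "\<dots> \<le> M * norm (Js s k)" by (rule mult_op_norm[OF bmeas_V V(2)])
  also have "\<dots> \<le> M * norm k" using M0 Js_norm_le by (intro mult_left_mono)
  finally have "norm (Jt (mult_op V (Js s k))) \<le> M * norm k" .
  moreover have "norm (mult_op (am s) k) \<le> 1 * norm k"
    by (rule mult_op_norm[OF bmeas_am]) (use am_le_1[OF s0(1)] am_nonneg[of s] in \<open>simp add: abs_of_nonneg\<close>)
  ultimately have "norm (mult_op (am s) k) + norm (Jt (mult_op V (Js s k))) \<le> (1 + M) * norm k"
    by (simp add: distrib_right)
  then show ?thesis unfolding L_def by (rule order_trans[OF norm_triangle_ineq])
qed

lemma form_A_eq: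
  assumes u: "sq_int u" "mk u = Js s k" and v: "sq_int v" "mk v = Js s l"
  shows "(LINT x|lebesgue. V x * u x * v x) = inner (mult_op V (Js s k)) (Js s l)"
    "integrable lebesgue (\<lambda>x. V x * u x * v x)" "form_A s V u v = inner (L k) l"
proof -
  have meas: "(\<lambda>x. V x * u x * v x) \<in> borel_measurable lebesgue"
    using u(1) v(1) borel_imp_lebesgue[OF V(1)] by (intro borel_measurable_times) (auto simp: sq_int_def)
  have m2: "(\<lambda>x. V x * fn (mk u) x * fn (mk v) x) \<in> borel_measurable borel"
    by (intro borel_measurable_times V fn_measurable)
  have ae: "AE x in lebesgue. V x * u x * v x = V x * fn (mk u) x * fn (mk v) x"
    unfolding AE_lborel_iff using fn_mk_sq_int[OF u(1)] fn_mk_sq_int[OF v(1)] by eventually_elim simp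
  show e: "(LINT x|lebesgue. V x * u x * v x) = inner (mult_op V (Js s k)) (Js s l)"
    unfolding inner_mult_op[OF bmeas_V] u(2)[symmetric] v(2)[symmetric]
    using lebesgue_integral_eq(1)[OF meas m2] ae unfolding AE_lborel_iff by blast
  have "integrable lborel (\<lambda>x. (V x * fn (mk u) x) * fn (mk v) x)"
    by (rule l2fun_mult_integrable[OF l2fun_mult[OF bmeas_V l2fun_fn] l2fun_fn])
  then show "integrable lebesgue (\<lambda>x. V x * u x * v x)"
    using lebesgue_integral_eq(2)[OF meas m2] ae unfolding AE_lborel_iff by blast
  show "form_A s V u v = inner (L k) l"
    unfolding form_A_def e inner_L frac_form_eq[OF u v s0(1)] ..
qed

lemma Hs_fn_Js: "fn (Js s k) \<in> Hs s" "sq_int (fn (Js s k))"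
  using Hs_iff[OF s0(2)] sq_int_fn by (auto simp: mk_fn)

text \<open>Solvability of the linear equation, transported to the variable \<open>k\<close>: the
  right-hand side \<open>w\<close> becomes \<open>Jt w\<close>, the adjoint of \<open>Js s\<close>
  applied to \<open>w\<close>.\<close>

lemma L_solves: "\<exists>z. L z = Jt w"
proof -
  obtain u where u: "u \<in> Hs s" "\<And>v. v \<in> Hs s \<Longrightarrow> form_A s V u v = (LINT x|lebesgue. fn w x * v x)"
    using gap sq_int_fn[of w] unfolding zero_in_gap_def by blast
  obtain z where z: "sq_int u" "mk u = Js s z" using u(1) Hs_iff[OF s0(2)] by blast
  have "inner (L z) l = inner (Jt w) l" for l
  proof -
    have "inner (L z) l = form_A s V u (fn (Js s l))"
      by (rule form_A_eq(3)[OF z Hs_fn_Js(2) mk_fn, symmetric])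
    also have "\<dots> = (LINT x|lebesgue. fn w x * fn (Js s l) x)" by (rule u(2)[OF Hs_fn_Js(1)])
    also have "\<dots> = inner w (Js s l)" using inner_mk_sq_int[OF sq_int_fn[of w] sq_int_fn[of "Js s l"]] by simp
    also have "\<dots> = inner (Jt w) l" using Js_adjoint[of l w] inner_commute[of w "Js s l"] inner_commute[of l "Jt w"] by simp
    finally show ?thesis .
  qed
  then have "inner (L z - Jt w) (L z - Jt w) = 0" by (simp only: inner_diff_left diff_self)
  then show ?thesis by auto
qed

text \<open>A Garding inequality: by \<open>am_add_jm_ge\<close> the kinetic part misses the full
  norm by at most the L2 norm of the function itself, and the potential is controlled by that norm
  too.\<close>

lemma L_coercive: "(norm k)\<^sup>2 - (M + 1) * (norm (Js s k))\<^sup>2 \<le> inner (L k) k"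
proof -
  have Jn: "(norm (Js s k))\<^sup>2 = (LINT \<xi>|lborel. (jm s \<xi>)\<^sup>2 * (fn k \<xi>)\<^sup>2)"
    unfolding Js_def norm_HT mult_op_def norm_sq_mk[OF jm_fn] by (simp add: power_mult_distrib)
  have ij: "integrable lborel (\<lambda>\<xi>. (jm s \<xi>)\<^sup>2 * (fn k \<xi>)\<^sup>2)"
    using l2fun_integrable_sq[OF jm_fn[of k]] by (simp add: power_mult_distrib)
  have ia: "integrable lborel (\<lambda>\<xi>. am s \<xi> * (fn k \<xi>)\<^sup>2)"
    using l2fun_mult_integrable[OF l2fun_mult[OF bmeas_am l2fun_fn] l2fun_fn, of k k] by (simp add: power2_eq_square mult.assoc)
  have "(norm k)\<^sup>2 = (LINT \<xi>|lborel. (fn k \<xi>)\<^sup>2)" by (rule norm_sq_l2)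
  also have "\<dots> \<le> (LINT \<xi>|lborel. am s \<xi> * (fn k \<xi>)\<^sup>2 + (jm s \<xi>)\<^sup>2 * (fn k \<xi>)\<^sup>2)"
  proof (rule integral_mono)
    fix \<xi>
    have "1 * (fn k \<xi>)\<^sup>2 \<le> (am s \<xi> + (jm s \<xi>)\<^sup>2) * (fn k \<xi>)\<^sup>2"
      using s by (intro mult_right_mono am_add_jm_ge) auto
    then show "(fn k \<xi>)\<^sup>2 \<le> am s \<xi> * (fn k \<xi>)\<^sup>2 + (jm s \<xi>)\<^sup>2 * (fn k \<xi>)\<^sup>2" by (simp add: distrib_right)
  qed (use ia ij in \<open>auto intro: l2fun_integrable_sq\<close>)
  also have "\<dots> = (LINT \<xi>|lborel. am s \<xi> * (fn k \<xi>)\<^sup>2) + (norm (Js s k))\<^sup>2"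
    unfolding Jn by (rule Bochner_Integration.integral_add[OF ia ij])
  also have "(LINT \<xi>|lborel. am s \<xi> * (fn k \<xi>)\<^sup>2) = inner (mult_op (am s) k) k"
    unfolding inner_mult_op[OF bmeas_am] by (simp add: power2_eq_square mult.assoc)
  finally have 1: "(norm k)\<^sup>2 \<le> inner (mult_op (am s) k) k + (norm (Js s k))\<^sup>2" .
  have "\<bar>inner (mult_op V (Js s k)) (Js s k)\<bar> \<le> norm (mult_op V (Js s k)) * norm (Js s k)" by (rule Cauchy_Schwarz_ineq2)
  also have "\<dots> \<le> (M * norm (Js s k)) * norm (Js s k)" by (intro mult_right_mono mult_op_norm[OF bmeas_V V(2)] norm_ge_zero)
  finally have "\<bar>inner (mult_op V (Js s k)) (Js s k)\<bar> \<le> M * (norm (Js s k))\<^sup>2" by (simp add: power2_eq_square mult.assoc)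
  then show ?thesis using 1 unfolding inner_L distrib_right by linarith
qed

text \<open>Since \<open>0\<close> is in the resolvent set, every \<open>Jt w\<close> is in the range of the symmetric operator \<open>L\<close>; hence the
  vectors \<open>Js s k / norm (L k)\<close> are weakly bounded, and the uniform boundedness principle applies.\<close>

lemma Js_le_L: "\<exists>B\<ge>0. \<forall>k. norm (Js s k) \<le> B * norm (L k)"
proof -
  have test: "\<exists>z::l2. \<forall>k. \<bar>inner (Js s k) w\<bar> \<le> norm (L k) * norm z" for w
  proof -
    obtain z where z: "L z = Jt w" using L_solves by blast
    have "\<bar>inner (Js s k) w\<bar> \<le> norm (L k) * norm z" for k
      unfolding Js_adjoint z[symmetric] L_sym[symmetric] by (rule Cauchy_Schwarz_ineq2)
    then show ?thesis by (intro exI[of _ z] allI)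
  qed
  let ?A = "(\<lambda>k. (1 / norm (L k)) *\<^sub>R Js s k) ` {k. L k \<noteq> 0}"
  have "\<exists>B. \<forall>a\<in>?A. \<bar>inner a w\<bar> \<le> B" for w
  proof -
    obtain z :: l2 where z: "\<And>k. \<bar>inner (Js s k) w\<bar> \<le> norm (L k) * norm z" using test[of w] by blast
    have "\<bar>inner a w\<bar> \<le> norm z" if a: "a \<in> ?A" for a
    proof -
      obtain k where k: "L k \<noteq> 0" "a = (1 / norm (L k)) *\<^sub>R Js s k" using a unfolding image_iff by blast
      have "\<bar>inner a w\<bar> = \<bar>inner (Js s k) w\<bar> / norm (L k)" by (simp add: k(2))
      also have "\<dots> \<le> norm z" using z[of k] k(1) by (simp add: pos_divide_le_eq mult.commute)
      finally show ?thesis .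
    qed
    then show ?thesis by blast
  qed
  then obtain B where B: "\<And>a. a \<in> ?A \<Longrightarrow> norm a \<le> B" using weakly_bounded_imp_bounded[of ?A] by blast
  have "norm (Js s k) \<le> max B 0 * norm (L k)" for k
  proof (cases "L k = 0")
    case True
    have "\<bar>inner (Js s k) (Js s k)\<bar> \<le> 0" using test[of "Js s k"] True by (metis mult_zero_left norm_zero)
    then have "Js s k = 0" using inner_ge_zero[of "Js s k"] inner_eq_zero_iff[of "Js s k"] by linarith
    then show ?thesis by simp
  next
    case False
    have "norm ((1 / norm (L k)) *\<^sub>R Js s k) \<le> B" using False by (intro B) blast
    then have "norm (Js s k) / norm (L k) \<le> max B 0" by simp
    then show ?thesis using False using pos_divide_le_eq[of "norm (L k)" "norm (Js s k)" "max B 0"] by simp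
  qed
  then show ?thesis by (intro exI[of _ "max B 0"]) auto
qed

text \<open>In the square of the lower-order term of \<open>L_coercive\<close> one factor is
  estimated by \<open>Js_le_L\<close> and the other by \<open>norm k\<close>, so that
  \<open>norm k\<close> can be cancelled.\<close>

lemma L_bounded_below: "\<exists>c>0. c \<le> 1 \<and> (\<forall>k. c * norm k \<le> norm (L k))"
proof -
  obtain B where B: "B \<ge> 0" "\<And>k. norm (Js s k) \<le> B * norm (L k)" using Js_le_L by blast
  define D where "D = 1 + (M + 1) * B"
  have D: "D \<ge> 1" using B M0 by (simp add: D_def)
  have "norm k \<le> D * norm (L k)" for k
  proof (cases "k = 0")
    case False
    have "(norm k)\<^sup>2 \<le> inner (L k) k + (M + 1) * (norm (Js s k))\<^sup>2" using L_coercive[of k] by linarith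
    also have "inner (L k) k \<le> norm (L k) * norm k" by (rule norm_cauchy_schwarz)
    also have "(M + 1) * (norm (Js s k))\<^sup>2 \<le> (M + 1) * (B * norm (L k) * norm k)"
      unfolding power2_eq_square using M0 B Js_norm_le[of k] by (intro mult_left_mono mult_mono) auto
    finally have "norm k * norm k \<le> (D * norm (L k)) * norm k" by (simp add: D_def power2_eq_square algebra_simps)
    then show ?thesis using False using mult_le_cancel_right_pos[of "norm k" "norm k" "D * norm (L k)"] by simp
  next
    case True
    then show ?thesis using D mult_nonneg_nonneg[of D "norm (L k)"] by simp
  qed
  then have "1 / D * norm k \<le> norm (L k)" for k using D by (simp add: pos_divide_le_eq mult.commute)
  then show ?thesis using D by (intro exI[of _ "1 / D"]) auto
qed

text \<open>Indicators of disjoint unit boxes at frequencies beyond \<open>R\<close>. There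
  \<open>(jm s \<xi>)\<^sup>2\<close> is at most \<open>1 / (2 * (M + 1))\<close>, which is how
  \<open>R\<close> is chosen, and the lower-order term of \<open>L_coercive\<close> takes away at
  most \<open>1 / 2\<close>.\<close>

lemma L_high_frequencies:
  "\<exists>v::nat \<Rightarrow> l2. (\<forall>m n. inner (v m) (v n) = (if m = n then 1 else 0)) \<and> (\<forall>n. 1 / 2 \<le> inner (L (v n)) (v n))"
proof -
  define R where "R = (2 * (M + 1)) powr (1 / (2 * s))"
  have R: "R > 0" using M0 by (simp add: R_def)
  have "1 / (2 * s) * (- 2 * s) = - 1" using s0 by simp
  then have "R powr (- 2 * s) = (2 * (M + 1)) powr (- 1)" by (simp only: R_def powr_powr)
  also have "\<dots> = 1 / (2 * (M + 1))" using M0 by (simp add: powr_minus_divide)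
  finally have Rs: "R powr (- 2 * s) = 1 / (2 * (M + 1))" .
  define a where "a n = (R + real n) *\<^sub>R (One :: R3)" for n
  define B where "B n = box (a n) (a n + One)" for n
  obtain b0 :: R3 where b0: "b0 \<in> Basis" using nonempty_Basis by blast
  have co: "a n \<bullet> b = R + real n" if "b \<in> Basis" for n b using that by (simp add: a_def)
  have inB: "R + real n < x \<bullet> b0" "x \<bullet> b0 < R + real n + 1" if "x \<in> B n" for x n
    using that b0 co[OF b0, of n] unfolding B_def mem_box by (auto simp: inner_add_left)
  have disj: "x \<notin> B m" if "x \<in> B n" "m \<noteq> n" for x m n
  proof
    assume "x \<in> B m"
    then have "real n < real m + 1" "real m < real n + 1" using inB that(1) by (smt (verit))+
    then show False using that(2) by linarith
  qed
  have meas: "measure lborel (B n) = 1" for n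
    unfolding B_def by (subst measure_lborel_box) (auto simp: inner_add_left)
  define v where "v n = mk (indicator (B n))" for n
  have l2: "l2fun (indicator (B n))" for n unfolding B_def by (rule l2fun_indicator_box)
  have orth: "inner (v m) (v n) = (if m = n then 1 else 0)" for m n
  proof -
    have "inner (v m) (v n) = (LINT x|lborel. indicat_real (B m) x * indicat_real (B n) x)"
      unfolding v_def by (rule inner_mk_mk[OF l2 l2])
    also have "\<dots> = (if m = n then 1 else 0)"
    proof (cases "m = n")
      case True
      then have "(LINT x|lborel. indicat_real (B m) x * indicat_real (B n) x) = (LINT x|lborel. indicat_real (B n) x)"
        by (intro Bochner_Integration.integral_cong) (auto simp: indicator_def)
      also have "\<dots> = 1" using meas[of n] by simp
      finally show ?thesis using True by simp
    next
      case False
      then have "(LINT x|lborel. indicat_real (B m) x * indicat_real (B n) x) = (LINT x|(lborel::R3 measure). 0::real)"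
        by (intro Bochner_Integration.integral_cong) (auto simp: indicator_def dest: disj)
      then show ?thesis using False by simp
    qed
    finally show ?thesis .
  qed
  have nv: "norm (v n) = 1" for n using orth[of n n] by (simp add: norm_eq_sqrt_inner)
  have "1 / 2 \<le> inner (L (v n)) (v n)" for n
  proof -
    let ?f = "\<lambda>\<xi>. jm s \<xi> * indicator (B n) \<xi>"
    have fl: "l2fun ?f" by (rule l2fun_mult[OF bmeas_jm l2])
    have "(norm (Js s (v n)))\<^sup>2 = (norm (mk ?f))\<^sup>2" unfolding Js_def norm_HT v_def mult_op_mk[OF bmeas_jm l2] ..
    also have "\<dots> = (LINT \<xi>|lborel. (?f \<xi>)\<^sup>2)" by (rule norm_sq_mk[OF fl])
    also have "\<dots> \<le> (LINT \<xi>|lborel. 1 / (2 * (M + 1)) * (indicator (B n) \<xi>)\<^sup>2)"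
    proof (rule integral_mono)
      fix \<xi>
      have "(jm s \<xi>)\<^sup>2 \<le> 1 / (2 * (M + 1))" if "\<xi> \<in> B n"
      proof -
        have "R \<le> norm \<xi>" using inB(1)[OF that] Basis_le_norm[OF b0, of \<xi>] by linarith
        then show ?thesis using jm_le_powr[OF R, of \<xi>] Rs by simp
      qed
      then show "(?f \<xi>)\<^sup>2 \<le> 1 / (2 * (M + 1)) * (indicator (B n) \<xi>)\<^sup>2" by (auto simp: indicator_def)
    qed (use l2fun_integrable_sq[OF fl] l2fun_integrable_sq[OF l2] in auto)
    also have "\<dots> = 1 / (2 * (M + 1)) * (norm (v n))\<^sup>2" unfolding v_def norm_sq_mk[OF l2] by simp
    finally have "(norm (Js s (v n)))\<^sup>2 \<le> 1 / (2 * (M + 1))" unfolding nv by simp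
    then have "(M + 1) * (norm (Js s (v n)))\<^sup>2 \<le> (M + 1) * (1 / (2 * (M + 1)))" using M0 by (intro mult_left_mono) auto
    also have "\<dots> = 1 / 2"
    proof -
      have "M + 1 \<noteq> 0" using M0 by linarith
      then show ?thesis by simp
    qed
    finally show ?thesis using L_coercive[of "v n"] unfolding nv by simp
  qed
  then show ?thesis using orth by blast
qed

end

section \<open>The nonlocal quartic term\<close>

text \<open>In the application \<open>b\<close> is, on the Hartley side, the Bessel potential of
  order \<open>t\<close> of \<open>K u v\<close>, so that \<open>(norm (b u u))\<^sup>2\<close> is
  the integral of \<open>K\<close> times the potential of \<open>u\<close> times
  \<open>u\<^sup>2\<close>, and \<open>N\<close> is the L2 norm of \<open>K u\<^sup>2\<close>. Weak
  continuity enters through \<open>N\<close>.\<close>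

locale quartic =
  fixes b :: "'a::{real_inner,banach} \<Rightarrow> 'a \<Rightarrow> 'b::real_inner" and N :: "'a \<Rightarrow> real" and C :: real and d :: "nat \<Rightarrow> 'a"
  assumes b_add: "\<And>x y z. b (x + y) z = b x z + b y z" and b_scale: "\<And>r x z. b (r *\<^sub>R x) z = r *\<^sub>R b x z"
    and b_sym: "\<And>x y. b x y = b y x"
    and N: "\<And>x. 0 \<le> N x" "\<And>r x. N (r *\<^sub>R x) = r\<^sup>2 * N x" "\<And>x. N x \<le> C * (norm x)\<^sup>2"
    and b_le: "\<And>x y. (norm (b x y))\<^sup>2 \<le> N x * N y"
    and N_weak: "\<And>k. weakly k 0 \<Longrightarrow> (\<lambda>n. N (k n)) \<longlonglongrightarrow> 0"
    and b_def: "\<And>w. b w w = 0 \<Longrightarrow> w = 0" and tot: "total_seq d" and C0: "0 \<le> C"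
begin

lemma b_norm: "norm (b x y) \<le> C * norm x * norm y"
proof (rule power2_le_imp_le)
  have "N x * N y \<le> (C * (norm x)\<^sup>2) * (C * (norm y)\<^sup>2)" by (intro mult_mono N) (simp_all add: C0)
  then show "(norm (b x y))\<^sup>2 \<le> (C * norm x * norm y)\<^sup>2" using b_le[of x y] by (simp add: power_mult_distrib power2_eq_square mult_ac)
qed (simp add: C0)

sublocale b: bounded_bilinear b
proof
  show "b a (x + y) = b a x + b a y" for a x y using b_add b_sym by metis
  show "b a (r *\<^sub>R y) = r *\<^sub>R b a y" for a r y using b_scale b_sym by metis
  show "\<exists>K. \<forall>x y. norm (b x y) \<le> norm x * norm y * K" using b_norm by (intro exI[of _ C]) (simp add: mult_ac)
qed (rule b_add b_scale)+

definition \<Psi>4 :: "'a \<Rightarrow> real" where "\<Psi>4 u = (norm (b u u))\<^sup>2 / 4"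
definition \<psi>4 :: "'a \<Rightarrow> 'a" where "\<psi>4 u = (SOME z. \<forall>l. inner (b u u) (b u l) = inner z l)"

lemma inner_psi4: "inner (\<psi>4 u) l = inner (b u u) (b u l)"
proof -
  have "bounded_linear (\<lambda>l. inner (b u u) (b u l))"
    by (rule bounded_linear_inner_right_comp[OF b.bounded_linear_right])
  then obtain z where "\<And>l. inner (b u u) (b u l) = inner z l" by (rule riesz_representation) blast
  then have "\<exists>z. \<forall>l. inner (b u u) (b u l) = inner z l" by blast
  then have "\<forall>l. inner (b u u) (b u l) = inner (\<psi>4 u) l" unfolding \<psi>4_def by (rule someI_ex)
  then show ?thesis by simp
qed

lemma psi4_self: "inner (\<psi>4 u) u = 4 * \<Psi>4 u"
  by (simp add: inner_psi4 \<Psi>4_def dot_square_norm)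

lemma psi4_odd: "\<psi>4 (- u) = - \<psi>4 u"
proof -
  have "inner (\<psi>4 (- u)) l = inner (- \<psi>4 u) l" for l by (simp add: inner_psi4 b.minus_left b.minus_right)
  then have "inner (\<psi>4 (- u) - (- \<psi>4 u)) (\<psi>4 (- u) - (- \<psi>4 u)) = 0" by (simp only: inner_diff_left diff_self)
  then show ?thesis by (simp only: inner_eq_zero_iff right_minus_eq)
qed

lemma Psi4_nonneg: "0 \<le> \<Psi>4 u" by (simp add: \<Psi>4_def)
lemma Psi4_0: "\<Psi>4 0 = 0" by (simp add: \<Psi>4_def b.zero_left)

lemma Psi4_scale: assumes "0 < \<tau>" shows "\<Psi>4 (\<tau> *\<^sub>R u) = \<tau> powr 4 * \<Psi>4 u"
proof -
  have "\<tau> powr 4 = \<tau> ^ 4" using assms by (intro powr_numeral) simp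
  then show ?thesis by (simp add: \<Psi>4_def b.scaleR_left b.scaleR_right power_mult_distrib power4_eq_xxxx power2_eq_square)
qed

text \<open>Polarisation writes the difference as \<open>b (k n - l) (k n + l)\<close>, and
  \<open>N (k n - l)\<close> tends to 0.\<close>

lemma b_weak: assumes w: "weakly k l" shows "(\<lambda>n. b (k n) (k n)) \<longlonglongrightarrow> b l l"
proof -
  obtain B where B: "\<And>n. norm (k n) \<le> B" using weakly_imp_bounded[OF w] by blast
  have Bl: "norm l \<le> B" using weakly_norm_le[OF w B] .
  have w0: "weakly (\<lambda>n. k n - l) 0" using weakly_diff[OF w weakly_const[of l]] by simp
  have le: "norm (b (k n) (k n) - b l l) \<le> sqrt (N (k n - l) * (C * (2 * B)\<^sup>2))" for n
  proof -
    have "b (k n) (k n) - b l l = b (k n - l) (k n + l)"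
      using b_sym[of l "k n"] by (simp add: b.diff_left b.add_right)
    moreover have "(norm (b (k n - l) (k n + l)))\<^sup>2 \<le> N (k n - l) * (C * (2 * B)\<^sup>2)"
    proof -
      have "norm (k n + l) \<le> 2 * B" using norm_triangle_ineq[of "k n" l] B[of n] Bl by linarith
      then have "(norm (k n + l))\<^sup>2 \<le> (2 * B)\<^sup>2" by (intro power_mono) auto
      then have "C * (norm (k n + l))\<^sup>2 \<le> C * (2 * B)\<^sup>2" using C0 by (intro mult_left_mono)
      then have "N (k n + l) \<le> C * (2 * B)\<^sup>2" using N(3)[of "k n + l"] by linarith
      then show ?thesis using b_le[of "k n - l" "k n + l"] mult_left_mono[OF _ N(1)] order_trans by blast
    qed
    ultimately show ?thesis by (simp add: real_le_rsqrt)
  qed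
  have "(\<lambda>n. sqrt (N (k n - l) * (C * (2 * B)\<^sup>2))) \<longlonglongrightarrow> sqrt (0 * (C * (2 * B)\<^sup>2))"
    by (intro tendsto_intros N_weak w0)
  then have z: "(\<lambda>n. sqrt (N (k n - l) * (C * (2 * B)\<^sup>2))) \<longlonglongrightarrow> 0" by simp
  have "(\<lambda>n. b (k n) (k n) - b l l) \<longlonglongrightarrow> 0" by (rule Lim_null_comparison[OF _ z]) (use le in simp)
  then show ?thesis by (rule LIM_zero_cancel)
qed

lemma Psi4_weak: "weakly k l \<Longrightarrow> (\<lambda>n. \<Psi>4 (k n)) \<longlonglongrightarrow> \<Psi>4 l"
  unfolding \<Psi>4_def by (intro tendsto_intros b_weak) simp_all

lemma Psi4_quad:
  "\<exists>D. \<forall>u h. norm u \<le> R \<longrightarrow> norm h \<le> 1 \<longrightarrow> \<bar>\<Psi>4 (u + h) - \<Psi>4 u - inner (\<psi>4 u) h\<bar> \<le> D * (norm h)\<^sup>2"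
proof -
  define Q where "Q = max R 1"
  have Q: "1 \<le> Q" "R \<le> Q" by (auto simp: Q_def)
  have "\<bar>\<Psi>4 (u + h) - \<Psi>4 u - inner (\<psi>4 u) h\<bar> \<le> 3 * (C * Q)\<^sup>2 * (norm h)\<^sup>2" if u: "norm u \<le> R" and h: "norm h \<le> 1" for u h
  proof -
    let ?x = "b u u" and ?y = "b u h" and ?z = "b h h" and ?e = "norm h"
    have uQ: "norm u \<le> Q" using u Q by linarith
    have CQ: "0 \<le> C * Q" using C0 Q by simp
    have x: "norm ?x \<le> C * Q * Q" by (rule order_trans[OF b_norm]) (intro mult_mono uQ, use C0 Q in auto)
    have y: "norm ?y \<le> C * Q * ?e" by (rule order_trans[OF b_norm]) (intro mult_mono uQ, use C0 Q in auto)
    have z: "norm ?z \<le> C * ?e * ?e" by (rule b_norm)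
    have z2: "C * ?e * ?e \<le> C * Q * ?e" using h Q C0 by (intro mult_right_mono mult_left_mono) auto
    have z3: "C * Q * ?e \<le> C * Q" using h CQ by (simp add: mult_left_le)
    \<comment> \<open>Each of the four inner products beyond first order is at most
      \<open>(C * Q)\<^sup>2 * ?e\<^sup>2\<close>, and their coefficients add up to less than
      3.\<close>
    have ex: "b (u + h) (u + h) = ?x + 2 *\<^sub>R ?y + ?z"
      using b_sym[of h u] by (simp add: b.add_left b.add_right scaleR_2)
    have "\<Psi>4 (u + h) - \<Psi>4 u - inner (\<psi>4 u) h = inner ?y ?y + inner ?x ?z / 2 + inner ?y ?z + inner ?z ?z / 4"
      unfolding \<Psi>4_def ex inner_psi4
      by (simp add: power2_norm_eq_inner inner_add_left inner_add_right inner_commute[of ?y ?x] inner_commute[of ?z ?x] inner_commute[of ?z ?y] field_simps)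
    moreover have "\<bar>inner ?y ?y\<bar> \<le> (C * Q * ?e) * (C * Q * ?e)"
      by (rule order_trans[OF Cauchy_Schwarz_ineq2]) (intro mult_mono y, use CQ in auto)
    moreover have "\<bar>inner ?x ?z\<bar> \<le> (C * Q * Q) * (C * ?e * ?e)"
      by (rule order_trans[OF Cauchy_Schwarz_ineq2]) (intro mult_mono x z, use C0 Q in auto)
    moreover have "\<bar>inner ?y ?z\<bar> \<le> (C * Q * ?e) * (C * Q * ?e)"
      by (rule order_trans[OF Cauchy_Schwarz_ineq2]) (intro mult_mono y order_trans[OF z z2], use CQ in auto)
    moreover have "\<bar>inner ?z ?z\<bar> \<le> (C * Q * ?e) * (C * Q * ?e)"
      by (rule order_trans[OF Cauchy_Schwarz_ineq2]) (intro mult_mono order_trans[OF z z2], use CQ in auto)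
    moreover have "(C * Q * Q) * (C * ?e * ?e) = (C * Q)\<^sup>2 * ?e\<^sup>2" "(C * Q * ?e) * (C * Q * ?e) = (C * Q)\<^sup>2 * ?e\<^sup>2"
      by (simp_all add: power2_eq_square mult_ac)
    moreover have "0 \<le> (C * Q)\<^sup>2 * ?e\<^sup>2" by simp
    ultimately show ?thesis by argo
  qed
  then show ?thesis by blast
qed

text \<open>One factor is estimated by \<open>N u\<close> and not by the norm of \<open>u\<close>;
  the gain is used in \<open>psi4_growth\<close>, where \<open>N u\<close> is small compared with
  \<open>(norm u)\<^sup>2\<close>.\<close>

lemma psi4_norm: "norm (\<psi>4 u) \<le> norm (b u u) * sqrt (C * N u)"
proof (cases "\<psi>4 u = 0")
  case False
  have "norm (\<psi>4 u) * norm (\<psi>4 u) = inner (b u u) (b u (\<psi>4 u))"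
    unfolding inner_psi4[symmetric] by (simp add: dot_square_norm power2_eq_square)
  also have "\<dots> \<le> norm (b u u) * norm (b u (\<psi>4 u))" by (rule norm_cauchy_schwarz)
  also have "norm (b u (\<psi>4 u)) \<le> sqrt (C * N u) * norm (\<psi>4 u)"
  proof -
    have "(norm (b u (\<psi>4 u)))\<^sup>2 \<le> N u * (C * (norm (\<psi>4 u))\<^sup>2)" using b_le[of u "\<psi>4 u"] mult_left_mono[OF N(3)[of "\<psi>4 u"] N(1)[of u]] by linarith
    then have "norm (b u (\<psi>4 u)) \<le> sqrt (N u * (C * (norm (\<psi>4 u))\<^sup>2))" by (rule real_le_rsqrt)
    also have "\<dots> = sqrt (C * N u) * norm (\<psi>4 u)" by (simp add: real_sqrt_mult mult_ac)
    finally show ?thesis .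
  qed
  finally have "norm (\<psi>4 u) * norm (\<psi>4 u) \<le> norm (b u u) * sqrt (C * N u) * norm (\<psi>4 u)" by (simp add: mult_left_mono mult.assoc)
  then show ?thesis using False mult_le_cancel_right_pos[of "norm (\<psi>4 u)"] by simp
qed (simp add: N C0)

text \<open>If \<open>norm (b u u)\<close> stays bounded then \<open>u / norm u\<close> can only tend weakly to \<open>0\<close> as \<open>norm u \<rightarrow> \<infinity>\<close>,
  so \<open>N u\<close> is negligible compared with \<open>(norm u)\<^sup>2\<close>.\<close>

lemma psi4_growth:
  assumes e: "\<epsilon> > 0" shows "\<exists>R. \<forall>u. (norm (b u u))\<^sup>2 \<le> A \<longrightarrow> R \<le> norm u \<longrightarrow> norm (\<psi>4 u) \<le> \<epsilon> * norm u"
proof -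
  \<comment> \<open>Makes \<open>(\<bar>A\<bar> + 1) * (C + 1) * \<delta>\<close> equal to
    \<open>\<epsilon>\<^sup>2\<close> in the final estimate.\<close>
  define \<delta> where "\<delta> = \<epsilon>\<^sup>2 / ((\<bar>A\<bar> + 1) * (C + 1))"
  have D: "\<delta> > 0" using e C0 by (auto simp: \<delta>_def intro!: divide_pos_pos mult_pos_pos)
  have "\<exists>R. \<forall>u. (norm (b u u))\<^sup>2 \<le> A \<longrightarrow> R \<le> norm u \<longrightarrow> N u \<le> \<delta> * (norm u)\<^sup>2"
  proof (rule ccontr)
    assume "\<not> ?thesis"
    then have "\<exists>u. (norm (b u u))\<^sup>2 \<le> A \<and> real n + 1 \<le> norm u \<and> \<delta> * (norm u)\<^sup>2 < N u" for n :: nat by (meson not_le)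
    then obtain u where u: "\<And>n. (norm (b (u n) (u n)))\<^sup>2 \<le> A" "\<And>n. real n + 1 \<le> norm (u n)" "\<And>n. \<delta> * (norm (u n))\<^sup>2 < N (u n)"
      by metis
    have u0: "0 < norm (u n)" for n using u(2)[of n] by linarith
    define w where "w n = (1 / norm (u n)) *\<^sub>R u n" for n
    have nw: "norm (w n) \<le> 1" for n using u0[of n] by (simp add: w_def)
    have Nw: "\<delta> < N (w n)" for n
    proof -
      have "\<delta> = (1 / norm (u n))\<^sup>2 * (\<delta> * (norm (u n))\<^sup>2)" using u0[of n] by (simp add: power_divide)
      also have "\<dots> < (1 / norm (u n))\<^sup>2 * N (u n)" using u0[of n] by (intro mult_strict_left_mono u(3)) simp
      finally show ?thesis by (simp only: w_def N(2))
    qed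
    obtain r l where r: "strict_mono (r :: nat \<Rightarrow> nat)" "weakly (w \<circ> r) l"
      using nw by (rule bounded_seq_weakly_convergent_subseq[OF tot])
    have A0: "0 \<le> A" using order_trans[OF zero_le_power2 u(1)[of 0]] .
    have bw: "norm (b (w n) (w n)) \<le> sqrt A / real (Suc n)" for n
    proof -
      have "norm (b (w n) (w n)) = norm (b (u n) (u n)) / (norm (u n) * norm (u n))"
        using u0[of n] by (simp add: w_def b.scaleR_left b.scaleR_right)
      also have "\<dots> \<le> sqrt A / (norm (u n) * norm (u n))" using real_le_rsqrt[OF u(1)[of n]] by (intro divide_right_mono) auto
      also have "\<dots> \<le> sqrt A / real (Suc n)"
      proof (rule divide_left_mono)
        have "real (Suc n) * 1 \<le> norm (u n) * norm (u n)" using u(2)[of n] by (intro mult_mono) auto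
        then show "real (Suc n) \<le> norm (u n) * norm (u n)" by simp
      qed (use A0 u0[of n] in auto)
      finally show ?thesis .
    qed
    have "(\<lambda>n. sqrt A / real (Suc n)) \<longlonglongrightarrow> 0" by (rule LIMSEQ_Suc[OF lim_const_over_n])
    then have "(\<lambda>n. b (w n) (w n)) \<longlonglongrightarrow> 0" by (rule Lim_null_comparison[rotated]) (use bw in simp)
    then have "((\<lambda>n. b (w n) (w n)) \<circ> r) \<longlonglongrightarrow> 0" by (rule LIMSEQ_subseq_LIMSEQ) (rule r(1))
    moreover have "((\<lambda>n. b (w n) (w n)) \<circ> r) \<longlonglongrightarrow> b l l" using b_weak[OF r(2)] by (simp add: o_def)
    ultimately have "b l l = 0" using LIMSEQ_unique by blast
    then have "l = 0" by (rule b_def)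
    then have "(\<lambda>n. N ((w \<circ> r) n)) \<longlonglongrightarrow> 0" using N_weak r(2) by blast
    then have "\<delta> \<le> 0" by (rule LIMSEQ_le_const) (use Nw in \<open>auto intro: less_imp_le\<close>)
    then show False using D by simp
  qed
  then obtain R where R: "\<And>u. (norm (b u u))\<^sup>2 \<le> A \<Longrightarrow> R \<le> norm u \<Longrightarrow> N u \<le> \<delta> * (norm u)\<^sup>2" by blast
  have "norm (\<psi>4 u) \<le> \<epsilon> * norm u" if u: "(norm (b u u))\<^sup>2 \<le> A" "R \<le> norm u" for u
  proof -
    have "(norm (\<psi>4 u))\<^sup>2 \<le> (norm (b u u) * sqrt (C * N u))\<^sup>2" by (intro power_mono psi4_norm norm_ge_zero)
    also have "\<dots> = (norm (b u u))\<^sup>2 * (C * N u)" using N C0 by (simp add: power_mult_distrib)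
    also have "\<dots> \<le> (\<bar>A\<bar> + 1) * ((C + 1) * (\<delta> * (norm u)\<^sup>2))" using u(1) R[OF u] C0 N by (intro mult_mono) auto
    also have "\<dots> = ((\<bar>A\<bar> + 1) * (C + 1)) * \<delta> * (norm u)\<^sup>2" by (simp only: mult.assoc)
    also have "((\<bar>A\<bar> + 1) * (C + 1)) * \<delta> = \<epsilon>\<^sup>2"
    proof -
      have "(\<bar>A\<bar> + 1) * (C + 1) \<noteq> 0" using C0 by (intro no_zero_divisors) linarith+
      then show ?thesis by (simp only: \<delta>_def times_divide_eq_right nonzero_mult_div_cancel_left not_False_eq_True)
    qed
    finally have "(norm (\<psi>4 u))\<^sup>2 \<le> (\<epsilon> * norm u)\<^sup>2" by (simp only: power_mult_distrib)
    then show ?thesis by (rule power2_le_imp_le) (use e in simp)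
  qed
  then show ?thesis by blast
qed

end

section \<open>The power nonlinearity\<close>

lemma abs_powr_2: "\<bar>x\<bar> powr (p - 2) * x * x = \<bar>x\<bar> powr (p::real)"
proof (cases "x = 0")
  case False
  have "\<bar>x\<bar> powr (p - 2) * \<bar>x\<bar> powr 2 = \<bar>x\<bar> powr p" unfolding powr_add[symmetric] by simp
  moreover have "\<bar>x\<bar> powr 2 = x * x"
    using False powr_numeral[of "\<bar>x\<bar>" "num.Bit0 num.One"] by (simp add: power2_eq_square)
  ultimately show ?thesis by (metis mult.assoc)
qed simp

lemma abs_powr_1: "\<bar>x\<bar> powr (p - 1) * \<bar>x\<bar> = \<bar>x\<bar> powr (p::real)"
proof (cases "x = 0")
  case False
  have "\<bar>x\<bar> powr (p - 1) * \<bar>x\<bar> powr 1 = \<bar>x\<bar> powr p" by (simp only: powr_add[symmetric]) simp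
  then show ?thesis using False by simp
qed simp

lemma abs_powr_mult: "\<bar>\<bar>x\<bar> powr (p - 2) * x\<bar> = \<bar>x\<bar> powr (p - 1 :: real)"
  using abs_powr_1[of x "p - 1"] by (simp add: abs_mult diff_diff_eq)

lemma DERIV_abs_powr_nz:
  assumes "x \<noteq> (0::real)" shows "((\<lambda>x. \<bar>x\<bar> powr p) has_real_derivative p * (\<bar>x\<bar> powr (p - 2) * x)) (at x)"
proof -
  \<comment> \<open>Writing the absolute value through the square avoids a distinction of signs when
    differentiating.\<close>
  have e: "\<bar>y\<bar> powr a = (y\<^sup>2) powr (a / 2)" for y a :: real
  proof (cases "y = 0")
    case False
    then have "y\<^sup>2 = \<bar>y\<bar> powr 2" by (simp add: powr_numeral)
    then have "(y\<^sup>2) powr (a / 2) = \<bar>y\<bar> powr (2 * (a / 2))" by (simp only: powr_powr)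
    then show ?thesis by simp
  qed simp
  have "((\<lambda>x. (x\<^sup>2) powr (p / 2)) has_real_derivative (p / 2 * (x\<^sup>2) powr (p / 2 - 1)) * (2 * x)) (at x)"
    by (rule DERIV_chain2[OF has_real_derivative_powr]) (use assms in \<open>auto intro!: derivative_eq_intros\<close>)
  moreover have "(x\<^sup>2) powr (p / 2 - 1) = \<bar>x\<bar> powr (p - 2)" unfolding e[of x "p - 2"] by (simp add: diff_divide_distrib)
  ultimately show ?thesis unfolding e[of _ p, abs_def] by (simp add: mult_ac)
qed

lemma abs_powr_tendsto_0: "0 < p \<Longrightarrow> ((\<lambda>h::real. \<bar>h\<bar> powr p) \<longlongrightarrow> 0) (at 0)"
proof -
  assume p: "0 < p"
  have "((\<lambda>h::real. \<bar>h\<bar> powr p) \<longlongrightarrow> \<bar>0\<bar> powr p) (at 0)"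
    using p by (intro tendsto_powr' tendsto_intros) auto
  then show ?thesis by simp
qed

lemma DERIV_abs_powr:
  assumes p: "1 < p" shows "((\<lambda>x. \<bar>x\<bar> powr p) has_real_derivative p * (\<bar>x\<bar> powr (p - 2) * x)) (at x)"
proof (cases "x = 0")
  case True
  have "((\<lambda>h::real. (\<bar>0 + h\<bar> powr p - \<bar>0\<bar> powr p) / h) \<longlongrightarrow> 0) (at 0)"
  proof (rule Lim_null_comparison[OF _ abs_powr_tendsto_0[of "p - 1"]])
    show "\<forall>\<^sub>F h::real in at 0. norm ((\<bar>0 + h\<bar> powr p - \<bar>0\<bar> powr p) / h) \<le> \<bar>h\<bar> powr (p - 1)"
      unfolding eventually_at_filter
    proof (rule always_eventually, intro allI impI)
      fix h :: real assume "h \<noteq> 0"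
      then show "norm ((\<bar>0 + h\<bar> powr p - \<bar>0\<bar> powr p) / h) \<le> \<bar>h\<bar> powr (p - 1)"
        using abs_powr_1[of h p] by (simp add: abs_divide pos_divide_le_eq)
    qed
  qed (use p in simp)
  then show ?thesis unfolding True DERIV_def by simp
qed (rule DERIV_abs_powr_nz)

lemma DERIV_abs_powr_mult:
  assumes p: "2 < p" shows "((\<lambda>x. \<bar>x\<bar> powr (p - 2) * x) has_real_derivative (p - 1) * \<bar>x\<bar> powr (p - 2)) (at x)"
proof (cases "x = 0")
  case True
  have "((\<lambda>h::real. (\<bar>0 + h\<bar> powr (p - 2) * (0 + h) - \<bar>0\<bar> powr (p - 2) * 0) / h) \<longlongrightarrow> 0) (at 0)"
  proof (rule Lim_null_comparison[OF _ abs_powr_tendsto_0[of "p - 2"]])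
    show "\<forall>\<^sub>F h::real in at 0. norm ((\<bar>0 + h\<bar> powr (p - 2) * (0 + h) - \<bar>0\<bar> powr (p - 2) * 0) / h) \<le> \<bar>h\<bar> powr (p - 2)"
      unfolding eventually_at_filter by (rule always_eventually) simp
  qed (use p in simp)
  then show ?thesis unfolding True DERIV_def by simp
next
  case False
  have "((\<lambda>x. \<bar>x\<bar> powr (p - 2) * x) has_real_derivative ((p - 2) * (\<bar>x\<bar> powr ((p - 2) - 2) * x)) * x + 1 * \<bar>x\<bar> powr (p - 2)) (at x)"
    by (rule DERIV_mult[OF DERIV_abs_powr_nz[OF False] DERIV_ident])
  moreover have "((p - 2) * (\<bar>x\<bar> powr ((p - 2) - 2) * x)) * x + 1 * \<bar>x\<bar> powr (p - 2) = (p - 1) * \<bar>x\<bar> powr (p - 2)"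
    using abs_powr_2[of x "p - 2"] by (simp add: mult.assoc algebra_simps)
  ultimately show ?thesis by simp
qed

lemma abs_powr_mult_lipschitz:
  assumes p: "2 < p" and "\<bar>a\<bar> \<le> m" "\<bar>b\<bar> \<le> (m::real)"
  shows "\<bar>\<bar>a\<bar> powr (p - 2) * a - \<bar>b\<bar> powr (p - 2) * b\<bar> \<le> (p - 1) * m powr (p - 2) * \<bar>a - b\<bar>"
proof -
  have "norm (\<bar>a\<bar> powr (p - 2) * a - \<bar>b\<bar> powr (p - 2) * b) \<le> (p - 1) * m powr (p - 2) * norm (a - b)"
  proof (rule field_differentiable_bound[where S = "{-m..m}" and f = "\<lambda>x. \<bar>x\<bar> powr (p - 2) * x"])
    show "((\<lambda>x. \<bar>x\<bar> powr (p - 2) * x) has_field_derivative (p - 1) * \<bar>z\<bar> powr (p - 2)) (at z within {-m..m})" for z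
      by (rule has_field_derivative_at_within[OF DERIV_abs_powr_mult[OF p]])
    show "norm ((p - 1) * \<bar>z\<bar> powr (p - 2)) \<le> (p - 1) * m powr (p - 2)" if "z \<in> {-m..m}" for z
    proof -
      have "\<bar>z\<bar> powr (p - 2) \<le> m powr (p - 2)" using p that by (intro powr_mono2) auto
      then show ?thesis using p by (simp add: abs_mult mult_left_mono)
    qed
  qed (use assms in auto)
  then show ?thesis by simp
qed

lemma abs_powr_lipschitz:
  assumes p: "2 < p" and "\<bar>a\<bar> \<le> m" "\<bar>b\<bar> \<le> (m::real)"
  shows "\<bar>\<bar>a\<bar> powr p - \<bar>b\<bar> powr p\<bar> \<le> p * m powr (p - 1) * \<bar>a - b\<bar>"
proof -
  have "norm (\<bar>a\<bar> powr p - \<bar>b\<bar> powr p) \<le> p * m powr (p - 1) * norm (a - b)"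
  proof (rule field_differentiable_bound[where S = "{-m..m}" and f = "\<lambda>x. \<bar>x\<bar> powr p"])
    show "((\<lambda>x. \<bar>x\<bar> powr p) has_field_derivative p * (\<bar>z\<bar> powr (p - 2) * z)) (at z within {-m..m})" for z
      by (rule has_field_derivative_at_within[OF DERIV_abs_powr]) (use p in simp)
    show "norm (p * (\<bar>z\<bar> powr (p - 2) * z)) \<le> p * m powr (p - 1)" if "z \<in> {-m..m}" for z
    proof -
      have "\<bar>z\<bar> powr (p - 1) \<le> m powr (p - 1)" using p that by (intro powr_mono2) auto
      then show ?thesis using p abs_powr_mult[of z p] by (simp add: abs_mult[of p] mult_left_mono)
    qed
  qed (use assms in auto)
  then show ?thesis by simp
qed

text \<open>The mean value inequality for the power minus its linear part at \<open>a\<close>, whose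
  derivative is small near \<open>a\<close> by \<open>abs_powr_mult_lipschitz\<close>.\<close>

lemma abs_powr_taylor:
  assumes p: "2 < p"
  shows "\<bar>\<bar>a + b\<bar> powr p - \<bar>a\<bar> powr p - p * (\<bar>a\<bar> powr (p - 2) * a * b)\<bar> \<le> p * (p - 1) * (\<bar>a\<bar> + \<bar>b\<bar>) powr (p - 2) * (b::real)\<^sup>2"
proof -
  let ?c = "\<bar>a\<bar> powr (p - 2) * a" and ?m = "\<bar>a\<bar> + \<bar>b\<bar>"
  let ?B = "p * ((p - 1) * ?m powr (p - 2) * \<bar>b\<bar>)"
  have "norm ((\<bar>a + b\<bar> powr p - p * ?c * (a + b)) - (\<bar>a\<bar> powr p - p * ?c * a)) \<le> ?B * norm ((a + b) - a)"
  proof (rule field_differentiable_bound[where S = "cball a \<bar>b\<bar>" and f = "\<lambda>x. \<bar>x\<bar> powr p - p * ?c * x"])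
    show "((\<lambda>x. \<bar>x\<bar> powr p - p * ?c * x) has_field_derivative p * (\<bar>z\<bar> powr (p - 2) * z) - p * ?c) (at z within cball a \<bar>b\<bar>)" for z
      by (rule has_field_derivative_at_within, rule DERIV_diff[OF DERIV_abs_powr DERIV_cmult_Id]) (use p in simp)
    show "norm (p * (\<bar>z\<bar> powr (p - 2) * z) - p * ?c) \<le> ?B" if "z \<in> cball a \<bar>b\<bar>" for z
    proof -
      have z: "\<bar>z - a\<bar> \<le> \<bar>b\<bar>" using that by (simp add: dist_real_def)
      have "\<bar>\<bar>z\<bar> powr (p - 2) * z - ?c\<bar> \<le> (p - 1) * ?m powr (p - 2) * \<bar>z - a\<bar>"
        by (rule abs_powr_mult_lipschitz[OF p]) (use z in linarith)+
      also have "\<dots> \<le> (p - 1) * ?m powr (p - 2) * \<bar>b\<bar>" using z p by (intro mult_left_mono) auto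
      finally have "p * \<bar>\<bar>z\<bar> powr (p - 2) * z - ?c\<bar> \<le> ?B" using p by (intro mult_left_mono) auto
      then show ?thesis using p by (simp add: abs_mult flip: right_diff_distrib)
    qed
  qed (auto simp: dist_real_def)
  moreover have "?B * norm ((a + b) - a) = p * (p - 1) * ?m powr (p - 2) * b\<^sup>2" by (simp add: power2_eq_square mult_ac)
  moreover have "(\<bar>a + b\<bar> powr p - p * ?c * (a + b)) - (\<bar>a\<bar> powr p - p * ?c * a) = \<bar>a + b\<bar> powr p - \<bar>a\<bar> powr p - p * (?c * b)"
    by (simp add: algebra_simps)
  ultimately show ?thesis by (metis real_norm_def)
qed

lemma powr_sum_le: assumes "0 \<le> x" "0 \<le> y" "0 < (p::real)" shows "(x + y) powr p \<le> 2 powr p * (x powr p + y powr p)"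
proof -
  have "(x + y) powr p \<le> (2 * max x y) powr p" using assms by (intro powr_mono2) auto
  also have "\<dots> = 2 powr p * max x y powr p" using assms by (intro powr_mult)
  also have "max x y powr p \<le> x powr p + y powr p" by (simp add: max_def)
  finally show ?thesis by (simp add: mult_left_mono)
qed

text \<open>The factor \<open>\<epsilon>\<^sup>2\<close> is kept outside the powers: with
  \<open>h\<close> equal to \<open>\<epsilon>\<close> times a unit vector it becomes
  \<open>(norm h)\<^sup>2\<close> in \<open>P_quad\<close>.\<close>

lemma abs_powr_taylor_scaled:
  fixes a b p \<epsilon> :: real
  assumes p: "2 < p" and e: "0 \<le> \<epsilon>" "\<epsilon> \<le> 1"
  shows "\<bar>\<bar>a + \<epsilon> * b\<bar> powr p - \<bar>a\<bar> powr p - p * (\<bar>a\<bar> powr (p - 2) * a * (\<epsilon> * b))\<bar>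
    \<le> p * (p - 1) * 2 powr p * \<epsilon>\<^sup>2 * (\<bar>a\<bar> powr p + \<bar>b\<bar> powr p)"
proof -
  let ?m = "\<bar>a\<bar> + \<bar>b\<bar>"
  have eb: "\<bar>\<epsilon> * b\<bar> \<le> \<bar>b\<bar>" using e by (simp add: abs_mult mult_left_le_one_le)
  have "(\<bar>a\<bar> + \<bar>\<epsilon> * b\<bar>) powr (p - 2) * (\<epsilon> * b)\<^sup>2 \<le> ?m powr (p - 2) * (\<epsilon>\<^sup>2 * (?m * ?m))"
  proof (intro mult_mono powr_mono2)
    have "\<bar>b\<bar> * \<bar>b\<bar> \<le> ?m * ?m" by (intro mult_mono) auto
    then show "(\<epsilon> * b)\<^sup>2 \<le> \<epsilon>\<^sup>2 * (?m * ?m)" by (simp add: power_mult_distrib mult_left_mono power2_eq_square[of b])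
  qed (use p eb in auto)
  also have "\<dots> = \<epsilon>\<^sup>2 * ?m powr p" using abs_powr_2[of ?m p] by (simp add: mult_ac)
  also have "\<dots> \<le> \<epsilon>\<^sup>2 * (2 powr p * (\<bar>a\<bar> powr p + \<bar>b\<bar> powr p))" using p by (intro mult_left_mono powr_sum_le) auto
  finally have "p * (p - 1) * ((\<bar>a\<bar> + \<bar>\<epsilon> * b\<bar>) powr (p - 2) * (\<epsilon> * b)\<^sup>2) \<le> p * (p - 1) * (\<epsilon>\<^sup>2 * (2 powr p * (\<bar>a\<bar> powr p + \<bar>b\<bar> powr p)))"
    using p by (intro mult_left_mono) auto
  then show ?thesis using abs_powr_taylor[OF p, of a "\<epsilon> * b"] by (simp add: mult_ac)
qed

text \<open>Either \<open>\<bar>a - b\<bar>\<close> is at most \<open>\<eta>\<close> times the sum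
  of the sizes, or that sum is less than \<open>\<bar>a - b\<bar> / \<eta>\<close>. In
  \<open>P_weak\<close> the first term is small with \<open>\<eta>\<close> and the second tends to
  0.\<close>

lemma abs_powr_diff_le:
  fixes a b p \<eta> :: real
  assumes p: "2 < p" and e: "0 < \<eta>"
  shows "\<bar>\<bar>a\<bar> powr p - \<bar>b\<bar> powr p\<bar> \<le> p * (\<eta> * 2 powr p * (\<bar>a\<bar> powr p + \<bar>b\<bar> powr p) + \<eta> powr (1 - p) * \<bar>a - b\<bar> powr p)"
proof -
  let ?m = "\<bar>a\<bar> + \<bar>b\<bar>" and ?d = "\<bar>a - b\<bar>"
  have "?m powr (p - 1) * ?d \<le> \<eta> * ?m powr p + \<eta> powr (1 - p) * ?d powr p"
  proof (cases "?d \<le> \<eta> * ?m")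
    case True
    have "?m powr (p - 1) * ?d \<le> ?m powr (p - 1) * (\<eta> * ?m)" using True by (intro mult_left_mono) auto
    also have "\<dots> = \<eta> * ?m powr p" using abs_powr_1[of ?m p] by (simp add: mult_ac)
    finally show ?thesis by (simp add: add_increasing2)
  next
    case False
    then have "?m \<le> ?d / \<eta>" using e by (simp add: pos_le_divide_eq mult.commute)
    then have "?m powr (p - 1) \<le> (?d / \<eta>) powr (p - 1)" using p by (intro powr_mono2) auto
    also have "\<dots> = \<eta> powr (1 - p) * ?d powr (p - 1)"
      using e powr_minus_divide[of \<eta> "p - 1"] by (simp add: powr_divide)
    finally have "?m powr (p - 1) * ?d \<le> \<eta> powr (1 - p) * ?d powr (p - 1) * ?d" by (intro mult_right_mono) auto
    also have "\<dots> = \<eta> powr (1 - p) * ?d powr p" using abs_powr_1[of "a - b" p] by (simp add: mult.assoc)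
    finally show ?thesis using e by (simp add: add_increasing)
  qed
  also have "\<eta> * ?m powr p \<le> \<eta> * (2 powr p * (\<bar>a\<bar> powr p + \<bar>b\<bar> powr p))" using p e by (intro mult_left_mono powr_sum_le) auto
  finally have "p * (?m powr (p - 1) * ?d) \<le> p * (\<eta> * (2 powr p * (\<bar>a\<bar> powr p + \<bar>b\<bar> powr p)) + \<eta> powr (1 - p) * ?d powr p)"
    using p by (intro mult_left_mono) auto
  moreover have "\<bar>\<bar>a\<bar> powr p - \<bar>b\<bar> powr p\<bar> \<le> p * ?m powr (p - 1) * ?d" by (rule abs_powr_lipschitz[OF p]) auto
  ultimately show ?thesis by (simp add: mult.assoc)
qed

lemma abs_powr_form_le: assumes p: "2 < p" shows "\<bar>\<bar>a\<bar> powr (p - 2) * a * b\<bar> \<le> \<bar>a\<bar> powr p + \<bar>b\<bar> powr (p::real)"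
proof -
  have "\<bar>\<bar>a\<bar> powr (p - 2) * a * b\<bar> = \<bar>a\<bar> powr (p - 1) * \<bar>b\<bar>" by (simp only: abs_mult[of _ b] abs_powr_mult)
  also have "\<dots> \<le> \<bar>a\<bar> powr p + \<bar>b\<bar> powr p"
  proof (cases "\<bar>b\<bar> \<le> \<bar>a\<bar>")
    case True
    then have "\<bar>a\<bar> powr (p - 1) * \<bar>b\<bar> \<le> \<bar>a\<bar> powr (p - 1) * \<bar>a\<bar>" by (intro mult_left_mono) auto
    then show ?thesis unfolding abs_powr_1 by (simp add: add_increasing2)
  next
    case False
    then have "\<bar>a\<bar> powr (p - 1) * \<bar>b\<bar> \<le> \<bar>b\<bar> powr (p - 1) * \<bar>b\<bar>" using p by (intro mult_right_mono powr_mono2) auto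
    then show ?thesis unfolding abs_powr_1 by (simp add: add_increasing)
  qed
  finally show ?thesis .
qed

section \<open>Linearity and injectivity of the function attached to \<open>k\<close>, up to null
  sets\<close>

lemma (in sobolev) U_add: "AE x in lborel. U (k + l) x = U k x + U l x"
proof -
  have "Js s (k + l) = Js s k + Js s l"
    using bounded_linear_Js[of s] s by (intro linear_add bounded_linear.linear) auto
  then show ?thesis unfolding U_def using fn_add by simp
qed

lemma (in sobolev) U_scale: "AE x in lborel. U (c *\<^sub>R k) x = c * U k x"
proof -
  have "Js s (c *\<^sub>R k) = c *\<^sub>R Js s k"
    using bounded_linear_Js[of s] s by (intro linear_scale bounded_linear.linear) auto
  then show ?thesis unfolding U_def using fn_scaleR by simp
qed

lemma (in sobolev) U_diff: "AE x in lborel. U (k - l) x = U k x - U l x"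
  using U_add[of k "- l"] U_scale[of "-1" l] by eventually_elim simp

lemma (in sobolev) U_eq_0D: assumes "AE x in lborel. U k x = 0" shows "k = 0"
proof -
  have "AE x in lborel. fn (Js s k) x = fn 0 x" using assms fn_zero unfolding U_def by eventually_elim simp
  then have "Js s k = 0" by (rule l2_eqI)
  then have "mult_op (jm s) k = 0" using HT_Js[of s k] HT_scaleR[of 0 0] by simp
  then have "mk (\<lambda>\<xi>. jm s \<xi> * fn k \<xi>) = mk (fn 0)" by (simp add: mult_op_def)
  then have "AE \<xi> in lborel. jm s \<xi> * fn k \<xi> = fn 0 \<xi>" by (rule mk_eqD[OF jm_fn l2fun_fn])
  then have "AE \<xi> in lborel. fn k \<xi> = fn 0 \<xi>"
    using fn_zero
  proof eventually_elim
    case (elim \<xi>)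
    then show ?case using jm_pos[of s \<xi>] by simp
  qed
  then show ?thesis by (rule l2_eqI)
qed

section \<open>The weighted power term and its gradient\<close>

locale power_part = sobolev_weight + assumes p2: "2 < p"
begin

definition P :: "l2 \<Rightarrow> real" where "P k = (LINT x|lborel. W x * \<bar>U k x\<bar> powr p)"

lemma P_nonneg: "0 \<le> P k" unfolding P_def using W0 by (intro Bochner_Integration.integral_nonneg) simp

lemma P_bounded: "\<exists>C\<ge>0. \<forall>k. norm k \<le> B \<longrightarrow> P k \<le> C" using weighted_bound[of B] unfolding P_def by blast

lemma dominated:
  assumes f: "f \<in> borel_measurable borel" and le: "\<And>x. \<bar>f x\<bar> \<le> c * (\<bar>U k x\<bar> powr p + \<bar>U l x\<bar> powr p)"
  shows "integrable lborel (\<lambda>x. W x * f x)" "\<bar>LINT x|lborel. W x * f x\<bar> \<le> c * (P k + P l)"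
proof -
  let ?h = "\<lambda>x. c * (W x * \<bar>U k x\<bar> powr p + W x * \<bar>U l x\<bar> powr p)"
  have h: "integrable lborel ?h" using weighted_integrable by simp
  have le': "\<bar>W x * f x\<bar> \<le> ?h x" for x
  proof -
    have "W x * \<bar>f x\<bar> \<le> W x * (c * (\<bar>U k x\<bar> powr p + \<bar>U l x\<bar> powr p))" by (intro mult_left_mono le W0)
    then show ?thesis using W0[of x] by (simp add: abs_mult algebra_simps)
  qed
  show i: "integrable lborel (\<lambda>x. W x * f x)"
  proof (rule Bochner_Integration.integrable_bound[OF h])
    show "(\<lambda>x. W x * f x) \<in> borel_measurable lborel" using f W by simp
    show "AE x in lborel. norm (W x * f x) \<le> norm (?h x)"
      using le' by (intro AE_I2) (metis abs_ge_self order_trans real_norm_def)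
  qed
  have "\<bar>LINT x|lborel. W x * f x\<bar> \<le> (LINT x|lborel. \<bar>W x * f x\<bar>)"
    using integral_norm_bound[of lborel "\<lambda>x. W x * f x"] by simp
  also have "\<dots> \<le> (LINT x|lborel. ?h x)" by (rule integral_mono[OF integrable_abs[OF i] h le'])
  also have "\<dots> = c * (P k + P l)" unfolding P_def using weighted_integrable by simp
  finally show "\<bar>LINT x|lborel. W x * f x\<bar> \<le> c * (P k + P l)" .
qed

definition pform :: "l2 \<Rightarrow> l2 \<Rightarrow> real" where
  "pform k l = (LINT x|lborel. W x * (\<bar>U k x\<bar> powr (p - 2) * U k x * U l x))"

lemma pform_integrable: "integrable lborel (\<lambda>x. W x * (\<bar>U k x\<bar> powr (p - 2) * U k x * U l x))"
  and pform_le: "\<bar>pform k l\<bar> \<le> P k + P l"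
proof -
  have m: "(\<lambda>x. \<bar>U k x\<bar> powr (p - 2) * U k x * U l x) \<in> borel_measurable borel" by measurable
  have le: "\<bar>\<bar>U k x\<bar> powr (p - 2) * U k x * U l x\<bar> \<le> 1 * (\<bar>U k x\<bar> powr p + \<bar>U l x\<bar> powr p)" for x
    using abs_powr_form_le[OF p2] by simp
  show "integrable lborel (\<lambda>x. W x * (\<bar>U k x\<bar> powr (p - 2) * U k x * U l x))" by (rule dominated(1)[OF m le])
  show "\<bar>pform k l\<bar> \<le> P k + P l" unfolding pform_def using dominated(2)[OF m le] by simp
qed

lemma pform_self: "pform k k = P k" unfolding pform_def P_def by (simp only: abs_powr_2)

lemma pform_meas: "(\<lambda>x. W x * (\<bar>U k x\<bar> powr (p - 2) * U k x * U l x)) \<in> borel_measurable lborel"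
  using pform_integrable by (rule borel_measurable_integrable)

lemma pform_add: "pform k (l + m) = pform k l + pform k m"
proof -
  have "pform k (l + m) = (LINT x|lborel. W x * (\<bar>U k x\<bar> powr (p - 2) * U k x * U l x) + W x * (\<bar>U k x\<bar> powr (p - 2) * U k x * U m x))"
    unfolding pform_def
  proof (rule integral_cong_AE)
    show "AE x in lborel. W x * (\<bar>U k x\<bar> powr (p - 2) * U k x * U (l + m) x) = W x * (\<bar>U k x\<bar> powr (p - 2) * U k x * U l x) + W x * (\<bar>U k x\<bar> powr (p - 2) * U k x * U m x)"
      using U_add[of l m] by eventually_elim (simp add: algebra_simps)
  qed (intro pform_meas borel_measurable_add)+
  then show ?thesis unfolding pform_def by (simp add: pform_integrable)
qed

lemma pform_scale: "pform k (c *\<^sub>R l) = c * pform k l"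
proof -
  have "pform k (c *\<^sub>R l) = (LINT x|lborel. c * (W x * (\<bar>U k x\<bar> powr (p - 2) * U k x * U l x)))"
    unfolding pform_def
  proof (rule integral_cong_AE)
    show "AE x in lborel. W x * (\<bar>U k x\<bar> powr (p - 2) * U k x * U (c *\<^sub>R l) x) = c * (W x * (\<bar>U k x\<bar> powr (p - 2) * U k x * U l x))"
      using U_scale[of c l] by eventually_elim (simp add: mult_ac)
  qed (intro pform_meas borel_measurable_times borel_measurable_const)+
  then show ?thesis unfolding pform_def by simp
qed

lemma P_scale: "P (c *\<^sub>R k) = \<bar>c\<bar> powr p * P k"
proof -
  have m: "(\<lambda>x. W x * \<bar>U l x\<bar> powr p) \<in> borel_measurable lborel" for l
    using weighted_integrable by (rule borel_measurable_integrable)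
  have "P (c *\<^sub>R k) = (LINT x|lborel. \<bar>c\<bar> powr p * (W x * \<bar>U k x\<bar> powr p))" unfolding P_def
  proof (rule integral_cong_AE)
    show "AE x in lborel. W x * \<bar>U (c *\<^sub>R k) x\<bar> powr p = \<bar>c\<bar> powr p * (W x * \<bar>U k x\<bar> powr p)"
      using U_scale[of c k] by eventually_elim (simp add: abs_mult powr_mult mult_ac)
  qed (intro m borel_measurable_times borel_measurable_const)+
  then show ?thesis unfolding P_def by simp
qed

text \<open>By linearity \<open>pform_le\<close> need only be used for unit vectors, on which
  \<open>P\<close> is bounded; this yields a bound linear in \<open>norm l\<close>.\<close>

lemma pform_bound: "\<exists>C\<ge>0. \<forall>k l. \<bar>pform k l\<bar> \<le> (P k + C) * norm l"
proof -
  obtain C where C: "C \<ge> 0" "\<And>k. norm k \<le> 1 \<Longrightarrow> P k \<le> C" using P_bounded[of 1] by blast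
  have "\<bar>pform k l\<bar> \<le> (P k + C) * norm l" for k l
  proof (cases "l = 0")
    case True
    then show ?thesis using pform_scale[of k 0 0] by simp
  next
    case False
    define m where "m = (1 / norm l) *\<^sub>R l"
    have m: "norm m \<le> 1" "l = norm l *\<^sub>R m" using False by (simp_all add: m_def)
    have "\<bar>pform k l\<bar> = norm l * \<bar>pform k m\<bar>" using pform_scale[of k "norm l" m] m(2) by (simp add: abs_mult)
    also have "\<dots> \<le> norm l * (P k + C)" using pform_le[of k m] C(2)[OF m(1)] by (intro mult_left_mono) auto
    finally show ?thesis by (simp only: mult.commute)
  qed
  then show ?thesis using C by blast
qed

definition \<psi>p :: "l2 \<Rightarrow> l2" where "\<psi>p k = (SOME z. \<forall>l. pform k l = inner z l)"

lemma inner_psip: "inner (\<psi>p k) l = pform k l"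
proof -
  obtain C where C: "\<And>l. \<bar>pform k l\<bar> \<le> (P k + C) * norm l" using pform_bound by blast
  have "bounded_linear (pform k)"
    by (rule bounded_linear_intro[where K = "P k + C"]) (use C in \<open>simp_all add: pform_add pform_scale mult.commute\<close>)
  then obtain z where "\<And>l. pform k l = inner z l" by (rule riesz_representation) blast
  then have "\<exists>z. \<forall>l. pform k l = inner z l" by blast
  then have "\<forall>l. pform k l = inner (\<psi>p k) l" unfolding \<psi>p_def by (rule someI_ex)
  then show ?thesis by simp
qed

text \<open>A bound by \<open>P k\<close>, not by a power of \<open>norm k\<close>: as
  \<open>inner (\<psi>p k) k\<close> equals \<open>P k\<close>, a bound of this pairing bounds the
  gradient itself, which is even stronger than sublinear growth.\<close>

lemma psip_norm: "\<exists>C\<ge>0. \<forall>k. norm (\<psi>p k) \<le> P k + C"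
proof -
  obtain C where C: "C \<ge> 0" "\<And>k l. \<bar>pform k l\<bar> \<le> (P k + C) * norm l" using pform_bound by blast
  have "norm (\<psi>p k) \<le> P k + C" for k
  proof (cases "\<psi>p k = 0")
    case True then show ?thesis using C P_nonneg[of k] by simp
  next
    case False
    have "norm (\<psi>p k) * norm (\<psi>p k) = pform k (\<psi>p k)"
      unfolding inner_psip[symmetric] by (simp add: dot_square_norm power2_eq_square)
    also have "\<dots> \<le> (P k + C) * norm (\<psi>p k)" using C(2)[of k "\<psi>p k"] by linarith
    finally show ?thesis using False mult_le_cancel_right_pos[of "norm (\<psi>p k)" "norm (\<psi>p k)" "P k + C"] by simp
  qed
  then show ?thesis using C by blast
qed

lemma psip_odd: "\<psi>p (- k) = - \<psi>p k"
proof -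
  have "pform (- k) l = - pform k l" for l
  proof -
    have "pform (- k) l = (LINT x|lborel. - (W x * (\<bar>U k x\<bar> powr (p - 2) * U k x * U l x)))"
      unfolding pform_def
    proof (rule integral_cong_AE)
      show "AE x in lborel. W x * (\<bar>U (- k) x\<bar> powr (p - 2) * U (- k) x * U l x) = - (W x * (\<bar>U k x\<bar> powr (p - 2) * U k x * U l x))"
        using U_scale[of "-1" k] by eventually_elim simp
    qed (intro pform_meas borel_measurable_uminus)+
    then show ?thesis by (simp add: pform_def)
  qed
  then have "inner (\<psi>p (- k)) l = inner (- \<psi>p k) l" for l by (simp add: inner_psip)
  then have "inner (\<psi>p (- k) - (- \<psi>p k)) (\<psi>p (- k) - (- \<psi>p k)) = 0" by (simp only: inner_diff_left diff_self)
  then show ?thesis by (simp only: inner_eq_zero_iff right_minus_eq)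
qed

lemma P_weak: assumes w: "weakly k l" shows "(\<lambda>n. P (k n)) \<longlonglongrightarrow> P l"
proof (rule LIMSEQ_I)
  fix e :: real assume e: "e > 0"
  obtain B where B: "\<And>n. norm (k n) \<le> B" using weakly_imp_bounded[OF w] by blast
  obtain C where C: "C \<ge> 0" "\<And>k. norm k \<le> B \<Longrightarrow> P k \<le> C" using P_bounded[of B] by blast
  have Pl: "P l \<le> C" "\<And>n. P (k n) \<le> C" using C(2) B weakly_norm_le[OF w B] by blast+
  define D where "D = p * 2 powr p * (2 * C)"
  have D: "D \<ge> 0" using p2 C by (simp add: D_def)
  define \<eta> where "\<eta> = e / (2 * (D + 1))"
  have eta: "\<eta> > 0" using e D unfolding \<eta>_def by (intro divide_pos_pos) auto
  have eta2: "\<eta> * D \<le> e / 2"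
  proof -
    have "\<eta> * D \<le> \<eta> * (D + 1)" using eta by simp
    also have "\<dots> = e / 2" using D unfolding \<eta>_def by (simp add: field_simps)
    finally show ?thesis .
  qed
  have w0: "weakly (\<lambda>n. k n - l) 0" using weakly_diff[OF w weakly_const[of l]] by simp
  let ?c = "p * \<eta> powr (1 - p)"
  have "(\<lambda>n. ?c * P (k n - l)) \<longlonglongrightarrow> ?c * 0" unfolding P_def by (intro tendsto_mult tendsto_const weighted_compactness w0)
  moreover have "e / 2 > 0" using e by simp
  ultimately obtain N where N: "\<And>n. n \<ge> N \<Longrightarrow> norm (?c * P (k n - l) - ?c * 0) < e / 2" using LIMSEQ_D by blast
  have "norm (P (k n) - P l) < e" if n: "n \<ge> N" for n
  proof -
    let ?f = "\<lambda>x. W x * \<bar>U (k n) x\<bar> powr p" and ?g = "\<lambda>x. W x * \<bar>U l x\<bar> powr p" and ?h = "\<lambda>x. W x * \<bar>U (k n - l) x\<bar> powr p"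
    have ih: "integrable lborel (\<lambda>x. p * (\<eta> * 2 powr p * (?f x + ?g x) + \<eta> powr (1 - p) * ?h x))"
      using weighted_integrable by simp
    have "\<bar>P (k n) - P l\<bar> = \<bar>LINT x|lborel. ?f x - ?g x\<bar>" unfolding P_def using weighted_integrable by simp
    also have "\<dots> \<le> (LINT x|lborel. \<bar>?f x - ?g x\<bar>)" using integral_norm_bound[of lborel "\<lambda>x. ?f x - ?g x"] by simp
    also have "\<dots> \<le> (LINT x|lborel. p * (\<eta> * 2 powr p * (?f x + ?g x) + \<eta> powr (1 - p) * ?h x))"
    proof (rule integral_mono_AE[OF _ ih])
      show "integrable lborel (\<lambda>x. \<bar>?f x - ?g x\<bar>)" by (intro integrable_abs Bochner_Integration.integrable_diff weighted_integrable)
      show "AE x in lborel. \<bar>?f x - ?g x\<bar> \<le> p * (\<eta> * 2 powr p * (?f x + ?g x) + \<eta> powr (1 - p) * ?h x)"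
        using U_diff[of "k n" l]
      proof eventually_elim
        case (elim x)
        have "W x * \<bar>\<bar>U (k n) x\<bar> powr p - \<bar>U l x\<bar> powr p\<bar>
          \<le> W x * (p * (\<eta> * 2 powr p * (\<bar>U (k n) x\<bar> powr p + \<bar>U l x\<bar> powr p) + \<eta> powr (1 - p) * \<bar>U (k n) x - U l x\<bar> powr p))"
          by (intro mult_left_mono abs_powr_diff_le p2 eta W0)
        moreover have "W x * \<bar>\<bar>U (k n) x\<bar> powr p - \<bar>U l x\<bar> powr p\<bar> = \<bar>?f x - ?g x\<bar>"
          using W0[of x] by (simp add: abs_mult flip: right_diff_distrib)
        moreover have "W x * (p * (\<eta> * 2 powr p * (\<bar>U (k n) x\<bar> powr p + \<bar>U l x\<bar> powr p) + \<eta> powr (1 - p) * \<bar>U (k n) x - U l x\<bar> powr p))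
          = p * (\<eta> * 2 powr p * (?f x + ?g x) + \<eta> powr (1 - p) * ?h x)" unfolding elim by algebra
        ultimately show ?case by simp
      qed
    qed
    also have "\<dots> = p * (\<eta> * 2 powr p * (P (k n) + P l) + \<eta> powr (1 - p) * P (k n - l))"
      unfolding P_def using weighted_integrable by simp
    also have "\<dots> \<le> p * (\<eta> * 2 powr p * (2 * C) + \<eta> powr (1 - p) * P (k n - l))"
      using p2 eta Pl(1) Pl(2)[of n] by (intro mult_left_mono add_right_mono) auto
    also have "\<dots> = \<eta> * D + ?c * P (k n - l)" unfolding D_def by algebra
    also have "\<dots> < e" using eta2 N[OF n] by simp
    finally show ?thesis by simp
  qed
  then show "\<exists>N. \<forall>n\<ge>N. norm (P (k n) - P l) < e" by blast
qed

lemma P_quad: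
  "\<exists>C. \<forall>u h. norm u \<le> R \<longrightarrow> norm h \<le> 1 \<longrightarrow> \<bar>P (u + h) / p - P u / p - inner (\<psi>p u) h\<bar> \<le> C * (norm h)\<^sup>2"
proof -
  obtain A where A: "A \<ge> 0" "\<And>k. norm k \<le> max R 1 \<Longrightarrow> P k \<le> A" using P_bounded[of "max R 1"] by blast
  let ?c = "p * (p - 1) * 2 powr p"
  have "\<bar>P (u + h) / p - P u / p - inner (\<psi>p u) h\<bar> \<le> ?c * (2 * A) / p * (norm h)\<^sup>2" if u: "norm u \<le> R" and h: "norm h \<le> 1" for u h
  proof (cases "h = 0")
    case True then show ?thesis by simp
  next
    case False
    define e where "e = norm h"
    define m where "m = (1 / e) *\<^sub>R h"
    have e: "0 < e" "e \<le> 1" using False h by (simp_all add: e_def)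
    have m: "norm m = 1" "h = e *\<^sub>R m" using e by (simp_all add: m_def e_def)
    let ?D = "\<lambda>x. \<bar>U u x + e * U m x\<bar> powr p - \<bar>U u x\<bar> powr p - p * (\<bar>U u x\<bar> powr (p - 2) * U u x * (e * U m x))"
    have le: "\<bar>?D x\<bar> \<le> (?c * e\<^sup>2) * (\<bar>U u x\<bar> powr p + \<bar>U m x\<bar> powr p)" for x
      using abs_powr_taylor_scaled[OF p2, of e "U u x" "U m x"] e by simp
    have meas: "?D \<in> borel_measurable borel" by measurable
    have i: "integrable lborel (\<lambda>x. W x * \<bar>U (u + h) x\<bar> powr p - W x * \<bar>U u x\<bar> powr p - p * (W x * (\<bar>U u x\<bar> powr (p - 2) * U u x * U h x)))"
      by (intro Bochner_Integration.integrable_diff weighted_integrable integrable_mult_right pform_integrable)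
    have "P (u + h) - P u - p * pform u h = (LINT x|lborel. W x * \<bar>U (u + h) x\<bar> powr p - W x * \<bar>U u x\<bar> powr p - p * (W x * (\<bar>U u x\<bar> powr (p - 2) * U u x * U h x)))"
      unfolding P_def pform_def using weighted_integrable pform_integrable[of u h] by simp
    also have "\<dots> = (LINT x|lborel. W x * ?D x)"
    proof (rule integral_cong_AE)
      show "AE x in lborel. W x * \<bar>U (u + h) x\<bar> powr p - W x * \<bar>U u x\<bar> powr p - p * (W x * (\<bar>U u x\<bar> powr (p - 2) * U u x * U h x)) = W x * ?D x"
        using U_add[of u h] U_scale[of e m] unfolding m(2)[symmetric]
        by eventually_elim (simp add: algebra_simps)
    qed (use i dominated(1)[OF meas le] in \<open>auto intro: borel_measurable_integrable\<close>)
    finally have "\<bar>P (u + h) - P u - p * pform u h\<bar> \<le> (?c * e\<^sup>2) * (P u + P m)" using dominated(2)[OF meas le] by simp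
    also have "\<dots> \<le> (?c * e\<^sup>2) * (2 * A)"
    proof (rule mult_left_mono)
      have "P u \<le> A" "P m \<le> A" using u m by (auto intro: A(2))
      then show "P u + P m \<le> 2 * A" by simp
    qed (use p2 in simp)
    finally have "\<bar>P (u + h) - P u - p * pform u h\<bar> / p \<le> (?c * e\<^sup>2) * (2 * A) / p" using p2 by (intro divide_right_mono) auto
    moreover have "\<bar>P (u + h) / p - P u / p - inner (\<psi>p u) h\<bar> = \<bar>P (u + h) - P u - p * pform u h\<bar> / p"
    proof -
      have "P (u + h) / p - P u / p - inner (\<psi>p u) h = (P (u + h) - P u - p * pform u h) / p"
        using p2 by (simp add: inner_psip diff_divide_distrib)
      then show ?thesis using p2 by (simp add: abs_divide)
    qed
    moreover have "(?c * e\<^sup>2) * (2 * A) / p = ?c * (2 * A) / p * (norm h)\<^sup>2" by (simp add: e_def)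
    ultimately show ?thesis by linarith
  qed
  then show ?thesis by blast
qed

lemma P_pos: assumes pos: "AE x in lborel. 0 < W x" and k: "k \<noteq> 0" shows "0 < P k"
proof (rule ccontr)
  assume "\<not> 0 < P k"
  then have "P k = 0" using P_nonneg[of k] by linarith
  then have "AE x in lborel. W x * \<bar>U k x\<bar> powr p = 0"
    unfolding P_def using W0 by (subst (asm) integral_nonneg_eq_0_iff_AE[OF weighted_integrable]) auto
  then have "AE x in lborel. U k x = 0" using pos by eventually_elim (auto simp: powr_eq_0_iff)
  then show False using U_eq_0D k by blast
qed

end

section \<open>The system\<close>

lemma abs_powr_4: "\<bar>x\<bar> powr 4 = (x::real) ^ 4"
proof (cases "x = 0")
  case False
  then have "\<bar>x\<bar> powr 4 = \<bar>x\<bar> ^ 4" by (intro powr_numeral) simp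
  then show ?thesis by (simp add: power_even_abs_numeral)
qed simp

lemma mult_jm_eq_0D: assumes "mult_op (jm t) z = 0" "0 \<le> t" shows "z = 0"
proof -
  have "AE \<xi> in lborel. jm t \<xi> * fn z \<xi> = fn 0 \<xi>"
    using fn_mult_op[OF jm_bmeas[OF assms(2)], of z] unfolding assms(1) by eventually_elim simp
  then have "AE \<xi> in lborel. fn z \<xi> = fn 0 \<xi>" using fn_zero
  proof eventually_elim
    case (elim \<xi>)
    then show ?case using jm_pos[of t \<xi>] by simp
  qed
  then show ?thesis by (rule l2_eqI)
qed

text \<open>\<open>K\<close> and \<open>g\<close> stand for Borel versions that are nonnegative, and
  for \<open>K\<close> bounded, at every point; \<open>solution\<close> returns to the given
  functions.\<close>

locale schroedinger_bessel = schroedinger +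
  fixes t q :: real and K g :: "R3 \<Rightarrow> real" and \<kappa> :: real
  assumes t: "0 \<le> t" and K: "K \<in> borel_measurable borel" "\<And>x. 0 \<le> K x" "\<And>x. K x \<le> \<kappa>" "AE x in lborel. 0 < K x"
    and Kp: "integrable lborel (\<lambda>x. K x powr (3 / (4 * s - 3)))"
    and q: "2 < q" "q < 6 / (3 - 2 * s)"
    and g: "g \<in> borel_measurable borel" "\<And>x. 0 \<le> g x" "AE x in lborel. 0 < g x"
    and gp: "integrable lborel (\<lambda>x. g x powr (6 / (6 - q * (3 - 2 * s))))"
begin

text \<open>The integrability exponents of the hypotheses are the conjugates of
  \<open>ps / 4\<close> and \<open>ps / q\<close>.\<close>

lemma exponents: "ps / (ps - 4) = 3 / (4 * s - 3)" "ps / (ps - q) = 6 / (6 - q * (3 - 2 * s))"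
proof -
  define a where "a = 3 - 2 * s"
  have a: "0 < a" using s by (simp add: a_def)
  have p: "ps = 6 / a" by (simp add: ps_def a_def)
  have e: "ps / (ps - r) = 6 / (6 - r * a)" for r
  proof -
    have "ps - r = (6 - r * a) / a" using a by (simp add: p diff_divide_distrib)
    then show ?thesis using a by (simp add: p)
  qed
  have "6 - 4 * a = 2 * (4 * s - 3)" by (simp add: a_def)
  then have "ps / (ps - 4) = 6 / (2 * (4 * s - 3))" by (simp only: e)
  also have "\<dots> = 3 / (4 * s - 3)" using mult_divide_mult_cancel_left[of 2 3 "4 * s - 3"] by simp
  finally show "ps / (ps - 4) = 3 / (4 * s - 3)" .
  show "ps / (ps - q) = 6 / (6 - q * (3 - 2 * s))" unfolding e a_def ..
qed

text \<open>The weight of the fourth power is \<open>K\<^sup>2\<close>, because the L2 norm of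
  \<open>K u\<^sup>2\<close> is measured; one factor of \<open>K\<close> is bounded and the other
  integrable with the required exponent.\<close>

sublocale kw: sobolev_weight s "\<lambda>x. (K x)\<^sup>2" 4
proof
  show "(\<lambda>x. (K x)\<^sup>2) \<in> borel_measurable borel" by (intro borel_measurable_power K)
  let ?r = "3 / (4 * s - 3)"
  have r: "?r > 0" using s by simp
  have b: "integrable lborel (\<lambda>x. K x powr ?r * K x powr ?r)"
  proof (rule integrable_mult_bounded[where C = "\<kappa> powr ?r", OF Kp])
    show "(\<lambda>x. K x powr ?r) \<in> borel_measurable lborel" using K(1) by simp
    show "\<bar>K x powr ?r\<bar> \<le> \<kappa> powr ?r" for x using r K by (simp add: powr_mono2)
  qed
  have "(K x)\<^sup>2 powr ?r = K x powr ?r * K x powr ?r" for x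
    unfolding power2_eq_square using K(2) by (intro powr_mult)
  then show "integrable lborel (\<lambda>x. (K x)\<^sup>2 powr (ps / (ps - 4)))" unfolding exponents using b by simp
qed (use ps in simp_all)

sublocale gw: power_part s g q
proof
  show "integrable lborel (\<lambda>x. g x powr (ps / (ps - q)))" unfolding exponents by (rule gp)
  show "q < ps" unfolding ps_def by (rule q)
qed (use g q in auto)

section \<open>The nonlocal term as a quartic form\<close>

definition KU :: "l2 \<Rightarrow> l2 \<Rightarrow> R3 \<Rightarrow> real" where "KU k l x = K x * U k x * U l x"

lemma KU_measurable: "KU k l \<in> borel_measurable borel"
  unfolding KU_def[abs_def] by (intro borel_measurable_times K U_measurable)

lemma KU_sq: "(KU k l x)\<^sup>2 = KU k k x * KU l l x" by (simp add: KU_def power2_eq_square mult_ac)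

lemma KU_diag_sq: "(KU k k x)\<^sup>2 = (K x)\<^sup>2 * \<bar>U k x\<bar> powr 4"
  by (simp add: KU_def abs_powr_4 power_mult_distrib power2_eq_square power4_eq_xxxx mult_ac)

lemma KU_diag_l2: "l2fun (KU k k)"
  unfolding l2fun_def using KU_measurable kw.weighted_integrable[of k] by (simp add: KU_diag_sq)

lemma KU_l2: "l2fun (KU k l)"
proof -
  have "integrable lborel (\<lambda>x. (KU k l x)\<^sup>2)" unfolding KU_sq by (intro l2fun_mult_integrable KU_diag_l2)
  then show ?thesis using KU_measurable by (simp add: l2fun_def)
qed

definition pk :: "l2 \<Rightarrow> l2 \<Rightarrow> l2" where "pk k l = mk (KU k l)"

lemma pk_add: "pk (k + l) m = pk k m + pk l m"
proof -
  have "AE x in lborel. KU (k + l) m x = KU k m x + KU l m x"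
    using U_add[of k l] by eventually_elim (simp add: KU_def algebra_simps)
  then have "pk (k + l) m = mk (\<lambda>x. KU k m x + KU l m x)" unfolding pk_def by (rule mk_cong)
  then show ?thesis unfolding pk_def by (simp add: mk_add KU_l2)
qed

lemma pk_scale: "pk (c *\<^sub>R k) m = c *\<^sub>R pk k m"
proof -
  have "AE x in lborel. KU (c *\<^sub>R k) m x = c * KU k m x"
    using U_scale[of c k] by eventually_elim (simp add: KU_def mult_ac)
  then have "pk (c *\<^sub>R k) m = mk (\<lambda>x. c * KU k m x)" unfolding pk_def by (rule mk_cong)
  then show ?thesis unfolding pk_def by (simp add: mk_scale KU_l2)
qed

lemma pk_sym: "pk k l = pk l k"
proof -
  have "KU k l = KU l k" by (rule ext) (simp add: KU_def mult_ac)
  then show ?thesis by (simp add: pk_def)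
qed

definition N :: "l2 \<Rightarrow> real" where "N k = norm (pk k k)"

lemma N_sq: "(N k)\<^sup>2 = (LINT x|lborel. (K x)\<^sup>2 * \<bar>U k x\<bar> powr 4)"
  unfolding N_def pk_def norm_sq_mk[OF KU_diag_l2] KU_diag_sq ..

text \<open>Pointwise \<open>(K u v)\<^sup>2\<close> is the product of \<open>K u\<^sup>2\<close>
  and \<open>K v\<^sup>2\<close>, to which Cauchy-Schwarz applies.\<close>

lemma norm_pk_le: "(norm (pk k l))\<^sup>2 \<le> N k * N l"
proof -
  have "(norm (pk k l))\<^sup>2 = (LINT x|lborel. KU k k x * KU l l x)"
    unfolding pk_def norm_sq_mk[OF KU_l2] KU_sq ..
  also have "\<dots> = inner (pk k k) (pk l l)" unfolding pk_def by (rule inner_mk_mk[OF KU_l2 KU_l2, symmetric])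
  also have "\<dots> \<le> N k * N l" unfolding N_def by (rule norm_cauchy_schwarz)
  finally show ?thesis .
qed

lemma N_scale: "N (r *\<^sub>R k) = r\<^sup>2 * N k"
proof -
  have "pk (r *\<^sub>R k) (r *\<^sub>R k) = r *\<^sub>R (r *\<^sub>R pk k k)" using pk_scale pk_sym by metis
  then show ?thesis unfolding N_def by (simp add: power2_eq_square)
qed

lemma N_le: "\<exists>C\<ge>0. \<forall>k. N k \<le> C * (norm k)\<^sup>2"
proof -
  obtain C where C: "C \<ge> 0" "\<And>k. norm k \<le> 1 \<Longrightarrow> (LINT x|lborel. (K x)\<^sup>2 * \<bar>U k x\<bar> powr 4) \<le> C"
    using kw.weighted_bound[of 1] by blast
  have "N k \<le> sqrt C * (norm k)\<^sup>2" for k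
  proof (cases "k = 0")
    case True then show ?thesis using N_scale[of 0 0] by simp
  next
    case False
    define m where "m = (1 / norm k) *\<^sub>R k"
    have m: "norm m \<le> 1" "k = norm k *\<^sub>R m" using False by (simp_all add: m_def)
    have "N m \<le> sqrt C" using C(2)[OF m(1)] N_sq[of m] by (intro real_le_rsqrt) simp
    then have "(norm k)\<^sup>2 * N m \<le> (norm k)\<^sup>2 * sqrt C" by (intro mult_left_mono) auto
    then show ?thesis using N_scale[of "norm k" m] m(2) by (simp add: mult.commute)
  qed
  then show ?thesis using C by (intro exI[of _ "sqrt C"]) auto
qed

text \<open>A fixed witness of \<open>N_le\<close>, since the locale \<open>quartic\<close> takes
  its constant as a parameter.\<close>

definition Cb :: real where "Cb = (SOME C. C \<ge> 0 \<and> (\<forall>k. N k \<le> C * (norm k)\<^sup>2))"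

lemma Cb: "Cb \<ge> 0" "N k \<le> Cb * (norm k)\<^sup>2"
  using someI_ex[OF N_le] unfolding Cb_def by blast+

text \<open>The Hartley transform of the Bessel potential of order \<open>t\<close> of
  \<open>K u v\<close>. With it \<open>Js t (b k k)\<close> is the potential of the statement, and
  \<open>inner_b\<close> yields its defining identity.\<close>

definition b :: "l2 \<Rightarrow> l2 \<Rightarrow> l2" where "b k l = mult_op (jm t) (HT (pk k l))"

lemma inner_b: "inner (b k l) m = inner (pk k l) (Js t m)"
  unfolding b_def Js_def mult_op_sym[OF jm_bmeas[OF t]] HT_sym ..

sublocale quartic b N Cb box_seq
proof
  have lin: "linear (\<lambda>z. mult_op (jm t) (HT z))"
    by (intro bounded_linear.linear bounded_linear_compose[OF mult_op_bounded_linear[OF jm_bmeas[OF t]] HT_bounded_linear])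
  show "b (x + y) z = b x z + b y z" for x y z unfolding b_def pk_add by (rule linear_add[OF lin])
  show "b (r *\<^sub>R x) z = r *\<^sub>R b x z" for r x z unfolding b_def pk_scale by (rule linear_scale[OF lin])
  show "b x y = b y x" for x y unfolding b_def pk_sym[of x y] ..
  show "0 \<le> N x" for x by (simp add: N_def)
  show "N (r *\<^sub>R x) = r\<^sup>2 * N x" for r x by (rule N_scale)
  show "N x \<le> Cb * (norm x)\<^sup>2" for x by (rule Cb)
  show "0 \<le> Cb" by (rule Cb)
  show "(norm (b x y))\<^sup>2 \<le> N x * N y" for x y
  proof -
    have "norm (b x y) \<le> 1 * norm (HT (pk x y))"
      unfolding b_def by (rule mult_op_norm[OF jm_bmeas[OF t]]) (use jm_le_1[OF t] jm_pos[of t] in \<open>simp add: abs_of_pos\<close>)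
    then have "(norm (b x y))\<^sup>2 \<le> (norm (pk x y))\<^sup>2" by (intro power_mono) (simp_all add: norm_HT)
    then show ?thesis using norm_pk_le[of x y] by linarith
  qed
  show "(\<lambda>n. N (k n)) \<longlonglongrightarrow> 0" if "weakly k 0" for k
  proof -
    have "(\<lambda>n. (N (k n))\<^sup>2) \<longlonglongrightarrow> 0" unfolding N_sq by (rule kw.weighted_compactness[OF that])
    then have "(\<lambda>n. sqrt ((N (k n))\<^sup>2)) \<longlonglongrightarrow> sqrt 0" by (rule tendsto_real_sqrt)
    then show ?thesis by (simp add: N_def)
  qed
  show "w = 0" if "b w w = 0" for w
  proof -
    have "HT (pk w w) = 0" using that t unfolding b_def by (rule mult_jm_eq_0D)
    then have "pk w w = 0" using HT_HT[of "pk w w"] HT_scaleR[of 0 0] by simp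
    then have "mk (KU w w) = mk (fn 0)" by (simp add: pk_def)
    then have "AE x in lborel. KU w w x = fn 0 x" by (rule mk_eqD[OF KU_l2 l2fun_fn])
    then have "AE x in lborel. U w x = 0" using fn_zero K(4) by eventually_elim (auto simp: KU_def)
    then show ?thesis by (rule U_eq_0D)
  qed
  show "total_seq box_seq" by (rule total_box_seq)
qed

section \<open>Critical points of the full energy and solutions of the system\<close>

definition \<Psi> :: "l2 \<Rightarrow> real" where "\<Psi> k = \<Psi>4 k + gw.P k / q"
definition \<psi> :: "l2 \<Rightarrow> l2" where "\<psi> k = \<psi>4 k + gw.\<psi>p k"

lemma inner_psi_self: "inner (\<psi> k) k = 4 * \<Psi>4 k + gw.P k"
  by (simp add: \<psi>_def inner_add_left psi4_self gw.inner_psip gw.pform_self)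

lemma critical_level: "\<exists>k. L k = \<psi> k \<and> R \<le> inner (L k) k / 2 - \<Psi> k"
proof -
  obtain c where c: "c > 0" "c \<le> 1" "\<And>k. c * norm k \<le> norm (L k)" using L_bounded_below by blast
  obtain v :: "nat \<Rightarrow> l2" where v: "\<And>m n. inner (v m) (v n) = (if m = n then 1 else 0)" "\<And>n. 1 / 2 \<le> inner (L (v n)) (v n)"
    using L_high_frequencies by blast
  \<comment> \<open>The quartic term has exponent 4 and the power term exponent \<open>q\<close>;
    the smaller one serves both.\<close>
  interpret F: indefinite_functional L c "1 + M" \<psi> \<Psi> "min 4 q" "1 / 2" box_seq v
  proof (intro indefinite_functional.intro symmetric_bounded_below.intro indefinite_functional_axioms.intro)
    show "bounded_linear L" by (rule L_bounded_linear)
    show "inner (L x) y = inner x (L y)" for x y by (rule L_sym)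
    show "0 < c" "c * norm x \<le> norm (L x)" for x using c by auto
    show "0 < 1 + M" "c \<le> 1 + M" using M0 c by auto
    show "norm (L x) \<le> (1 + M) * norm x" for x by (rule L_norm_le)
    show "(\<lambda>n. \<Psi> (u n)) \<longlonglongrightarrow> \<Psi> l" if "weakly u l" for u l
      unfolding \<Psi>_def using q by (intro tendsto_intros Psi4_weak gw.P_weak that) simp
    show "\<exists>C. \<forall>u h. norm u \<le> R \<longrightarrow> norm h \<le> 1 \<longrightarrow> \<bar>\<Psi> (u + h) - \<Psi> u - inner (\<psi> u) h\<bar> \<le> C * (norm h)\<^sup>2" for R
    proof -
      obtain A where A: "\<And>u h. norm u \<le> R \<Longrightarrow> norm h \<le> 1 \<Longrightarrow> \<bar>\<Psi>4 (u + h) - \<Psi>4 u - inner (\<psi>4 u) h\<bar> \<le> A * (norm h)\<^sup>2"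
        using Psi4_quad by blast
      obtain B where B: "\<And>u h. norm u \<le> R \<Longrightarrow> norm h \<le> 1 \<Longrightarrow> \<bar>gw.P (u + h) / q - gw.P u / q - inner (gw.\<psi>p u) h\<bar> \<le> B * (norm h)\<^sup>2"
        using gw.P_quad by blast
      have "\<bar>\<Psi> (u + h) - \<Psi> u - inner (\<psi> u) h\<bar> \<le> (A + B) * (norm h)\<^sup>2" if "norm u \<le> R" "norm h \<le> 1" for u h
        unfolding \<Psi>_def \<psi>_def inner_add_left distrib_right using A[OF that] B[OF that] by linarith
      then show ?thesis by blast
    qed
    show "\<psi> (- u) = - \<psi> u" for u by (simp add: \<psi>_def psi4_odd gw.psip_odd)
    show "2 < min 4 q" using q by simp
    show "min 4 q * \<Psi> u \<le> inner (\<psi> u) u" for u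
    proof -
      have "min 4 q * \<Psi>4 u \<le> 4 * \<Psi>4 u" using Psi4_nonneg by (intro mult_right_mono) auto
      moreover have "min 4 q * (gw.P u / q) \<le> q * (gw.P u / q)" using gw.P_nonneg q by (intro mult_right_mono) auto
      ultimately show ?thesis using q unfolding inner_psi_self \<Psi>_def distrib_left by simp
    qed
    show "\<tau> powr min 4 q * \<Psi> u \<le> \<Psi> (\<tau> *\<^sub>R u)" if "1 \<le> \<tau>" for \<tau> u
    proof -
      have "\<tau> powr min 4 q * \<Psi>4 u \<le> \<tau> powr 4 * \<Psi>4 u" using Psi4_nonneg that by (intro mult_right_mono powr_mono) auto
      moreover have "\<tau> powr min 4 q * (gw.P u / q) \<le> \<tau> powr q * (gw.P u / q)"
        using gw.P_nonneg q that by (intro mult_right_mono powr_mono) auto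
      ultimately show ?thesis using that Psi4_scale[of \<tau> u] gw.P_scale[of \<tau> u] unfolding \<Psi>_def distrib_left by simp
    qed
    show "0 < \<Psi> u" if "u \<noteq> 0" for u
      unfolding \<Psi>_def using gw.P_pos[OF g(3) that] Psi4_nonneg[of u] q by (intro add_nonneg_pos) auto
    show "\<Psi> 0 = 0" using gw.P_scale[of 0 0] Psi4_0 by (simp add: \<Psi>_def)
    show "\<exists>R. \<forall>u. inner (\<psi> u) u \<le> C \<longrightarrow> R \<le> norm u \<longrightarrow> norm (\<psi> u) \<le> \<epsilon> * norm u" if e: "0 < \<epsilon>" for C \<epsilon>
    proof -
      have "0 < \<epsilon> / 2" using e by simp
      then obtain R1 where R1: "\<And>u. (norm (b u u))\<^sup>2 \<le> C \<Longrightarrow> R1 \<le> norm u \<Longrightarrow> norm (\<psi>4 u) \<le> \<epsilon> / 2 * norm u"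
        using psi4_growth by blast
      obtain D where D: "\<And>k. norm (gw.\<psi>p k) \<le> gw.P k + D" using gw.psip_norm by blast
      \<comment> \<open>The quartic part takes half of \<open>\<epsilon>\<close> beyond its own
        threshold \<open>R1\<close>; the power part is bounded by \<open>C + D\<close> and falls
        below the other half for large norms.\<close>
      have "norm (\<psi> u) \<le> \<epsilon> * norm u" if u: "inner (\<psi> u) u \<le> C" "max R1 ((C + D) / (\<epsilon> / 2)) \<le> norm u" for u
      proof -
        have n: "4 * \<Psi>4 u = (norm (b u u))\<^sup>2" by (simp add: \<Psi>4_def)
        have 1: "(norm (b u u))\<^sup>2 \<le> C" using u(1) gw.P_nonneg[of u] n unfolding inner_psi_self by linarith
        have 2: "gw.P u \<le> C" using u(1) Psi4_nonneg[of u] unfolding inner_psi_self by linarith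
        have "norm (\<psi>4 u) \<le> \<epsilon> / 2 * norm u" using R1[OF 1] u(2) by simp
        moreover have "norm (gw.\<psi>p u) \<le> C + D" using D[of u] 2 by linarith
        moreover have "(C + D) / (\<epsilon> / 2) \<le> norm u" using u(2) by simp
        then have "C + D \<le> \<epsilon> / 2 * norm u" using e pos_divide_le_eq[of "\<epsilon> / 2" "C + D" "norm u"] by (simp add: mult.commute)
        ultimately show ?thesis using norm_triangle_ineq[of "\<psi>4 u" "gw.\<psi>p u"] unfolding \<psi>_def by linarith
      qed
      then show ?thesis by blast
    qed
    show "total_seq box_seq" by (rule total_box_seq)
    show "inner (v m) (v n) = (if m = n then 1 else 0)" for m n by (rule v)
    show "1 / 2 \<le> inner (L (v n)) (v n)" for n by (rule v)
  qed simp
  show ?thesis using F.critical_points_of_arbitrarily_high_level[of R] unfolding F.J_def by blast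
qed

text \<open>As \<open>\<Psi>\<close> is nonnegative and \<open>L\<close> is bounded by
  \<open>1 + M\<close>, the level \<open>(1 + M) * (real n)\<^sup>2 / 2\<close> can be reached only
  at norm \<open>n\<close> or more.\<close>

lemma large_critical_points: "\<exists>k. L k = \<psi> k \<and> real n \<le> norm k"
proof -
  obtain k where k: "L k = \<psi> k" "(1 + M) * (real n)\<^sup>2 / 2 \<le> inner (L k) k / 2 - \<Psi> k"
    using critical_level by blast
  have "0 \<le> \<Psi> k" unfolding \<Psi>_def using Psi4_nonneg gw.P_nonneg q by (intro add_nonneg_nonneg divide_nonneg_pos) auto
  then have "(1 + M) * (real n)\<^sup>2 \<le> inner (L k) k" using k(2) by linarith
  also have "\<dots> \<le> norm (L k) * norm k" by (rule norm_cauchy_schwarz)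
  also have "\<dots> \<le> ((1 + M) * norm k) * norm k" by (intro mult_right_mono L_norm_le) simp
  finally have "(1 + M) * (real n)\<^sup>2 \<le> (1 + M) * (norm k)\<^sup>2" by (simp add: power2_eq_square mult.assoc)
  then have "(real n)\<^sup>2 \<le> (norm k)\<^sup>2" using M0 mult_le_cancel_left_pos[of "1 + M" "(real n)\<^sup>2" "(norm k)\<^sup>2"] by simp
  then show ?thesis using k(1) power2_le_imp_le[of "real n" "norm k"] by auto
qed

text \<open>Testing \<open>L k = \<psi> k\<close> with \<open>l\<close> is the weak equation tested
  with the function that belongs to \<open>l\<close>. \<open>K'\<close> and \<open>g'\<close> are
  the given functions, equal almost everywhere to the Borel versions.\<close>

lemma solution:
  assumes k: "L k = \<psi> k" and K': "K' \<in> borel_measurable lebesgue" "AE x in lborel. K' x = K x"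
    and g': "g' \<in> borel_measurable lebesgue" "AE x in lborel. g' x = g x"
  shows "weak_solution s t q V K' g' (fn (Js s k)) (fn (Js t (b k k)))"
proof -
  let ?u = "fn (Js s k)" and ?\<phi> = "fn (Js t (b k k))"
  have u: "?u \<in> Hs s" "sq_int ?u" "mk ?u = Js s k" by (simp_all add: Hs_fn_Js)
  have phi: "sq_int ?\<phi>" "mk ?\<phi> = Js t (b k k)" "?\<phi> \<in> Lt2 t" using Lt2_iff[OF t] sq_int_fn by auto
  have leb: "fn h \<in> borel_measurable lebesgue" for h by (intro borel_imp_lebesgue fn_measurable)
  have sqm: "v \<in> borel_measurable lebesgue" if "sq_int v" for v :: "R3 \<Rightarrow> real" using that by (simp add: sq_int_def)
  have "is_phi_u t K' ?u ?\<phi>"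
    unfolding is_phi_u_def
  proof (intro conjI ballI phi(3))
    fix v assume "v \<in> Lt2 t"
    then obtain l where v: "sq_int v" "mk v = Js t l" using Lt2_iff[OF t] by blast
    have "Lt2_inner t ?\<phi> v = inner (pk k k) (Js t l)" unfolding Lt2_inner_eq[OF phi(1,2) v t] inner_b ..
    also have "\<dots> = (LINT x|lborel. KU k k x * fn (Js t l) x)" unfolding pk_def by (rule inner_mk[OF KU_l2])
    also have "\<dots> = (LINT x|lebesgue. K' x * (?u x)\<^sup>2 * v x)"
    proof (rule lebesgue_integral_eq(1)[symmetric])
      show "(\<lambda>x. K' x * (?u x)\<^sup>2 * v x) \<in> borel_measurable lebesgue"
        by (intro borel_measurable_times borel_measurable_power K'(1) leb sqm v)
      show "(\<lambda>x. KU k k x * fn (Js t l) x) \<in> borel_measurable borel" by (intro borel_measurable_times KU_measurable fn_measurable)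
      show "AE x in lborel. K' x * (?u x)\<^sup>2 * v x = KU k k x * fn (Js t l) x"
        using K'(2) fn_mk_sq_int[OF v(1)] unfolding v(2)
        by eventually_elim (simp add: KU_def U_def power2_eq_square)
    qed
    finally show "Lt2_inner t ?\<phi> v = (LINT x|lebesgue. K' x * (?u x)\<^sup>2 * v x)" .
  qed
  moreover have "frac_form s ?u v + (LINT x|lebesgue. V x * ?u x * v x - K' x * ?\<phi> x * ?u x * v x - g' x * \<bar>?u x\<bar> powr (q - 2) * ?u x * v x) = 0"
    if vH: "v \<in> Hs s" for v
  proof -
    obtain l where v: "sq_int v" "mk v = Js s l" using vH unfolding Hs_iff[OF s0(2)] by blast
    let ?F1 = "\<lambda>x. K' x * ?\<phi> x * ?u x * v x" and ?G1 = "\<lambda>x. KU k l x * ?\<phi> x"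
    have F1: "?F1 \<in> borel_measurable lebesgue" by (intro borel_measurable_times K'(1) leb sqm v)
    have G1: "?G1 \<in> borel_measurable borel" by (intro borel_measurable_times KU_measurable fn_measurable)
    have ae1: "AE x in lborel. ?F1 x = ?G1 x"
      using K'(2) fn_mk_sq_int[OF v(1)] unfolding v(2) by eventually_elim (simp add: KU_def U_def)
    \<comment> \<open>Integrability of each term is what allows the single integral of
      \<open>weak_solution\<close> to be split.\<close>
    have i1: "integrable lebesgue ?F1"
      unfolding lebesgue_integral_eq(2)[OF F1 G1 ae1] by (intro l2fun_mult_integrable KU_l2 l2fun_fn)
    have e1: "(LINT x|lebesgue. ?F1 x) = inner (b k k) (b k l)"
    proof -
      have "(LINT x|lebesgue. ?F1 x) = (LINT x|lborel. ?G1 x)" by (rule lebesgue_integral_eq(1)[OF F1 G1 ae1])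
      also have "\<dots> = inner (pk k l) (Js t (b k k))" unfolding pk_def by (rule inner_mk[OF KU_l2, symmetric])
      also have "\<dots> = inner (b k k) (b k l)" unfolding inner_b[symmetric] by (rule inner_commute)
      finally show ?thesis .
    qed
    let ?F2 = "\<lambda>x. g' x * \<bar>?u x\<bar> powr (q - 2) * ?u x * v x" and ?G2 = "\<lambda>x. g x * (\<bar>U k x\<bar> powr (q - 2) * U k x * U l x)"
    have up: "(\<lambda>x. \<bar>?u x\<bar> powr (q - 2)) \<in> borel_measurable lebesgue"
      by (rule borel_imp_lebesgue) simp
    have F2: "?F2 \<in> borel_measurable lebesgue" by (intro borel_measurable_times g'(1) up leb sqm v)
    have G2: "?G2 \<in> borel_measurable borel" using gw.pform_meas[of k l] by simp
    have ae2: "AE x in lborel. ?F2 x = ?G2 x"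
      using g'(2) fn_mk_sq_int[OF v(1)] unfolding v(2) by eventually_elim (simp add: U_def)
    have i2: "integrable lebesgue ?F2" unfolding lebesgue_integral_eq(2)[OF F2 G2 ae2] by (rule gw.pform_integrable)
    have e2: "(LINT x|lebesgue. ?F2 x) = gw.pform k l" unfolding gw.pform_def by (rule lebesgue_integral_eq(1)[OF F2 G2 ae2])
    note iV = form_A_eq(2)[OF u(2,3) v]
    have "inner (L k) l = inner (b k k) (b k l) + gw.pform k l"
      unfolding k \<psi>_def by (simp add: inner_add_left inner_psi4 gw.inner_psip)
    moreover have "(LINT x|lebesgue. V x * ?u x * v x - ?F1 x - ?F2 x) = (LINT x|lebesgue. V x * ?u x * v x) - (LINT x|lebesgue. ?F1 x) - (LINT x|lebesgue. ?F2 x)"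
      by (subst Bochner_Integration.integral_diff[OF Bochner_Integration.integrable_diff[OF iV i1] i2])
         (subst Bochner_Integration.integral_diff[OF iV i1], rule refl)
    moreover have "frac_form s ?u v + (LINT x|lebesgue. V x * ?u x * v x) = inner (L k) l"
      using form_A_eq(3)[OF u(2,3) v] unfolding form_A_def .
    ultimately show ?thesis unfolding e1 e2 by linarith
  qed
  ultimately show ?thesis unfolding weak_solution_def using u(1) phi(3) by blast
qed

end

section \<open>Borel versions of the data and conclusion\<close>

lemma borel_representative:
  fixes f :: "R3 \<Rightarrow> real"
  assumes "f \<in> borel_measurable lebesgue" obtains h where "h \<in> borel_measurable borel" "AE x in lborel. f x = h x"
  using completion_ex_borel_measurable_real[of f lborel] assms by auto

theorem theorem1p3:
  fixes s t q :: real and V K g :: "R3 \<Rightarrow> real"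
  assumes s: "3/4 < s" "s < 1"
    and t: "0 < t" "t < 1"
    and V: "continuous_on UNIV V" "\<exists>M. \<forall>x. \<bar>V x\<bar> \<le> M" "zero_in_gap s V"
    and K: "in_Lp (3 / (4 * s - 3)) K" "ess_bounded K" "AE x in lebesgue. K x > 0"
    and q: "2 < q" "q < 6 / (3 - 2 * s)"
    and g: "in_Lp (6 / (6 - q * (3 - 2 * s))) g" "AE x in lebesgue. g x > 0"
  shows "\<exists>u \<phi> :: nat \<Rightarrow> R3 \<Rightarrow> real.
           (\<forall>n. weak_solution s t q V K g (u n) (\<phi> n)) \<and>
           filterlim (\<lambda>n. Hs_norm s (u n)) at_top sequentially"
proof -
  obtain M where M: "\<And>x. \<bar>V x\<bar> \<le> M" using V(2) by blast
  have Km: "K \<in> borel_measurable lebesgue" and gm: "g \<in> borel_measurable lebesgue"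
    using K(1) g(1) by (simp_all add: in_Lp_def)
  obtain K0 where K0: "K0 \<in> borel_measurable borel" "AE x in lborel. K x = K0 x" by (rule borel_representative[OF Km])
  obtain g0 where g0: "g0 \<in> borel_measurable borel" "AE x in lborel. g x = g0 x" by (rule borel_representative[OF gm])
  obtain \<kappa> where kappa: "AE x in lborel. \<bar>K x\<bar> \<le> \<kappa>" using K(2) unfolding ess_bounded_def AE_lborel_iff by blast
  note pos = K(3)[unfolded AE_lborel_iff] g(2)[unfolded AE_lborel_iff]
  \<comment> \<open>Truncation to the range from 0 to \<open>\<bar>\<kappa>\<bar>\<close> changes
    \<open>K0\<close> only on a null set and makes sign and bound hold at every point.\<close>
  define K1 where "K1 x = max 0 (min \<bar>\<kappa>\<bar> (K0 x))" for x
  define g1 where "g1 x = max 0 (g0 x)" for x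
  have K1: "AE x in lborel. K x = K1 x" using K0(2) pos(1) kappa by eventually_elim (auto simp: K1_def)
  have g1: "AE x in lborel. g x = g1 x" using g0(2) pos(2) by eventually_elim (auto simp: g1_def)
  have mK1: "K1 \<in> borel_measurable borel" unfolding K1_def[abs_def] using K0(1) by simp
  have mg1: "g1 \<in> borel_measurable borel" unfolding g1_def[abs_def] using g0(1) by simp
  have int: "integrable lborel (\<lambda>x. h1 x powr e)"
    if "in_Lp e h" "AE x in lborel. h x = h1 x" "AE x in lborel. 0 < h x" "h1 \<in> borel_measurable borel" for h h1 e
  proof -
    have i: "integrable lebesgue (\<lambda>x. \<bar>h x\<bar> powr e)" using that(1) by (simp add: in_Lp_def)
    have m: "(\<lambda>x. h1 x powr e) \<in> borel_measurable borel" using that(4) by simp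
    have "AE x in lborel. \<bar>h x\<bar> powr e = h1 x powr e" using that(2,3) by eventually_elim simp
    then show ?thesis using lebesgue_integral_eq(2)[OF borel_measurable_integrable[OF i] m] i by blast
  qed
  interpret schroedinger_bessel s V M t q K1 g1 "\<bar>\<kappa>\<bar>"
  proof
    show "V \<in> borel_measurable borel" using V(1) by (rule borel_measurable_continuous_onI)
    show "AE x in lborel. 0 < K1 x" using K1 pos(1) by eventually_elim simp
    show "AE x in lborel. 0 < g1 x" using g1 pos(2) by eventually_elim simp
    show "integrable lborel (\<lambda>x. K1 x powr (3 / (4 * s - 3)))" by (rule int[OF K(1) K1 pos(1) mK1])
    show "integrable lborel (\<lambda>x. g1 x powr (6 / (6 - q * (3 - 2 * s))))" by (rule int[OF g(1) g1 pos(2) mg1])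
  qed (use s t q M V(3) mK1 mg1 in \<open>auto simp: K1_def g1_def\<close>)
  obtain k where k: "\<And>n. L (k n) = \<psi> (k n)" "\<And>n. real n \<le> norm (k n)" using large_critical_points by metis
  have "weak_solution s t q V K g (fn (Js s (k n))) (fn (Js t (b (k n) (k n))))" for n
    by (rule solution[OF k(1) Km K1 gm g1])
  moreover have "filterlim (\<lambda>n. Hs_norm s (fn (Js s (k n)))) at_top sequentially"
  proof (rule filterlim_at_top_mono[OF filterlim_real_sequentially])
    have "Hs_norm s (fn (Js s (k n))) = norm (k n)" for n by (rule Hs_norm_eq[OF sq_int_fn mk_fn s0(2)])
    then show "\<forall>\<^sub>F n in sequentially. real n \<le> Hs_norm s (fn (Js s (k n)))" using k(2) by simp
  qed
  ultimately show ?thesis by (intro exI[of _ "\<lambda>n. fn (Js s (k n))"] exI[of _ "\<lambda>n. fn (Js t (b (k n) (k n)))"]) blast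
qed

end
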